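(* Let $(\alpha,\beta)\in\mathbb{Q}^2$. Let $\lambda$ be a Borel probability measure on $\mathbb{R}$, absolutely continuous with respect to Lebesgue measure. Let $F:\mathbb{R}\times\Gamma\backslash G\to\mathbb{R}$ be bounded and continuous. Let $F_t:\mathbb{R}\times\Gamma\backslash G\to\mathbb{R}$ be a family of uniformly bounded, continuous functions such that $F_t\to F$ uniformly on compact sets as $t\to\infty$. Then $$\lim_{t\to\infty}\int_{\mathbb{R}}F_t\left(u,\ \Gamma\left(I;\begin{pmatrix}\alpha\\ \beta\end{pmatrix}\right)\Psi^u\Phi^t\right)d\lambda(u)=\int_{\Gamma\backslash G}\int_{\mathbb{R}}F(u,g)\,d\lambda(u)\,d\mu^{(\alpha,\beta)}_{\Gamma\backslash G}(g).$$
   Context: Group and lattice. $G=\mathrm{SL}(2,\mathbb{R})\ltimes\mathbb{R}^2$ with law $(M;\xi)(M';\xi')=(MM';\xi+M\xi')$. $\Gamma_\theta<\mathrm{SL}(2,\mathbb{Z})$ is the theta group generated by $\begin{pmatrix}0&-1\\1&0\end{pmatrix}$ and $\begin{pmatrix}1&2\\0&1\end{pmatrix}$, and $\Gamma=\Gamma_\theta\ltimes\mathbb{Z}^2<G$. Put $$\Phi^t=\left(\begin{pmatrix}e^{-t/2}&0\\0&e^{t/2}\end{pmatrix};\begin{pmatrix}0\\0\end{pmatrix}\right),\qquad \Psi^x=\left(\begin{pmatrix}1&x\\0&1\end{pmatrix};\begin{pmatrix}0\\0\end{pmatrix}\right).$$ Coordinates. Via the Iwasawa decomposition $M=\begin{pmatrix}1&x\\0&1\end{pmatrix}\begin{pmatrix}y^{1/2}&0\\0&y^{-1/2}\end{pmatrix}\begin{pmatrix}\cos\phi&-\sin\phi\\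 \sin\phi&\cos\phi\end{pmatrix}$, elements $(M;\xi)\in G$ are identified with $(x+iy,\phi;\xi)\in\mathfrak{H}\times[0,2\pi)\times\mathbb{R}^2$, where $\mathfrak{H}$ is the upper half-plane. A fundamental domain for $\Gamma\backslash G$ is $\mathcal{F}_\Gamma=\mathcal{F}_{\Gamma_\theta}\times[0,\pi)\times[-\frac12,\frac12)^2$, with $\mathcal{F}_{\Gamma_\theta}=\{z\in\mathfrak{H}:|z|>1,\ |z-2|>1,\ 0\le\mathrm{Re}\,z<2\}$. Measure. $\Gamma$ acts on $\mathbb{R}^2/\mathbb{Z}^2$, identified with $[-\frac12,\frac12)^2$, by affine maps $(M;v)\cdot\xi=v+M\xi$ modulo $\mathbb{Z}^2$. $S^{(\alpha,\beta)}\subset[-\frac12,\frac12)^2$ is the (finite) $\Gamma$-orbit of the representative of $(\alpha,\beta)$ modulo $\mathbb{Z}^2$. $\mu^{(\alpha,\beta)}_{\Gamma\backslash G}$ is the probability measure on $\Gamma\backslash G$ given on $\mathcal{F}_\Gamma$ by $$d\mu^{(\alpha,\beta)}_{\Gamma\backslash G}=\frac{1}{\pi^2|S^{(\alpha,\beta)}|}\frac{dx\,dy\,d\phi}{y^2}\times\sum_{p\in S^{(\alpha,\beta)}}\delta_p.$$ *)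

theory Defs
  imports "HOL-Probability.Probability" "HOL-Algebra.Group_Action" "HOL-Algebra.Generated_Groups"
begin

definition mat22 :: "real \<Rightarrow> real \<Rightarrow> real \<Rightarrow> real \<Rightarrow> real^2^2" where
  "mat22 a b c d = vector [vector [a, b], vector [c, d]]"

definition SL2 :: "(real^2^2) monoid" where
  "SL2 = \<lparr>carrier = {M. det M = 1}, mult = (\<lambda>M N. M ** N), one = mat 1\<rparr>"

definition ASL2 :: "((real^2^2) \<times> (real^2)) monoid" where
  "ASL2 = \<lparr>carrier = carrier SL2 \<times> UNIV,
     mult = (\<lambda>(M, \<xi>) (M', \<xi>'). (M ** M', \<xi> + M *v \<xi>')), one = (mat 1, 0)\<rparr>"

definition Gamma_theta :: "(real^2^2) set" where
  "Gamma_theta = generate SL2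
     {mat22 0 (-1) 1 0, mat22 1 2 0 1}"

definition Int_lattice :: "(real^2) set" where
  "Int_lattice = {v. \<forall>i. v $ i \<in> \<int>}"

definition Gamma_lattice :: "((real^2^2) \<times> (real^2)) set" where
  "Gamma_lattice = Gamma_theta \<times> Int_lattice"

definition Phi :: "real \<Rightarrow> (real^2^2) \<times> (real^2)" where
  "Phi t = (mat22 (exp (- t / 2)) 0 0 (exp (t / 2)), 0)"

definition Psi :: "real \<Rightarrow> (real^2^2) \<times> (real^2)" where
  "Psi x = (mat22 1 x 0 1, 0)"

lemma SL2_simps [simp]:
  "carrier SL2 = {M. det M = 1}" "M \<otimes>\<^bsub>SL2\<^esub> N = M ** N" "\<one>\<^bsub>SL2\<^esub> = mat 1"
  by (simp_all add: SL2_def)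

lemma ASL2_simps [simp]:
  "carrier ASL2 = {M. det M = 1} \<times> UNIV"
  "(M, \<xi>) \<otimes>\<^bsub>ASL2\<^esub> (M', \<xi>') = (M ** M', \<xi> + M *v \<xi>')"
  "\<one>\<^bsub>ASL2\<^esub> = (mat 1, 0)"
  by (simp_all add: ASL2_def)

lemma SL2_left_inverse:
  fixes M :: "real^2^2"
  assumes "det M = 1"
  shows "\<exists>N. det N = 1 \<and> N ** M = mat 1"
proof -
  have "invertible M"
    using assms by (simp add: invertible_det_nz)
  then obtain N where N: "N ** M = mat 1"
    by (auto simp: invertible_def)
  then have "det N * det M = 1"
    by (metis det_mul det_I)
  with N assms show ?thesis by auto
qed

lemma group_SL2: "group SL2"
  by (rule groupI) (auto simp: det_mul matrix_mul_assoc SL2_left_inverse)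

lemma group_ASL2: "group ASL2"
proof (rule groupI)
  fix g assume "g \<in> carrier ASL2"
  then obtain M \<xi> where g: "g = (M, \<xi>)" "det M = 1" by auto
  obtain N where "det N = 1" "N ** M = mat 1"
    using SL2_left_inverse g by blast
  then show "\<exists>h\<in>carrier ASL2. h \<otimes>\<^bsub>ASL2\<^esub> g = \<one>\<^bsub>ASL2\<^esub>"
    using g by (intro bexI[of _ "(N, - (N *v \<xi>))"]) auto
qed (auto simp: det_mul matrix_mul_assoc matrix_vector_mul_assoc matrix_vector_right_distrib add.assoc)

lemma subgroup_Gamma_theta: "subgroup Gamma_theta SL2"
  unfolding Gamma_theta_def
  by (rule group.generate_is_subgroup[OF group_SL2]) (auto simp: mat22_def det_2)

lemma Gamma_theta_Ints:
  assumes "M \<in> Gamma_theta"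
  shows "M $ i $ j \<in> \<int>"
proof -
  have inv_eq: "inv\<^bsub>SL2\<^esub> A = B" if "det A = 1" "det B = 1" "B ** A = mat 1" for A B
    using group.inv_equality[OF group_SL2, of B A] that by simp
  have 1: "inv\<^bsub>SL2\<^esub> (mat22 0 (-1) 1 0) = mat22 0 1 (-1) 0"
    by (rule inv_eq)
      (auto simp: mat22_def det_2 vec_eq_iff forall_2 matrix_matrix_mult_def sum_2 mat_def)
  have 2: "inv\<^bsub>SL2\<^esub> (mat22 1 2 0 1) = mat22 1 (-2) 0 1"
    by (rule inv_eq)
      (auto simp: mat22_def det_2 vec_eq_iff forall_2 matrix_matrix_mult_def sum_2 mat_def)
  have "\<forall>i j. M $ i $ j \<in> \<int>"
    using assms unfolding Gamma_theta_def
  proof (induction rule: generate.induct)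
    case one
    then show ?case by (auto simp: mat_def)
  next
    case (incl h)
    then show ?case by (auto simp: mat22_def forall_2)
  next
    case (inv h)
    then have "inv\<^bsub>SL2\<^esub> h = mat22 0 1 (-1) 0 \<or> inv\<^bsub>SL2\<^esub> h = mat22 1 (-2) 0 1"
      using 1 2 by blast
    then show ?case by (auto simp: mat22_def forall_2)
  next
    case (eng h1 h2)
    then show ?case by (auto simp: matrix_matrix_mult_def)
  qed
  then show ?thesis by blast
qed

lemma subgroup_Gamma_lattice: "subgroup Gamma_lattice ASL2"
proof (rule group.subgroupI[OF group_ASL2])
  show "Gamma_lattice \<subseteq> carrier ASL2"
    using subgroup.subset[OF subgroup_Gamma_theta] by (auto simp: Gamma_lattice_def)
  have "(mat 1, 0) \<in> Gamma_lattice"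
    using subgroup.one_closed[OF subgroup_Gamma_theta] by (auto simp: Gamma_lattice_def Int_lattice_def)
  then show "Gamma_lattice \<noteq> {}" by blast
next
  fix g assume "g \<in> Gamma_lattice"
  then obtain M v where g: "g = (M, v)" "M \<in> Gamma_theta" "v \<in> Int_lattice"
    by (auto simp: Gamma_lattice_def)
  define N where "N = inv\<^bsub>SL2\<^esub> M"
  have M: "M \<in> carrier SL2"
    using g subgroup.subset[OF subgroup_Gamma_theta] by blast
  have N: "N \<in> Gamma_theta"
    unfolding N_def using g subgroup.m_inv_closed[OF subgroup_Gamma_theta] by blast
  then have N': "N \<in> carrier SL2"
    using subgroup.subset[OF subgroup_Gamma_theta] by blast
  have NM: "N ** M = mat 1"
    using group.l_inv[OF group_SL2 M] by (simp add: N_def)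
  have "inv\<^bsub>ASL2\<^esub> g = (N, - (N *v v))"
    by (rule group.inv_equality[OF group_ASL2]) (use M N' NM g in auto)
  moreover have "- (N *v v) \<in> Int_lattice"
    using g Gamma_theta_Ints[OF N] by (auto simp: Int_lattice_def matrix_vector_mult_def)
  ultimately show "inv\<^bsub>ASL2\<^esub> g \<in> Gamma_lattice"
    using N by (auto simp: Gamma_lattice_def)
next
  fix g h assume "g \<in> Gamma_lattice" "h \<in> Gamma_lattice"
  then show "g \<otimes>\<^bsub>ASL2\<^esub> h \<in> Gamma_lattice"
    using subgroup.m_closed[OF subgroup_Gamma_theta]
    by (auto simp: Gamma_lattice_def Int_lattice_def matrix_vector_mult_def
        intro!: Ints_add Ints_sum Ints_mult Gamma_theta_Ints)
qed

text \<open>The space of cosets \<open>\<Gamma_lattice> g\<close> with the quotient topology of the Euclidean topology on the group.\<close>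

definition coset_topology :: "((real^2^2) \<times> (real^2)) set topology" where
  "coset_topology = topology (\<lambda>U. U \<subseteq> rcosets\<^bsub>ASL2\<^esub> Gamma_lattice \<and>
     openin (top_of_set (carrier ASL2)) {g \<in> carrier ASL2. Gamma_lattice #>\<^bsub>ASL2\<^esub> g \<in> U})"

lemma openin_coset_topology:
  "openin coset_topology U \<longleftrightarrow> U \<subseteq> rcosets\<^bsub>ASL2\<^esub> Gamma_lattice \<and>
     openin (top_of_set (carrier ASL2)) {g \<in> carrier ASL2. Gamma_lattice #>\<^bsub>ASL2\<^esub> g \<in> U}"
proof -
  let ?P = "\<lambda>U. {g \<in> carrier ASL2. Gamma_lattice #>\<^bsub>ASL2\<^esub> g \<in> U}"
  have 1: "?P (S \<inter> T) = ?P S \<inter> ?P T" for S T by auto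
  have 2: "?P (\<Union>\<K>) = (\<Union>S\<in>\<K>. ?P S)" for \<K> by auto
  have "istopology (\<lambda>U. U \<subseteq> rcosets\<^bsub>ASL2\<^esub> Gamma_lattice \<and> openin (top_of_set (carrier ASL2)) (?P U))"
    unfolding istopology_def 1 2 by blast
  then show ?thesis
    by (simp add: coset_topology_def topology_inverse')
qed

lemma topspace_coset_topology: "topspace coset_topology = rcosets\<^bsub>ASL2\<^esub> Gamma_lattice"
proof -
  have "{g \<in> carrier ASL2. Gamma_lattice #>\<^bsub>ASL2\<^esub> g \<in> rcosets\<^bsub>ASL2\<^esub> Gamma_lattice} = carrier ASL2"
    by (auto simp: RCOSETS_def)
  then have "openin coset_topology (rcosets\<^bsub>ASL2\<^esub> Gamma_lattice)"
    by (simp add: openin_coset_topology del: ASL2_simps)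
  moreover have "topspace coset_topology \<subseteq> rcosets\<^bsub>ASL2\<^esub> Gamma_lattice"
    using openin_topspace[of coset_topology] unfolding openin_coset_topology by blast
  ultimately show ?thesis
    by (intro antisym openin_subset)
qed

lemma quotient_map_coset:
  "quotient_map (top_of_set (carrier ASL2)) coset_topology (\<lambda>g. Gamma_lattice #>\<^bsub>ASL2\<^esub> g)"
  unfolding quotient_map_def topspace_coset_topology
  by (auto simp: openin_coset_topology RCOSETS_def simp del: ASL2_simps)

definition coset_borel :: "((real^2^2) \<times> (real^2)) set measure" where
  "coset_borel = sigma (topspace coset_topology) {U. openin coset_topology U}"

text \<open>The representative modulo \<open>\<int>\<^sup>2\<close> in \<open>[-1/2, 1/2)\<^sup>2\<close>.\<close>

definition torus_rep :: "real^2 \<Rightarrow> real^2" where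
  "torus_rep v = (\<chi> i. v $ i - of_int \<lfloor>v $ i + 1/2\<rfloor>)"

definition torus_act :: "(real^2^2) \<times> (real^2) \<Rightarrow> real^2 \<Rightarrow> real^2" where
  "torus_act = (\<lambda>(M, v) \<xi>. torus_rep (v + M *v \<xi>))"

definition torus_orbit :: "real \<Rightarrow> real \<Rightarrow> (real^2) set" where
  "torus_orbit \<alpha> \<beta> = orbit (ASL2\<lparr>carrier := Gamma_lattice\<rparr>) torus_act (torus_rep (vector [\<alpha>, \<beta>]))"

definition iwasawa :: "real \<Rightarrow> real \<Rightarrow> real \<Rightarrow> real^2^2" where
  "iwasawa x y \<phi> = mat22 1 x 0 1
     ** mat22 (sqrt y) 0 0 (1 / sqrt y)
     ** mat22 (cos \<phi>) (- sin \<phi>) (sin \<phi>) (cos \<phi>)"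

definition theta_domain :: "complex set" where
  "theta_domain = {z. Im z > 0 \<and> cmod z > 1 \<and> cmod (z - 2) > 1 \<and> 0 \<le> Re z \<and> Re z < 2}"

definition hyp_measure :: "(real \<times> real \<times> real) measure" where
  "hyp_measure = density
     (restrict_space lborel {(x, y, \<phi>). Complex x y \<in> theta_domain \<and> 0 \<le> \<phi> \<and> \<phi> < pi})
     (\<lambda>(x, y, \<phi>). ennreal (1 / y\<^sup>2))"

text \<open>The measure is given in coordinates on the fundamental domain and transported to the coset
  space; the counting measure on the orbit is the sum of its point masses.\<close>

definition mu :: "real \<Rightarrow> real \<Rightarrow> ((real^2^2) \<times> (real^2)) set measure" where
  "mu \<alpha> \<beta> = scale_measure (ennreal (1 / (pi\<^sup>2 * real (card (torus_orbit \<alpha> \<beta>)))))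
     (distr (hyp_measure \<Otimes>\<^sub>M count_space (torus_orbit \<alpha> \<beta>)) coset_borel
       (\<lambda>((x, y, \<phi>), p). Gamma_lattice #>\<^bsub>ASL2\<^esub> (iwasawa x y \<phi>, p)))"

end

theory Submission
  imports Defs
begin

text \<open>Fix the orbit \<open>S\<close> of the rational point. A function on \<open>\<Gamma> \ G\<close> restricted to the support of the
  limit measure is a family of functions of \<open>M\<close> indexed by \<open>p \<in> S\<close>, integrated against Haar measure over a
  fundamental domain of \<open>\<Gamma>\<^sub>\<theta>\<close>; right translation by \<open>SL(2,R)\<close> preserves this integral.

  The flow \<open>\<Phi>\<^sup>t\<close> is mixing. Given a bounded \<open>h\<close> of mean zero, right translates of \<open>h\<close> by lower unipotents, and
  averages of them, all have asymptotically the same correlation with \<open>f \<circ> \<Phi>\<^sup>t\<close>, because the flow contracts lower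
  unipotents and \<open>f\<close> is uniformly continuous. An average \<open>w\<close> of nearly minimal \<open>L\<^sup>2\<close> norm is, by the
  parallelogram law, almost invariant under the lower unipotents, hence by Mautner's argument under all of
  \<open>SL(2,R)\<close>. As \<open>SL(2,R)\<close> acts transitively, such a \<open>w\<close> has small variance, and so the correlations tend to \<open>0\<close>.

  Thickening the horocycle in the contracted directions to a bump function on \<open>SL(2,R)\<close>, summing it over
  \<open>\<Gamma>\<close> and unfolding turns mixing into equidistribution of the translated horocycle, first for continuous
  densities and then by \<open>L\<^sup>1\<close> approximation for all densities. Finally a cutoff function, whose mean value along the
  horocycles is controlled by equidistribution itself, excludes escape of mass and reduces bounded continuous
  \<open>F(u,g)\<close> and \<open>F\<^sub>t\<close> to step functions in \<open>u\<close> with uniformly continuous values.\<close>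

subsection \<open>Matrices of determinant one\<close>

text \<open>The customary proof of mixing extracts a weak limit in \<open>L^2\<close> and shows that
  it is invariant. Here every function stays bounded and uniformly continuous, so no completion is
  formed and invariance is only ever approximate: the mean square displacement \<open>Q\<close> of a
  near minimiser is small on lower unipotents, and matrix identities spread this bound over the
  group at the fixed loss 448. Since Haar measure is infinite, the passage from small displacement
  to small variance is made on a box, which has to be chosen before the admissible displacement.
  Rationality enters through the finiteness of the orbit, which gives the pairs
  \<open>(M, p)\<close> the finite mass \<open>card S * pi^2 / 2\<close>; transitivity on the orbit
  joins its points into one ergodic space. The volume is \<open>pi^2 / 2\<close> and not
  \<open>pi^2\<close> because the measure in Iwasawa coordinates is twice the Haar measure used
  here. The flow expands upper unipotents, but contracts or fixes the lower triangular directions.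
  Thickening a horocycle in those directions therefore costs an error that is uniform in
  \<open>t \<ge> 0\<close>.\<close>

lemma mat22_nth [simp]:
  "mat22 a b c d $ 1 $ 1 = a" "mat22 a b c d $ 1 $ 2 = b"
  "mat22 a b c d $ 2 $ 1 = c" "mat22 a b c d $ 2 $ 2 = d"
  by (simp_all add: mat22_def)

lemma mat22_eta: "mat22 (M$1$1) (M$1$2) (M$2$1) (M$2$2) = M"
  by (simp add: vec_eq_iff forall_2)

lemma mat22_eq_iff: "M = N \<longleftrightarrow> M$1$1 = N$1$1 \<and> M$1$2 = N$1$2 \<and> M$2$1 = N$2$1 \<and> M$2$2 = N$2$2"
  for M N :: "real^2^2"
  by (auto simp: vec_eq_iff forall_2)

lemma mat22_mult [simp]:
  "mat22 a b c d ** mat22 a' b' c' d' = mat22 (a*a'+b*c') (a*b'+b*d') (c*a'+d*c') (c*b'+d*d')"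
  by (simp add: mat22_eq_iff matrix_matrix_mult_def sum_2)

lemma matrix_mult_nth_22 [simp]: "(M ** N) $ i $ j = M$i$1 * N$1$j + M$i$2 * N$2$j" for M N :: "real^2^2"
  by (simp add: matrix_matrix_mult_def sum_2)

lemma det_mat22 [simp]: "det (mat22 a b c d) = a*d - b*c"
  by (simp add: det_2)

lemma mat_1_mat22: "mat 1 = mat22 1 0 0 1"
  by (simp add: mat22_eq_iff mat_def)

lemma mat_1_nth [simp]: "(mat 1 :: real^2^2) $ 1 $ 1 = 1" "(mat 1 :: real^2^2) $ 1 $ 2 = 0"
  "(mat 1 :: real^2^2) $ 2 $ 1 = 0" "(mat 1 :: real^2^2) $ 2 $ 2 = 1"
  by (simp_all add: mat_def)

definition SL :: "(real^2^2) set" where "SL = {M. det M = 1}"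

definition adj :: "real^2^2 \<Rightarrow> real^2^2" where
  "adj M = mat22 (M$2$2) (- M$1$2) (- M$2$1) (M$1$1)"

lemma adj_nth [simp]: "adj M $ 1 $ 1 = M$2$2" "adj M $ 1 $ 2 = - M$1$2"
  "adj M $ 2 $ 1 = - M$2$1" "adj M $ 2 $ 2 = M$1$1"
  by (simp_all add: adj_def)

lemma SL_iff: "M \<in> SL \<longleftrightarrow> M$1$1 * M$2$2 - M$1$2 * M$2$1 = 1"
  by (simp add: SL_def det_2)

lemma SL_mult [simp]: "M \<in> SL \<Longrightarrow> N \<in> SL \<Longrightarrow> M ** N \<in> SL"
  by (simp add: SL_def det_mul)

lemma SL_one [simp]: "mat 1 \<in> SL"
  by (simp add: SL_def)

lemma SL_adj [simp]: "M \<in> SL \<Longrightarrow> adj M \<in> SL"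
  by (simp add: SL_iff algebra_simps)

lemma adj_mult [simp]:
  assumes "M \<in> SL" shows "adj M ** M = mat 1" "M ** adj M = mat 1"
  using assms by (auto simp: mat22_eq_iff SL_iff algebra_simps)

lemma adj_mult_cancel [simp]:
  assumes "M \<in> SL" shows "adj M ** (M ** N) = N" "M ** (adj M ** N) = N"
    "(N ** M) ** adj M = N" "(N ** adj M) ** M = N"
  using assms by (simp_all add: matrix_mul_assoc, simp_all add: matrix_mul_assoc[symmetric])

lemma adj_adj [simp]: "adj (adj M) = M"
  by (simp add: mat22_eq_iff)

section \<open>Shears, diagonal matrices and generation by shears\<close>

definition up :: "real \<Rightarrow> real^2^2" where "up x = mat22 1 x 0 1"
definition lo :: "real \<Rightarrow> real^2^2" where "lo x = mat22 1 0 x 1"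
definition dg :: "real \<Rightarrow> real^2^2" where "dg e = mat22 (1/e) 0 0 e"
definition sw :: "real^2^2" where "sw = mat22 0 (-1) 1 0"

lemma up_SL [simp]: "up x \<in> SL" and lo_SL [simp]: "lo x \<in> SL" and sw_SL [simp]: "sw \<in> SL"
  and dg_SL [simp]: "e \<noteq> 0 \<Longrightarrow> dg e \<in> SL"
  by (simp_all add: up_def lo_def sw_def dg_def SL_def)

text \<open>A matrix with nonzero lower left entry \<open>c\<close> is a product upper shear,
  \<open>lo c\<close>, upper shear, the outer two being determined by the diagonal. If
  \<open>c = 0\<close>, the upper left entry is nonzero and multiplication by \<open>lo 1\<close>
  leads back to the first case.\<close>

lemma SL_shear_induct [consumes 1, case_names up lo mult]:
  assumes M: "M \<in> SL" and up: "\<And>x. P (up x)" and lo: "\<And>x. P (lo x)"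
    and mult: "\<And>M N. M \<in> SL \<Longrightarrow> N \<in> SL \<Longrightarrow> P M \<Longrightarrow> P N \<Longrightarrow> P (M ** N)"
  shows "P M"
proof -
  have *: "P M" if M: "M \<in> SL" and c: "M$2$1 \<noteq> 0" for M
  proof -
    let ?a = "M$1$1" and ?c = "M$2$1" and ?d = "M$2$2"
    have "M = up ((?a - 1)/?c) ** (lo ?c ** up ((?d - 1)/?c))"
      using M c by (simp add: mat22_eq_iff up_def lo_def SL_iff field_simps)
    then show ?thesis using up lo mult by (metis SL_mult up_SL lo_SL)
  qed
  show ?thesis
  proof (cases "M$2$1 = 0")
    case True
    then have a: "M$1$1 \<noteq> 0" using M by (auto simp: SL_iff)
    have "M = lo (-1) ** (lo 1 ** M)" by (simp add: mat22_eq_iff lo_def)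
    moreover have "P (lo 1 ** M)"
      by (rule *) (use True a M in \<open>auto simp: lo_def SL_iff algebra_simps\<close>)
    ultimately show ?thesis using lo mult M by (metis SL_mult lo_SL)
  qed (use * M in blast)
qed

subsection \<open>Haar measure\<close>

abbreviation SLb :: "(real^2^2) measure" where "SLb \<equiv> restrict_space borel SL"

text \<open>Haar measure is \<open>dt dc dd\<close> in the coordinates \<open>M = up t ** mat22 (1/d) 0 c d\<close>; the null set
  \<open>d = 0\<close> carries a junk value.\<close>

definition par :: "real \<Rightarrow> real \<Rightarrow> real \<Rightarrow> real^2^2" where
  "par t c d = (if d = 0 then mat 1 else mat22 (1/d + t*c) (t*d) c d)"

lemma par_SL [simp]: "par t c d \<in> SL"
  by (auto simp: par_def SL_def field_simps)

lemma measurable_mat22 [measurable (raw)]: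
  assumes [measurable]: "a \<in> borel_measurable M" "b \<in> borel_measurable M" "c \<in> borel_measurable M" "d \<in> borel_measurable M"
  shows "(\<lambda>x. mat22 (a x) (b x) (c x) (d x)) \<in> borel_measurable M"
proof -
  have "(\<lambda>x. mat22 (a x) (b x) (c x) (d x)) = (\<lambda>x. a x *\<^sub>R mat22 1 0 0 0 + b x *\<^sub>R mat22 0 1 0 0 +
       c x *\<^sub>R mat22 0 0 1 0 + d x *\<^sub>R mat22 0 0 0 1)"
    by (auto simp: mat22_eq_iff)
  then show ?thesis by simp
qed

lemma continuous_on_mat22 [continuous_intros]:
  assumes "continuous_on S a" "continuous_on S b" "continuous_on S c" "continuous_on S d"
  shows "continuous_on S (\<lambda>x. mat22 (a x) (b x) (c x) (d x))"
proof -
  have "(\<lambda>x. mat22 (a x) (b x) (c x) (d x)) = (\<lambda>x. a x *\<^sub>R mat22 1 0 0 0 + b x *\<^sub>R mat22 0 1 0 0 +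
       c x *\<^sub>R mat22 0 0 1 0 + d x *\<^sub>R mat22 0 0 0 1)"
    by (auto simp: mat22_eq_iff)
  then show ?thesis by (simp only:) (intro continuous_intros assms)
qed

lemma continuous_on_mmult [continuous_intros]:
  fixes f g :: "'a::topological_space \<Rightarrow> real^2^2"
  assumes "continuous_on S f" "continuous_on S g"
  shows "continuous_on S (\<lambda>x. f x ** g x)"
proof -
  have "(\<lambda>x. f x ** g x) = (\<lambda>x. mat22 ((f x ** g x)$1$1) ((f x ** g x)$1$2) ((f x ** g x)$2$1) ((f x ** g x)$2$2))"
    by (simp only: mat22_eta)
  then show ?thesis by (simp only: matrix_mult_nth_22) (intro continuous_intros assms)
qed

lemma closed_SL: "closed SL"
proof -
  have "SL = {M. M$1$1 * M$2$2 - M$1$2 * M$2$1 = 1}" by (auto simp: SL_iff)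
  moreover have "closed {M::real^2^2. M$1$1 * M$2$2 - M$1$2 * M$2$1 = 1}"
    by (intro closed_Collect_eq continuous_intros)
  ultimately show ?thesis by simp
qed

lemma space_SLb [simp]: "space SLb = SL"
  by (simp add: space_restrict_space)

lemma measurable_SLbI [measurable (raw)]:
  assumes "f \<in> borel_measurable M" "\<And>x. x \<in> space M \<Longrightarrow> f x \<in> SL"
  shows "f \<in> measurable M SLb"
  using assms by (intro measurable_restrict_space2) auto

lemma measurable_entry_SLb [measurable]: "(\<lambda>M. M $ i $ j) \<in> borel_measurable SLb"
  by (intro borel_measurable_continuous_on_restrict continuous_intros)

lemma measurable_mmult_SLb [measurable (raw)]:
  assumes "f \<in> measurable N SLb" "g \<in> measurable N SLb"
  shows "(\<lambda>x. f x ** g x) \<in> measurable N SLb"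
proof (rule measurable_SLbI)
  have [measurable]: "(\<lambda>x. f x $ i $ j) \<in> borel_measurable N" "(\<lambda>x. g x $ i $ j) \<in> borel_measurable N" for i j
    using measurable_compose[OF assms(1) measurable_entry_SLb] measurable_compose[OF assms(2) measurable_entry_SLb] by auto
  have "(\<lambda>x. f x ** g x) = (\<lambda>x. mat22 ((f x ** g x)$1$1) ((f x ** g x)$1$2) ((f x ** g x)$2$1) ((f x ** g x)$2$2))"
    by (simp only: mat22_eta)
  then show "(\<lambda>x. f x ** g x) \<in> borel_measurable N"
    by simp
  fix x assume "x \<in> space N"
  then show "f x ** g x \<in> SL" using measurable_space[OF assms(1)] measurable_space[OF assms(2)] by auto
qed

lemma measurable_adj_SLb [measurable (raw)]:
  assumes "f \<in> measurable N SLb"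
  shows "(\<lambda>x. adj (f x)) \<in> measurable N SLb"
proof (rule measurable_SLbI)
  have [measurable]: "(\<lambda>x. f x $ i $ j) \<in> borel_measurable N" for i j
    using measurable_compose[OF assms(1) measurable_entry_SLb] by auto
  show "(\<lambda>x. adj (f x)) \<in> borel_measurable N"
    unfolding adj_def by measurable
qed (use measurable_space[OF assms] in auto)

lemma measurable_const_SLb [measurable]: "g \<in> SL \<Longrightarrow> (\<lambda>x. g) \<in> measurable N SLb"
  by auto

lemma measurable_par [measurable (raw)]:
  assumes [measurable]: "f \<in> borel_measurable M" "g \<in> borel_measurable M" "h \<in> borel_measurable M"
  shows "(\<lambda>x. par (f x) (g x) (h x)) \<in> measurable M SLb"
proof (rule measurable_SLbI)
  show "(\<lambda>x. par (f x) (g x) (h x)) \<in> borel_measurable M"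
    unfolding par_def by measurable
qed simp

definition haar :: "(real^2^2) measure" where
  "haar = distr lborel SLb (\<lambda>(t, c, d). par t c d)"

lemma space_haar [simp]: "space haar = SL" and sets_haar [simp, measurable_cong]: "sets haar = sets SLb"
  by (simp_all add: haar_def space_restrict_space)

lemma nn_integral_lborel3:
  fixes f :: "real \<Rightarrow> real \<Rightarrow> real \<Rightarrow> ennreal"
  assumes f[measurable]: "(\<lambda>(x,y,z). f x y z) \<in> borel_measurable borel"
  shows "(\<integral>\<^sup>+p. (case p of (x,y,z) \<Rightarrow> f x y z) \<partial>lborel) = (\<integral>\<^sup>+z. \<integral>\<^sup>+y. \<integral>\<^sup>+x. f x y z \<partial>lborel \<partial>lborel \<partial>lborel)"
proof -
  have f': "(\<lambda>p. f (fst p) (fst (snd p)) (snd (snd p))) \<in> borel_measurable (borel \<Otimes>\<^sub>M borel \<Otimes>\<^sub>M borel)"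
    using f by (simp add: borel_prod split_def)
  have [measurable (raw)]: "(\<lambda>x. f (A x) (B x) (C x)) \<in> borel_measurable N"
    if [measurable]: "A \<in> borel_measurable N" "B \<in> borel_measurable N" "C \<in> borel_measurable N" for A B C and N :: "'z measure"
    using measurable_compose[of "\<lambda>x. (A x, B x, C x)" N, OF _ f'] by simp
  have [measurable]: "(\<lambda>p. f (fst p) (fst (snd p)) (snd (snd p))) \<in> borel_measurable (lborel \<Otimes>\<^sub>M (lborel :: (real \<times> real) measure))"
    using f by (simp add: lborel_prod split_def)
  have "(\<integral>\<^sup>+p. (case p of (x,y,z) \<Rightarrow> f x y z) \<partial>lborel) =
    (\<integral>\<^sup>+p. f (fst p) (fst (snd p)) (snd (snd p)) \<partial>(lborel \<Otimes>\<^sub>M lborel))"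
    by (simp add: lborel_prod split_def)
  also have "\<dots> = (\<integral>\<^sup>+q. \<integral>\<^sup>+x. f x (fst q) (snd q) \<partial>lborel \<partial>lborel)"
    by (subst lborel_pair.nn_integral_snd[symmetric]) (simp, simp)
  also have "\<dots> = (\<integral>\<^sup>+q. \<integral>\<^sup>+x. f x (fst q) (snd q) \<partial>lborel \<partial>(lborel \<Otimes>\<^sub>M lborel))"
    by (simp add: lborel_prod)
  also have "\<dots> = (\<integral>\<^sup>+z. \<integral>\<^sup>+y. \<integral>\<^sup>+x. f x y z \<partial>lborel \<partial>lborel \<partial>lborel)"
    by (subst lborel_pair.nn_integral_snd[symmetric]) auto
  finally show ?thesis .
qed

lemma nn_integral_lborel_swap:
  fixes f :: "real \<Rightarrow> real \<Rightarrow> ennreal"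
  assumes [measurable]: "(\<lambda>(x,y). f x y) \<in> borel_measurable (borel \<Otimes>\<^sub>M borel)"
  shows "(\<integral>\<^sup>+x. \<integral>\<^sup>+y. f x y \<partial>lborel \<partial>lborel) = (\<integral>\<^sup>+y. \<integral>\<^sup>+x. f x y \<partial>lborel \<partial>lborel)"
  by (rule lborel_pair.Fubini') simp

lemma AE_lborel_neq: "AE x in lborel. x \<noteq> (a::real)"
proof -
  have "AE x in lborel. x \<notin> {a}" by (rule AE_not_in) (auto intro: null_setsI)
  then show ?thesis by simp
qed

lemma nn_integral_translate:
  fixes f :: "real \<Rightarrow> ennreal"
  assumes [measurable]: "f \<in> borel_measurable borel"
  shows "(\<integral>\<^sup>+x. f (x + a) \<partial>lborel) = (\<integral>\<^sup>+x. f x \<partial>lborel)"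
  using nn_integral_real_affine[of f 1 a] by (simp add: add.commute)

lemma nn_integral_scale:
  fixes f :: "real \<Rightarrow> ennreal"
  assumes [measurable]: "f \<in> borel_measurable borel" and c: "c \<noteq> 0"
  shows "(\<integral>\<^sup>+x. f (c * x + a) \<partial>lborel) = ennreal (1/\<bar>c\<bar>) * (\<integral>\<^sup>+x. f x \<partial>lborel)"
proof -
  have "(\<integral>\<^sup>+x. f x \<partial>lborel) = ennreal \<bar>c\<bar> * (\<integral>\<^sup>+x. f (c * x + a) \<partial>lborel)"
    using nn_integral_real_affine[of f c a] c by (simp add: add.commute)
  moreover have "ennreal (1/\<bar>c\<bar>) * ennreal \<bar>c\<bar> = 1"
    using c by (simp add: ennreal_mult''[symmetric])
  ultimately show ?thesis by (simp add: mult.assoc[symmetric])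
qed

lemma nn_integral_haar:
  assumes [measurable]: "f \<in> borel_measurable SLb"
  shows "(\<integral>\<^sup>+M. f M \<partial>haar) = (\<integral>\<^sup>+d. \<integral>\<^sup>+c. \<integral>\<^sup>+t. f (par t c d) \<partial>lborel \<partial>lborel \<partial>lborel)"
proof -
  have [measurable]: "(\<lambda>(t,c,d). par t c d) \<in> measurable borel SLb"
    unfolding borel_prod[symmetric] split_def by measurable
  have "(\<integral>\<^sup>+M. f M \<partial>haar) = (\<integral>\<^sup>+p. (case p of (t,c,d) \<Rightarrow> f (par t c d)) \<partial>lborel)"
    unfolding haar_def by (subst nn_integral_distr) (auto intro!: nn_integral_cong)
  also have "\<dots> = (\<integral>\<^sup>+d. \<integral>\<^sup>+c. \<integral>\<^sup>+t. f (par t c d) \<partial>lborel \<partial>lborel \<partial>lborel)"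
    by (rule nn_integral_lborel3) (unfold borel_prod[symmetric] split_def, measurable)
  finally show ?thesis .
qed

section \<open>Invariance of Haar measure on both sides\<close>

definition right_inv :: "real^2^2 \<Rightarrow> bool" where
  "right_inv g \<longleftrightarrow> (\<forall>f\<in>borel_measurable SLb. (\<integral>\<^sup>+M. f (M ** g) \<partial>haar) = (\<integral>\<^sup>+M. f M \<partial>haar))"

definition left_inv :: "real^2^2 \<Rightarrow> bool" where
  "left_inv g \<longleftrightarrow> (\<forall>f\<in>borel_measurable SLb. (\<integral>\<^sup>+M. f (g ** M) \<partial>haar) = (\<integral>\<^sup>+M. f M \<partial>haar))"

text \<open>In the coordinates of \<open>par\<close> the bottom row \<open>(c, d)\<close> becomes
  \<open>(c + d * s, d)\<close> while \<open>t\<close> stays, so the claim is translation invariance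
  in \<open>c\<close>.\<close>

lemma right_inv_lo: "right_inv (lo s)"
  unfolding right_inv_def
proof safe
  fix f :: "_ \<Rightarrow> ennreal" assume [measurable]: "f \<in> borel_measurable SLb"
  have "(\<integral>\<^sup>+M. f (M ** lo s) \<partial>haar) = (\<integral>\<^sup>+d. \<integral>\<^sup>+c. \<integral>\<^sup>+t. f (par t c d ** lo s) \<partial>lborel \<partial>lborel \<partial>lborel)"
    by (rule nn_integral_haar) measurable
  also have "\<dots> = (\<integral>\<^sup>+d. \<integral>\<^sup>+c. \<integral>\<^sup>+t. f (par t (c + d * s) d) \<partial>lborel \<partial>lborel \<partial>lborel)"
    by (intro nn_integral_cong_AE, use AE_lborel_neq[of 0] in eventually_elim)
       (simp add: par_def lo_def algebra_simps)
  also have "\<dots> = (\<integral>\<^sup>+d. \<integral>\<^sup>+c. \<integral>\<^sup>+t. f (par t c d) \<partial>lborel \<partial>lborel \<partial>lborel)"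
    by (intro nn_integral_cong nn_integral_translate[where f="\<lambda>c. \<integral>\<^sup>+t. f (par t c _) \<partial>lborel"]) measurable
  also have "\<dots> = (\<integral>\<^sup>+M. f M \<partial>haar)" by (rule nn_integral_haar[symmetric]) measurable
  finally show "(\<integral>\<^sup>+M. f (M ** lo s) \<partial>haar) = (\<integral>\<^sup>+M. f M \<partial>haar)" .
qed

text \<open>The bottom row becomes \<open>(c, d + c * s)\<close>, and at fixed \<open>(c, d)\<close>
  the coordinate \<open>t\<close> is merely shifted by \<open>s / (d * (d + c * s))\<close>. The
  innermost integral over \<open>t\<close> absorbs the shift; afterwards \<open>d\<close> is
  translated at fixed \<open>c\<close>, which is why the two outer integrals are
  interchanged.\<close>

lemma right_inv_up: "right_inv (up s)"
  unfolding right_inv_def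
proof safe
  fix f :: "_ \<Rightarrow> ennreal" assume [measurable]: "f \<in> borel_measurable SLb"
  have "(\<integral>\<^sup>+M. f (M ** up s) \<partial>haar) = (\<integral>\<^sup>+d. \<integral>\<^sup>+c. \<integral>\<^sup>+t. f (par t c d ** up s) \<partial>lborel \<partial>lborel \<partial>lborel)"
    by (rule nn_integral_haar) measurable
  also have "\<dots> = (\<integral>\<^sup>+c. \<integral>\<^sup>+d. \<integral>\<^sup>+t. f (par t c d ** up s) \<partial>lborel \<partial>lborel \<partial>lborel)"
    by (rule nn_integral_lborel_swap) measurable
  also have "\<dots> = (\<integral>\<^sup>+c. \<integral>\<^sup>+d. \<integral>\<^sup>+t. f (par t c (d + c * s)) \<partial>lborel \<partial>lborel \<partial>lborel)"
  proof (rule nn_integral_cong, rule nn_integral_cong_AE)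
    fix c :: real
    show "AE d in lborel. (\<integral>\<^sup>+t. f (par t c d ** up s) \<partial>lborel) = (\<integral>\<^sup>+t. f (par t c (d + c * s)) \<partial>lborel)"
      using AE_lborel_neq[of 0] AE_lborel_neq[of "- c * s"]
    proof eventually_elim
      case (elim d)
      then have d: "d \<noteq> 0" "d + c * s \<noteq> 0" by auto
      have "par t c d ** up s = par (t + s / (d * (d + c * s))) c (d + c * s)" for t
        using d by (simp add: par_def up_def mat22_eq_iff divide_simps) (simp add: algebra_simps)
      then show ?case
        using nn_integral_translate[of "\<lambda>t. f (par t c (d + c * s))" "s / (d * (d + c * s))"] by simp
    qed
  qed
  also have "\<dots> = (\<integral>\<^sup>+c. \<integral>\<^sup>+d. \<integral>\<^sup>+t. f (par t c d) \<partial>lborel \<partial>lborel \<partial>lborel)"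
    by (intro nn_integral_cong nn_integral_translate[where f="\<lambda>d. \<integral>\<^sup>+t. f (par t _ d) \<partial>lborel"]) measurable
  also have "\<dots> = (\<integral>\<^sup>+d. \<integral>\<^sup>+c. \<integral>\<^sup>+t. f (par t c d) \<partial>lborel \<partial>lborel \<partial>lborel)"
    by (rule nn_integral_lborel_swap) measurable
  also have "\<dots> = (\<integral>\<^sup>+M. f M \<partial>haar)" by (rule nn_integral_haar[symmetric]) measurable
  finally show "(\<integral>\<^sup>+M. f (M ** up s) \<partial>haar) = (\<integral>\<^sup>+M. f M \<partial>haar)" .
qed

lemma right_inv_SL: "g \<in> SL \<Longrightarrow> right_inv g"
proof (induction rule: SL_shear_induct)
  fix M N assume *: "M \<in> SL" "N \<in> SL" "right_inv M" "right_inv N"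
  show "right_inv (M ** N)"
    unfolding right_inv_def
  proof safe
    fix f :: "_ \<Rightarrow> ennreal" assume [measurable]: "f \<in> borel_measurable SLb"
    have [measurable]: "(\<lambda>X. f (X ** N)) \<in> borel_measurable SLb" using * by measurable
    show "(\<integral>\<^sup>+X. f (X ** (M ** N)) \<partial>haar) = (\<integral>\<^sup>+X. f X \<partial>haar)"
      using *(3)[unfolded right_inv_def, rule_format, of "\<lambda>X. f (X ** N)"] *(4)[unfolded right_inv_def, rule_format, of f]
      by (simp add: matrix_mul_assoc)
  qed
qed (rule right_inv_up right_inv_lo)+

lemma left_inv_mult:
  assumes *: "M \<in> SL" "N \<in> SL" "left_inv M" "left_inv N"
  shows "left_inv (M ** N)"
  unfolding left_inv_def
proof safe
  fix f :: "_ \<Rightarrow> ennreal" assume [measurable]: "f \<in> borel_measurable SLb"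
  have [measurable]: "(\<lambda>X. f (M ** X)) \<in> borel_measurable SLb" using * by measurable
  show "(\<integral>\<^sup>+X. f (M ** N ** X) \<partial>haar) = (\<integral>\<^sup>+X. f X \<partial>haar)"
    using *(4)[unfolded left_inv_def, rule_format, of "\<lambda>X. f (M ** X)"] *(3)[unfolded left_inv_def, rule_format, of f]
    by (simp add: matrix_mul_assoc)
qed

lemma left_inv_up: "left_inv (up s)"
  unfolding left_inv_def
proof safe
  fix f :: "_ \<Rightarrow> ennreal" assume [measurable]: "f \<in> borel_measurable SLb"
  have "(\<integral>\<^sup>+M. f (up s ** M) \<partial>haar) = (\<integral>\<^sup>+d. \<integral>\<^sup>+c. \<integral>\<^sup>+t. f (up s ** par t c d) \<partial>lborel \<partial>lborel \<partial>lborel)"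
    by (rule nn_integral_haar) measurable
  also have "\<dots> = (\<integral>\<^sup>+d. \<integral>\<^sup>+c. \<integral>\<^sup>+t. f (par (t + s) c d) \<partial>lborel \<partial>lborel \<partial>lborel)"
    by (intro nn_integral_cong_AE, use AE_lborel_neq[of 0] in eventually_elim)
       (simp add: par_def up_def algebra_simps)
  also have "\<dots> = (\<integral>\<^sup>+d. \<integral>\<^sup>+c. \<integral>\<^sup>+t. f (par t c d) \<partial>lborel \<partial>lborel \<partial>lborel)"
    by (intro nn_integral_cong nn_integral_translate[where f="\<lambda>t. f (par t _ _)"]) measurable
  also have "\<dots> = (\<integral>\<^sup>+M. f M \<partial>haar)" by (rule nn_integral_haar[symmetric]) measurable
  finally show "(\<integral>\<^sup>+M. f (up s ** M) \<partial>haar) = (\<integral>\<^sup>+M. f M \<partial>haar)" .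
qed

text \<open>Substitutes \<open>b = t * d\<close>, the upper right entry of \<open>par t c d\<close>,
  for \<open>t\<close> at fixed \<open>d\<close>. The matrix \<open>sw\<close> exchanges
  \<open>b\<close> and \<open>d\<close> up to sign, so its action is simple in these coordinates and
  not in \<open>t\<close>.\<close>

lemma nn_integral_slope_swap:
  fixes h :: "real \<Rightarrow> real \<Rightarrow> ennreal"
  assumes [measurable]: "(\<lambda>(x,y). h x y) \<in> borel_measurable (borel \<Otimes>\<^sub>M borel)"
  shows "(\<integral>\<^sup>+t. \<integral>\<^sup>+d. h (t*d) d \<partial>lborel \<partial>lborel) = (\<integral>\<^sup>+d. ennreal (1/\<bar>d\<bar>) * (\<integral>\<^sup>+b. h b d \<partial>lborel) \<partial>lborel)"
proof -
  have "(\<integral>\<^sup>+t. \<integral>\<^sup>+d. h (t*d) d \<partial>lborel \<partial>lborel) = (\<integral>\<^sup>+d. \<integral>\<^sup>+t. h (t*d) d \<partial>lborel \<partial>lborel)"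
    by (rule nn_integral_lborel_swap) measurable
  also have "\<dots> = (\<integral>\<^sup>+d. ennreal (1/\<bar>d\<bar>) * (\<integral>\<^sup>+b. h b d \<partial>lborel) \<partial>lborel)"
  proof (intro nn_integral_cong_AE, use AE_lborel_neq[of 0] in eventually_elim)
    case (elim d)
    then show ?case using nn_integral_scale[of "\<lambda>b. h b d" d 0] by (simp add: mult.commute)
  qed
  finally show ?thesis .
qed

text \<open>With \<open>b\<close> in place of \<open>t\<close> Haar measure is
  \<open>db dc dd / |d|\<close>. Left multiplication by \<open>sw\<close> replaces
  \<open>(b, d)\<close> by \<open>(-d, b)\<close> and \<open>c\<close> by the upper left entry
  \<open>t * c + 1/d\<close>. The scale \<open>t = b/d\<close> of the latter contributes the factor
  \<open>|d|/|b|\<close>, which turns the weight \<open>1/|d|\<close> into \<open>1/|b|\<close>, the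
  weight that belongs to the new lower right entry.\<close>

lemma left_inv_sw: "left_inv sw"
  unfolding left_inv_def
proof safe
  fix f :: "_ \<Rightarrow> ennreal" assume [measurable]: "f \<in> borel_measurable SLb"
  define F where "F b d = (\<integral>\<^sup>+c. f (par (b/d) c d) \<partial>lborel)" for b d
  have [measurable]: "(\<lambda>(b,d). F b d) \<in> borel_measurable (borel \<Otimes>\<^sub>M borel)"
    unfolding F_def by measurable
  have flat: "(\<integral>\<^sup>+d. \<integral>\<^sup>+c. \<integral>\<^sup>+t. f (par t c d) \<partial>lborel \<partial>lborel \<partial>lborel) = (\<integral>\<^sup>+d. ennreal (1/\<bar>d\<bar>) * (\<integral>\<^sup>+b. F b d \<partial>lborel) \<partial>lborel)"
  proof -
    have "(\<integral>\<^sup>+d. \<integral>\<^sup>+c. \<integral>\<^sup>+t. f (par t c d) \<partial>lborel \<partial>lborel \<partial>lborel) = (\<integral>\<^sup>+d. \<integral>\<^sup>+t. \<integral>\<^sup>+c. f (par t c d) \<partial>lborel \<partial>lborel \<partial>lborel)"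
      by (intro nn_integral_cong nn_integral_lborel_swap) measurable
    also have "\<dots> = (\<integral>\<^sup>+d. \<integral>\<^sup>+t. F (t*d) d \<partial>lborel \<partial>lborel)"
      by (intro nn_integral_cong_AE, use AE_lborel_neq[of 0] in eventually_elim) (simp add: F_def)
    also have "\<dots> = (\<integral>\<^sup>+t. \<integral>\<^sup>+d. F (t*d) d \<partial>lborel \<partial>lborel)"
      by (rule nn_integral_lborel_swap) measurable
    also have "\<dots> = (\<integral>\<^sup>+d. ennreal (1/\<bar>d\<bar>) * (\<integral>\<^sup>+b. F b d \<partial>lborel) \<partial>lborel)"
      by (rule nn_integral_slope_swap) measurable
    finally show ?thesis .
  qed
  have "(\<integral>\<^sup>+M. f (sw ** M) \<partial>haar) = (\<integral>\<^sup>+d. \<integral>\<^sup>+c. \<integral>\<^sup>+t. f (sw ** par t c d) \<partial>lborel \<partial>lborel \<partial>lborel)"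
    by (rule nn_integral_haar) measurable
  also have "\<dots> = (\<integral>\<^sup>+d. \<integral>\<^sup>+t. \<integral>\<^sup>+c. f (sw ** par t c d) \<partial>lborel \<partial>lborel \<partial>lborel)"
    by (intro nn_integral_cong nn_integral_lborel_swap) measurable
  also have "\<dots> = (\<integral>\<^sup>+d. \<integral>\<^sup>+t. ennreal (1/\<bar>t\<bar>) * F (-d) (t*d) \<partial>lborel \<partial>lborel)"
  proof (intro nn_integral_cong_AE, use AE_lborel_neq[of 0] in eventually_elim)
    case (elim d)
    show ?case
    proof (intro nn_integral_cong_AE, use AE_lborel_neq[of 0] in eventually_elim)
      case (elim t)
      have "sw ** par t c d = par ((-d)/(t*d)) (t * c + 1/d) (t*d)" for c
        using \<open>d \<noteq> 0\<close> \<open>t \<noteq> 0\<close> by (simp add: par_def sw_def mat22_eq_iff) (simp add: field_simps)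
      then show ?case
        unfolding F_def using nn_integral_scale[of "\<lambda>c. f (par ((-d)/(t*d)) c (t*d))" t "1/d"] \<open>t \<noteq> 0\<close> by simp
    qed
  qed
  also have "\<dots> = (\<integral>\<^sup>+t. \<integral>\<^sup>+d. ennreal (1/\<bar>t\<bar>) * F (-d) (t*d) \<partial>lborel \<partial>lborel)"
    by (rule nn_integral_lborel_swap) measurable
  \<comment> \<open>The factor \<open>1/|t|\<close> is rewritten so that \<open>t\<close> occurs
    only in the product \<open>t * d\<close>, as the slope substitution demands.\<close>
  also have "\<dots> = (\<integral>\<^sup>+t. \<integral>\<^sup>+d. ennreal (\<bar>d\<bar>/\<bar>t*d\<bar>) * F (-d) (t*d) \<partial>lborel \<partial>lborel)"
  proof (rule nn_integral_cong, rule nn_integral_cong_AE)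
    fix t :: real
    show "AE d in lborel. ennreal (1/\<bar>t\<bar>) * F (-d) (t*d) = ennreal (\<bar>d\<bar>/\<bar>t*d\<bar>) * F (-d) (t*d)"
      using AE_lborel_neq[of 0] by eventually_elim (simp add: abs_mult)
  qed
  also have "\<dots> = (\<integral>\<^sup>+d. ennreal (1/\<bar>d\<bar>) * (\<integral>\<^sup>+b. ennreal (\<bar>d\<bar>/\<bar>b\<bar>) * F (-d) b \<partial>lborel) \<partial>lborel)"
    by (rule nn_integral_slope_swap[where h="\<lambda>b d. ennreal (\<bar>d\<bar>/\<bar>b\<bar>) * F (-d) b"]) measurable
  also have "\<dots> = (\<integral>\<^sup>+d. \<integral>\<^sup>+b. ennreal (1/\<bar>b\<bar>) * F (-d) b \<partial>lborel \<partial>lborel)"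
  proof (intro nn_integral_cong_AE, use AE_lborel_neq[of 0] in eventually_elim)
    case (elim d)
    have "ennreal (1/\<bar>d\<bar>) * (\<integral>\<^sup>+b. ennreal (\<bar>d\<bar>/\<bar>b\<bar>) * F (-d) b \<partial>lborel) =
      (\<integral>\<^sup>+b. ennreal (1/\<bar>d\<bar>) * (ennreal (\<bar>d\<bar>/\<bar>b\<bar>) * F (-d) b) \<partial>lborel)"
      by (rule nn_integral_cmult[symmetric]) measurable
    also have "\<dots> = (\<integral>\<^sup>+b. ennreal (1/\<bar>b\<bar>) * F (-d) b \<partial>lborel)"
      using elim by (intro nn_integral_cong) (simp add: mult.assoc[symmetric] ennreal_mult'[symmetric])
    finally show ?case .
  qed
  also have "\<dots> = (\<integral>\<^sup>+b. \<integral>\<^sup>+d. ennreal (1/\<bar>b\<bar>) * F (-d) b \<partial>lborel \<partial>lborel)"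
    by (rule nn_integral_lborel_swap) measurable
  also have "\<dots> = (\<integral>\<^sup>+b. ennreal (1/\<bar>b\<bar>) * (\<integral>\<^sup>+d. F d b \<partial>lborel) \<partial>lborel)"
    using nn_integral_scale[of "\<lambda>d. F d _" "-1" 0]
    by (intro nn_integral_cong) (simp add: nn_integral_cmult)
  also have "\<dots> = (\<integral>\<^sup>+M. f M \<partial>haar)"
    by (subst nn_integral_haar) (auto simp: flat)
  finally show "(\<integral>\<^sup>+M. f (sw ** M) \<partial>haar) = (\<integral>\<^sup>+M. f M \<partial>haar)" .
qed

lemma left_inv_SL: "g \<in> SL \<Longrightarrow> left_inv g"
proof (induction rule: SL_shear_induct)
  fix s
  \<comment> \<open>Conjugation by \<open>sw\<close> turns upper shears into lower ones;
    \<open>sw ** (sw ** sw)\<close> is the inverse of \<open>sw\<close>, which has order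
    four.\<close>
  have "lo s = sw ** (up (-s) ** (sw ** (sw ** sw)))"
    by (simp add: lo_def sw_def up_def)
  then show "left_inv (lo s)" by (auto intro!: left_inv_mult left_inv_up left_inv_sw)
qed (use left_inv_up left_inv_mult in auto)

lemma nn_integral_haar_right:
  assumes "f \<in> borel_measurable SLb" "g \<in> SL"
  shows "(\<integral>\<^sup>+M. f (M ** g) \<partial>haar) = (\<integral>\<^sup>+M. f M \<partial>haar)"
  using right_inv_SL[OF assms(2)] assms(1) by (auto simp: right_inv_def)

lemma nn_integral_haar_left:
  assumes "f \<in> borel_measurable SLb" "g \<in> SL"
  shows "(\<integral>\<^sup>+M. f (g ** M) \<partial>haar) = (\<integral>\<^sup>+M. f M \<partial>haar)"
  using left_inv_SL[OF assms(2)] assms(1) by (auto simp: left_inv_def)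

lemma pred_SLb_sets: "Measurable.pred SLb P \<Longrightarrow> {M\<in>SL. \<not> P M} \<in> sets SLb"
proof -
  assume [measurable]: "Measurable.pred SLb P"
  have "{M\<in>space SLb. \<not> P M} \<in> sets SLb" by measurable
  then show ?thesis by simp
qed

lemma AE_haarI:
  assumes [measurable]: "Measurable.pred SLb P"
    and AE: "AE d in lborel. AE c in lborel. AE t in lborel. P (par t c d)"
  shows "AE M in haar. P M"
proof -
  have s: "{M\<in>SL. \<not> P M} \<in> sets SLb" by (rule pred_SLb_sets) fact
  then have "emeasure haar {M\<in>SL. \<not> P M} = (\<integral>\<^sup>+M. indicator {M\<in>SL. \<not> P M} M \<partial>haar)"
    by simp
  also have "\<dots> = (\<integral>\<^sup>+d. \<integral>\<^sup>+c. \<integral>\<^sup>+t. indicator {M\<in>SL. \<not> P M} (par t c d) \<partial>lborel \<partial>lborel \<partial>lborel)"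
    by (rule nn_integral_haar) (use s in \<open>simp only: borel_measurable_indicator\<close>)
  also have "\<dots> = (\<integral>\<^sup>+d. 0 \<partial>(lborel::real measure))"
    apply (rule nn_integral_cong_AE)
    using AE
  proof eventually_elim
    case (elim d)
    have "(\<integral>\<^sup>+c. \<integral>\<^sup>+t. indicator {M\<in>SL. \<not> P M} (par t c d) \<partial>lborel \<partial>lborel) = (\<integral>\<^sup>+c. 0 \<partial>(lborel::real measure))"
      apply (rule nn_integral_cong_AE)
      using elim
    proof eventually_elim
      case (elim c)
      have "(\<integral>\<^sup>+t. indicator {M\<in>SL. \<not> P M} (par t c d) \<partial>lborel) = (\<integral>\<^sup>+t. 0 \<partial>(lborel::real measure))"
        by (rule nn_integral_cong_AE, use elim in eventually_elim) simp
      then show ?case by simp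
    qed
    then show ?case by simp
  qed
  finally have "emeasure haar {M\<in>SL. \<not> P M} = 0" by simp
  then show ?thesis
    using AE_iff_measurable[of "{M\<in>SL. \<not> P M}" haar P] s by simp
qed

lemma AE_haar_left:
  assumes P[measurable]: "Measurable.pred SLb P" and g: "g \<in> SL" and AE: "AE M in haar. P M"
  shows "AE M in haar. P (g ** M)"
proof -
  have "Measurable.pred SLb (\<lambda>M. P (g ** M))"
    using g by measurable
  from pred_SLb_sets[OF P] pred_SLb_sets[OF this]
  have s: "{M\<in>SL. \<not> P M} \<in> sets SLb" "{M\<in>SL. \<not> P (g ** M)} \<in> sets SLb" .
  have "emeasure haar {M\<in>SL. \<not> P (g ** M)} = (\<integral>\<^sup>+M. indicator {M\<in>SL. \<not> P (g ** M)} M \<partial>haar)"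
    using s by simp
  also have "\<dots> = (\<integral>\<^sup>+M. indicator {M\<in>SL. \<not> P M} (g ** M) \<partial>haar)"
    by (rule nn_integral_cong) (use g in \<open>simp add: indicator_def\<close>)
  also have "\<dots> = (\<integral>\<^sup>+M. indicator {M\<in>SL. \<not> P M} M \<partial>haar)"
    by (rule nn_integral_haar_left) (use s g in \<open>simp_all only: borel_measurable_indicator\<close>)
  also have "\<dots> = emeasure haar {M\<in>SL. \<not> P M}"
    using s by simp
  also have "\<dots> = 0"
    using AE AE_iff_measurable[of "{M\<in>SL. \<not> P M}" haar P] s by simp
  finally show ?thesis
    using AE_iff_measurable[of "{M\<in>SL. \<not> P (g ** M)}" haar "\<lambda>M. P (g ** M)"] s by simp
qed

lemma AE_haar_right:
  assumes P[measurable]: "Measurable.pred SLb P" and g: "g \<in> SL" and AE: "AE M in haar. P M"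
  shows "AE M in haar. P (M ** g)"
proof -
  have "Measurable.pred SLb (\<lambda>M. P (M ** g))"
    using g by measurable
  from pred_SLb_sets[OF P] pred_SLb_sets[OF this]
  have s: "{M\<in>SL. \<not> P M} \<in> sets SLb" "{M\<in>SL. \<not> P (M ** g)} \<in> sets SLb" .
  have "emeasure haar {M\<in>SL. \<not> P (M ** g)} = (\<integral>\<^sup>+M. indicator {M\<in>SL. \<not> P (M ** g)} M \<partial>haar)"
    using s by simp
  also have "\<dots> = (\<integral>\<^sup>+M. indicator {M\<in>SL. \<not> P M} (M ** g) \<partial>haar)"
    by (rule nn_integral_cong) (use g in \<open>simp add: indicator_def\<close>)
  also have "\<dots> = (\<integral>\<^sup>+M. indicator {M\<in>SL. \<not> P M} M \<partial>haar)"
    by (rule nn_integral_haar_right) (use s g in \<open>simp_all only: borel_measurable_indicator\<close>)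
  also have "\<dots> = emeasure haar {M\<in>SL. \<not> P M}"
    using s by simp
  also have "\<dots> = 0"
    using AE AE_iff_measurable[of "{M\<in>SL. \<not> P M}" haar P] s by simp
  finally show ?thesis
    using AE_iff_measurable[of "{M\<in>SL. \<not> P (M ** g)}" haar "\<lambda>M. P (M ** g)"] s by simp
qed

text \<open>In the coordinates of \<open>par\<close> this is the cube
  \<open>|t|, |c|, |d| \<le> k\<close>, since the upper right entry is \<open>t * d\<close>. The
  null set \<open>M$2$2 = 0\<close>, which the coordinates miss, is put into every box so that the
  boxes exhaust the whole group.\<close>

definition haar_box :: "nat \<Rightarrow> (real^2^2) set" where
  "haar_box k = {M\<in>SL. M$2$2 = 0 \<or> (\<bar>M$1$2\<bar> \<le> real k * \<bar>M$2$2\<bar> \<and> \<bar>M$2$1\<bar> \<le> real k \<and> \<bar>M$2$2\<bar> \<le> real k)}"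

lemma haar_box_measurable [measurable]: "haar_box k \<in> sets SLb"
proof -
  have "{M\<in>space SLb. M$2$2 = 0 \<or> (\<bar>M$1$2\<bar> \<le> real k * \<bar>M$2$2\<bar> \<and> \<bar>M$2$1\<bar> \<le> real k \<and> \<bar>M$2$2\<bar> \<le> real k)} \<in> sets SLb"
    by measurable
  then show ?thesis by (simp only: haar_box_def space_SLb)
qed

lemma haar_box_Un: "(\<Union>k. haar_box k) = SL"
proof
  show "SL \<subseteq> (\<Union>k. haar_box k)"
  proof
    fix M assume M: "M \<in> SL"
    obtain k where k: "real k \<ge> max (\<bar>M$1$2\<bar> / \<bar>M$2$2\<bar>) (max \<bar>M$2$1\<bar> \<bar>M$2$2\<bar>)"
      using real_arch_simple by blast
    have "M \<in> haar_box k"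
      using k M unfolding haar_box_def by (cases "M$2$2 = 0") (auto simp: field_simps)
    then show "M \<in> (\<Union>k. haar_box k)" by blast
  qed
qed (auto simp: haar_box_def)

lemma haar_box_mono: "incseq haar_box"
proof (rule incseq_SucI, rule subsetI)
  fix k M assume M: "M \<in> haar_box k"
  have "real k * \<bar>M$2$2\<bar> \<le> real (Suc k) * \<bar>M$2$2\<bar>" by (intro mult_right_mono) auto
  then show "M \<in> haar_box (Suc k)"
    using M unfolding haar_box_def by force
qed

lemma par_box:
  "d \<noteq> 0 \<Longrightarrow> par t c d \<in> haar_box k \<longleftrightarrow> - real k \<le> t \<and> t \<le> real k \<and> - real k \<le> c \<and> c \<le> real k \<and> - real k \<le> d \<and> d \<le> real k"
proof -
  assume d: "d \<noteq> 0"
  have "par t c d \<in> haar_box k \<longleftrightarrow> \<bar>t * d\<bar> \<le> real k * \<bar>d\<bar> \<and> \<bar>c\<bar> \<le> real k \<and> \<bar>d\<bar> \<le> real k"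
    using d par_SL[of t c d] unfolding haar_box_def by (simp add: par_def)
  also have "\<bar>t * d\<bar> \<le> real k * \<bar>d\<bar> \<longleftrightarrow> \<bar>t\<bar> \<le> real k"
    using d by (simp add: abs_mult)
  finally show ?thesis by (auto simp: abs_le_iff)
qed

lemma haar_box_finite: "emeasure haar (haar_box k) < \<infinity>"
proof -
  have "emeasure haar (haar_box k) = (\<integral>\<^sup>+M. indicator (haar_box k) M \<partial>haar)"
    by simp
  also have "\<dots> = (\<integral>\<^sup>+d. \<integral>\<^sup>+c. \<integral>\<^sup>+t. indicator (haar_box k) (par t c d) \<partial>lborel \<partial>lborel \<partial>lborel)"
    by (rule nn_integral_haar) measurable
  also have "\<dots> = (\<integral>\<^sup>+d. \<integral>\<^sup>+c. \<integral>\<^sup>+t. indicator {-real k..real k} d * (indicator {-real k..real k} c * indicator {-real k..real k} t) \<partial>lborel \<partial>lborel \<partial>lborel)"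
    by (intro nn_integral_cong_AE, use AE_lborel_neq[of 0] in eventually_elim)
       (intro nn_integral_cong, simp add: indicator_def par_box, fastforce)
  also have "\<dots> = ennreal (real (2*k)) * (ennreal (real (2*k)) * ennreal (real (2*k)))"
    by (simp add: nn_integral_cmult nn_integral_multc)
  also have "\<dots> < \<infinity>" by (simp add: ennreal_mult_less_top)
  finally show ?thesis .
qed

lemma sigma_finite_haar: "sigma_finite_measure haar"
proof
  show "\<exists>A. countable A \<and> A \<subseteq> sets haar \<and> \<Union>A = space haar \<and> (\<forall>a\<in>A. emeasure haar a \<noteq> \<infinity>)"
  proof (intro exI[of _ "range haar_box"] conjI ballI)
    show "range haar_box \<subseteq> sets haar" by (rule image_subsetI) (simp only: sets_haar haar_box_measurable)
    show "\<Union>(range haar_box) = space haar" by (simp only: haar_box_Un space_haar)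
    fix a assume "a \<in> range haar_box"
    then obtain k where "a = haar_box k" by (rule rangeE)
    then show "emeasure haar a \<noteq> \<infinity>" using haar_box_finite[of k] by (simp only: less_irrefl not_False_eq_True)
  qed (rule countable_image, simp)
qed

subsection \<open>The theta group\<close>

lemma inv_SL2_adj:
  assumes "M \<in> SL" shows "inv\<^bsub>SL2\<^esub> M = adj M"
proof -
  have "det M = 1" "det (adj M) = 1"
    using assms SL_adj[OF assms] by (simp_all only: SL_def mem_Collect_eq)
  then show ?thesis
    by (intro group.inv_equality[OF group_SL2]) (simp_all only: SL2_simps adj_mult[OF assms] mem_Collect_eq)
qed

lemma theta_SL [simp]: "M \<in> Gamma_theta \<Longrightarrow> M \<in> SL"
  using subgroup.subset[OF subgroup_Gamma_theta] by (auto simp: SL_def)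

lemma theta_mult [simp]: "M \<in> Gamma_theta \<Longrightarrow> N \<in> Gamma_theta \<Longrightarrow> M ** N \<in> Gamma_theta"
  using subgroup.m_closed[OF subgroup_Gamma_theta] by simp

lemma theta_one [simp]: "mat 1 \<in> Gamma_theta"
  using subgroup.one_closed[OF subgroup_Gamma_theta] by simp

lemma theta_adj [simp]: "M \<in> Gamma_theta \<Longrightarrow> adj M \<in> Gamma_theta"
  using subgroup.m_inv_closed[OF subgroup_Gamma_theta] inv_SL2_adj by fastforce

lemma theta_sw [simp]: "sw \<in> Gamma_theta"
  unfolding Gamma_theta_def sw_def by (rule generate.incl) simp

lemma theta_up2: "up 2 \<in> Gamma_theta"
  unfolding Gamma_theta_def up_def by (rule generate.incl) simp

lemma theta_up_nat: "up (2 * real n) \<in> Gamma_theta"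
proof (induction n)
  case 0
  have "up 0 = mat 1" by (simp add: up_def mat_1_mat22)
  then show ?case by simp
next
  case (Suc n)
  have "up (2 * real (Suc n)) = up 2 ** up (2 * real n)" by (simp add: up_def add.commute)
  then show ?case using Suc theta_up2 by simp
qed

lemma theta_up [simp]: "up (2 * of_int k) \<in> Gamma_theta"
proof (cases "k \<ge> 0")
  case True
  then show ?thesis using theta_up_nat[of "nat k"] by simp
next
  case False
  then have "up (2 * of_int k) = adj (up (2 * real (nat (-k))))"
    by (simp add: up_def mat22_eq_iff)
  then show ?thesis using theta_up_nat by simp
qed

lemma theta_minus [simp]: "mat22 (-1) 0 0 (-1) \<in> Gamma_theta"
proof -
  have "mat22 (-1) 0 0 (-1) = sw ** sw" by (simp add: sw_def)
  then show ?thesis by simp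
qed

text \<open>Modulo 2 the generator \<open>mat22 1 2 0 1\<close> is trivial and the other one
  exchanges the coordinates, so only two classes occur. What reduction theory takes from this is
  that a bottom row \<open>(r, s)\<close> has odd sum.\<close>

lemma theta_parity:
  assumes "M \<in> Gamma_theta"
  shows "\<exists>p q r s::int. M = mat22 (of_int p) (of_int q) (of_int r) (of_int s) \<and>
    ((odd p \<and> odd s \<and> even q \<and> even r) \<or> (even p \<and> even s \<and> odd q \<and> odd r))"
  using assms unfolding Gamma_theta_def
proof (induction rule: generate.induct)
  case one
  show ?case by (rule exI[of _ 1], rule exI[of _ 0], rule exI[of _ 0], rule exI[of _ 1]) (simp add: mat_1_mat22)
next
  case (incl h)
  then consider "h = mat22 0 (-1) 1 0" | "h = mat22 1 2 0 1" by blast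
  then show ?case
  proof cases
    case 1
    show ?thesis by (rule exI[of _ 0], rule exI[of _ "-1"], rule exI[of _ 1], rule exI[of _ 0]) (simp add: 1)
  next
    case 2
    show ?thesis by (rule exI[of _ 1], rule exI[of _ 2], rule exI[of _ 0], rule exI[of _ 1]) (simp add: 2)
  qed
next
  case (inv h)
  then consider "h = mat22 0 (-1) 1 0" | "h = mat22 1 2 0 1" by blast
  then show ?case
  proof cases
    case 1
    then have i: "inv\<^bsub>SL2\<^esub> h = mat22 0 1 (-1) 0" by (subst inv_SL2_adj) (auto simp: adj_def SL_def)
    show ?thesis unfolding i by (rule exI[of _ 0], rule exI[of _ "1"], rule exI[of _ "-1"], rule exI[of _ 0]) simp
  next
    case 2
    then have i: "inv\<^bsub>SL2\<^esub> h = mat22 1 (-2) 0 1" by (subst inv_SL2_adj) (auto simp: adj_def SL_def)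
    show ?thesis unfolding i by (rule exI[of _ 1], rule exI[of _ "-2"], rule exI[of _ 0], rule exI[of _ 1]) simp
  qed
next
  case (eng h1 h2)
  then obtain p q r s p' q' r' s' :: int where
    h: "h1 = mat22 (of_int p) (of_int q) (of_int r) (of_int s)" "h2 = mat22 (of_int p') (of_int q') (of_int r') (of_int s')"
    and *: "(odd p \<and> odd s \<and> even q \<and> even r) \<or> (even p \<and> even s \<and> odd q \<and> odd r)"
        "(odd p' \<and> odd s' \<and> even q' \<and> even r') \<or> (even p' \<and> even s' \<and> odd q' \<and> odd r')"
    by blast
  show ?case
    by (rule exI[of _ "p * p' + q * r'"], rule exI[of _ "p * q' + q * s'"], rule exI[of _ "r * p' + s * r'"], rule exI[of _ "r * q' + s * s'"]) (use * in \<open>auto simp: h\<close>)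
qed

lemma countable_theta [simp]: "countable Gamma_theta"
proof -
  have "Gamma_theta \<subseteq> (\<lambda>(p,q,r,s). mat22 (of_int p) (of_int q) (of_int r) (of_int s)) ` (UNIV :: (int\<times>int\<times>int\<times>int) set)"
    using theta_parity by (force simp: image_iff)
  then show ?thesis
    by (rule countable_subset) simp
qed

subsection \<open>A fundamental domain\<close>

definition qA :: "real^2^2 \<Rightarrow> real" where "qA M = (M$1$1)\<^sup>2 + (M$1$2)\<^sup>2"
definition qX :: "real^2^2 \<Rightarrow> real" where "qX M = M$1$1 * M$2$1 + M$1$2 * M$2$2"
definition qN :: "real^2^2 \<Rightarrow> real" where "qN M = (M$2$1)\<^sup>2 + (M$2$2)\<^sup>2"

lemma qA_measurable [measurable]: "qA \<in> borel_measurable SLb"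
  and qX_measurable [measurable]: "qX \<in> borel_measurable SLb"
  and qN_measurable [measurable]: "qN \<in> borel_measurable SLb"
  unfolding qA_def[abs_def] qX_def[abs_def] qN_def[abs_def] by measurable

text \<open>In terms of \<open>z = M\<cdot>i\<close> one has \<open>qN M = 1 / Im z\<close>, \<open>qX M = Re z / Im z\<close> and
  \<open>qA M = \<bar>z\<bar>\<^sup>2 / Im z\<close>; the condition on \<open>M$2$1\<close> selects one of \<open>\<plusminus>M\<close>.\<close>

definition FD :: "(real^2^2) set" where
  "FD = {M\<in>SL. 0 < M$2$1 \<and> qN M < qA M \<and> 4 * qX M < qA M + 3 * qN M \<and> 0 \<le> qX M \<and> qX M < 2 * qN M}"

lemma FD_SL: "M \<in> FD \<Longrightarrow> M \<in> SL"
  by (simp add: FD_def)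

lemma FD_measurable [measurable]: "FD \<in> sets SLb"
proof -
  have "{M\<in>space SLb. 0 < M$2$1 \<and> qN M < qA M \<and> 4 * qX M < qA M + 3 * qN M \<and> 0 \<le> qX M \<and> qX M < 2 * qN M} \<in> sets SLb"
    by measurable
  then show ?thesis by (simp only: FD_def space_SLb)
qed

lemma qN_pos: "M \<in> SL \<Longrightarrow> qN M > 0"
proof -
  assume "M \<in> SL"
  then have "M$2$1 \<noteq> 0 \<or> M$2$2 \<noteq> 0" by (auto simp: SL_iff)
  then show ?thesis by (auto simp: qN_def sum_power2_gt_zero_iff)
qed

lemma qA_pos: "M \<in> SL \<Longrightarrow> qA M > 0"
proof -
  assume "M \<in> SL"
  then have "M$1$1 \<noteq> 0 \<or> M$1$2 \<noteq> 0" by (auto simp: SL_iff)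
  then show ?thesis by (auto simp: qA_def sum_power2_gt_zero_iff)
qed

text \<open>\<open>qA\<close>, \<open>qX\<close> and \<open>qN\<close> are the entries of the Gram
  matrix of the rows of \<open>M\<close>, whose determinant is one.\<close>

lemma qAN: "M \<in> SL \<Longrightarrow> qA M * qN M = 1 + (qX M)\<^sup>2"
proof -
  assume "M \<in> SL"
  then have "(M$1$1 * M$2$2 - M$1$2 * M$2$1)\<^sup>2 = 1" by (simp add: SL_iff)
  then show ?thesis by (simp add: qA_def qN_def qX_def power2_eq_square algebra_simps)
qed

lemma qN_mult: "qN (G ** M) = (G$2$1)\<^sup>2 * qA M + 2 * G$2$1 * G$2$2 * qX M + (G$2$2)\<^sup>2 * qN M"
  by (simp add: qN_def qA_def qX_def power2_eq_square algebra_simps)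

text \<open>Bounding the cross term below by \<open>- 2 * |r| * |s| * N\<close> and replacing
  \<open>A\<close> by \<open>N\<close> leaves \<open>(|r| - |s|)^2 * N\<close>, and parity excludes
  \<open>|r| = |s|\<close>. Strictness comes from \<open>A > N\<close> together with
  \<open>r \<noteq> 0\<close>.\<close>

lemma quadratic_form_lower:
  fixes A X N :: real and r s :: int
  assumes "N > 0" "A > N" "\<bar>X\<bar> \<le> N" "r \<noteq> 0" "odd (r + s)"
  shows "r\<^sup>2 * A + 2 * r * s * X + s\<^sup>2 * N > N"
proof -
  have "real_of_int \<bar>r\<bar> \<noteq> real_of_int \<bar>s\<bar>" using \<open>odd (r + s)\<close> by (auto simp: abs_if split: if_splits)
  then have "\<bar>r\<bar> - \<bar>s\<bar> \<noteq> 0" by auto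
  then have "1 \<le> \<bar>\<bar>r\<bar> - \<bar>s\<bar>\<bar>" by linarith
  then have "1\<^sup>2 \<le> \<bar>\<bar>r\<bar> - \<bar>s\<bar>\<bar>\<^sup>2" by (rule power_mono) simp
  then have "1 \<le> (\<bar>r\<bar> - \<bar>s\<bar>)\<^sup>2" by simp
  then have 1: "1 \<le> (\<bar>real_of_int r\<bar> - \<bar>real_of_int s\<bar>)\<^sup>2"
    by (metis of_int_1_le_iff of_int_abs of_int_diff of_int_power)
  have "- (r * s * X) \<le> \<bar>real_of_int r\<bar> * \<bar>real_of_int s\<bar> * N"
  proof -
    have "- (r * s * X) \<le> \<bar>r * s * X\<bar>" by linarith
    also have "\<dots> = \<bar>real_of_int r\<bar> * \<bar>real_of_int s\<bar> * \<bar>X\<bar>" by (simp add: abs_mult)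
    also have "\<dots> \<le> \<bar>real_of_int r\<bar> * \<bar>real_of_int s\<bar> * N" using assms by (intro mult_left_mono) auto
    finally show ?thesis .
  qed
  moreover have "r\<^sup>2 * A > r\<^sup>2 * N" using assms by (intro mult_strict_left_mono) auto
  moreover have "(\<bar>real_of_int r\<bar> - \<bar>real_of_int s\<bar>)\<^sup>2 * N \<ge> 1 * N"
    using 1 assms by (intro mult_right_mono) auto
  moreover have "(\<bar>real_of_int r\<bar> - \<bar>real_of_int s\<bar>)\<^sup>2 = r\<^sup>2 + s\<^sup>2 - 2 * (\<bar>real_of_int r\<bar> * \<bar>real_of_int s\<bar>)"
    by (simp add: power2_diff)
  ultimately show ?thesis by (simp add: algebra_simps)
qed

text \<open>\<open>1 / qN\<close> is the height of the point, so points of \<open>FD\<close> are the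
  highest of their orbits. On the left half of the strip the estimate for quadratic forms applies
  directly. On the right half the point is first moved by \<open>-2\<close>, which changes
  \<open>s\<close> into \<open>s + 2 * r\<close> and so keeps the parity; the condition
  \<open>4 * qX M < qA M + 3 * qN M\<close> is \<open>qN < qA\<close> for the moved point.\<close>

lemma FD_qN_increase:
  assumes M: "M \<in> FD" and G: "G \<in> Gamma_theta" "G$2$1 \<noteq> 0"
  shows "qN (G ** M) > qN M"
proof -
  obtain p q r s :: int where G_eq: "G = mat22 (of_int p) (of_int q) (of_int r) (of_int s)" and odd: "odd (r + s)"
    using theta_parity[OF G(1)] by (metis odd_add)
  have r: "r \<noteq> 0" using G(2) G_eq by auto
  have N: "qN M > 0" using M qN_pos FD_SL by auto
  have FD: "qN M < qA M" "4 * qX M < qA M + 3 * qN M" "0 \<le> qX M" "qX M < 2 * qN M"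
    using M by (auto simp: FD_def)
  have eq: "qN (G ** M) = r\<^sup>2 * qA M + 2 * r * s * qX M + s\<^sup>2 * qN M"
    by (simp add: qN_mult G_eq)
  show ?thesis
  proof (cases "qX M \<le> qN M")
    case True
    then show ?thesis unfolding eq using quadratic_form_lower[of "qN M" "qA M" "qX M" r s] FD N r odd by simp
  next
    case False
    have "r\<^sup>2 * (qA M - 4 * qX M + 4 * qN M) + 2 * r * (s + 2 * r) * (qX M - 2 * qN M) + (s + 2 * r)\<^sup>2 * qN M > qN M"
      using quadratic_form_lower[of "qN M" "qA M - 4 * qX M + 4 * qN M" "qX M - 2 * qN M" r "s + 2 * r"] FD N r odd False by simp
    moreover have "r\<^sup>2 * (qA M - 4 * qX M + 4 * qN M) + 2 * r * (s + 2 * r) * (qX M - 2 * qN M) + (s + 2 * r)\<^sup>2 * qN M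
       = r\<^sup>2 * qA M + 2 * r * s * qX M + s\<^sup>2 * qN M"
      by (simp add: power2_eq_square algebra_simps)
    ultimately show ?thesis unfolding eq by simp
  qed
qed

text \<open>A nonzero lower left entry of \<open>G\<close> would raise \<open>qN\<close> on the way
  there by \<open>G\<close> and again on the way back by \<open>adj G\<close>. Hence
  \<open>G\<close> is an even translation up to sign; the positive lower left entry of elements of
  \<open>FD\<close> fixes the sign, and the half-open strip of width 2 leaves only the trivial
  translation.\<close>

lemma FD_unique:
  assumes M: "M \<in> FD" and G: "G \<in> Gamma_theta" and GM: "G ** M \<in> FD"
  shows "G = mat 1"
proof -
  have c0: "G$2$1 = 0"
  proof (rule ccontr)
    assume *: "G$2$1 \<noteq> 0"
    have "qN (G ** M) > qN M" using FD_qN_increase[OF M G *] .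
    moreover have "qN (adj G ** (G ** M)) > qN (G ** M)"
      using FD_qN_increase[OF GM theta_adj[OF G]] * by simp
    ultimately show False using G by simp
  qed
  obtain p q r s :: int where G_eq: "G = mat22 (of_int p) (of_int q) (of_int r) (of_int s)"
     and par: "((odd p \<and> odd s \<and> even q \<and> even r) \<or> (even p \<and> even s \<and> odd q \<and> odd r))"
    using theta_parity[OF G(1)] by metis
  have r: "r = 0" using c0 G_eq by simp
  have "real_of_int (p * s) = 1" using theta_SL[OF G] G_eq r by (simp add: SL_def)
  then have ps: "p * s = 1" by linarith
  have q: "even q" using par r by auto
  have cpos: "M$2$1 > 0" "(G ** M)$2$1 > 0" using M GM by (auto simp: FD_def)
  then have "real_of_int s > 0" using G_eq r by (simp add: zero_less_mult_iff)
  then have s: "s = 1" using ps by (metis of_int_0_less_iff pos_zmult_eq_1_iff mult.commute)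
  then have p: "p = 1" using ps by simp
  have X: "qX (G ** M) = qX M + q * qN M" "qN (G ** M) = qN M"
    by (simp_all add: G_eq r s p qX_def qN_def power2_eq_square algebra_simps)
  have N: "qN M > 0" using M qN_pos FD_SL by auto
  have "0 \<le> qX M" "qX M < 2 * qN M" "0 \<le> qX M + q * qN M" "qX M + q * qN M < 2 * qN M"
    using M GM X by (auto simp: FD_def)
  then have "real_of_int q * qN M < 2 * qN M" "(-2) * qN M < real_of_int q * qN M" by linarith+
  then have "real_of_int q < 2" "-2 < real_of_int q" using mult_less_cancel_right_pos[OF N] by blast+
  then have "q < 2" "-2 < q" by linarith+
  then have "q = 0" using q by presburger
  then show ?thesis by (simp add: G_eq r s p mat_1_mat22)
qed

text \<open>Only finitely many values lie below \<open>qN M\<close>: completing squares in a form of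
  determinant one bounds \<open>r^2\<close> and \<open>s^2\<close>, so only finitely many integral
  bottom rows compete.\<close>

lemma exists_min_qN:
  assumes M: "M \<in> SL"
  shows "\<exists>G\<in>Gamma_theta. \<forall>H\<in>Gamma_theta. qN (G ** M) \<le> qN (H ** M)"
proof -
  \<comment> \<open>\<open>B\<close> dominates \<open>v * qN M\<close> and \<open>v * qA M\<close>
    for every competing value \<open>v \<le> qN M\<close>; these products in turn dominate
    \<open>r^2\<close> and \<open>s^2\<close>.\<close>
  define B where "B = max (qN M * qN M) (qA M * qN M)"
  define Z where "Z = {k::int. (of_int k)\<^sup>2 \<le> B}"
  have "Z \<subseteq> {-\<lceil>B+1\<rceil>..\<lceil>B+1\<rceil>}"
  proof
    fix k assume "k \<in> Z"
    then have "(real_of_int k)\<^sup>2 \<le> B" by (simp add: Z_def)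
    moreover have "\<bar>real_of_int k\<bar> \<le> (real_of_int k)\<^sup>2 + 1"
      using zero_le_power2[of "\<bar>real_of_int k\<bar> - 1"] by (simp add: power2_diff)
    ultimately have "\<bar>real_of_int k\<bar> \<le> B + 1" by linarith
    then have "\<bar>real_of_int k\<bar> \<le> real_of_int \<lceil>B+1\<rceil>" by linarith
    then show "k \<in> {-\<lceil>B+1\<rceil>..\<lceil>B+1\<rceil>}" by auto
  qed
  then have finZ: "finite Z" by (rule finite_subset) simp
  define V where "V = {qN (H ** M) |H. H \<in> Gamma_theta \<and> qN (H ** M) \<le> qN M}"
  have "V \<subseteq> (\<lambda>(r,s). (of_int r)\<^sup>2 * qA M + 2 * of_int r * of_int s * qX M + (of_int s)\<^sup>2 * qN M) ` (Z \<times> Z)"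
  proof
    fix v assume "v \<in> V"
    then obtain H where H: "H \<in> Gamma_theta" "v = qN (H ** M)" "v \<le> qN M" by (auto simp: V_def)
    obtain p q r s :: int where H_eq: "H = mat22 (of_int p) (of_int q) (of_int r) (of_int s)"
      using theta_parity[OF H(1)] by metis
    have v: "v = r\<^sup>2 * qA M + 2 * r * s * qX M + s\<^sup>2 * qN M"
      using H by (simp add: H_eq qN_mult)
    have "v * qN M = (s * qN M + r * qX M)\<^sup>2 + r\<^sup>2 * (qA M * qN M - (qX M)\<^sup>2)"
      unfolding v by (simp add: power2_eq_square algebra_simps)
    then have "r\<^sup>2 \<le> v * qN M" using qAN[OF M] by simp
    also have "\<dots> \<le> B" using H(3) qN_pos[OF M] by (auto simp: B_def intro!: le_max_iff_disj[THEN iffD2] disjI1 mult_right_mono)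
    finally have r: "r \<in> Z" by (simp add: Z_def)
    have "v * qA M = (r * qA M + s * qX M)\<^sup>2 + s\<^sup>2 * (qA M * qN M - (qX M)\<^sup>2)"
      unfolding v by (simp add: power2_eq_square algebra_simps)
    then have "s\<^sup>2 \<le> v * qA M" using qAN[OF M] by simp
    also have "\<dots> \<le> qN M * qA M" using H(3) qA_pos[OF M] by (intro mult_right_mono) auto
    also have "\<dots> \<le> B" by (simp add: B_def mult.commute)
    finally have s: "s \<in> Z" by (simp add: Z_def)
    show "v \<in> (\<lambda>(r,s). (of_int r)\<^sup>2 * qA M + 2 * of_int r * of_int s * qX M + (of_int s)\<^sup>2 * qN M) ` (Z \<times> Z)"
      using r s v by (force simp: image_iff)
  qed
  note V_sub = this
  have finV: "finite V" by (rule finite_subset[OF V_sub finite_imageI]) (simp add: finZ)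
  have "qN M \<in> V" unfolding V_def by (rule CollectI, rule exI[of _ "mat 1"]) simp
  then have "Min V \<in> V" using finV by (intro Min_in) auto
  then obtain G where G: "G \<in> Gamma_theta" "Min V = qN (G ** M)" by (auto simp: V_def)
  have "qN (G ** M) \<le> qN (H ** M)" if "H \<in> Gamma_theta" for H
  proof (cases "qN (H ** M) \<le> qN M")
    case True
    then have "qN (H ** M) \<in> V" using that by (auto simp: V_def)
    then show ?thesis using G(2) finV by (metis Min_le)
  next
    case False
    moreover have "Min V \<le> qN M" using \<open>qN M \<in> V\<close> finV by simp
    ultimately show ?thesis using G(2) by simp
  qed
  then show ?thesis using G(1) by blast
qed

text \<open>A highest point of the orbit, translated into the strip, satisfies the two circle
  conditions weakly, by comparison with its images under \<open>sw\<close> and under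
  \<open>sw\<close> after the translation by \<open>-2\<close>. The hypothesis \<open>ne\<close>,
  used along the orbit, excludes equality and gives the lower left entry a sign.\<close>

lemma FD_exists:
  assumes M: "M \<in> SL"
    and ne: "\<And>G. G \<in> Gamma_theta \<Longrightarrow> (G ** M)$2$1 \<noteq> 0 \<and> qA (G ** M) \<noteq> qN (G ** M)"
  shows "\<exists>G\<in>Gamma_theta. G ** M \<in> FD"
proof -
  obtain G where G: "G \<in> Gamma_theta" "\<And>H. H \<in> Gamma_theta \<Longrightarrow> qN (G ** M) \<le> qN (H ** M)"
    using exists_min_qN[OF M] by blast
  define k where "k = \<lfloor>qX (G ** M) / (2 * qN (G ** M))\<rfloor>"
  define T where "T = up (2 * of_int (-k)) ** G"
  have T: "T \<in> Gamma_theta" using G(1) by (simp add: T_def del: of_int_minus)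
  have Npos: "qN (T ** M) > 0" using qN_pos T M by simp
  have NT: "qN (T ** M) = qN (G ** M)"
    by (simp add: T_def up_def qN_def matrix_mul_assoc[symmetric])
  have XT: "qX (T ** M) = qX (G ** M) - 2 * k * qN (G ** M)"
    unfolding T_def matrix_mul_assoc[symmetric] qX_def qN_def by (simp add: up_def algebra_simps power2_eq_square)
  have k: "of_int k * (2 * qN (G ** M)) \<le> qX (G ** M)" "qX (G ** M) < (of_int k + 1) * (2 * qN (G ** M))"
    using floor_divide_lower[of "2 * qN (G ** M)" "qX (G ** M)"] floor_divide_upper[of "2 * qN (G ** M)" "qX (G ** M)"] Npos NT
    by (simp_all add: k_def)
  have X: "0 \<le> qX (T ** M)" "qX (T ** M) < 2 * qN (T ** M)"
    using k unfolding XT NT by (simp_all add: algebra_simps)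
  have min: "qN (T ** M) \<le> qN (H ** (T ** M))" if "H \<in> Gamma_theta" for H
    using G(2)[of "H ** T"] that T NT by (simp add: matrix_mul_assoc)
  have "qN (sw ** (T ** M)) = qA (T ** M)" by (simp add: sw_def qN_def qA_def)
  moreover have "qA (T ** M) \<noteq> qN (T ** M)" using ne[OF T] by simp
  ultimately have A1: "qN (T ** M) < qA (T ** M)" using min[of sw] by simp
  let ?U = "up (2 * of_int (-1))"
  have U: "?U \<in> Gamma_theta" by (rule theta_up)
  have "qN (?U ** (T ** M)) = qN (T ** M)" "qA (?U ** (T ** M)) = qA (T ** M) - 4 * qX (T ** M) + 4 * qN (T ** M)"
    by (simp_all add: up_def qN_def qA_def qX_def power2_eq_square algebra_simps)
  moreover have "qN ((sw ** ?U) ** (T ** M)) = qA (?U ** (T ** M))"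
    by (simp add: matrix_mul_assoc[symmetric] sw_def qN_def qA_def)
  moreover have "qN (T ** M) \<le> qN ((sw ** ?U) ** (T ** M))"
    using min[of "sw ** ?U"] U by simp
  moreover have "qA ((?U ** T) ** M) \<noteq> qN ((?U ** T) ** M)" using ne[of "?U ** T"] U T by simp
  ultimately have A2: "4 * qX (T ** M) < qA (T ** M) + 3 * qN (T ** M)"
    by (simp add: matrix_mul_assoc)
  show ?thesis
  proof (cases "(T ** M)$2$1 > 0")
    case True
    then have "T ** M \<in> FD" using X A1 A2 T M unfolding FD_def by simp
    then show ?thesis using T by blast
  next
    case False
    then have neg: "(T ** M)$2$1 < 0" using ne[OF T] by (meson not_less_iff_gr_or_eq)
    \<comment> \<open>Minus the identity leaves \<open>qA\<close>, \<open>qX\<close> and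
      \<open>qN\<close> unchanged and corrects the sign of the lower left entry.\<close>
    let ?m = "mat22 (-1) 0 0 (-1)"
    have "(?m ** (T ** M)) $ 2 $ 1 > 0" "qX (?m ** (T ** M)) = qX (T ** M)" "qN (?m ** (T ** M)) = qN (T ** M)" "qA (?m ** (T ** M)) = qA (T ** M)"
      using neg by (simp_all add: qX_def qN_def qA_def power2_eq_square algebra_simps)
    then have "?m ** (T ** M) \<in> FD"
      unfolding FD_def using X A1 A2 T M theta_SL[OF theta_minus] by simp
    then have "(?m ** T) ** M \<in> FD" by (simp only: matrix_mul_assoc)
    then show ?thesis using T theta_minus theta_mult by blast
  qed
qed

text \<open>The points to be excluded are translates of two sets by a countable group, so it
  suffices that both sets are null and that left translation preserves null sets.\<close>

lemma AE_FD_unique: "AE M in haar. \<exists>G\<in>Gamma_theta. \<forall>H\<in>Gamma_theta. H ** M \<in> FD \<longleftrightarrow> H = G"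
proof -
  have 1: "AE M in haar. M$2$1 \<noteq> 0"
  proof (rule AE_haarI)
    show "AE d in lborel. AE c in lborel. AE t in lborel. par t c d $ 2 $ 1 \<noteq> 0"
      using AE_lborel_neq[of 0]
    proof eventually_elim
      case (elim d)
      show ?case using AE_lborel_neq[of 0] by eventually_elim (use elim in \<open>simp add: par_def\<close>)
    qed
  qed measurable
  have 2: "AE M in haar. qA M \<noteq> qN M"
  proof (rule AE_haarI)
    show "AE d in lborel. AE c in lborel. AE t in lborel. qA (par t c d) \<noteq> qN (par t c d)"
      using AE_lborel_neq[of 0]
    proof eventually_elim
      case (elim d)
      show ?case
      proof (rule AE_I2)
        fix c :: real
        \<comment> \<open>This is \<open>qA - qN\<close> along \<open>par t c d\<close> as a
          polynomial in \<open>t\<close>. Its leading coefficient \<open>c^2 + d^2\<close> is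
          nonzero because \<open>d\<close> is, so it has finitely many roots.\<close>
        let ?p = "[: (1/d)\<^sup>2 - c\<^sup>2 - d\<^sup>2, 2*c/d, c\<^sup>2 + d\<^sup>2 :]"
        have nz: "c\<^sup>2 + d\<^sup>2 \<noteq> 0" using elim by (simp add: sum_power2_eq_zero_iff)
        have "finite {t. poly ?p t = 0}" by (rule poly_roots_finite) (use nz in simp)
        then have "{t. poly ?p t = 0} \<in> null_sets lborel" by (intro finite_imp_null_set_lborel)
        then have "AE t in lborel. t \<notin> {t. poly ?p t = 0}" by (rule AE_not_in)
        then show "AE t in lborel. qA (par t c d) \<noteq> qN (par t c d)"
          
          proof eventually_elim
            case (elim t)
            have "qA (par t c d) - qN (par t c d) = poly ?p t"
              using \<open>d \<noteq> 0\<close> by (simp add: par_def qA_def qN_def power2_eq_square ring_distribs add_divide_distrib)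
            then show ?case using elim by auto
          qed
      qed
    qed
  qed measurable
  have "AE M in haar. (G ** M)$2$1 \<noteq> 0 \<and> qA (G ** M) \<noteq> qN (G ** M)" if "G \<in> Gamma_theta" for G
  proof -
    have p[measurable]: "Measurable.pred SLb (\<lambda>M. M$2$1 \<noteq> 0)" "Measurable.pred SLb (\<lambda>M. qA M \<noteq> qN M)" by measurable
    show ?thesis
      using AE_haar_left[OF p(1) theta_SL[OF that] 1] AE_haar_left[OF p(2) theta_SL[OF that] 2] by eventually_elim auto
  qed
  then have "AE M in haar. \<forall>G\<in>Gamma_theta. (G ** M)$2$1 \<noteq> 0 \<and> qA (G ** M) \<noteq> qN (G ** M)"
    by (subst AE_ball_countable) auto
  moreover have "AE M in haar. M \<in> SL" by (rule AE_I2) simp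
  ultimately show ?thesis
  proof eventually_elim
    case (elim M)
    then obtain G where G: "G \<in> Gamma_theta" "G ** M \<in> FD" using FD_exists by blast
    have "H = G" if H: "H \<in> Gamma_theta" "H ** M \<in> FD" for H
    proof -
      have "(H ** adj G) ** (G ** M) = H ** M" using G by (simp add: matrix_mul_assoc[symmetric])
      then have "H ** adj G = mat 1" using FD_unique[OF G(2), of "H ** adj G"] H G by simp
      then have "(H ** adj G) ** G = G" by simp
      then show ?thesis using G by simp
    qed
    then show ?case using G by blast
  qed
qed

lemma AE_FD_count: "AE M in haar. (\<integral>\<^sup>+G. indicator FD (G ** M) \<partial>count_space Gamma_theta) = (1::ennreal)"
  using AE_FD_unique
proof eventually_elim
  case (elim M)
  then obtain G where G: "G \<in> Gamma_theta" "\<And>H. H\<in>Gamma_theta \<Longrightarrow> H ** M \<in> FD \<longleftrightarrow> H = G" by blast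
  have "(\<integral>\<^sup>+H. indicator FD (H ** M) \<partial>count_space Gamma_theta) = (\<integral>\<^sup>+H. indicator {G} H \<partial>count_space Gamma_theta)"
    using G by (intro nn_integral_cong) (auto split: split_indicator)
  then show ?case using G(1) by simp
qed

lemma indicator_FD_measurable:
  assumes "G \<in> SL" shows "(\<lambda>y. indicator FD (G ** y) :: ennreal) \<in> borel_measurable SLb"
  by (rule measurable_compose[OF _ borel_measurable_indicator[OF FD_measurable]])
     (rule measurable_mmult_SLb[where f="\<lambda>_. G" and g="\<lambda>y. y", OF measurable_const_SLb[OF assms] measurable_ident_sets[OF refl]])

lemma FD_count_measurable:
  "(\<lambda>M. \<integral>\<^sup>+G. indicator FD (G ** M) \<partial>count_space Gamma_theta) \<in> borel_measurable SLb"
proof (rule sigma_finite_measure.borel_measurable_nn_integral[OF sigma_finite_measure_count_space_countable])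
  show "(\<lambda>(x, y). indicator FD (y ** x) :: ennreal) \<in> borel_measurable (SLb \<Otimes>\<^sub>M count_space Gamma_theta)"
    by (subst measurable_pair_swap_iff, rule measurable_pair_measure_countable1)
      (simp_all only: split_conv countable_theta indicator_FD_measurable theta_SL)
qed simp

lemma measurable_haar_iff [simp]: "f \<in> measurable haar N \<longleftrightarrow> f \<in> measurable SLb N"
  by (simp only: measurable_cong_sets[OF sets_haar refl])

section \<open>Unfolding integrals over the group\<close>

lemma bij_adj_theta: "bij_betw adj Gamma_theta Gamma_theta"
  by (rule bij_betwI[of _ _ _ adj]) auto

text \<open>Almost every \<open>M\<close> has exactly one translate in \<open>FD\<close>, so the sum
  of \<open>indicator FD (G ** M)\<close> over \<open>G\<close> may be inserted as a factor 1. Left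
  invariance then moves \<open>adj G\<close> onto \<open>f\<close>, and inversion permutes the
  group.\<close>

lemma unfold_haar:
  assumes [measurable]: "f \<in> borel_measurable SLb"
  shows "(\<integral>\<^sup>+M. f M \<partial>haar) = (\<integral>\<^sup>+M. indicator FD M * (\<integral>\<^sup>+G. f (G ** M) \<partial>count_space Gamma_theta) \<partial>haar)"
proof -
  have m: "(\<lambda>M. f M * indicator FD (G ** M)) \<in> borel_measurable SLb"
    "(\<lambda>M. f (G ** M) * indicator FD M) \<in> borel_measurable SLb" if "G \<in> Gamma_theta" for G
    using theta_SL[OF that] by measurable
  have "(\<integral>\<^sup>+M. f M \<partial>haar) = (\<integral>\<^sup>+M. (\<integral>\<^sup>+G. f M * indicator FD (G ** M) \<partial>count_space Gamma_theta) \<partial>haar)"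
    by (rule nn_integral_cong_AE, use AE_FD_count in eventually_elim) (simp add: nn_integral_cmult)
  also have "\<dots> = (\<integral>\<^sup>+G. (\<integral>\<^sup>+M. f M * indicator FD (G ** M) \<partial>haar) \<partial>count_space Gamma_theta)"
    by (rule nn_integral_count_space_nn_integral) (use m in auto)
  also have "\<dots> = (\<integral>\<^sup>+G. (\<integral>\<^sup>+M. f (adj G ** M) * indicator FD M \<partial>haar) \<partial>count_space Gamma_theta)"
  proof (rule nn_integral_cong)
    fix G assume "G \<in> space (count_space Gamma_theta)"
    then have G: "G \<in> Gamma_theta" by simp
    have "(\<integral>\<^sup>+M. f M * indicator FD (G ** M) \<partial>haar) = (\<integral>\<^sup>+M. f (adj G ** M) * indicator FD (G ** (adj G ** M)) \<partial>haar)"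
      by (rule nn_integral_haar_left[symmetric]) (use G m in auto)
    also have "\<dots> = (\<integral>\<^sup>+M. f (adj G ** M) * indicator FD M \<partial>haar)"
      using G by simp
    finally show "(\<integral>\<^sup>+M. f M * indicator FD (G ** M) \<partial>haar) = (\<integral>\<^sup>+M. f (adj G ** M) * indicator FD M \<partial>haar)" .
  qed
  also have "\<dots> = (\<integral>\<^sup>+G. (\<integral>\<^sup>+M. f (G ** M) * indicator FD M \<partial>haar) \<partial>count_space Gamma_theta)"
    by (rule nn_integral_bij_count_space[OF bij_adj_theta])
  also have "\<dots> = (\<integral>\<^sup>+M. (\<integral>\<^sup>+G. f (G ** M) * indicator FD M \<partial>count_space Gamma_theta) \<partial>haar)"
    by (rule nn_integral_count_space_nn_integral[symmetric]) (use m in auto)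
  also have "\<dots> = (\<integral>\<^sup>+M. indicator FD M * (\<integral>\<^sup>+G. f (G ** M) \<partial>count_space Gamma_theta) \<partial>haar)"
    by (intro nn_integral_cong) (simp add: nn_integral_cmult[symmetric] mult.commute)
  finally show ?thesis .
qed

text \<open>The translate of \<open>FD\<close> by \<open>g\<close> is again a fundamental domain.
  Unfolding its integral over \<open>FD\<close> counts the translates of \<open>M ** adj g\<close>
  that lie in \<open>FD\<close>, and this count is one for almost every \<open>M\<close> because
  right translation preserves null sets.\<close>

lemma FD_right_invariant:
  assumes [measurable]: "f \<in> borel_measurable SLb" and g: "g \<in> SL"
    and inv: "\<And>G M. G \<in> Gamma_theta \<Longrightarrow> M \<in> SL \<Longrightarrow> f (G ** M) = f M"
  shows "(\<integral>\<^sup>+M. indicator FD M * f (M ** g) \<partial>haar) = (\<integral>\<^sup>+M. indicator FD M * f M \<partial>haar)"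
proof -
  have [measurable]: "(\<lambda>M. indicator FD (M ** adj g) * f M :: ennreal) \<in> borel_measurable SLb"
    using g by measurable
  have [measurable]: "(\<lambda>M. \<integral>\<^sup>+G. indicator FD (G ** M) \<partial>count_space Gamma_theta) \<in> borel_measurable SLb"
    by (rule FD_count_measurable)
  have "(\<integral>\<^sup>+M. indicator FD M * f (M ** g) \<partial>haar) = (\<integral>\<^sup>+M. indicator FD ((M ** g) ** adj g) * f (M ** g) \<partial>haar)"
    using g by (intro nn_integral_cong) simp
  also have "\<dots> = (\<integral>\<^sup>+M. indicator FD (M ** adj g) * f M \<partial>haar)"
    by (rule nn_integral_haar_right) (use g in auto)
  also have "\<dots> = (\<integral>\<^sup>+M. indicator FD M * (\<integral>\<^sup>+G. indicator FD (G ** M ** adj g) * f (G ** M) \<partial>count_space Gamma_theta) \<partial>haar)"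
    by (rule unfold_haar) measurable
  also have "\<dots> = (\<integral>\<^sup>+M. indicator FD M * (f M * (\<integral>\<^sup>+G. indicator FD (G ** (M ** adj g)) \<partial>count_space Gamma_theta)) \<partial>haar)"
  proof (rule nn_integral_cong)
    fix M assume "M \<in> space haar"
    then have M: "M \<in> SL" by simp
    have "(\<integral>\<^sup>+G. indicator FD (G ** M ** adj g) * f (G ** M) \<partial>count_space Gamma_theta)
       = (\<integral>\<^sup>+G. f M * indicator FD (G ** (M ** adj g)) \<partial>count_space Gamma_theta)"
      by (intro nn_integral_cong) (simp add: inv M matrix_mul_assoc mult.commute)
    also have "\<dots> = f M * (\<integral>\<^sup>+G. indicator FD (G ** (M ** adj g)) \<partial>count_space Gamma_theta)"
      by (rule nn_integral_cmult) simp
    finally show "indicator FD M * (\<integral>\<^sup>+G. indicator FD (G ** M ** adj g) * f (G ** M) \<partial>count_space Gamma_theta)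
      = indicator FD M * (f M * (\<integral>\<^sup>+G. indicator FD (G ** (M ** adj g)) \<partial>count_space Gamma_theta))"
      by simp
  qed
  also have "\<dots> = (\<integral>\<^sup>+M. indicator FD M * f M \<partial>haar)"
  proof (rule nn_integral_cong_AE)
    have p: "Measurable.pred SLb (\<lambda>M. (\<integral>\<^sup>+G. indicator FD (G ** M) \<partial>count_space Gamma_theta) = (1::ennreal))"
      by measurable
    show "AE M in haar. indicator FD M * (f M * (\<integral>\<^sup>+G. indicator FD (G ** (M ** adj g)) \<partial>count_space Gamma_theta)) = indicator FD M * f M"
      using AE_haar_right[OF p SL_adj[OF g] AE_FD_count] by eventually_elim simp
  qed
  finally show ?thesis .
qed

subsection \<open>Iwasawa coordinates\<close>

text \<open>Only the restriction of \<open>f\<close> to the union is known to be measurable. Taking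
  it as a density turns monotone convergence into continuity of a measure from below.\<close>

lemma nn_integral_Un_incseq:
  fixes f :: "real \<Rightarrow> ennreal" and A :: "nat \<Rightarrow> real set"
  assumes [measurable]: "\<And>n. A n \<in> sets borel" and A: "incseq A"
    and f: "(\<lambda>x. f x * indicator (\<Union>n. A n) x) \<in> borel_measurable borel"
  shows "(\<integral>\<^sup>+x. f x * indicator (\<Union>n. A n) x \<partial>lborel) = (SUP n. \<integral>\<^sup>+x. f x * indicator (A n) x \<partial>lborel)"
proof -
  define h where "h x = f x * indicator (\<Union>n. A n) x" for x
  have [measurable]: "h \<in> borel_measurable lborel" using f by (simp add: h_def[abs_def])
  have e: "emeasure (density lborel h) B = (\<integral>\<^sup>+x. f x * indicator B x \<partial>lborel)" if "B \<subseteq> (\<Union>n. A n)" "B \<in> sets borel" for B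
  proof -
    have "h x * indicator B x = f x * indicator B x" for x
      using that(1) by (cases "x \<in> B") (auto simp: h_def indicator_def)
    then show ?thesis using that(2) by (simp add: emeasure_density)
  qed
  have "(SUP n. emeasure (density lborel h) (A n)) = emeasure (density lborel h) (\<Union>n. A n)"
    by (rule SUP_emeasure_incseq) (use A in auto)
  moreover have "emeasure (density lborel h) (A n) = (\<integral>\<^sup>+x. f x * indicator (A n) x \<partial>lborel)" for n
    by (rule e) auto
  moreover have "emeasure (density lborel h) (\<Union>n. A n) = (\<integral>\<^sup>+x. f x * indicator (\<Union>n. A n) x \<partial>lborel)"
    by (rule e) auto
  ultimately show ?thesis by simp
qed

text \<open>Carries the substitution rule from compact intervals over to the open or unbounded ones
  on which the angle, the height and \<open>arcsin\<close> have to be substituted.\<close>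

lemma nn_integral_subst_exhaust:
  fixes f :: "real \<Rightarrow> ennreal" and a b :: "nat \<Rightarrow> real"
  assumes f: "f \<in> borel_measurable borel"
    and ab: "\<And>n. a n < b n" "\<And>n. a (Suc n) \<le> a n" "\<And>n. b n \<le> b (Suc n)"
    and deriv: "\<And>n x. x \<in> {a n..b n} \<Longrightarrow> (g has_real_derivative g' x) (at x)"
    and cont: "\<And>n. continuous_on {a n..b n} g'"
    and nonneg: "\<And>n x. x \<in> {a n..b n} \<Longrightarrow> 0 \<le> g' x"
    and m: "(\<lambda>x. f (g x) * ennreal (g' x) * indicator (\<Union>n. {a n..b n}) x) \<in> borel_measurable borel"
  shows "(\<integral>\<^sup>+x. f x * indicator (\<Union>n. {g (a n)..g (b n)}) x \<partial>lborel) =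
    (\<integral>\<^sup>+x. f (g x) * ennreal (g' x) * indicator (\<Union>n. {a n..b n}) x \<partial>lborel)"
proof -
  have mono: "g x \<le> g y" if "x \<in> {a n..b n}" "y \<in> {a n..b n}" "x \<le> y" for n x y
  proof (rule DERIV_nonneg_imp_nondecreasing[OF that(3)])
    fix z assume "x \<le> z" "z \<le> y"
    then have "z \<in> {a n..b n}" using that by auto
    then show "\<exists>d. (g has_real_derivative d) (at z) \<and> 0 \<le> d" using deriv nonneg by blast
  qed
  have inc: "incseq (\<lambda>n. {a n..b n})"
    by (rule incseq_SucI) (simp add: ab(2,3) order.strict_implies_order)
  have ginc: "incseq (\<lambda>n. {g (a n)..g (b n)})"
  proof (rule incseq_SucI)
    fix n
    have "g (a (Suc n)) \<le> g (a n)" "g (b n) \<le> g (b (Suc n))"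
      by (rule mono[of _ "Suc n"]; use ab(1)[of n] ab(1)[of "Suc n"] ab(2,3)[of n] in simp)+
    then show "{g (a n)..g (b n)} \<subseteq> {g (a (Suc n))..g (b (Suc n))}" by auto
  qed
  have "(\<integral>\<^sup>+x. f x * indicator (\<Union>n. {g (a n)..g (b n)}) x \<partial>lborel)
     = (SUP n. \<integral>\<^sup>+x. f x * indicator {g (a n)..g (b n)} x \<partial>lborel)"
    by (rule nn_integral_Un_incseq[OF _ ginc]) (use f in measurable)
  also have "\<dots> = (SUP n. \<integral>\<^sup>+x. f (g x) * ennreal (g' x) * indicator {a n..b n} x \<partial>lborel)"
    by (rule SUP_cong[OF refl], rule nn_integral_substitution_aux) (use deriv cont nonneg ab(1) f in simp_all)
  also have "\<dots> = (\<integral>\<^sup>+x. f (g x) * ennreal (g' x) * indicator (\<Union>n. {a n..b n}) x \<partial>lborel)"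
    by (rule nn_integral_Un_incseq[OF _ inc m, symmetric]) auto
  finally show ?thesis .
qed

text \<open>Here \<open>s = - cot p\<close>, so a bottom row proportional to
  \<open>(sin p, cos p)\<close> with first entry \<open>c\<close> is
  \<open>(c, - (c * s))\<close>.\<close>

lemma nn_integral_angle_subst:
  fixes K :: "real \<Rightarrow> ennreal"
  assumes [measurable]: "K \<in> borel_measurable borel"
  shows "(\<integral>\<^sup>+p. K p * indicator {0<..<pi} p \<partial>lborel) = (\<integral>\<^sup>+s. K (arctan s + pi/2) * ennreal (1 / (1 + s\<^sup>2)) \<partial>lborel)"
proof -
  let ?g = "\<lambda>s. arctan s + pi/2"
  let ?a = "\<lambda>n::nat. - real n - 1" and ?b = "\<lambda>n::nat. real n + 1"
  have I: "(\<Union>n. {?a n..?b n}) = UNIV"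
  proof (rule UNIV_eq_I[symmetric])
    fix x :: real
    obtain n where "\<bar>x\<bar> \<le> real n" using real_arch_simple by blast
    then show "x \<in> (\<Union>n. {?a n..?b n})" by (intro UN_I[of n]) auto
  qed
  have J: "(\<Union>n. {?g (?a n)..?g (?b n)}) = {0<..<pi}"
  proof (intro equalityI subsetI)
    fix x assume "x \<in> (\<Union>n. {?g (?a n)..?g (?b n)})"
    then obtain n where "?g (?a n) \<le> x" "x \<le> ?g (?b n)" by auto
    then show "x \<in> {0<..<pi}" using arctan_lbound[of "?a n"] arctan_ubound[of "?b n"] by auto
  next
    fix x assume "x \<in> {0<..<pi}"
    then have x: "- (pi/2) < x - pi/2" "x - pi/2 < pi/2" by auto
    obtain n where n: "\<bar>tan (x - pi/2)\<bar> \<le> real n" using real_arch_simple by blast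
    have "arctan (tan (x - pi/2)) = x - pi/2" by (rule arctan_tan) (use x in auto)
    moreover have "arctan (?a n) \<le> arctan (tan (x - pi/2))" "arctan (tan (x - pi/2)) \<le> arctan (?b n)"
      unfolding arctan_le_iff using n by linarith+
    ultimately show "x \<in> (\<Union>n. {?g (?a n)..?g (?b n)})" by (intro UN_I[of n]) auto
  qed
  have nz: "1 + s\<^sup>2 \<noteq> 0" for s :: real using zero_le_power2[of s] by linarith
  have "(\<integral>\<^sup>+x. K x * indicator (\<Union>n. {?g (?a n)..?g (?b n)}) x \<partial>lborel) =
    (\<integral>\<^sup>+x. K (?g x) * ennreal (1 / (1 + x\<^sup>2)) * indicator (\<Union>n. {?a n..?b n}) x \<partial>lborel)"
  proof (rule nn_integral_subst_exhaust)
    show "(\<lambda>x. K (arctan x + pi / 2) * ennreal (1 / (1 + x\<^sup>2)) * indicator (\<Union>n. {?a n..?b n}) x) \<in> borel_measurable borel"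
      unfolding I by measurable
    fix n x
    show "((\<lambda>s. arctan s + pi / 2) has_real_derivative 1 / (1 + x\<^sup>2)) (at x)"
      by (auto intro!: derivative_eq_intros simp: inverse_eq_divide)
    show "continuous_on {?a n..?b n} (\<lambda>x. 1 / (1 + x\<^sup>2))"
      by (intro continuous_intros) (use nz in auto)
  qed auto
  then show ?thesis unfolding I J by (simp only: indicator_UNIV mult_1_right)
qed

text \<open>With \<open>w = sin p\<close> the Iwasawa matrix at height \<open>y\<close> has lower
  left entry \<open>c = w / sqrt y\<close>; the variable of integration passes from \<open>y\<close>
  to \<open>c\<close>.\<close>

lemma nn_integral_height_subst:
  fixes K :: "real \<Rightarrow> ennreal"
  assumes [measurable]: "K \<in> borel_measurable borel" and w: "w > 0"
  shows "(\<integral>\<^sup>+y. ennreal (1/y\<^sup>2) * K y * indicator {0<..} y \<partial>lborel) =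
    (\<integral>\<^sup>+c. ennreal (2*c/w\<^sup>2) * K (w\<^sup>2/c\<^sup>2) * indicator {0<..} c \<partial>lborel)"
proof -
  \<comment> \<open>The map from \<open>c\<close> to \<open>w^2/c^2\<close> decreases, whereas the
    substitution rule asks for a nonnegative derivative. The computation is therefore made in
    \<open>- y\<close> and reflected at the end.\<close>
  let ?f = "\<lambda>x. ennreal (1/x\<^sup>2) * K (- x)"
  let ?g = "\<lambda>c. - w\<^sup>2/c\<^sup>2" and ?g' = "\<lambda>c. 2 * w\<^sup>2/c^3"
  let ?a = "\<lambda>n. 1 / (real n + 2)" and ?b = "\<lambda>n::nat. real n + 1"
  have I: "(\<Union>n. {?a n..?b n}) = {0<..}"
  proof (intro equalityI subsetI)
    fix x :: real assume x: "x \<in> {0<..}"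
    obtain n where n: "max x (1/x) \<le> real n" using real_arch_simple by blast
    then have "1/x \<le> real n + 2" by auto
    then have "1 / (real n + 2) \<le> x" using x by (simp add: field_simps)
    then show "x \<in> (\<Union>n. {?a n..?b n})" using n by (intro UN_I[of n]) auto
  next
    fix x assume "x \<in> (\<Union>n. {?a n..?b n})"
    then obtain n where "?a n \<le> x" by auto
    moreover have "0 < ?a n" by simp
    ultimately show "x \<in> {0<..}" unfolding greaterThan_iff by (rule less_le_trans[rotated])
  qed
  have J: "(\<Union>n. {?g (?a n)..?g (?b n)}) = {..<0}"
  proof (intro equalityI subsetI)
    fix x :: real assume x: "x \<in> {..<0}"
    define c where "c = w / sqrt (-x)"
    have c: "c > 0" "?g c = x" using x w by (auto simp: c_def power_divide)
    then have "c \<in> (\<Union>n. {?a n..?b n})" unfolding I by simp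
    then obtain n where n: "?a n \<le> c" "c \<le> ?b n" by auto
    have "(?a n)\<^sup>2 \<le> c\<^sup>2" "c\<^sup>2 \<le> (?b n)\<^sup>2" using n c(1) by (auto intro!: power_mono)
    then have "w\<^sup>2/c\<^sup>2 \<le> w\<^sup>2/(?a n)\<^sup>2" "w\<^sup>2/(?b n)\<^sup>2 \<le> w\<^sup>2/c\<^sup>2"
      using c(1) w by (auto intro!: divide_left_mono mult_pos_pos zero_less_power)
    then show "x \<in> (\<Union>n. {?g (?a n)..?g (?b n)})" using c(2) by (intro UN_I[of n]) auto
  next
    fix x assume "x \<in> (\<Union>n. {?g (?a n)..?g (?b n)})"
    then obtain n where "x \<le> ?g (?b n)" by auto
    moreover have "?g (?b n) < 0" using w by (simp add: divide_neg_pos)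
    ultimately show "x \<in> {..<0}" unfolding lessThan_iff by (rule le_less_trans)
  qed
  have pos: "x > 0" if "x \<in> {?a n..?b n}" for x n
  proof -
    have "x \<in> (\<Union>n. {?a n..?b n})" using that by blast
    then show ?thesis unfolding I by simp
  qed
  have "(\<integral>\<^sup>+x. ?f x * indicator (\<Union>n. {?g (?a n)..?g (?b n)}) x \<partial>lborel) =
    (\<integral>\<^sup>+x. ?f (?g x) * ennreal (?g' x) * indicator (\<Union>n. {?a n..?b n}) x \<partial>lborel)"
  proof (rule nn_integral_subst_exhaust)
    show "(\<lambda>x. ?f (?g x) * ennreal (?g' x) * indicator (\<Union>n. {?a n..?b n}) x) \<in> borel_measurable borel"
      unfolding I by measurable
    fix n x
    show "?a n < ?b n" by (simp add: field_simps add_pos_nonneg)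
    show "?a (Suc n) \<le> ?a n" by (simp add: field_simps)
    show "continuous_on {?a n..?b n} ?g'"
      by (intro continuous_intros) (use pos in fastforce)
    assume x: "x \<in> {?a n..?b n}"
    then show "0 \<le> ?g' x" using pos[OF x] by simp
    show "(?g has_real_derivative ?g' x) (at x)"
      using pos[OF x] by (auto intro!: derivative_eq_intros simp: power2_eq_square power3_eq_cube divide_simps)
  qed auto
  then have "(\<integral>\<^sup>+x. ?f x * indicator {..<0} x \<partial>lborel) =
    (\<integral>\<^sup>+x. ?f (?g x) * ennreal (?g' x) * indicator {0<..} x \<partial>lborel)"
    unfolding I J .
  note main = this
  define h where "h x = ?f x * indicator {..<0} x" for x
  have [measurable]: "h \<in> borel_measurable borel" unfolding h_def[abs_def] by measurable
  have refl: "(\<integral>\<^sup>+x. ?f x * indicator {..<0} x \<partial>lborel) = (\<integral>\<^sup>+y. ennreal (1/y\<^sup>2) * K y * indicator {0<..} y \<partial>lborel)"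
  proof -
    have "(\<integral>\<^sup>+x. h x \<partial>lborel) = (\<integral>\<^sup>+x. h ((-1) * x + 0) \<partial>lborel)"
      by (subst nn_integral_scale) auto
    also have "\<dots> = (\<integral>\<^sup>+y. ennreal (1/y\<^sup>2) * K y * indicator {0<..} y \<partial>lborel)"
      by (intro nn_integral_cong) (simp add: h_def split: split_indicator)
    finally show ?thesis by (simp only: h_def)
  qed
  have "(\<integral>\<^sup>+x. ?f (?g x) * ennreal (?g' x) * indicator {0<..} x \<partial>lborel) = (\<integral>\<^sup>+c. ennreal (2*c/w\<^sup>2) * K (w\<^sup>2/c\<^sup>2) * indicator {0<..} c \<partial>lborel)"
  proof (rule nn_integral_cong)
    fix c :: real
    show "?f (?g c) * ennreal (?g' c) * indicator {0<..} c = ennreal (2*c/w\<^sup>2) * K (w\<^sup>2/c\<^sup>2) * indicator {0<..} c"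
    proof (cases "c > 0")
      case True
      then have key: "ennreal (1/(?g c)\<^sup>2) * ennreal (?g' c) = ennreal (2*c/w\<^sup>2)"
        using w by (simp add: ennreal_mult'[symmetric] divide_simps) (simp add: eval_nat_numeral)
      have swap: "x * k * y = (x * y) * k" for x y k :: ennreal by (simp only: mult_ac)
      have neg: "- (?g c) = w\<^sup>2/c\<^sup>2" by simp
      have e: "?f (?g c) * ennreal (?g' c) = (ennreal (1/(?g c)\<^sup>2) * ennreal (?g' c)) * K (w\<^sup>2/c\<^sup>2)"
        unfolding neg by (rule swap)
      show ?thesis unfolding e key ..
    qed simp
  qed
  with main refl show ?thesis by (simp only:)
qed

text \<open>Here \<open>x\<close> is the real part and \<open>(c, d)\<close> the bottom row; thus \<open>y = 1 / (c\<^sup>2 + d\<^sup>2)\<close>.\<close>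

definition kmat :: "real \<Rightarrow> real \<Rightarrow> real \<Rightarrow> real^2^2" where
  "kmat x c d = mat22 (x*c + d/(c\<^sup>2+d\<^sup>2)) (x*d - c/(c\<^sup>2+d\<^sup>2)) c d"

lemma kmat_SL: "c\<^sup>2 + d\<^sup>2 \<noteq> 0 \<Longrightarrow> kmat x c d \<in> SL"
proof -
  assume "c\<^sup>2 + d\<^sup>2 \<noteq> 0"
  then have "d * d / (c\<^sup>2 + d\<^sup>2) + c * c / (c\<^sup>2 + d\<^sup>2) = 1"
    by (simp add: add_divide_distrib[symmetric] power2_eq_square add.commute)
  then show ?thesis
    unfolding kmat_def SL_def by (simp add: algebra_simps)
qed

lemma iwasawa_eq:
  "iwasawa x y p = mat22 (sqrt y * cos p + x / sqrt y * sin p) (x / sqrt y * cos p - sqrt y * sin p) (sin p / sqrt y) (cos p / sqrt y)"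
  by (simp add: iwasawa_def algebra_simps)

lemma iwasawa_SL: "y > 0 \<Longrightarrow> iwasawa x y p \<in> SL"
  unfolding iwasawa_def by (intro SL_mult) (auto simp: SL_def simp flip: power2_eq_square)

lemma iwasawa_kmat:
  assumes c: "c > 0"
  shows "iwasawa x ((1 / sqrt (1 + s\<^sup>2))\<^sup>2 / c\<^sup>2) (arctan s + pi/2) = kmat x c (- (c * s))"
proof -
  define r where "r = sqrt (1 + s\<^sup>2)"
  have r: "r > 0" "r\<^sup>2 = 1 + s\<^sup>2" by (auto simp: r_def add_pos_nonneg)
  have sq: "sqrt ((1 / sqrt (1 + s\<^sup>2))\<^sup>2 / c\<^sup>2) = 1 / (r * c)"
    using c r by (simp add: r_def real_sqrt_divide)
  have tr: "sin (arctan s + pi/2) = 1/r" "cos (arctan s + pi/2) = - s/r"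
    by (simp_all add: sin_add cos_add cos_arctan sin_arctan r_def)
  have e: "c\<^sup>2 + (c * s)\<^sup>2 = c\<^sup>2 * r\<^sup>2" by (simp add: r(2) power_mult_distrib algebra_simps)
  show ?thesis
    unfolding iwasawa_eq sq tr kmat_def
    using r(1) c e by (simp add: mat22_eq_iff power2_eq_square)
qed

lemma iwasawa_q:
  assumes "y > 0"
  shows "qN (iwasawa x y p) = 1/y" "qX (iwasawa x y p) = x/y" "qA (iwasawa x y p) = (x\<^sup>2+y\<^sup>2)/y"
proof -
  define r where "r = sqrt y"
  define C S where "C = cos p" and "S = sin p"
  have r: "r > 0" "y = r\<^sup>2" using assms by (auto simp: r_def)
  have sc: "S * S = 1 - C * C" using sin_squared_eq[of p] by (simp add: C_def S_def power2_eq_square)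
  have sc': "S * (S * t) = (1 - C * C) * t" for t using sc by (simp add: mult.assoc[symmetric])
  show "qN (iwasawa x y p) = 1/y" "qX (iwasawa x y p) = x/y" "qA (iwasawa x y p) = (x\<^sup>2+y\<^sup>2)/y"
    unfolding iwasawa_eq qN_def qX_def qA_def r_def[symmetric] C_def[symmetric] S_def[symmetric] using r(1)
    by (simp_all add: r(2) power2_eq_square divide_simps) (simp_all add: algebra_simps sc sc')
qed

text \<open>At \<open>p = 0\<close> the lower left entry vanishes, so this end of the angular
  interval belongs to the coordinate region but not to \<open>FD\<close>; the discrepancy is a null
  set.\<close>

lemma iwasawa_FD:
  assumes "y > 0" "0 < p" "p < pi"
  shows "iwasawa x y p \<in> FD \<longleftrightarrow> Complex x y \<in> theta_domain"
proof -
  have c: "iwasawa x y p $ 2 $ 1 > 0" using assms by (simp add: iwasawa_eq sin_gt_zero)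
  have 1: "1/y < (x\<^sup>2+y\<^sup>2)/y \<longleftrightarrow> 1 < cmod (Complex x y)"
    using assms(1) by (simp add: cmod_def divide_less_cancel real_less_rsqrt)
  have 2: "4 * (x/y) < (x\<^sup>2+y\<^sup>2)/y + 3 * (1/y) \<longleftrightarrow> 1 < cmod (Complex x y - 2)"
  proof -
    have "4 * (x/y) < (x\<^sup>2+y\<^sup>2)/y + 3 * (1/y) \<longleftrightarrow> 4 * x < x\<^sup>2+y\<^sup>2 + 3"
      using assms(1) by (simp add: field_simps)
    also have "\<dots> \<longleftrightarrow> 1 < (x-2)\<^sup>2 + y\<^sup>2" by (auto simp: power2_eq_square algebra_simps)
    also have "\<dots> \<longleftrightarrow> 1 < cmod (Complex x y - 2)" by (simp add: cmod_def)
    finally show ?thesis .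
  qed
  show ?thesis
    using assms c iwasawa_SL[OF assms(1)] 1 2
    by (simp add: FD_def theta_domain_def iwasawa_q zero_le_divide_iff divide_less_cancel)
qed

definition hyp_region :: "(real \<times> real \<times> real) set" where
  "hyp_region = {(x, y, p). Complex x y \<in> theta_domain \<and> 0 \<le> p \<and> p < pi}"

lemma measurable_fst3 [measurable]: "fst \<in> borel_measurable (borel :: (real \<times> real \<times> real) measure)"
  "(\<lambda>z. fst (snd z)) \<in> borel_measurable (borel :: (real \<times> real \<times> real) measure)"
  "(\<lambda>z. snd (snd z)) \<in> borel_measurable (borel :: (real \<times> real \<times> real) measure)"
  by (intro borel_measurable_continuous_onI continuous_intros)+

lemma theta_domain_iff:
  "Complex x y \<in> theta_domain \<longleftrightarrow> 0 < y \<and> 1 < x\<^sup>2 + y\<^sup>2 \<and> 1 < (x - 2)\<^sup>2 + y\<^sup>2 \<and> 0 \<le> x \<and> x < 2"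
  by (simp add: theta_domain_def cmod_def)

lemma hyp_region_measurable [measurable]: "hyp_region \<in> sets borel"
proof -
  have "{z \<in> space (borel :: (real \<times> real \<times> real) measure). 0 < fst (snd z) \<and> 1 < (fst z)\<^sup>2 + (fst (snd z))\<^sup>2 \<and>
     1 < (fst z - 2)\<^sup>2 + (fst (snd z))\<^sup>2 \<and> 0 \<le> fst z \<and> fst z < 2 \<and> 0 \<le> snd (snd z) \<and> snd (snd z) < pi} \<in> sets borel"
    by measurable
  also have "{z \<in> space (borel :: (real \<times> real \<times> real) measure). 0 < fst (snd z) \<and> 1 < (fst z)\<^sup>2 + (fst (snd z))\<^sup>2 \<and>
     1 < (fst z - 2)\<^sup>2 + (fst (snd z))\<^sup>2 \<and> 0 \<le> fst z \<and> fst z < 2 \<and> 0 \<le> snd (snd z) \<and> snd (snd z) < pi} = hyp_region"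
    by (auto simp: hyp_region_def theta_domain_iff)
  finally show ?thesis .
qed

lemma hyp_measure_eq: "hyp_measure = density (restrict_space lborel hyp_region) (\<lambda>z. ennreal (1 / (fst (snd z))\<^sup>2))"
  by (simp add: hyp_measure_def hyp_region_def split_def)

lemma space_hyp_measure: "space hyp_measure = hyp_region"
  by (simp add: hyp_measure_eq space_restrict_space)

lemma measurable_hyp_measure:
  "f \<in> measurable lborel N \<Longrightarrow> f \<in> measurable hyp_measure N"
  unfolding hyp_measure_eq by (simp add: measurable_restrict_space1)

lemma nn_integral_hyp_measure:
  fixes g :: "real \<Rightarrow> real \<Rightarrow> real \<Rightarrow> ennreal"
  assumes g: "(\<lambda>(x,y,p). g x y p) \<in> borel_measurable borel"
  shows "(\<integral>\<^sup>+z. (case z of (x,y,p) \<Rightarrow> g x y p) \<partial>hyp_measure) =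
    (\<integral>\<^sup>+p. \<integral>\<^sup>+y. \<integral>\<^sup>+x. ennreal (1/y\<^sup>2) * g x y p * indicator hyp_region (x,y,p) \<partial>lborel \<partial>lborel \<partial>lborel)"
proof -
  have g': "(\<lambda>z. g (fst z) (fst (snd z)) (snd (snd z))) \<in> borel_measurable borel"
    using g by (simp add: split_def)
  note g'[measurable]
  have "(\<integral>\<^sup>+z. (case z of (x,y,p) \<Rightarrow> g x y p) \<partial>hyp_measure) =
    (\<integral>\<^sup>+z. ennreal (1 / (fst (snd z))\<^sup>2) * g (fst z) (fst (snd z)) (snd (snd z)) \<partial>restrict_space lborel hyp_region)"
    unfolding hyp_measure_eq split_def
    by (rule nn_integral_density) (rule measurable_restrict_space1, measurable)+
  also have "\<dots> = (\<integral>\<^sup>+z. (case z of (x,y,p) \<Rightarrow> ennreal (1/y\<^sup>2) * g x y p * indicator hyp_region (x,y,p)) \<partial>lborel)"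
    by (subst nn_integral_restrict_space) (auto simp: split_def intro!: nn_integral_cong)
  also have "\<dots> = (\<integral>\<^sup>+p. \<integral>\<^sup>+y. \<integral>\<^sup>+x. ennreal (1/y\<^sup>2) * g x y p * indicator hyp_region (x,y,p) \<partial>lborel \<partial>lborel \<partial>lborel)"
    by (rule nn_integral_lborel3) (simp only: split_def prod.collapse, measurable)
  finally show ?thesis .
qed

lemma borel3: "(borel \<Otimes>\<^sub>M (borel \<Otimes>\<^sub>M borel)) = (borel :: (real \<times> real \<times> real) measure)"
  by (simp add: borel_prod)

text \<open>The value \<open>mat 1\<close> for a nonpositive entry keeps the map inside
  \<open>SL\<close> for all arguments, so it can be composed with functions that are measurable on
  \<open>SL\<close> only. The same device serves the Iwasawa map below.\<close>

lemma kmat_measurable [measurable (raw)]: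
  assumes [measurable]: "f \<in> borel_measurable M" "g \<in> borel_measurable M" "h \<in> borel_measurable M"
  shows "(\<lambda>x. if g x > 0 then kmat (f x) (g x) (h x) else mat 1) \<in> measurable M SLb"
proof (rule measurable_SLbI)
  show "(\<lambda>x. if g x > 0 then kmat (f x) (g x) (h x) else mat 1) \<in> borel_measurable M"
    unfolding kmat_def by measurable
  fix x
  show "(if g x > 0 then kmat (f x) (g x) (h x) else mat 1) \<in> SL"
  proof (cases "g x > 0")
    case True
    then have "(g x)\<^sup>2 + (h x)\<^sup>2 \<noteq> 0" by (simp add: sum_power2_eq_zero_iff)
    then show ?thesis using True by (simp add: kmat_SL)
  qed simp
qed

lemma iwasawa_measurable [measurable (raw)]:
  assumes [measurable]: "f \<in> borel_measurable M" "g \<in> borel_measurable M" "h \<in> borel_measurable M"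
  shows "(\<lambda>x. if g x > 0 then iwasawa (f x) (g x) (h x) else mat 1) \<in> measurable M SLb"
proof (rule measurable_SLbI)
  show "(\<lambda>x. if g x > 0 then iwasawa (f x) (g x) (h x) else mat 1) \<in> borel_measurable M"
    unfolding iwasawa_eq by measurable
qed (simp add: iwasawa_SL)

text \<open>For a fixed bottom row, \<open>t\<close> and the real part \<open>x\<close> differ by
  the constant \<open>c / (d * (c^2 + d^2))\<close>, so the change of coordinates is a translation.
  By \<open>f0\<close> neither the half \<open>c \<le> 0\<close> nor the junk value
  \<open>mat 1\<close> contributes.\<close>

lemma nn_integral_haar_kmat:
  assumes f[measurable]: "f \<in> borel_measurable SLb" and f0: "\<And>M. M$2$1 \<le> 0 \<Longrightarrow> f M = 0"
  shows "(\<integral>\<^sup>+M. f M \<partial>haar) = (\<integral>\<^sup>+c. \<integral>\<^sup>+d. \<integral>\<^sup>+x. (f (if c > 0 then kmat x c d else mat 1)) \<partial>lborel \<partial>lborel \<partial>lborel)"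
proof -
  have "(\<integral>\<^sup>+M. f M \<partial>haar) = (\<integral>\<^sup>+d. \<integral>\<^sup>+c. \<integral>\<^sup>+t. f (par t c d) \<partial>lborel \<partial>lborel \<partial>lborel)"
    by (rule nn_integral_haar) measurable
  also have "\<dots> = (\<integral>\<^sup>+d. \<integral>\<^sup>+c. \<integral>\<^sup>+x. f (if c > 0 then kmat x c d else mat 1) \<partial>lborel \<partial>lborel \<partial>lborel)"
  proof (intro nn_integral_cong_AE, use AE_lborel_neq[of 0] in eventually_elim)
    case (elim d)
    show ?case
    proof (rule nn_integral_cong)
      fix c :: real
      show "(\<integral>\<^sup>+t. f (par t c d) \<partial>lborel) = (\<integral>\<^sup>+x. f (if c > 0 then kmat x c d else mat 1) \<partial>lborel)"
      proof (cases "c > 0")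
        case True
        let ?e = "c / (d * (c\<^sup>2 + d\<^sup>2))"
        have nz: "c\<^sup>2 + d\<^sup>2 \<noteq> 0" using True by (simp add: sum_power2_eq_zero_iff)
        have "kmat x c d = par (x + - ?e) c d" for x
        proof -
          have 1: "1/d - ?e * c = d / (c\<^sup>2 + d\<^sup>2)" "?e * d = c / (c\<^sup>2 + d\<^sup>2)"
            using elim nz by (simp_all add: divide_simps) (simp_all add: power2_eq_square)
          show ?thesis
            unfolding kmat_def par_def 1(1)[symmetric] 1(2)[symmetric] using elim
            by (simp add: mat22_eq_iff algebra_simps)
        qed
        then show ?thesis using True nn_integral_translate[of "\<lambda>t. f (par t c d)" "- ?e"] by simp
      next
        case False
        then show ?thesis using elim by (simp add: f0 par_def)
      qed
    qed
  qed
  also have "\<dots> = (\<integral>\<^sup>+c. \<integral>\<^sup>+d. \<integral>\<^sup>+x. f (if c > 0 then kmat x c d else mat 1) \<partial>lborel \<partial>lborel \<partial>lborel)"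
    by (rule nn_integral_lborel_swap) measurable
  finally show ?thesis .
qed

text \<open>The bottom row is \<open>(sin p, cos p) / sqrt y\<close>, and polar coordinates give
  \<open>dc dd = dy dp / (2 * y^2)\<close>. This is the origin of the factor 2.\<close>

lemma FD_iwasawa:
  assumes f[measurable]: "f \<in> borel_measurable SLb"
  shows "(\<integral>\<^sup>+(x,y,p). f (iwasawa x y p) \<partial>hyp_measure) = 2 * (\<integral>\<^sup>+M. indicator FD M * f M \<partial>haar)"
proof -
  define G where "G M = indicator FD M * f M" for M
  have G[measurable]: "G \<in> borel_measurable SLb" unfolding G_def by measurable
  have G0: "G M = 0" if "M$2$1 \<le> 0" for M using that by (simp add: G_def FD_def)
  define Iw where "Iw x y p = (if y > 0 then iwasawa x y p else mat 1)" for x y p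
  have Iw[measurable (raw)]: "(\<lambda>x. Iw (a x) (b x) (c x)) \<in> measurable M SLb"
    if "a \<in> borel_measurable M" "b \<in> borel_measurable M" "c \<in> borel_measurable M" for a b c and M :: "'z measure"
    unfolding Iw_def using that by (rule iwasawa_measurable)
  have "(\<integral>\<^sup>+(x,y,p). f (iwasawa x y p) \<partial>hyp_measure) = (\<integral>\<^sup>+(x,y,p). f (Iw x y p) \<partial>hyp_measure)"
    by (rule nn_integral_cong) (auto simp: space_hyp_measure hyp_region_def theta_domain_iff Iw_def)
  also have "\<dots> = (\<integral>\<^sup>+p. \<integral>\<^sup>+y. \<integral>\<^sup>+x. ennreal (1/y\<^sup>2) * f (Iw x y p) * indicator hyp_region (x,y,p) \<partial>lborel \<partial>lborel \<partial>lborel)"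
    by (rule nn_integral_hyp_measure) (unfold borel3[symmetric] split_def, measurable)
  also have "\<dots> = (\<integral>\<^sup>+p. (\<integral>\<^sup>+y. ennreal (1/y\<^sup>2) * (\<integral>\<^sup>+x. G (Iw x y p) \<partial>lborel) * indicator {0<..} y \<partial>lborel) * indicator {0<..<pi} p \<partial>lborel)"
  proof (intro nn_integral_cong_AE, use AE_lborel_neq[of 0] in eventually_elim)
    case (elim p)
    show ?case
    proof (cases "0 < p \<and> p < pi")
      case True
      have "(\<integral>\<^sup>+x. ennreal (1/y\<^sup>2) * f (Iw x y p) * indicator hyp_region (x,y,p) \<partial>lborel) =
         ennreal (1/y\<^sup>2) * (\<integral>\<^sup>+x. G (Iw x y p) \<partial>lborel) * indicator {0<..} y" for y
      proof (cases "y > 0")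
        case y: True
        have "ennreal (1/y\<^sup>2) * f (Iw x y p) * indicator hyp_region (x,y,p) = ennreal (1/y\<^sup>2) * G (Iw x y p)" for x
          using True y iwasawa_FD[of y p x] by (auto simp: G_def Iw_def hyp_region_def split: split_indicator)
        then show ?thesis using y by (simp add: nn_integral_cmult)
      next
        case False
        then have "indicator hyp_region (x,y,p) = (0::ennreal)" for x
          by (auto simp: hyp_region_def theta_domain_iff)
        then show ?thesis using False by simp
      qed
      then show ?thesis using True by simp
    next
      case False
      then have "indicator hyp_region (x,y,p) = (0::ennreal)" for x y
        using elim by (auto simp: hyp_region_def split: split_indicator)
      then show ?thesis using False by simp
    qed
  qed
  also have "\<dots> = (\<integral>\<^sup>+s. (\<integral>\<^sup>+y. ennreal (1/y\<^sup>2) * (\<integral>\<^sup>+x. G (Iw x y (arctan s + pi/2)) \<partial>lborel) * indicator {0<..} y \<partial>lborel) * ennreal (1 / (1 + s\<^sup>2)) \<partial>lborel)"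
    by (rule nn_integral_angle_subst[where K="\<lambda>p. \<integral>\<^sup>+y. ennreal (1/y\<^sup>2) * (\<integral>\<^sup>+x. G (Iw x y p) \<partial>lborel) * indicator {0<..} y \<partial>lborel"]) measurable
  also have "\<dots> = (\<integral>\<^sup>+s. (\<integral>\<^sup>+c. 2 * (ennreal c * (\<integral>\<^sup>+x. G (if c > 0 then kmat x c (- (c * s)) else mat 1) \<partial>lborel)) * indicator {0<..} c \<partial>lborel) \<partial>lborel)"
  proof (rule nn_integral_cong)
    fix s :: real
    let ?w = "1 / sqrt (1 + s\<^sup>2)"
    have pos: "1 + s\<^sup>2 > 0" by (simp add: add_pos_nonneg)
    then have w: "?w > 0" "?w\<^sup>2 = 1 / (1 + s\<^sup>2)" by (simp_all add: power_divide)
    have m1: "(\<lambda>y. \<integral>\<^sup>+x. G (Iw x y (arctan s + pi/2)) \<partial>lborel) \<in> borel_measurable borel"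
      by measurable
    have [measurable]: "(\<lambda>c. \<integral>\<^sup>+x. G (Iw x (?w\<^sup>2/c\<^sup>2) (arctan s + pi/2)) \<partial>lborel) \<in> borel_measurable borel"
      by measurable
    have "(\<integral>\<^sup>+y. ennreal (1/y\<^sup>2) * (\<integral>\<^sup>+x. G (Iw x y (arctan s + pi/2)) \<partial>lborel) * indicator {0<..} y \<partial>lborel) * ennreal (1 / (1 + s\<^sup>2))
      = (\<integral>\<^sup>+c. ennreal (2*c/?w\<^sup>2) * (\<integral>\<^sup>+x. G (Iw x (?w\<^sup>2/c\<^sup>2) (arctan s + pi/2)) \<partial>lborel) * indicator {0<..} c \<partial>lborel) * ennreal (1 / (1 + s\<^sup>2))"
      by (subst nn_integral_height_subst[OF m1 w(1)]) (rule refl)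
    also have "\<dots> = (\<integral>\<^sup>+c. ennreal (2*c/?w\<^sup>2) * (\<integral>\<^sup>+x. G (Iw x (?w\<^sup>2/c\<^sup>2) (arctan s + pi/2)) \<partial>lborel) * indicator {0<..} c * ennreal (1 / (1 + s\<^sup>2)) \<partial>lborel)"
      by (rule nn_integral_multc[symmetric]) measurable
    also have "\<dots> = (\<integral>\<^sup>+c. 2 * (ennreal c * (\<integral>\<^sup>+x. G (if c > 0 then kmat x c (- (c * s)) else mat 1) \<partial>lborel)) * indicator {0<..} c \<partial>lborel)"
    proof (rule nn_integral_cong)
      fix c :: real
      show "ennreal (2*c/?w\<^sup>2) * (\<integral>\<^sup>+x. G (Iw x (?w\<^sup>2/c\<^sup>2) (arctan s + pi/2)) \<partial>lborel) * indicator {0<..} c * ennreal (1 / (1 + s\<^sup>2))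
        = 2 * (ennreal c * (\<integral>\<^sup>+x. G (if c > 0 then kmat x c (- (c * s)) else mat 1) \<partial>lborel)) * indicator {0<..} c"
      proof (cases "c > 0")
        case True
        have i: "Iw x (?w\<^sup>2/c\<^sup>2) (arctan s + pi/2) = kmat x c (- (c * s))" for x
          using iwasawa_kmat[OF True, of x s] True w(1) by (simp add: Iw_def)
        have "ennreal (2*c/?w\<^sup>2) * ennreal (1 / (1 + s\<^sup>2)) = ennreal (2 * c)"
          unfolding w(2) using True pos by (subst ennreal_mult'[symmetric]) auto
        also have "\<dots> = 2 * ennreal c" using True by (simp add: ennreal_mult')
        finally have k: "ennreal (2*c/?w\<^sup>2) * ennreal (1 / (1 + s\<^sup>2)) = 2 * ennreal c" .
        have sw: "a * b * 1 * d = a * d * b" for a b d :: ennreal by (simp add: mult_ac)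
        have "ennreal (2*c/?w\<^sup>2) * (\<integral>\<^sup>+x. G (kmat x c (- (c * s))) \<partial>lborel) * 1 * ennreal (1 / (1 + s\<^sup>2))
          = 2 * ennreal c * (\<integral>\<^sup>+x. G (kmat x c (- (c * s))) \<partial>lborel)"
          by (simp only: sw k)
        then show ?thesis using True by (simp only: i) (simp add: mult.assoc)
      qed simp
    qed
    finally show "(\<integral>\<^sup>+y. ennreal (1/y\<^sup>2) * (\<integral>\<^sup>+x. G (Iw x y (arctan s + pi/2)) \<partial>lborel) * indicator {0<..} y \<partial>lborel) * ennreal (1 / (1 + s\<^sup>2))
      = (\<integral>\<^sup>+c. 2 * (ennreal c * (\<integral>\<^sup>+x. G (if c > 0 then kmat x c (- (c * s)) else mat 1) \<partial>lborel)) * indicator {0<..} c \<partial>lborel)" .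
  qed
  also have "\<dots> = (\<integral>\<^sup>+c. (\<integral>\<^sup>+s. 2 * (ennreal c * (\<integral>\<^sup>+x. G (if c > 0 then kmat x c (- (c * s)) else mat 1) \<partial>lborel)) * indicator {0<..} c \<partial>lborel) \<partial>lborel)"
    by (rule nn_integral_lborel_swap) measurable
  also have "\<dots> = (\<integral>\<^sup>+c. 2 * (\<integral>\<^sup>+d. \<integral>\<^sup>+x. G (if c > 0 then kmat x c d else mat 1) \<partial>lborel \<partial>lborel) \<partial>lborel)"
  proof (rule nn_integral_cong)
    fix c :: real
    show "(\<integral>\<^sup>+s. 2 * (ennreal c * (\<integral>\<^sup>+x. G (if c > 0 then kmat x c (- (c * s)) else mat 1) \<partial>lborel)) * indicator {0<..} c \<partial>lborel)
       = 2 * (\<integral>\<^sup>+d. \<integral>\<^sup>+x. G (if c > 0 then kmat x c d else mat 1) \<partial>lborel \<partial>lborel)"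
    proof (cases "c > 0")
      case True
      define h where "h d = (\<integral>\<^sup>+x. G (if c > 0 then kmat x c d else mat 1) \<partial>lborel)" for d
      have [measurable]: "h \<in> borel_measurable borel" unfolding h_def by measurable
      have "(\<integral>\<^sup>+s. 2 * (ennreal c * h (- (c * s))) * indicator {0<..} c \<partial>lborel) = 2 * (ennreal c * (\<integral>\<^sup>+s. h ((-c) * s + 0) \<partial>lborel))"
        using True by (simp add: nn_integral_cmult)
      also have "\<dots> = 2 * (ennreal c * (ennreal (1/c) * (\<integral>\<^sup>+d. h d \<partial>lborel)))"
        using True by (subst nn_integral_scale) auto
      also have "\<dots> = 2 * (\<integral>\<^sup>+d. h d \<partial>lborel)"
        using True by (simp add: mult.assoc[symmetric] ennreal_mult'[symmetric] del: ennreal_mult')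
      finally show ?thesis by (simp only: h_def)
    next
      case False
      then show ?thesis using G0[of "mat 1"] by simp
    qed
  qed
  also have "\<dots> = 2 * (\<integral>\<^sup>+c. \<integral>\<^sup>+d. \<integral>\<^sup>+x. G (if c > 0 then kmat x c d else mat 1) \<partial>lborel \<partial>lborel \<partial>lborel)"
    by (rule nn_integral_cmult) measurable
  also have "\<dots> = 2 * (\<integral>\<^sup>+M. G M \<partial>haar)"
    by (subst nn_integral_haar_kmat[OF G G0]) auto
  finally show ?thesis by (simp only: G_def)
qed

section \<open>Volume of the fundamental domain\<close>

lemma nn_integral_height:
  assumes h: "h > 0"
  shows "(\<integral>\<^sup>+y. ennreal (1/y\<^sup>2) * indicator {h<..} y \<partial>lborel) = ennreal (1/h)"
proof -
  have "(\<integral>\<^sup>+y. ennreal (1/y\<^sup>2) * indicator {h<..} y \<partial>lborel) = (\<integral>\<^sup>+y. ennreal (1/y\<^sup>2) * indicator {h..} y \<partial>lborel)"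
    by (intro nn_integral_cong_AE, use AE_lborel_neq[of h] in eventually_elim) (auto split: split_indicator)
  also have "\<dots> = ennreal (0 - (- 1 / h))"
  proof (rule nn_integral_FTC_atLeast)
    fix x assume "h \<le> x"
    then show "((\<lambda>y. - 1 / y) has_real_derivative 1 / x\<^sup>2) (at x)"
      using h by (auto intro!: derivative_eq_intros simp: power2_eq_square)
  next
    show "((\<lambda>y::real. - 1 / y) \<longlongrightarrow> 0) at_top"
      by (intro tendsto_divide_0[OF tendsto_const] filterlim_at_top_imp_at_infinity filterlim_ident)
  qed auto
  finally show ?thesis by simp
qed

text \<open>The derivative of \<open>arcsin\<close> blows up at both ends, so the interval is
  exhausted by compact ones that stay \<open>1 / (n + 2)\<close> away from them.\<close>

lemma nn_integral_arcsin:
  "(\<integral>\<^sup>+x. ennreal (1 / sqrt (1 - x\<^sup>2)) * indicator {-1<..<1} x \<partial>lborel) = ennreal pi"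
proof -
  let ?a = "\<lambda>n. - 1 + 1 / (real n + 2)" and ?b = "\<lambda>n. 1 - 1 / (real n + 2)"
  have lt: "1 / (real n + 2) < 1" "0 < 1 / (real n + 2)" for n by (simp_all add: field_simps)
  have I: "(\<Union>n. {?a n..?b n}) = {-1<..<1}"
  proof (intro equalityI subsetI)
    fix x :: real assume x: "x \<in> {-1<..<1}"
    obtain n where n: "1 / (1 - \<bar>x\<bar>) \<le> real n" using real_arch_simple by blast
    have "1 / (real n + 2) \<le> 1 - \<bar>x\<bar>"
    proof -
      have "1 / (1 - \<bar>x\<bar>) \<le> real n + 2" "0 < 1 - \<bar>x\<bar>" using n x by auto
      then show ?thesis by (simp add: field_simps)
    qed
    then show "x \<in> (\<Union>n. {?a n..?b n})" by (intro UN_I[of n]) auto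
  next
    fix x assume "x \<in> (\<Union>n. {?a n..?b n})"
    then obtain n where "?a n \<le> x" "x \<le> ?b n" by auto
    then show "x \<in> {-1<..<1}" using lt(2)[of n] unfolding greaterThanLessThan_iff by (intro conjI; linarith)
  qed
  have mem: "-1 < x \<and> x < 1" if "x \<in> {?a n..?b n}" for x n
    using that lt(2)[of n] unfolding atLeastAtMost_iff by (intro conjI; linarith)
  have J1: "(\<Union>n. {arcsin (?a n)..arcsin (?b n)}) = {-(pi/2)<..<pi/2}"
  proof (intro equalityI subsetI)
    fix x assume "x \<in> (\<Union>n. {arcsin (?a n)..arcsin (?b n)})"
    then obtain n where n: "arcsin (?a n) \<le> x" "x \<le> arcsin (?b n)" by auto
    have "arcsin (-1) < arcsin (?a n)" "arcsin (?b n) < arcsin 1"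
      by (rule arcsin_less_arcsin; use lt[of n] in linarith)+
    then show "x \<in> {-(pi/2)<..<pi/2}" using n by simp
  next
    fix x assume x: "x \<in> {-(pi/2)<..<pi/2}"
    then have "sin x \<in> {-1<..<1}"
      using sin_monotone_2pi[of "-(pi/2)" x] sin_monotone_2pi[of x "pi/2"] by auto
    then obtain n where n: "?a n \<le> sin x" "sin x \<le> ?b n" unfolding I[symmetric] by auto
    have "arcsin (?a n) \<le> arcsin (sin x)" "arcsin (sin x) \<le> arcsin (?b n)"
      using n lt[of n] by (auto intro!: arcsin_le_arcsin)
    moreover have "arcsin (sin x) = x" using x by (intro arcsin_sin) auto
    ultimately show "x \<in> (\<Union>n. {arcsin (?a n)..arcsin (?b n)})" by (intro UN_I[of n]) auto
  qed
  have "(\<integral>\<^sup>+x. 1 * indicator (\<Union>n. {arcsin (?a n)..arcsin (?b n)}) x \<partial>lborel) =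
    (\<integral>\<^sup>+x. 1 * ennreal (1 / sqrt (1 - x\<^sup>2)) * indicator (\<Union>n. {?a n..?b n}) x \<partial>lborel)"
  proof (rule nn_integral_subst_exhaust)
    show "(\<lambda>x. 1 * ennreal (1 / sqrt (1 - x\<^sup>2)) * indicator (\<Union>n. {?a n..?b n}) x) \<in> borel_measurable borel"
      unfolding I by measurable
    fix n x
    show "?a n < ?b n" using lt(1)[of n] by linarith
    have dec: "1 / (real (Suc n) + 2) \<le> 1 / (real n + 2)" by (intro divide_left_mono) auto
    then show "?a (Suc n) \<le> ?a n" "?b n \<le> ?b (Suc n)" by linarith+
    show "continuous_on {?a n..?b n} (\<lambda>x. 1 / sqrt (1 - x\<^sup>2))"
    proof (intro continuous_intros ballI)
      fix x assume "x \<in> {?a n..?b n}"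
      then have "x\<^sup>2 < 1" using mem[of x n] by (simp add: abs_square_less_1 abs_less_iff)
      then show "sqrt (1 - x\<^sup>2) \<noteq> 0" by simp
    qed
    assume x: "x \<in> {?a n..?b n}"
    show "(arcsin has_real_derivative 1 / sqrt (1 - x\<^sup>2)) (at x)"
      using DERIV_arcsin[of x] mem[OF x] by (simp add: inverse_eq_divide)
    have "x\<^sup>2 < 1" using mem[OF x] by (simp add: abs_square_less_1 abs_less_iff)
    then show "0 \<le> 1 / sqrt (1 - x\<^sup>2)" by simp
  qed auto
  then show ?thesis unfolding I J1 by simp
qed

text \<open>Integrating \<open>1/y^2\<close> above the lower boundary gives the reciprocal of its
  height. The boundary consists of a quarter of the unit circle about 0, over \<open>(0, 1)\<close>,
  and one of the unit circle about 2, over \<open>(1, 2)\<close>. Moving the second by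
  \<open>-2\<close> completes a half circle over \<open>(-1, 1)\<close>, with integral
  \<open>pi\<close>; the angle contributes the other factor \<open>pi\<close>.\<close>

lemma emeasure_hyp_measure: "emeasure hyp_measure hyp_region = ennreal (pi\<^sup>2)"
proof -
  define B where "B = {(x,y). 0 < y \<and> 1 < x\<^sup>2 + y\<^sup>2 \<and> 1 < (x - 2)\<^sup>2 + y\<^sup>2 \<and> 0 \<le> x \<and> x < (2::real)}"
  have B[measurable]: "B \<in> sets (borel \<Otimes>\<^sub>M borel)"
  proof -
    have "{z \<in> space (borel \<Otimes>\<^sub>M borel). 0 < snd z \<and> 1 < (fst z)\<^sup>2 + (snd z)\<^sup>2 \<and> 1 < (fst z - 2)\<^sup>2 + (snd z)\<^sup>2 \<and> 0 \<le> fst z \<and> fst z < (2::real)}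
       \<in> sets (borel \<Otimes>\<^sub>M (borel :: real measure))" by measurable
    also have "{z \<in> space (borel \<Otimes>\<^sub>M borel). 0 < snd z \<and> 1 < (fst z)\<^sup>2 + (snd z)\<^sup>2 \<and> 1 < (fst z - 2)\<^sup>2 + (snd z)\<^sup>2 \<and> 0 \<le> fst z \<and> fst z < (2::real)} = B"
      by (auto simp: B_def space_pair_measure)
    finally show ?thesis .
  qed
  define u where "u x = ennreal (1 / sqrt (1 - x\<^sup>2))" for x
  have [measurable]: "u \<in> borel_measurable borel" unfolding u_def by measurable
  have A: "(\<integral>\<^sup>+y. ennreal (1/y\<^sup>2) * indicator B (x,y) \<partial>lborel) =
     u x * indicator {0<..<1} x + u (x - 2) * indicator {-1<..<0} (x - 2)" if "x \<noteq> 0" "x \<noteq> 1" for x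
  proof -
    have gen: "(\<integral>\<^sup>+y. ennreal (1/y\<^sup>2) * indicator B (x,y) \<partial>lborel) = u z"
      if z: "-1 < z" "z < 1" and Bz: "\<And>y. (x,y) \<in> B \<longleftrightarrow> 0 < y \<and> 1 < z\<^sup>2 + y\<^sup>2" for z
    proof -
      have z1: "z\<^sup>2 < 1" using z by (simp add: abs_square_less_1 abs_less_iff)
      have "(x,y) \<in> B \<longleftrightarrow> sqrt (1 - z\<^sup>2) < y" for y
      proof
        assume "(x,y) \<in> B"
        then have "0 < y" "1 - z\<^sup>2 < y\<^sup>2" using Bz by auto
        then show "sqrt (1 - z\<^sup>2) < y" using z1 by (intro real_less_lsqrt) auto
      next
        assume *: "sqrt (1 - z\<^sup>2) < y"
        moreover have "0 < sqrt (1 - z\<^sup>2)" using z1 by simp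
        ultimately have "y > 0" by linarith
        moreover have "(sqrt (1 - z\<^sup>2))\<^sup>2 < y\<^sup>2" using * z1 by (intro power_strict_mono) auto
        ultimately show "(x,y) \<in> B" using Bz z1 by simp
      qed
      then have "indicator B (x,y) = (indicator {sqrt (1 - z\<^sup>2)<..} y :: ennreal)" for y
        by (simp split: split_indicator)
      then show ?thesis using z1 by (simp add: nn_integral_height u_def)
    qed
    have "x < 0 \<or> (0 < x \<and> x < 1) \<or> (1 < x \<and> x < 2) \<or> 2 \<le> x" using that by linarith
    then consider "x < 0" | "0 < x" "x < 1" | "1 < x" "x < 2" | "2 \<le> x" by blast
    then show ?thesis
    proof cases
      case 2
      have "(x,y) \<in> B \<longleftrightarrow> 0 < y \<and> 1 < x\<^sup>2 + y\<^sup>2" for y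
      proof -
        have "x\<^sup>2 \<le> (x - 2)\<^sup>2" using 2 by (simp add: power2_eq_square algebra_simps)
        then show ?thesis using 2 by (auto simp: B_def)
      qed
      then show ?thesis using gen[of x] 2 by simp
    next
      case 3
      have "(x,y) \<in> B \<longleftrightarrow> 0 < y \<and> 1 < (x-2)\<^sup>2 + y\<^sup>2" for y
      proof -
        have "(x - 2)\<^sup>2 \<le> x\<^sup>2" using 3 by (simp add: power2_eq_square algebra_simps)
        then show ?thesis using 3 by (auto simp: B_def)
      qed
      then show ?thesis using gen[of "x-2"] 3 by simp
    qed (simp_all add: B_def)
  qed
  have "emeasure hyp_measure hyp_region = (\<integral>\<^sup>+z. (case z of (x,y,p) \<Rightarrow> 1) \<partial>hyp_measure)"
    by (simp add: space_hyp_measure split_def)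
  also have "\<dots> = (\<integral>\<^sup>+p. \<integral>\<^sup>+y. \<integral>\<^sup>+x. ennreal (1/y\<^sup>2) * 1 * indicator hyp_region (x,y,p) \<partial>lborel \<partial>lborel \<partial>lborel)"
    by (rule nn_integral_hyp_measure) (simp add: split_def)
  also have "\<dots> = (\<integral>\<^sup>+p. (\<integral>\<^sup>+y. \<integral>\<^sup>+x. ennreal (1/y\<^sup>2) * indicator B (x,y) \<partial>lborel \<partial>lborel) * indicator {0..<pi} p \<partial>lborel)"
  proof (rule nn_integral_cong)
    fix p :: real
    have "indicator hyp_region (x,y,p) = (indicator B (x,y) * indicator {0..<pi} p :: ennreal)" for x y
      by (auto simp: hyp_region_def theta_domain_iff B_def split: split_indicator)
    then show "(\<integral>\<^sup>+y. \<integral>\<^sup>+x. ennreal (1/y\<^sup>2) * 1 * indicator hyp_region (x,y,p) \<partial>lborel \<partial>lborel) =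
       (\<integral>\<^sup>+y. \<integral>\<^sup>+x. ennreal (1/y\<^sup>2) * indicator B (x,y) \<partial>lborel \<partial>lborel) * indicator {0..<pi} p"
      by (cases "p \<in> {0..<pi}") simp_all
  qed
  also have "\<dots> = (\<integral>\<^sup>+y. \<integral>\<^sup>+x. ennreal (1/y\<^sup>2) * indicator B (x,y) \<partial>lborel \<partial>lborel) * ennreal pi"
    by (simp add: nn_integral_cmult_indicator)
  also have "(\<integral>\<^sup>+y. \<integral>\<^sup>+x. ennreal (1/y\<^sup>2) * indicator B (x,y) \<partial>lborel \<partial>lborel)
    = (\<integral>\<^sup>+x. \<integral>\<^sup>+y. ennreal (1/y\<^sup>2) * indicator B (x,y) \<partial>lborel \<partial>lborel)"
    by (rule nn_integral_lborel_swap) measurable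
  also have "\<dots> = (\<integral>\<^sup>+x. u x * indicator {0<..<1} x + u (x - 2) * indicator {-1<..<0} (x - 2) \<partial>lborel)"
    by (intro nn_integral_cong_AE, use AE_lborel_neq[of 0] AE_lborel_neq[of 1] in eventually_elim) (rule A)
  also have "\<dots> = (\<integral>\<^sup>+x. u x * indicator {0<..<1} x \<partial>lborel) + (\<integral>\<^sup>+x. u (x - 2) * indicator {-1<..<0} (x - 2) \<partial>lborel)"
    by (rule nn_integral_add) measurable
  also have "(\<integral>\<^sup>+x. u (x - 2) * indicator {-1<..<0} (x - 2) \<partial>lborel) = (\<integral>\<^sup>+x. u x * indicator {-1<..<0} x \<partial>lborel)"
    using nn_integral_translate[of "\<lambda>x. u x * indicator {-1<..<0} x" "-2"] by simp
  also have "(\<integral>\<^sup>+x. u x * indicator {0<..<1} x \<partial>lborel) + (\<integral>\<^sup>+x. u x * indicator {-1<..<0} x \<partial>lborel)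
    = (\<integral>\<^sup>+x. u x * indicator {0<..<1} x + u x * indicator {-1<..<0} x \<partial>lborel)"
    by (rule nn_integral_add[symmetric]) measurable
  also have "\<dots> = (\<integral>\<^sup>+x. u x * indicator {-1<..<1} x \<partial>lborel)"
    by (intro nn_integral_cong_AE, use AE_lborel_neq[of 0] in eventually_elim) (auto split: split_indicator)
  also have "\<dots> = ennreal pi"
    unfolding u_def by (rule nn_integral_arcsin)
  finally show ?thesis by (simp add: ennreal_mult' power2_eq_square)
qed

lemma emeasure_FD: "emeasure haar FD = ennreal (pi\<^sup>2 / 2)"
proof -
  have "2 * emeasure haar FD = 2 * (\<integral>\<^sup>+M. indicator FD M * 1 \<partial>haar)"
    using FD_measurable by simp
  also have "\<dots> = (\<integral>\<^sup>+(x,y,p). 1 \<partial>hyp_measure)"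
    by (rule FD_iwasawa[symmetric]) simp
  also have "\<dots> = ennreal (pi\<^sup>2)"
    by (simp add: split_def space_hyp_measure emeasure_hyp_measure)
  finally have "2 * emeasure haar FD = ennreal (pi\<^sup>2)" .
  moreover have "emeasure haar FD = ennreal (1/2) * (2 * emeasure haar FD)"
  proof -
    have "ennreal (1/2) * 2 = 1" using ennreal_mult'[of "1/2" 2] by simp
    then show ?thesis by (simp only: mult.assoc[symmetric] mult_1)
  qed
  ultimately have "emeasure haar FD = ennreal (1/2) * ennreal (pi\<^sup>2)" by (simp only:)
  also have "\<dots> = ennreal (1/2 * pi\<^sup>2)" by (rule ennreal_mult[symmetric]) auto
  finally show ?thesis by (simp only: times_divide_eq_left mult_1)
qed

subsection \<open>Functions on the finite covers of the modular quotient\<close>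

text \<open>A density instead of a restriction: the underlying space remains \<open>SL\<close>, and
  functions on the group can be integrated as they are.\<close>

definition fdm :: "(real^2^2) measure" where "fdm = density haar (indicator FD)"

lemma space_fdm [simp]: "space fdm = SL" and sets_fdm [simp, measurable_cong]: "sets fdm = sets SLb"
  by (simp_all add: fdm_def)

lemma measurable_fdm_iff [simp]: "f \<in> measurable fdm N \<longleftrightarrow> f \<in> measurable SLb N"
  by (simp only: measurable_cong_sets[OF sets_fdm refl])

lemma nn_integral_fdm:
  assumes [measurable]: "f \<in> borel_measurable SLb"
  shows "(\<integral>\<^sup>+M. f M \<partial>fdm) = (\<integral>\<^sup>+M. indicator FD M * f M \<partial>haar)"
  unfolding fdm_def by (rule nn_integral_density) simp_all

lemma emeasure_fdm: "emeasure fdm (space fdm) = ennreal (pi\<^sup>2 / 2)"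
proof -
  have "emeasure fdm (space fdm) = (\<integral>\<^sup>+M. 1 \<partial>fdm)" by simp
  also have "\<dots> = (\<integral>\<^sup>+M. indicator FD M \<partial>haar)" by (subst nn_integral_fdm) auto
  also have "\<dots> = ennreal (pi\<^sup>2 / 2)" using FD_measurable by (simp add: emeasure_FD)
  finally show ?thesis .
qed

interpretation fdm: finite_measure fdm
  by (rule finite_measureI) (simp only: emeasure_fdm, simp)

lemma measure_fdm: "measure fdm SL = pi\<^sup>2 / 2"
  using emeasure_fdm by (simp add: measure_def)

text \<open>Lifts of bounded functions on the quotient that are uniformly continuous under right translation by
  \<open>SL(2,R)\<close>.\<close>

definition good :: "(real^2^2 \<Rightarrow> real^2 \<Rightarrow> real) \<Rightarrow> bool" where
  "good f \<longleftrightarrow> (\<forall>M\<in>SL. \<forall>\<xi>. \<forall>G\<in>Gamma_theta. \<forall>n\<in>Int_lattice. f (G ** M) (G *v \<xi> + n) = f M \<xi>) \<and>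
     (\<exists>B. \<forall>M\<in>SL. \<forall>\<xi>. \<bar>f M \<xi>\<bar> \<le> B) \<and>
     (\<forall>e>0. \<exists>d>0. \<forall>M\<in>SL. \<forall>\<xi>. \<forall>h\<in>SL. norm (h - mat 1) < d \<longrightarrow> \<bar>f (M ** h) \<xi> - f M \<xi>\<bar> < e)"

lemma goodI:
  assumes "\<And>M \<xi> G n. M \<in> SL \<Longrightarrow> G \<in> Gamma_theta \<Longrightarrow> n \<in> Int_lattice \<Longrightarrow> f (G ** M) (G *v \<xi> + n) = f M \<xi>"
    and "\<And>M \<xi>. M \<in> SL \<Longrightarrow> \<bar>f M \<xi>\<bar> \<le> B"
    and "\<And>e. e > 0 \<Longrightarrow> \<exists>d>0. \<forall>M\<in>SL. \<forall>\<xi>. \<forall>h\<in>SL. norm (h - mat 1) < d \<longrightarrow> \<bar>f (M ** h) \<xi> - f M \<xi>\<bar> < e"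
  shows "good f"
  unfolding good_def using assms by blast

lemma good_inv: "good f \<Longrightarrow> M \<in> SL \<Longrightarrow> G \<in> Gamma_theta \<Longrightarrow> n \<in> Int_lattice \<Longrightarrow> f (G ** M) (G *v \<xi> + n) = f M \<xi>"
  unfolding good_def by blast

lemma good_bound:
  assumes "good f" obtains B where "B > 0" "\<And>M \<xi>. M \<in> SL \<Longrightarrow> \<bar>f M \<xi>\<bar> \<le> B"
proof -
  obtain B where B: "\<And>M \<xi>. M \<in> SL \<Longrightarrow> \<bar>f M \<xi>\<bar> \<le> B" using assms unfolding good_def by blast
  show ?thesis
  proof (rule that[of "max B 1"])
    fix M \<xi> assume "M \<in> SL"
    then show "\<bar>f M \<xi>\<bar> \<le> max B 1" using B[of M \<xi>] by simp
  qed simp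
qed

lemma good_ucont:
  assumes "good f" "e > 0"
  obtains d where "d > 0" "\<And>M \<xi> h. M \<in> SL \<Longrightarrow> h \<in> SL \<Longrightarrow> norm (h - mat 1) < d \<Longrightarrow> \<bar>f (M ** h) \<xi> - f M \<xi>\<bar> < e"
  using assms unfolding good_def by blast

lemma good_const: "good (\<lambda>M \<xi>. c)"
  by (rule goodI[of _ "\<bar>c\<bar>"]) (auto intro: exI[of _ 1])

lemma good_add: assumes "good f" "good g" shows "good (\<lambda>M \<xi>. f M \<xi> + g M \<xi>)"
proof -
  obtain B C where B: "\<And>M \<xi>. M \<in> SL \<Longrightarrow> \<bar>f M \<xi>\<bar> \<le> B" and C: "\<And>M \<xi>. M \<in> SL \<Longrightarrow> \<bar>g M \<xi>\<bar> \<le> C"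
    using good_bound assms by metis
  show ?thesis
  proof (rule goodI[of _ "B + C"])
    fix M :: "real^2^2" and \<xi> :: "real^2" assume M: "M \<in> SL"
    show "\<bar>f M \<xi> + g M \<xi>\<bar> \<le> B + C" using B[OF M, of \<xi>] C[OF M, of \<xi>] by linarith
    fix G and n :: "real^2" assume "G \<in> Gamma_theta" "n \<in> Int_lattice"
    then show "f (G ** M) (G *v \<xi> + n) + g (G ** M) (G *v \<xi> + n) = f M \<xi> + g M \<xi>"
      by (simp add: good_inv[OF assms(1) M] good_inv[OF assms(2) M])
  next
    fix e :: real assume "e > 0"
    then have e: "e/2 > 0" by simp
    obtain d1 where d1: "d1 > 0" "\<And>M \<xi> h. M \<in> SL \<Longrightarrow> h \<in> SL \<Longrightarrow> norm (h - mat 1) < d1 \<Longrightarrow> \<bar>f (M ** h) \<xi> - f M \<xi>\<bar> < e/2"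
      using good_ucont[OF assms(1) e] by blast
    obtain d2 where d2: "d2 > 0" "\<And>M \<xi> h. M \<in> SL \<Longrightarrow> h \<in> SL \<Longrightarrow> norm (h - mat 1) < d2 \<Longrightarrow> \<bar>g (M ** h) \<xi> - g M \<xi>\<bar> < e/2"
      using good_ucont[OF assms(2) e] by blast
    show "\<exists>d>0. \<forall>M\<in>SL. \<forall>\<xi>. \<forall>h\<in>SL. norm (h - mat 1) < d \<longrightarrow> \<bar>(f (M ** h) \<xi> + g (M ** h) \<xi>) - (f M \<xi> + g M \<xi>)\<bar> < e"
    proof (intro exI[of _ "min d1 d2"] conjI ballI allI impI)
      fix M \<xi> h assume *: "M \<in> SL" "h \<in> SL" "norm (h - mat 1) < min d1 d2"
      then show "\<bar>(f (M ** h) \<xi> + g (M ** h) \<xi>) - (f M \<xi> + g M \<xi>)\<bar> < e"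
        using d1(2)[of M h \<xi>] d2(2)[of M h \<xi>] by linarith
    qed (use d1 d2 in simp)
  qed
qed

lemma good_mult: assumes "good f" "good g" shows "good (\<lambda>M \<xi>. f M \<xi> * g M \<xi>)"
proof -
  obtain B where B: "B > 0" "\<And>M \<xi>. M \<in> SL \<Longrightarrow> \<bar>f M \<xi>\<bar> \<le> B" using good_bound[OF assms(1)] by metis
  obtain C where C: "C > 0" "\<And>M \<xi>. M \<in> SL \<Longrightarrow> \<bar>g M \<xi>\<bar> \<le> C" using good_bound[OF assms(2)] by metis
  show ?thesis
  proof (rule goodI[of _ "B * C"])
    fix M :: "real^2^2" and \<xi> :: "real^2" assume M: "M \<in> SL"
    show "\<bar>f M \<xi> * g M \<xi>\<bar> \<le> B * C" using B(2)[OF M, of \<xi>] C(2)[OF M, of \<xi>] B(1) by (simp add: abs_mult mult_mono)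
    fix G and n :: "real^2" assume "G \<in> Gamma_theta" "n \<in> Int_lattice"
    then show "f (G ** M) (G *v \<xi> + n) * g (G ** M) (G *v \<xi> + n) = f M \<xi> * g M \<xi>"
      by (simp add: good_inv[OF assms(1) M] good_inv[OF assms(2) M])
  next
    fix e :: real assume e: "e > 0"
    obtain d1 where d1: "d1 > 0" "\<And>M \<xi> h. M \<in> SL \<Longrightarrow> h \<in> SL \<Longrightarrow> norm (h - mat 1) < d1 \<Longrightarrow> \<bar>f (M ** h) \<xi> - f M \<xi>\<bar> < e/(2*C)"
      using good_ucont[OF assms(1), of "e/(2*C)"] e C(1) by auto
    obtain d2 where d2: "d2 > 0" "\<And>M \<xi> h. M \<in> SL \<Longrightarrow> h \<in> SL \<Longrightarrow> norm (h - mat 1) < d2 \<Longrightarrow> \<bar>g (M ** h) \<xi> - g M \<xi>\<bar> < e/(2*B)"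
      using good_ucont[OF assms(2), of "e/(2*B)"] e B(1) by auto
    show "\<exists>d>0. \<forall>M\<in>SL. \<forall>\<xi>. \<forall>h\<in>SL. norm (h - mat 1) < d \<longrightarrow> \<bar>f (M ** h) \<xi> * g (M ** h) \<xi> - f M \<xi> * g M \<xi>\<bar> < e"
    proof (intro exI[of _ "min d1 d2"] conjI ballI allI impI)
      fix M \<xi> h assume *: "M \<in> SL" "h \<in> SL" "norm (h - mat 1) < min d1 d2"
      have "f (M ** h) \<xi> * g (M ** h) \<xi> - f M \<xi> * g M \<xi> = (f (M ** h) \<xi> - f M \<xi>) * g (M ** h) \<xi> + f M \<xi> * (g (M ** h) \<xi> - g M \<xi>)"
        by (simp add: algebra_simps)
      also have "\<bar>\<dots>\<bar> \<le> \<bar>f (M ** h) \<xi> - f M \<xi>\<bar> * \<bar>g (M ** h) \<xi>\<bar> + \<bar>f M \<xi>\<bar> * \<bar>g (M ** h) \<xi> - g M \<xi>\<bar>"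
        by (metis abs_mult abs_triangle_ineq)
      also have "\<dots> \<le> \<bar>f (M ** h) \<xi> - f M \<xi>\<bar> * C + B * \<bar>g (M ** h) \<xi> - g M \<xi>\<bar>"
        using * B C by (intro add_mono mult_left_mono mult_right_mono) auto
      also have "\<dots> < e/(2*C) * C + B * (e/(2*B))"
        using * B(1) C(1) d1(2)[of M h \<xi>] d2(2)[of M h \<xi>]
        by (intro add_strict_mono mult_strict_left_mono mult_strict_right_mono) auto
      also have "\<dots> = e" using B(1) C(1) by simp
      finally show "\<bar>f (M ** h) \<xi> * g (M ** h) \<xi> - f M \<xi> * g M \<xi>\<bar> < e" .
    qed (use d1 d2 in simp)
  qed
qed

lemma good_cmult: "good f \<Longrightarrow> good (\<lambda>M \<xi>. c * f M \<xi>)"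
  using good_mult[OF good_const] .

lemma good_diff: assumes "good f" "good g" shows "good (\<lambda>M \<xi>. f M \<xi> - g M \<xi>)"
  using good_add[OF assms(1) good_cmult[OF assms(2), of "-1"]] by simp

lemma good_power2: "good f \<Longrightarrow> good (\<lambda>M \<xi>. (f M \<xi>)\<^sup>2)"
  using good_mult[of f f] by (simp add: power2_eq_square)

lemma conj_near_one:
  assumes g: "g \<in> SL" and d: "d > 0"
  shows "\<exists>d'>0. \<forall>h\<in>SL. norm (h - mat 1) < d' \<longrightarrow> norm (adj g ** h ** g - mat 1) < d"
proof -
  have "continuous_on UNIV (\<lambda>h. adj g ** h ** g)" by (intro continuous_intros)
  then have "\<exists>d'>0. \<forall>h\<in>UNIV. dist h (mat 1) < d' \<longrightarrow> dist (adj g ** h ** g) (adj g ** mat 1 ** g) < d"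
    using d unfolding continuous_on_iff by blast
  moreover have "adj g ** mat 1 ** g = mat 1" using g by simp
  ultimately show ?thesis by (auto simp: dist_norm)
qed

text \<open>\<open>M ** h ** g = (M ** g) ** (adj g ** h ** g)\<close>: the perturbation gets
  conjugated by the fixed \<open>g\<close>, and conjugation is continuous at the identity.\<close>

lemma good_translate:
  assumes f: "good f" and g: "g \<in> SL" shows "good (\<lambda>M \<xi>. f (M ** g) \<xi>)"
proof -
  obtain B where B: "\<And>M \<xi>. M \<in> SL \<Longrightarrow> \<bar>f M \<xi>\<bar> \<le> B" using good_bound[OF f] by metis
  show ?thesis
  proof (rule goodI[of _ B])
    fix M :: "real^2^2" and \<xi> :: "real^2" assume M: "M \<in> SL"
    then show "\<bar>f (M ** g) \<xi>\<bar> \<le> B" using B g by simp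
    fix G and n :: "real^2" assume "G \<in> Gamma_theta" "n \<in> Int_lattice"
    then show "f (G ** M ** g) (G *v \<xi> + n) = f (M ** g) \<xi>"
      using good_inv[OF f, of "M ** g" G n \<xi>] M g by (simp add: matrix_mul_assoc)
  next
    fix e :: real assume e: "e > 0"
    obtain d where d: "d > 0" "\<And>M \<xi> h. M \<in> SL \<Longrightarrow> h \<in> SL \<Longrightarrow> norm (h - mat 1) < d \<Longrightarrow> \<bar>f (M ** h) \<xi> - f M \<xi>\<bar> < e"
      using good_ucont[OF f e] by blast
    obtain d' where d': "d' > 0" "\<And>h. h \<in> SL \<Longrightarrow> norm (h - mat 1) < d' \<Longrightarrow> norm (adj g ** h ** g - mat 1) < d"
      using conj_near_one[OF g d(1)] by blast
    show "\<exists>d>0. \<forall>M\<in>SL. \<forall>\<xi>. \<forall>h\<in>SL. norm (h - mat 1) < d \<longrightarrow> \<bar>f (M ** h ** g) \<xi> - f (M ** g) \<xi>\<bar> < e"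
    proof (intro exI[of _ d'] conjI ballI allI impI)
      fix M \<xi> h assume *: "M \<in> SL" "h \<in> SL" "norm (h - mat 1) < d'"
      have "M ** h ** g = (M ** g) ** (adj g ** h ** g)"
        using g by (simp add: matrix_mul_assoc[symmetric])
      then show "\<bar>f (M ** h ** g) \<xi> - f (M ** g) \<xi>\<bar> < e"
        using d(2)[of "M ** g" "adj g ** h ** g" \<xi>] d'(2)[of h] * g by simp
    qed (rule d'(1))
  qed
qed

lemma good_continuous:
  assumes f: "good f" shows "continuous_on SL (\<lambda>M. f M \<xi>)"
  unfolding continuous_on_iff
proof (intro ballI allI impI)
  fix M e assume M: "M \<in> SL" and e: "(0::real) < e"
  obtain d where d: "d > 0" "\<And>M \<xi> h. M \<in> SL \<Longrightarrow> h \<in> SL \<Longrightarrow> norm (h - mat 1) < d \<Longrightarrow> \<bar>f (M ** h) \<xi> - f M \<xi>\<bar> < e"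
    using good_ucont[OF f e] by blast
  have "continuous_on UNIV (\<lambda>M'::real^2^2. adj M ** M')"
    by (rule continuous_on_mmult[OF continuous_on_const continuous_on_id])
  then obtain d' where d': "d' > 0" "\<And>M'. dist M' M < d' \<Longrightarrow> dist (adj M ** M') (adj M ** M) < d"
    using d unfolding continuous_on_iff by blast
  show "\<exists>d>0. \<forall>M'\<in>SL. dist M' M < d \<longrightarrow> dist (f M' \<xi>) (f M \<xi>) < e"
  proof (intro exI[of _ d'] conjI ballI impI)
    fix M' assume *: "M' \<in> SL" "dist M' M < d'"
    have "norm (adj M ** M' - mat 1) < d" using d'(2)[OF *(2)] M by (simp add: dist_norm)
    then show "dist (f M' \<xi>) (f M \<xi>) < e"
      using d(2)[OF M, of "adj M ** M'" \<xi>] M * by (simp add: dist_real_def)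
  qed (rule d'(1))
qed

lemma good_measurable [measurable]: "good f \<Longrightarrow> (\<lambda>M. f M \<xi>) \<in> borel_measurable SLb"
  by (rule borel_measurable_continuous_on_restrict[OF good_continuous])

lemma good_integrable:
  assumes f: "good f" shows "integrable fdm (\<lambda>M. f M \<xi>)"
proof -
  obtain B where B: "\<And>M \<xi>. M \<in> SL \<Longrightarrow> \<bar>f M \<xi>\<bar> \<le> B" using good_bound[OF f] by metis
  show ?thesis
    by (rule fdm.integrable_const_bound[of _ B]) (use B f good_measurable in auto)
qed

section \<open>The finite orbit and the invariant integral over its copies of the quotient\<close>

lemma Int_lattice_zero [simp]: "0 \<in> Int_lattice" by (simp add: Int_lattice_def)
lemma Int_lattice_add: "a \<in> Int_lattice \<Longrightarrow> b \<in> Int_lattice \<Longrightarrow> a + b \<in> Int_lattice" by (simp add: Int_lattice_def)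
lemma Int_lattice_minus: "a \<in> Int_lattice \<Longrightarrow> - a \<in> Int_lattice" by (simp add: Int_lattice_def)
lemma Int_lattice_diff: "a \<in> Int_lattice \<Longrightarrow> b \<in> Int_lattice \<Longrightarrow> a - b \<in> Int_lattice" by (simp add: Int_lattice_def)
lemma Int_lattice_theta: "G \<in> Gamma_theta \<Longrightarrow> a \<in> Int_lattice \<Longrightarrow> G *v a \<in> Int_lattice"
  by (auto simp: Int_lattice_def matrix_vector_mult_def intro!: Ints_sum Ints_mult Gamma_theta_Ints)

text \<open>Points of \<open>S\<close> stand for classes modulo the integer lattice, so the action
  and its transitivity are formulated up to \<open>Int_lattice\<close>. Transitivity is what permits
  mixing: if \<open>S\<close> split into smaller orbits, the indicator of one of them would be
  invariant under right translation.\<close>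

locale torus_orbit_set =
  fixes S :: "(real^2) set"
  assumes finS: "finite S" and neS: "S \<noteq> {}"
    and act: "\<And>G p. G \<in> Gamma_theta \<Longrightarrow> p \<in> S \<Longrightarrow> \<exists>q\<in>S. G *v p - q \<in> Int_lattice"
    and reps: "\<And>p q. p \<in> S \<Longrightarrow> q \<in> S \<Longrightarrow> p - q \<in> Int_lattice \<Longrightarrow> p = q"
    and trans: "\<And>p q. p \<in> S \<Longrightarrow> q \<in> S \<Longrightarrow> \<exists>G\<in>Gamma_theta. G *v p - q \<in> Int_lattice"
begin

definition J :: "(real^2^2 \<Rightarrow> real^2 \<Rightarrow> real) \<Rightarrow> real" where
  "J f = (\<Sum>p\<in>S. \<integral>M. f M p \<partial>fdm)"

definition T :: real where "T = real (card S) * (pi\<^sup>2 / 2)"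

lemma T_pos: "T > 0"
  using finS neS by (simp add: T_def card_gt_0_iff)

lemma J_const: "J (\<lambda>M \<xi>. c) = c * T"
  by (simp add: J_def T_def measure_fdm)

lemma J_add: "good f \<Longrightarrow> good g \<Longrightarrow> J (\<lambda>M \<xi>. f M \<xi> + g M \<xi>) = J f + J g"
  by (simp add: J_def good_integrable sum.distrib)

lemma J_diff: "good f \<Longrightarrow> good g \<Longrightarrow> J (\<lambda>M \<xi>. f M \<xi> - g M \<xi>) = J f - J g"
  by (simp add: J_def good_integrable sum_subtractf)

lemma J_cmult: "J (\<lambda>M \<xi>. c * f M \<xi>) = c * J f"
  by (simp add: J_def sum_distrib_left)

lemma J_mono: "good f \<Longrightarrow> good g \<Longrightarrow> (\<And>M \<xi>. M \<in> SL \<Longrightarrow> f M \<xi> \<le> g M \<xi>) \<Longrightarrow> J f \<le> J g"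
  unfolding J_def by (intro sum_mono integral_mono good_integrable) auto

lemma J_nonneg: "(\<And>M \<xi>. M \<in> SL \<Longrightarrow> 0 \<le> f M \<xi>) \<Longrightarrow> 0 \<le> J f"
  unfolding J_def by (intro sum_nonneg integral_nonneg_AE) auto

lemma J_cong: "(\<And>M \<xi>. M \<in> SL \<Longrightarrow> f M \<xi> = g M \<xi>) \<Longrightarrow> J f = J g"
  unfolding J_def by (intro sum.cong Bochner_Integration.integral_cong refl) auto

lemma J_abs_le:
  assumes f: "good f" and B: "\<And>M \<xi>. M \<in> SL \<Longrightarrow> \<bar>f M \<xi>\<bar> \<le> B"
  shows "\<bar>J f\<bar> \<le> B * T"
proof -
  have "f M \<xi> \<le> B" "- B \<le> f M \<xi>" if "M \<in> SL" for M \<xi> using B[OF that, of \<xi>] by linarith+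
  then have "J f \<le> J (\<lambda>M \<xi>. B)" "J (\<lambda>M \<xi>. - B) \<le> J f"
    by (auto intro!: J_mono f good_const)
  then show ?thesis by (simp add: J_const abs_le_iff)
qed

text \<open>\<open>G\<close> carries the class of \<open>p\<close> to that of some
  \<open>q p\<close> in \<open>S\<close>, and \<open>f (G ** M) (q p) = f M p\<close>. Inequivalent
  points stay inequivalent, so \<open>q\<close> is a permutation of \<open>S\<close>.\<close>

lemma sum_orbit_invariant:
  assumes f: "good f" and M: "M \<in> SL" and G: "G \<in> Gamma_theta"
  shows "(\<Sum>p\<in>S. f (G ** M) p) = (\<Sum>p\<in>S. f M p)"
proof -
  obtain q where q: "\<And>p. p \<in> S \<Longrightarrow> q p \<in> S" "\<And>p. p \<in> S \<Longrightarrow> G *v p - q p \<in> Int_lattice"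
    using act[OF G] by metis
  have inj: "inj_on q S"
  proof (rule inj_onI)
    fix p p' assume *: "p \<in> S" "p' \<in> S" "q p = q p'"
    have "(G *v p - q p) - (G *v p' - q p') \<in> Int_lattice"
      by (rule Int_lattice_diff; use q * in blast)
    then have "G *v (p - p') \<in> Int_lattice" using * by (simp add: matrix_vector_mult_diff_distrib)
    then have "adj G *v (G *v (p - p')) \<in> Int_lattice" by (rule Int_lattice_theta[OF theta_adj[OF G]])
    then have "p - p' \<in> Int_lattice"
      by (simp only: matrix_vector_mul_assoc adj_mult[OF theta_SL[OF G]] matrix_vector_mul_lid)
    then show "p = p'" using reps * by blast
  qed
  have img: "q ` S = S"
    using finS inj q(1) by (intro card_subset_eq) (auto simp: card_image)
  have "(\<Sum>p\<in>S. f (G ** M) p) = (\<Sum>p\<in>q ` S. f (G ** M) p)" by (simp add: img)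
  also have "\<dots> = (\<Sum>p\<in>S. f (G ** M) (q p))" using inj by (simp add: sum.reindex)
  also have "\<dots> = (\<Sum>p\<in>S. f M p)"
  proof (rule sum.cong[OF refl])
    fix p assume p: "p \<in> S"
    have "f (G ** M) (G *v p + - (G *v p - q p)) = f M p"
      using q(2)[OF p] by (intro good_inv f M G Int_lattice_minus)
    then show "f (G ** M) (q p) = f M p" by simp
  qed
  finally show ?thesis .
qed

text \<open>The sum over \<open>S\<close> is invariant under \<open>Gamma_theta\<close> while its
  single terms are only permuted, so the change of fundamental domain is applied to the sum, after
  adding \<open>B\<close> to make it nonnegative.\<close>

lemma J_translate:
  assumes f: "good f" and g: "g \<in> SL"
  shows "J (\<lambda>M \<xi>. f (M ** g) \<xi>) = J f"
proof -
  obtain B where B: "\<And>M \<xi>. M \<in> SL \<Longrightarrow> \<bar>f M \<xi>\<bar> \<le> B" using good_bound[OF f] by metis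
  define F where "F M = (\<Sum>p\<in>S. f M p + B)" for M
  have [measurable]: "F \<in> borel_measurable SLb" unfolding F_def using good_measurable[OF f] by measurable
  have fB: "0 \<le> f M p + B" if "M \<in> SL" for M p using B[OF that, of p] by linarith
  have F0: "0 \<le> F M" if "M \<in> SL" for M
    unfolding F_def using fB[OF that] by (intro sum_nonneg) auto
  have Finv: "F (G ** M) = F M" if "G \<in> Gamma_theta" "M \<in> SL" for G M
    using sum_orbit_invariant[OF f that(2,1)] by (simp add: F_def sum.distrib)
  have [measurable]: "(\<lambda>M. F (M ** g)) \<in> borel_measurable SLb" using g by measurable
  have int: "(\<integral>M. F (M ** g) \<partial>fdm) = (\<integral>M. F M \<partial>fdm)"
  proof -
    have "(\<integral>\<^sup>+M. ennreal (F (M ** g)) \<partial>fdm) = (\<integral>\<^sup>+M. ennreal (F M) \<partial>fdm)"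
      using FD_right_invariant[OF _ g, of "\<lambda>M. ennreal (F M)"] Finv by (simp add: nn_integral_fdm)
    moreover have "(\<integral>M. F (M ** g) \<partial>fdm) = enn2real (\<integral>\<^sup>+M. ennreal (F (M ** g)) \<partial>fdm)"
      by (rule integral_eq_nn_integral) (use F0 g in auto)
    moreover have "(\<integral>M. F M \<partial>fdm) = enn2real (\<integral>\<^sup>+M. ennreal (F M) \<partial>fdm)"
      by (rule integral_eq_nn_integral) (use F0 in auto)
    ultimately show ?thesis by simp
  qed
  have i: "integrable fdm (\<lambda>M. f M p)" "integrable fdm (\<lambda>M. f (M ** g) p)" for p
    using good_integrable[OF f] good_integrable[OF good_translate[OF f g]] by auto
  have "(\<integral>M. F (M ** g) \<partial>fdm) = J (\<lambda>M \<xi>. f (M ** g) \<xi>) + B * T"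
    unfolding F_def J_def T_def using i by (simp add: sum.distrib measure_fdm)
  moreover have "(\<integral>M. F M \<partial>fdm) = J f + B * T"
    unfolding F_def J_def T_def using i by (simp add: sum.distrib measure_fdm)
  ultimately show ?thesis using int by simp
qed

definition Q :: "(real^2^2 \<Rightarrow> real^2 \<Rightarrow> real) \<Rightarrow> real^2^2 \<Rightarrow> real" where
  "Q w g = J (\<lambda>M \<xi>. (w (M ** g) \<xi> - w M \<xi>)\<^sup>2)"

lemma Q_good: "good w \<Longrightarrow> g \<in> SL \<Longrightarrow> good (\<lambda>M \<xi>. (w (M ** g) \<xi> - w M \<xi>)\<^sup>2)"
  by (intro good_power2 good_diff good_translate)

text \<open>The displacement from \<open>M\<close> to \<open>M ** g ** h\<close> is split at
  \<open>M ** g\<close>. The square of the sum costs the factor 2, and invariance of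
  \<open>J\<close> removes the translation by \<open>g\<close> from the first part.\<close>

lemma Q_mult:
  assumes w: "good w" and g: "g \<in> SL" "h \<in> SL"
  shows "Q w (g ** h) \<le> 2 * Q w g + 2 * Q w h"
proof -
  have "Q w (g ** h) \<le> J (\<lambda>M \<xi>. 2 * (w (M ** g ** h) \<xi> - w (M ** g) \<xi>)\<^sup>2 + 2 * (w (M ** g) \<xi> - w M \<xi>)\<^sup>2)"
    unfolding Q_def
  proof (rule J_mono)
    show "good (\<lambda>M \<xi>. (w (M ** (g ** h)) \<xi> - w M \<xi>)\<^sup>2)" by (intro Q_good w SL_mult g)
    show "good (\<lambda>M \<xi>. 2 * (w (M ** g ** h) \<xi> - w (M ** g) \<xi>)\<^sup>2 + 2 * (w (M ** g) \<xi> - w M \<xi>)\<^sup>2)"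
      using good_translate[OF Q_good[OF w g(2)] g(1)] by (intro good_add good_cmult Q_good w g)
    fix M :: "real^2^2" and \<xi> :: "real^2"
    have "(a + b)\<^sup>2 \<le> 2 * a\<^sup>2 + 2 * b\<^sup>2" for a b :: real
      using zero_le_power2[of "a - b"] by (simp add: power2_eq_square algebra_simps)
    from this[of "w (M ** g ** h) \<xi> - w (M ** g) \<xi>" "w (M ** g) \<xi> - w M \<xi>"]
    show "(w (M ** (g ** h)) \<xi> - w M \<xi>)\<^sup>2 \<le> 2 * (w (M ** g ** h) \<xi> - w (M ** g) \<xi>)\<^sup>2 + 2 * (w (M ** g) \<xi> - w M \<xi>)\<^sup>2"
      by (simp add: matrix_mul_assoc)
  qed
  also have "\<dots> = 2 * J (\<lambda>M \<xi>. (w (M ** g ** h) \<xi> - w (M ** g) \<xi>)\<^sup>2) + 2 * Q w g"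
    using good_translate[OF Q_good[OF w g(2)] g(1)]
    by (subst J_add) (auto intro!: good_cmult Q_good w g simp: J_cmult Q_def)
  also have "J (\<lambda>M \<xi>. (w (M ** g ** h) \<xi> - w (M ** g) \<xi>)\<^sup>2) = Q w h"
    unfolding Q_def using J_translate[OF Q_good[OF w g(2)] g(1)] .
  finally show ?thesis by simp
qed

lemma Q_continuous:
  assumes w: "good w" and e: "e > 0"
  shows "\<exists>d>0. \<forall>h\<in>SL. norm (h - mat 1) < d \<longrightarrow> Q w h \<le> e"
proof -
  define e' where "e' = sqrt (e / T)"
  have e': "e' > 0" "e'\<^sup>2 * T = e" using e T_pos by (simp_all add: e'_def)
  obtain d where d: "d > 0" "\<And>M \<xi> h. M \<in> SL \<Longrightarrow> h \<in> SL \<Longrightarrow> norm (h - mat 1) < d \<Longrightarrow> \<bar>w (M ** h) \<xi> - w M \<xi>\<bar> < e'"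
    using good_ucont[OF w e'(1)] by blast
  have "Q w h \<le> e" if h: "h \<in> SL" "norm (h - mat 1) < d" for h
  proof -
    have "\<bar>Q w h\<bar> \<le> e'\<^sup>2 * T"
      unfolding Q_def
    proof (rule J_abs_le[OF Q_good[OF w h(1)]])
      fix M \<xi> assume "M \<in> SL"
      then have "\<bar>w (M ** h) \<xi> - w M \<xi>\<bar> \<le> e'" using d(2)[of M h \<xi>] h by simp
      then have "\<bar>w (M ** h) \<xi> - w M \<xi>\<bar>\<^sup>2 \<le> e'\<^sup>2" by (rule power_mono) simp
      then show "\<bar>(w (M ** h) \<xi> - w M \<xi>)\<^sup>2\<bar> \<le> e'\<^sup>2" by simp
    qed
    then show ?thesis using e' by linarith
  qed
  then show ?thesis using d(1) by blast
qed

end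

section \<open>Spreading almost invariance from lower unipotents to the group\<close>

lemma up_near_one: "d > 0 \<Longrightarrow> \<exists>r>0. \<forall>x. \<bar>x\<bar> < r \<longrightarrow> norm (up x - mat 1) < d"
proof -
  assume d: "d > 0"
  have "continuous_on UNIV up" unfolding up_def[abs_def] by (intro continuous_intros)
  then have "\<exists>r>0. \<forall>x\<in>UNIV. dist x 0 < r \<longrightarrow> dist (up x) (up 0) < d"
    using d unfolding continuous_on_iff by blast
  moreover have "up 0 = mat 1" by (simp add: up_def mat_1_mat22)
  ultimately show ?thesis by (simp add: dist_norm)
qed

text \<open>The Mautner phenomenon: \<open>lo s ** up c ** lo s'\<close> is close to the diagonal matrix
  \<open>dg e\<close> for suitable large \<open>s, s'\<close> and small \<open>c\<close>.\<close>

lemma mautner: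
  fixes Q :: "real^2^2 \<Rightarrow> real"
  assumes Qm: "\<And>g h. g \<in> SL \<Longrightarrow> h \<in> SL \<Longrightarrow> Q (g ** h) \<le> 2 * Q g + 2 * Q h"
    and Qc: "\<And>e. e > 0 \<Longrightarrow> \<exists>d>0. \<forall>h\<in>SL. norm (h - mat 1) < d \<longrightarrow> Q h \<le> e"
    and Ql: "\<And>s. Q (lo s) \<le> \<delta>" and g: "g \<in> SL"
  shows "Q g \<le> 448 * \<delta>"
proof -
  have Qup: "\<exists>r>0. \<forall>x. \<bar>x\<bar> < r \<longrightarrow> Q (up x) \<le> e" if e: "e > 0" for e
  proof -
    obtain d where d: "d > 0" "\<And>h. h \<in> SL \<Longrightarrow> norm (h - mat 1) < d \<Longrightarrow> Q h \<le> e" using Qc[OF e] by blast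
    obtain r where "r > 0" "\<And>x. \<bar>x\<bar> < r \<Longrightarrow> norm (up x - mat 1) < d" using up_near_one[OF d(1)] by blast
    then show ?thesis using d(2)[OF up_SL] by blast
  qed
  have Qdg: "Q (dg a) \<le> 10 * \<delta>" if a: "a \<noteq> 0" for a
  proof (rule field_le_epsilon)
    fix e :: real assume e: "e > 0"
    obtain r where r: "r > 0" "\<And>x. \<bar>x\<bar> < r \<Longrightarrow> Q (up x) \<le> e / 12" using Qup[of "e/12"] e by auto
    \<comment> \<open>This makes both \<open>c\<close> and \<open>c * a\<close> smaller than
      \<open>r\<close>, so both upper shears are cheap; \<open>s\<close> and \<open>s'\<close> are
      then solved from the matrix identity for \<open>dg a\<close>.\<close>
    define c where "c = r / (2 * (1 + \<bar>a\<bar>))"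
    have c: "c > 0" "c < r" "\<bar>c * a\<bar> < r"
    proof -
      show "c > 0" using r(1) by (simp add: c_def add_pos_nonneg)
      have "1 + \<bar>a\<bar> \<noteq> 0" by linarith
      then have "c * (1 + \<bar>a\<bar>) = r / 2" by (simp add: c_def divide_simps)
      then have "c + c * \<bar>a\<bar> = r / 2" by (simp add: algebra_simps)
      moreover have "0 \<le> c * \<bar>a\<bar>" using \<open>c > 0\<close> by simp
      moreover have "\<bar>c * a\<bar> = c * \<bar>a\<bar>" using \<open>c > 0\<close> by (simp add: abs_mult)
      ultimately show "c < r" "\<bar>c * a\<bar> < r" using r(1) \<open>c > 0\<close> by linarith+
    qed
    define s where "s = (a - 1) / c"
    define s' where "s' = (1/a - 1) / c"
    have "dg a = lo s ** (up c ** (lo s' ** up (- (c * a))))"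
      using a c(1) by (simp add: dg_def lo_def up_def s_def s'_def mat22_eq_iff divide_simps)
    \<comment> \<open>The four factors carry the weights 2, 4, 8 and 8. The lower shears account for
      \<open>(2 + 8) * \<delta>\<close>, the upper ones for
      \<open>(4 + 8) * (e / 12)\<close>.\<close>
    then have "Q (dg a) \<le> 2 * Q (lo s) + 2 * (2 * Q (up c) + 2 * (2 * Q (lo s') + 2 * Q (up (- (c * a)))))"
      using Qm[of "lo s" "up c ** (lo s' ** up (- (c * a)))"] Qm[of "up c" "lo s' ** up (- (c * a))"] Qm[of "lo s'" "up (- (c * a))"]
      by simp
    moreover have "Q (up c) \<le> e/12" "Q (up (- (c * a))) \<le> e/12" by (rule r(2); use c in simp)+
    moreover have "x \<le> 10 * \<delta> + e" if "x \<le> 2 * p + 2 * (2 * q + 2 * (2 * r + 2 * t))" "p \<le> \<delta>" "q \<le> e/12" "r \<le> \<delta>" "t \<le> e/12" for x p q r t :: real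
      using that by simp
    ultimately show "Q (dg a) \<le> 10 * \<delta> + e" using Ql by blast
  qed
  have Qu: "Q (up x) \<le> 60 * \<delta>" for x
  proof (rule field_le_epsilon)
    fix e :: real assume e: "e > 0"
    obtain r where r: "r > 0" "\<And>x. \<bar>x\<bar> < r \<Longrightarrow> Q (up x) \<le> e / 4" using Qup[of "e/4"] e by auto
    \<comment> \<open>Conjugation by \<open>dg a\<close> rescales an upper shear by
      \<open>a^2\<close>, and this \<open>a\<close> brings any given \<open>x\<close> below
      \<open>r\<close>. The bound is \<open>60 = 2 * 10 + 4 * 10\<close>.\<close>
    define a where "a = sqrt (r / (2 * (1 + \<bar>x\<bar>)))"
    have a: "a > 0" "\<bar>x * a\<^sup>2\<bar> < r"
    proof -
      show "a > 0" using r(1) by (simp add: a_def add_pos_nonneg)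
      have "a\<^sup>2 = r / (2 * (1 + \<bar>x\<bar>))" using r(1) by (simp add: a_def)
      then have "\<bar>x * a\<^sup>2\<bar> = \<bar>x\<bar> / (1 + \<bar>x\<bar>) * (r / 2)" using r(1) by (simp add: abs_mult)
      also have "\<dots> \<le> 1 * (r / 2)" using r(1) by (intro mult_right_mono) (auto simp: divide_simps)
      also have "\<dots> < r" using r(1) by simp
      finally show "\<bar>x * a\<^sup>2\<bar> < r" .
    qed
    have "up x = dg a ** (up (x * a\<^sup>2) ** dg (1/a))"
      using a(1) by (simp add: dg_def up_def mat22_eq_iff power2_eq_square)
    then have "Q (up x) \<le> 2 * Q (dg a) + 2 * (2 * Q (up (x * a\<^sup>2)) + 2 * Q (dg (1/a)))"
      using Qm[of "dg a" "up (x * a\<^sup>2) ** dg (1/a)"] Qm[of "up (x * a\<^sup>2)" "dg (1/a)"] a(1) by simp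
    moreover have "Q (up (x * a\<^sup>2)) \<le> e/4" using a(2) by (rule r(2))
    ultimately show "Q (up x) \<le> 60 * \<delta> + e" using Qdg[of a] Qdg[of "1/a"] a(1) by simp
  qed
  have Qg: "Q g \<le> 164 * \<delta>" if g: "g \<in> SL" "g$2$2 \<noteq> 0" for g
  proof -
    let ?b = "g$1$2" and ?c = "g$2$1" and ?d = "g$2$2"
    \<comment> \<open>A factorisation valid where the lower right entry is nonzero, whence
      \<open>164 = 2 * 60 + 4 * 10 + 4\<close>.\<close>
    have "g = up (?b/?d) ** (dg ?d ** lo (?c/?d))"
      using g by (simp add: up_def dg_def lo_def mat22_eq_iff SL_iff field_simps)
    then have "Q g \<le> 2 * Q (up (?b/?d)) + 2 * (2 * Q (dg ?d) + 2 * Q (lo (?c/?d)))"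
      using Qm[of "up (?b/?d)" "dg ?d ** lo (?c/?d)"] Qm[of "dg ?d" "lo (?c/?d)"] g(2) by simp
    moreover have "x \<le> 164 * \<delta>" if "x \<le> 2 * p + 2 * (2 * q + 2 * r)" "p \<le> 60 * \<delta>" "q \<le> 10 * \<delta>" "r \<le> \<delta>" for x p q r :: real
      using that by simp
    ultimately show ?thesis using Qu Qdg[OF g(2)] Ql by blast
  qed
  \<comment> \<open>An idempotent satisfies \<open>Q (lo 0) \<le> 4 * Q (lo 0)\<close>, so
    \<open>Q (lo 0)\<close> and with it \<open>\<delta>\<close> are nonnegative; only then is 448 a
    weaker constant than 164.\<close>
  have "lo 0 ** lo 0 = lo 0" by (simp add: lo_def)
  then have "Q (lo 0) \<le> 2 * Q (lo 0) + 2 * Q (lo 0)"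
    using Qm[OF lo_SL lo_SL, of 0 0] by (simp only:)
  then have \<delta>: "\<delta> \<ge> 0" using Ql[of 0] by linarith
  show ?thesis
  proof (cases "g$2$2 = 0")
    case True
    then have "g$2$1 \<noteq> 0" using g by (auto simp: SL_iff)
    \<comment> \<open>One more shear makes the lower right entry nonzero, at the total cost
      \<open>2 * 164 + 2 * 60 = 448\<close>.\<close>
    then have "(g ** up 1)$2$2 \<noteq> 0" using True by (simp add: up_def)
    then have "Q (g ** up 1) \<le> 164 * \<delta>" by (intro Qg SL_mult g up_SL)
    moreover have "g = (g ** up 1) ** up (-1)"
      by (simp add: up_def mat22_eq_iff)
    then have "Q g \<le> 2 * Q (g ** up 1) + 2 * Q (up (-1))" using Qm[OF SL_mult[OF g up_SL] up_SL, of 1 "-1"] by simp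
    moreover have "x \<le> 448 * \<delta>" if "x \<le> 2 * p + 2 * q" "p \<le> 164 * \<delta>" "q \<le> 60 * \<delta>" for x p q :: real
      using that \<delta> by simp
    ultimately show ?thesis using Qu by blast
  next
    case False
    then show ?thesis using Qg[OF g] \<delta> by linarith
  qed
qed

subsection \<open>Mixing\<close>

interpretation haar: sigma_finite_measure haar by (rule sigma_finite_haar)
interpretation haar2: pair_sigma_finite haar haar ..

text \<open>Haar measure of \<open>SL(2,R)\<close> is infinite, so almost invariance can only be integrated over a box
  in the group; \<open>tail\<close> is what the box misses.\<close>

definition tail :: "real^2^2 \<Rightarrow> nat \<Rightarrow> ennreal" where
  "tail G k = (\<integral>\<^sup>+M. indicator FD M * (\<integral>\<^sup>+g. indicator FD (G ** M ** g) * indicator (- haar_box k) g \<partial>haar) \<partial>haar)"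

lemma haar_box_compl_measurable: "(\<lambda>g. indicator (- haar_box k) g :: ennreal) \<in> borel_measurable SLb"
proof -
  have [measurable]: "(\<lambda>g. indicator (haar_box k) g :: ennreal) \<in> borel_measurable SLb" by measurable
  have "(\<lambda>g. indicator (- haar_box k) g :: ennreal) = (\<lambda>g. 1 - indicator (haar_box k) g)"
    by (auto split: split_indicator)
  then show ?thesis by simp
qed

lemma measurable_mmult3:
  assumes G: "G \<in> SL" and [measurable]: "f \<in> borel_measurable SLb"
  shows "(\<lambda>(M, g). f (G ** M ** g)) \<in> borel_measurable (SLb \<Otimes>\<^sub>M SLb)"
  using G by measurable

lemma nn_integral_FD_shift:
  assumes G: "G \<in> SL" shows "(\<integral>\<^sup>+g. indicator FD (G ** g) \<partial>haar) = emeasure haar FD"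
proof -
  have "(\<integral>\<^sup>+g. indicator FD (G ** g) \<partial>haar) = (\<integral>\<^sup>+g. indicator FD g \<partial>haar)"
    by (rule nn_integral_haar_left[OF borel_measurable_indicator[OF FD_measurable] G])
  then show ?thesis using FD_measurable by simp
qed

text \<open>By left invariance each inner integral is a part of the volume of \<open>FD\<close>, so
  it tends to 0 as the boxes exhaust the group. The same volume dominates the outer integral over
  \<open>FD\<close>.\<close>

lemma tail_tendsto:
  assumes G: "G \<in> SL" shows "tail G \<longlonglongrightarrow> 0"
proof -
  note [measurable] = haar_box_compl_measurable
  have fin: "emeasure haar FD < \<infinity>" by (simp add: emeasure_FD)
  have m[measurable]: "(\<lambda>(M, g). indicator FD (G ** M ** g) :: ennreal) \<in> borel_measurable (SLb \<Otimes>\<^sub>M SLb)"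
    by (rule measurable_mmult3[OF G borel_measurable_indicator[OF FD_measurable]])
  have mI[measurable]: "(\<lambda>M. \<integral>\<^sup>+g. indicator FD (G ** M ** g) * indicator (- haar_box k) g \<partial>haar) \<in> borel_measurable SLb" for k
    by measurable
  have inner: "(\<lambda>k. \<integral>\<^sup>+g. indicator FD (G ** M ** g) * indicator (- haar_box k) g \<partial>haar) \<longlonglongrightarrow> 0" if M: "M \<in> SL" for M
  proof -
    have mg[measurable]: "(\<lambda>g. indicator FD (G ** M ** g) :: ennreal) \<in> borel_measurable SLb"
      by (rule indicator_FD_measurable) (simp add: G M)
    have mk: "(\<lambda>g. indicator FD (G ** M ** g) * indicator (- haar_box k) g :: ennreal) \<in> borel_measurable SLb" for k
      by (intro borel_measurable_times_ennreal mg haar_box_compl_measurable)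
    have "(\<lambda>k. \<integral>\<^sup>+g. indicator FD (G ** M ** g) * indicator (- haar_box k) g \<partial>haar) \<longlonglongrightarrow> (\<integral>\<^sup>+g. 0 \<partial>haar)"
    proof (rule nn_integral_dominated_convergence[where w="\<lambda>g. indicator FD (G ** M ** g)"])
      show "(\<integral>\<^sup>+g. indicator FD (G ** M ** g) \<partial>haar) < \<infinity>"
        using nn_integral_FD_shift[of "G ** M"] G M fin by simp
      show "AE g in haar. (\<lambda>k. indicator FD (G ** M ** g) * indicator (- haar_box k) g) \<longlonglongrightarrow> (0::ennreal)"
      proof (rule AE_I2)
        fix g assume "g \<in> space haar"
        then have "g \<in> (\<Union>k. haar_box k)" using haar_box_Un by simp
        then obtain k where k: "g \<in> haar_box k" by blast
        have "\<forall>\<^sub>F j in sequentially. indicator FD (G ** M ** g) * indicator (- haar_box j) g = (0::ennreal)"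
          using eventually_ge_at_top[of k]
        proof eventually_elim
          case (elim j)
          then have "g \<in> haar_box j" using k haar_box_mono by (meson in_mono incseqD)
          then show ?case by simp
        qed
        then show "(\<lambda>k. indicator FD (G ** M ** g) * indicator (- haar_box k) g) \<longlonglongrightarrow> (0::ennreal)"
          by (rule tendsto_eventually)
      qed
      show "AE g in haar. indicator FD (G ** M ** g) * indicator (- haar_box k) g \<le> (indicator FD (G ** M ** g)::ennreal)" for k
        by (rule AE_I2) (simp split: split_indicator)
    qed (simp_all only: measurable_haar_iff mk mg borel_measurable_const)
    then show ?thesis by simp
  qed
  have mo: "(\<lambda>M. indicator FD M * (\<integral>\<^sup>+g. indicator FD (G ** M ** g) * indicator (- haar_box k) g \<partial>haar)) \<in> borel_measurable SLb" for k
    by (intro borel_measurable_times_ennreal mI borel_measurable_indicator FD_measurable)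
  have mw: "(\<lambda>M. indicator FD M * emeasure haar FD) \<in> borel_measurable SLb"
    by (intro borel_measurable_times_ennreal borel_measurable_const borel_measurable_indicator FD_measurable)
  have "(\<lambda>k. \<integral>\<^sup>+M. indicator FD M * (\<integral>\<^sup>+g. indicator FD (G ** M ** g) * indicator (- haar_box k) g \<partial>haar) \<partial>haar) \<longlonglongrightarrow> (\<integral>\<^sup>+M. 0 \<partial>haar)"
  proof (rule nn_integral_dominated_convergence[where w="\<lambda>M. indicator FD M * emeasure haar FD"])
    show "(\<integral>\<^sup>+M. indicator FD M * emeasure haar FD \<partial>haar) < \<infinity>"
      using fin FD_measurable by (simp add: nn_integral_multc ennreal_mult_less_top)
    show "AE M in haar. indicator FD M * (\<integral>\<^sup>+g. indicator FD (G ** M ** g) * indicator (- haar_box k) g \<partial>haar) \<le> indicator FD M * emeasure haar FD" for k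
    proof (rule AE_I2)
      fix M assume "M \<in> space haar"
      then have GM: "G ** M \<in> SL" using G by simp
      have "(\<integral>\<^sup>+g. indicator FD (G ** M ** g) * indicator (- haar_box k) g \<partial>haar) \<le> (\<integral>\<^sup>+g. indicator FD (G ** M ** g) \<partial>haar)"
        by (rule nn_integral_mono) (simp split: split_indicator)
      also have "\<dots> = emeasure haar FD" by (rule nn_integral_FD_shift[OF GM])
      finally show "indicator FD M * (\<integral>\<^sup>+g. indicator FD (G ** M ** g) * indicator (- haar_box k) g \<partial>haar) \<le> indicator FD M * emeasure haar FD"
        by (rule mult_left_mono) simp
    qed
    show "AE M in haar. (\<lambda>k. indicator FD M * (\<integral>\<^sup>+g. indicator FD (G ** M ** g) * indicator (- haar_box k) g \<partial>haar)) \<longlonglongrightarrow> 0"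
    proof (rule AE_I2)
      fix M assume "M \<in> space haar"
      then have "M \<in> SL" by simp
      from inner[OF this]
      show "(\<lambda>k. indicator FD M * (\<integral>\<^sup>+g. indicator FD (G ** M ** g) * indicator (- haar_box k) g \<partial>haar)) \<longlonglongrightarrow> 0"
        by (cases "M \<in> FD") simp_all
    qed
  qed (simp_all only: measurable_haar_iff mo mw borel_measurable_const)
  then show ?thesis by (simp add: tail_def[abs_def])
qed

section \<open>Almost invariant functions have small variance\<close>

context torus_orbit_set
begin

lemma Q_component:
  assumes w: "good w" and g: "g \<in> SL" and p: "p \<in> S"
  shows "(\<integral>\<^sup>+M. ennreal ((w M p - w (M ** g) p)\<^sup>2) \<partial>fdm) \<le> ennreal (Q w g)"
proof -
  have "(\<integral>\<^sup>+M. ennreal ((w M p - w (M ** g) p)\<^sup>2) \<partial>fdm) = (\<integral>\<^sup>+M. ennreal ((w (M ** g) p - w M p)\<^sup>2) \<partial>fdm)"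
    by (simp add: power2_commute)
  also have "\<dots> = ennreal (\<integral>M. (w (M ** g) p - w M p)\<^sup>2 \<partial>fdm)"
    by (rule nn_integral_eq_integral[OF good_integrable[OF Q_good[OF w g]]]) simp
  also have "\<dots> \<le> ennreal (Q w g)"
    unfolding Q_def J_def using p finS
    by (intro ennreal_leI member_le_sum[of p S "\<lambda>p. \<integral>M. (w (M ** g) p - w M p)\<^sup>2 \<partial>fdm"]) auto
  finally show ?thesis .
qed

text \<open>The substitution \<open>M' = G ** M ** g\<close> trades the second point for a group
  element, and invariance of \<open>w\<close> turns \<open>w M' q\<close> into
  \<open>w (M ** g) p\<close>. For \<open>g\<close> in the box the square integrates to at most
  \<open>Q w g\<close>; outside, the crude bound \<open>(2 * B)^2\<close> meets the remaining mass
  \<open>tail G k\<close>.\<close>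

lemma pair_bound:
  assumes w: "good w" and B: "\<And>M \<xi>. M \<in> SL \<Longrightarrow> \<bar>w M \<xi>\<bar> \<le> B" and Q: "\<And>g. g \<in> SL \<Longrightarrow> Q w g \<le> \<eta>"
    and pq: "p \<in> S" and G: "G \<in> Gamma_theta" "G *v p - q \<in> Int_lattice"
  shows "(\<integral>\<^sup>+M. \<integral>\<^sup>+M'. ennreal ((w M p - w M' q)\<^sup>2) \<partial>fdm \<partial>fdm)
      \<le> ennreal \<eta> * emeasure haar (haar_box k) + ennreal (4 * B\<^sup>2) * tail G k"
proof -
  note [measurable] = haar_box_compl_measurable good_measurable[OF w]
  have GS: "G \<in> SL" using G by simp
  have m[measurable]: "(\<lambda>(M, g). indicator FD (G ** M ** g) :: ennreal) \<in> borel_measurable (SLb \<Otimes>\<^sub>M SLb)"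
    by (rule measurable_mmult3[OF GS borel_measurable_indicator[OF FD_measurable]])
  have m2[measurable]: "(\<lambda>(M, g). ennreal ((w M p - w (M ** g) p)\<^sup>2)) \<in> borel_measurable (SLb \<Otimes>\<^sub>M SLb)"
    by measurable
  have wG: "w (G ** M) q = w M p" if "M \<in> SL" for M
    using good_inv[OF w that G(1) Int_lattice_minus[OF G(2)], of p] by simp
  have inner: "(\<integral>\<^sup>+M'. ennreal ((w M p - w M' q)\<^sup>2) \<partial>fdm) \<le>
      (\<integral>\<^sup>+g. indicator (haar_box k) g * ennreal ((w M p - w (M ** g) p)\<^sup>2) \<partial>haar) +
      ennreal (4 * B\<^sup>2) * (\<integral>\<^sup>+g. indicator FD (G ** M ** g) * indicator (- haar_box k) g \<partial>haar)"
    (is "_ \<le> ?A + _ * ?C") if M: "M \<in> SL" for M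
  proof -
    have mM[measurable]: "(\<lambda>g. indicator FD (G ** M ** g) :: ennreal) \<in> borel_measurable SLb"
      by (rule indicator_FD_measurable) (simp add: GS M)
    have mM2[measurable]: "(\<lambda>g. ennreal ((w M p - w (M ** g) p)\<^sup>2)) \<in> borel_measurable SLb"
      using M by measurable
    have m3: "(\<lambda>g. indicator (haar_box k) g * ennreal ((w M p - w (M ** g) p)\<^sup>2)) \<in> borel_measurable SLb"
      by (intro borel_measurable_times_ennreal mM2 borel_measurable_indicator haar_box_measurable)
    have m4: "(\<lambda>g. indicator FD (G ** M ** g) * indicator (- haar_box k) g :: ennreal) \<in> borel_measurable SLb"
      by (intro borel_measurable_times_ennreal mM haar_box_compl_measurable)
    have "(\<integral>\<^sup>+M'. ennreal ((w M p - w M' q)\<^sup>2) \<partial>fdm) = (\<integral>\<^sup>+M'. indicator FD M' * ennreal ((w M p - w M' q)\<^sup>2) \<partial>haar)"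
      by (rule nn_integral_fdm) measurable
    also have "\<dots> = (\<integral>\<^sup>+g. indicator FD (G ** M ** g) * ennreal ((w M p - w (G ** M ** g) q)\<^sup>2) \<partial>haar)"
    proof -
      have mf: "(\<lambda>M'. indicator FD M' * ennreal ((w M p - w M' q)\<^sup>2)) \<in> borel_measurable SLb" by measurable
      show ?thesis by (rule nn_integral_haar_left[OF mf SL_mult[OF GS M], symmetric])
    qed
    also have "\<dots> \<le> (\<integral>\<^sup>+g. indicator (haar_box k) g * ennreal ((w M p - w (M ** g) p)\<^sup>2) + ennreal (4 * B\<^sup>2) * (indicator FD (G ** M ** g) * indicator (- haar_box k) g) \<partial>haar)"
    proof (rule nn_integral_mono)
      fix g assume "g \<in> space haar"
      then have g: "g \<in> SL" by simp
      have e: "w (G ** M ** g) q = w (M ** g) p" using wG[of "M ** g"] M g by (simp add: matrix_mul_assoc)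
      have "\<bar>w M p - w (M ** g) p\<bar> \<le> 2 * B" using B[of M p] B[of "M ** g" p] M g by simp
      then have "\<bar>w M p - w (M ** g) p\<bar>\<^sup>2 \<le> (2 * B)\<^sup>2" by (rule power_mono) simp
      then have "ennreal ((w M p - w (M ** g) p)\<^sup>2) \<le> ennreal (4 * B\<^sup>2)" by (intro ennreal_leI) (simp add: power_mult_distrib)
      then show "indicator FD (G ** M ** g) * ennreal ((w M p - w (G ** M ** g) q)\<^sup>2) \<le>
         indicator (haar_box k) g * ennreal ((w M p - w (M ** g) p)\<^sup>2) + ennreal (4 * B\<^sup>2) * (indicator FD (G ** M ** g) * indicator (- haar_box k) g)"
        unfolding e by (cases "g \<in> haar_box k"; cases "G ** M ** g \<in> FD") simp_all
    qed
    also have "\<dots> = ?A + (\<integral>\<^sup>+g. ennreal (4 * B\<^sup>2) * (indicator FD (G ** M ** g) * indicator (- haar_box k) g) \<partial>haar)"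
      by (rule nn_integral_add) (simp_all only: measurable_haar_iff m3 borel_measurable_times_ennreal borel_measurable_const m4)
    also have "(\<integral>\<^sup>+g. ennreal (4 * B\<^sup>2) * (indicator FD (G ** M ** g) * indicator (- haar_box k) g) \<partial>haar) = ennreal (4 * B\<^sup>2) * ?C"
      by (rule nn_integral_cmult) (simp only: measurable_haar_iff m4)
    finally show ?thesis .
  qed
  have mA[measurable]: "(\<lambda>M. \<integral>\<^sup>+g. indicator (haar_box k) g * ennreal ((w M p - w (M ** g) p)\<^sup>2) \<partial>haar) \<in> borel_measurable SLb"
    by measurable
  have mC[measurable]: "(\<lambda>M. \<integral>\<^sup>+g. indicator FD (G ** M ** g) * indicator (- haar_box k) g \<partial>haar) \<in> borel_measurable SLb"
    by measurable
  have A: "(\<integral>\<^sup>+M. \<integral>\<^sup>+g. indicator (haar_box k) g * ennreal ((w M p - w (M ** g) p)\<^sup>2) \<partial>haar \<partial>fdm) \<le> ennreal \<eta> * emeasure haar (haar_box k)"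
  proof -
    interpret P: pair_sigma_finite fdm haar ..
    have mm: "(\<lambda>(M, g). indicator (haar_box k) g * ennreal ((w M p - w (M ** g) p)\<^sup>2)) \<in> borel_measurable (fdm \<Otimes>\<^sub>M haar)"
      by measurable
    have "(\<integral>\<^sup>+M. \<integral>\<^sup>+g. indicator (haar_box k) g * ennreal ((w M p - w (M ** g) p)\<^sup>2) \<partial>haar \<partial>fdm) =
       (\<integral>\<^sup>+g. \<integral>\<^sup>+M. indicator (haar_box k) g * ennreal ((w M p - w (M ** g) p)\<^sup>2) \<partial>fdm \<partial>haar)"
      by (rule P.Fubini'[OF mm, symmetric])
    also have "\<dots> \<le> (\<integral>\<^sup>+g. ennreal \<eta> * indicator (haar_box k) g \<partial>haar)"
    proof (rule nn_integral_mono)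
      fix g assume "g \<in> space haar"
      then have g: "g \<in> SL" by simp
      have mg: "(\<lambda>M. ennreal ((w M p - w (M ** g) p)\<^sup>2)) \<in> borel_measurable fdm"
        using good_measurable[OF w, of p] good_measurable[OF good_translate[OF w g], of p]
        unfolding measurable_fdm_iff by measurable
      have "(\<integral>\<^sup>+M. indicator (haar_box k) g * ennreal ((w M p - w (M ** g) p)\<^sup>2) \<partial>fdm) = indicator (haar_box k) g * (\<integral>\<^sup>+M. ennreal ((w M p - w (M ** g) p)\<^sup>2) \<partial>fdm)"
        by (rule nn_integral_cmult[OF mg])
      also have "\<dots> \<le> indicator (haar_box k) g * ennreal \<eta>"
        by (rule mult_left_mono[OF order.trans[OF Q_component[OF w g pq] ennreal_leI[OF Q[OF g]]]]) simp
      finally show "(\<integral>\<^sup>+M. indicator (haar_box k) g * ennreal ((w M p - w (M ** g) p)\<^sup>2) \<partial>fdm) \<le> ennreal \<eta> * indicator (haar_box k) g"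
        by (simp only: mult.commute)
    qed
    also have "\<dots> = ennreal \<eta> * emeasure haar (haar_box k)"
      by (rule nn_integral_cmult_indicator) (simp only: sets_haar haar_box_measurable)
    finally show ?thesis .
  qed
  have C: "(\<integral>\<^sup>+M. ennreal (4 * B\<^sup>2) * (\<integral>\<^sup>+g. indicator FD (G ** M ** g) * indicator (- haar_box k) g \<partial>haar) \<partial>fdm) = ennreal (4 * B\<^sup>2) * tail G k"
    unfolding tail_def nn_integral_fdm[OF mC, symmetric] by (rule nn_integral_cmult) (simp only: measurable_fdm_iff mC)
  have "(\<integral>\<^sup>+M. \<integral>\<^sup>+M'. ennreal ((w M p - w M' q)\<^sup>2) \<partial>fdm \<partial>fdm) \<le>
    (\<integral>\<^sup>+M. (\<integral>\<^sup>+g. indicator (haar_box k) g * ennreal ((w M p - w (M ** g) p)\<^sup>2) \<partial>haar) +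
      ennreal (4 * B\<^sup>2) * (\<integral>\<^sup>+g. indicator FD (G ** M ** g) * indicator (- haar_box k) g \<partial>haar) \<partial>fdm)"
    by (rule nn_integral_mono) (simp only: space_fdm inner)
  also have "\<dots> = (\<integral>\<^sup>+M. \<integral>\<^sup>+g. indicator (haar_box k) g * ennreal ((w M p - w (M ** g) p)\<^sup>2) \<partial>haar \<partial>fdm) +
      (\<integral>\<^sup>+M. ennreal (4 * B\<^sup>2) * (\<integral>\<^sup>+g. indicator FD (G ** M ** g) * indicator (- haar_box k) g \<partial>haar) \<partial>fdm)"
    by (rule nn_integral_add) (simp_all only: measurable_fdm_iff mA borel_measurable_times_ennreal borel_measurable_const mC)
  also have "\<dots> \<le> ennreal \<eta> * emeasure haar (haar_box k) + ennreal (4 * B\<^sup>2) * tail G k"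
    unfolding C by (rule add_right_mono[OF A])
  finally show ?thesis .
qed

lemma double_integral_expand:
  assumes w: "good w"
  shows "(\<integral>\<^sup>+M. \<integral>\<^sup>+M'. ennreal ((w M p - w M' q)\<^sup>2) \<partial>fdm \<partial>fdm) =
    ennreal (pi\<^sup>2/2 * (\<integral>M. (w M p)\<^sup>2 \<partial>fdm) + pi\<^sup>2/2 * (\<integral>M. (w M q)\<^sup>2 \<partial>fdm) - 2 * (\<integral>M. w M p \<partial>fdm) * (\<integral>M. w M q \<partial>fdm))"
proof -
  have i: "integrable fdm (\<lambda>M. w M r)" "integrable fdm (\<lambda>M. (w M r)\<^sup>2)" for r
    using good_integrable[OF w] good_integrable[OF good_power2[OF w]] by auto
  have e: "(x - w M' q)\<^sup>2 = x\<^sup>2 - 2 * x * w M' q + (w M' q)\<^sup>2" for x M' by (simp add: power2_diff)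
  have ii: "integrable fdm (\<lambda>M'. (x - w M' q)\<^sup>2)" for x
    unfolding e using i by simp
  have I: "(\<integral>M'. (x - w M' q)\<^sup>2 \<partial>fdm) = pi\<^sup>2/2 * x\<^sup>2 - 2 * x * (\<integral>M. w M q \<partial>fdm) + (\<integral>M. (w M q)\<^sup>2 \<partial>fdm)" for x
    unfolding e using i by (simp add: measure_fdm)
  have "(\<integral>\<^sup>+M. \<integral>\<^sup>+M'. ennreal ((w M p - w M' q)\<^sup>2) \<partial>fdm \<partial>fdm) = (\<integral>\<^sup>+M. ennreal (\<integral>M'. (w M p - w M' q)\<^sup>2 \<partial>fdm) \<partial>fdm)"
    by (intro nn_integral_cong nn_integral_eq_integral ii) simp
  also have "\<dots> = ennreal (\<integral>M. (\<integral>M'. (w M p - w M' q)\<^sup>2 \<partial>fdm) \<partial>fdm)"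
  proof (rule nn_integral_eq_integral)
    show "integrable fdm (\<lambda>M. \<integral>M'. (w M p - w M' q)\<^sup>2 \<partial>fdm)"
      unfolding I using i by simp
    show "AE M in fdm. 0 \<le> (\<integral>M'. (w M p - w M' q)\<^sup>2 \<partial>fdm)" by simp
  qed
  also have "(\<integral>M. (\<integral>M'. (w M p - w M' q)\<^sup>2 \<partial>fdm) \<partial>fdm) =
    pi\<^sup>2/2 * (\<integral>M. (w M p)\<^sup>2 \<partial>fdm) + pi\<^sup>2/2 * (\<integral>M. (w M q)\<^sup>2 \<partial>fdm) - 2 * (\<integral>M. w M p \<partial>fdm) * (\<integral>M. w M q \<partial>fdm)"
    unfolding I using i by (simp add: measure_fdm)
  finally show ?thesis .
qed

text \<open>Summed over all pairs from \<open>S\<close> the double integrals give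
  \<open>2 * T * J (w^2) - 2 * (J w)^2\<close>, and the second term vanishes. The box is fixed from
  \<open>B\<close> and \<open>e\<close> first, because \<open>\<eta>\<close> has to be small
  relative to the measure of the box.\<close>

lemma variance_bound:
  assumes B: "B > 0" and e: "e > 0"
  shows "\<exists>\<eta>>0. \<forall>w. good w \<longrightarrow> (\<forall>M\<in>SL. \<forall>\<xi>. \<bar>w M \<xi>\<bar> \<le> B) \<longrightarrow> J w = 0 \<longrightarrow> (\<forall>g\<in>SL. Q w g \<le> \<eta>) \<longrightarrow> J (\<lambda>M \<xi>. (w M \<xi>)\<^sup>2) \<le> e"
proof -
  obtain Gf where Gf: "\<And>p q. p \<in> S \<Longrightarrow> q \<in> S \<Longrightarrow> Gf p q \<in> Gamma_theta" "\<And>p q. p \<in> S \<Longrightarrow> q \<in> S \<Longrightarrow> Gf p q *v p - q \<in> Int_lattice"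
    using trans by metis
  have cS: "real (card S) > 0" using finS neS by (simp add: card_gt_0_iff)
  \<comment> \<open>The allowance for one pair: over all \<open>card S\<close> squared pairs it adds
    up to \<open>2 * T * e\<close>. Half of it is spent on the tail and half on the box.\<close>
  define b where "b = 2 * T * e / (real (card S))\<^sup>2"
  have b: "b > 0" using T_pos e cS by (simp add: b_def)
  define \<tau> where "\<tau> = b / (2 * (4 * B\<^sup>2))"
  have \<tau>: "\<tau> > 0" using b B by (simp add: \<tau>_def)
  have "\<forall>\<^sub>F k in sequentially. \<forall>(p,q)\<in>S\<times>S. tail (Gf p q) k < ennreal \<tau>"
  proof (subst eventually_ball_finite_distrib)
    show "finite (S \<times> S)" using finS by simp
    show "\<forall>y\<in>S \<times> S. \<forall>\<^sub>F k in sequentially. case y of (p, q) \<Rightarrow> tail (Gf p q) k < ennreal \<tau>"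
    proof safe
      fix p q assume "p \<in> S" "q \<in> S"
      then show "\<forall>\<^sub>F k in sequentially. tail (Gf p q) k < ennreal \<tau>"
        using tail_tendsto[OF theta_SL[OF Gf(1)], of p q] \<tau> by (intro order_tendstoD(2)) auto
    qed
  qed
  then obtain k where k: "\<And>p q. p \<in> S \<Longrightarrow> q \<in> S \<Longrightarrow> tail (Gf p q) k < ennreal \<tau>"
    unfolding eventually_sequentially by blast
  define E where "E = enn2real (emeasure haar (haar_box k))"
  have E: "emeasure haar (haar_box k) = ennreal E" "E \<ge> 0"
    using haar_box_finite[of k] by (simp_all add: E_def)
  define \<eta> where "\<eta> = (b / 2) / (E + 1)"
  have \<eta>: "\<eta> > 0" "\<eta> * E \<le> b / 2"
  proof -
    show "\<eta> > 0" using b E by (simp add: \<eta>_def)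
    have "\<eta> * E \<le> \<eta> * (E + 1)" using \<open>\<eta> > 0\<close> by simp
    also have "\<dots> = b / 2"
    proof -
      have "E + 1 \<noteq> 0" using E(2) by linarith
      then show ?thesis unfolding \<eta>_def by (rule nonzero_eq_divide_eq[THEN iffD1, OF _ refl])
    qed
    finally show "\<eta> * E \<le> b / 2" .
  qed
  have "J (\<lambda>M \<xi>. (w M \<xi>)\<^sup>2) \<le> e"
    if w: "good w" and wB: "\<And>M \<xi>. M \<in> SL \<Longrightarrow> \<bar>w M \<xi>\<bar> \<le> B" and J0: "J w = 0" and Q: "\<And>g. g \<in> SL \<Longrightarrow> Q w g \<le> \<eta>" for w
  proof -
    define c where "c p = (\<integral>M. (w M p)\<^sup>2 \<partial>fdm)" for p
    define a where "a p = (\<integral>M. w M p \<partial>fdm)" for p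
    have each: "pi\<^sup>2/2 * c p + pi\<^sup>2/2 * c q - 2 * a p * a q \<le> b" if p: "p \<in> S" and q: "q \<in> S" for p q
    proof -
      have "ennreal (pi\<^sup>2/2 * c p + pi\<^sup>2/2 * c q - 2 * a p * a q) \<le> ennreal \<eta> * ennreal E + ennreal (4 * B\<^sup>2) * tail (Gf p q) k"
        using pair_bound[OF w wB Q p Gf[OF p q], of k] unfolding double_integral_expand[OF w] E(1) c_def a_def .
      also have "\<dots> \<le> ennreal (b/2) + ennreal (b/2)"
      proof (rule add_mono)
        have "ennreal \<eta> * ennreal E = ennreal (\<eta> * E)" using \<eta>(1) E(2) by (intro ennreal_mult[symmetric]) auto
        also have "\<dots> \<le> ennreal (b/2)" by (rule ennreal_leI[OF \<eta>(2)])
        finally show "ennreal \<eta> * ennreal E \<le> ennreal (b/2)" .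
        have "ennreal (4 * B\<^sup>2) * tail (Gf p q) k \<le> ennreal (4 * B\<^sup>2) * ennreal \<tau>"
          using k[OF p q] by (intro mult_left_mono) auto
        also have "\<dots> = ennreal (4 * B\<^sup>2 * \<tau>)" using \<tau> by (intro ennreal_mult[symmetric]) auto
        also have "4 * B\<^sup>2 * \<tau> = b/2" using B by (simp add: \<tau>_def)
        finally show "ennreal (4 * B\<^sup>2) * tail (Gf p q) k \<le> ennreal (b/2)" .
      qed
      also have "\<dots> = ennreal (b/2 + b/2)" using b by (intro ennreal_plus[symmetric]) auto
      finally show ?thesis using b by (simp add: ennreal_le_iff)
    qed
    have "(\<Sum>p\<in>S. \<Sum>q\<in>S. pi\<^sup>2/2 * c p + pi\<^sup>2/2 * c q - 2 * a p * a q) \<le> (\<Sum>p\<in>S. \<Sum>q\<in>S. b)"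
      by (intro sum_mono each)
    also have "\<dots> = (real (card S))\<^sup>2 * b" by (simp add: power2_eq_square)
    also have "\<dots> = 2 * T * e" using cS by (simp add: b_def)
    also have "(\<Sum>p\<in>S. \<Sum>q\<in>S. pi\<^sup>2/2 * c p + pi\<^sup>2/2 * c q - 2 * a p * a q) =
       2 * T * (\<Sum>p\<in>S. c p)"
    proof -
      have a0: "(\<Sum>p\<in>S. a p) = 0" using J0 by (simp only: J_def a_def)
      have "(\<Sum>p\<in>S. \<Sum>q\<in>S. 2 * a p * a q) = (\<Sum>p\<in>S. 2 * a p * (\<Sum>q\<in>S. a q))"
        by (simp only: sum_distrib_left)
      also have "\<dots> = 0" by (simp only: a0 mult_zero_right sum.neutral_const)
      finally have 1: "(\<Sum>p\<in>S. \<Sum>q\<in>S. 2 * a p * a q) = 0" .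
      have 2: "(\<Sum>p\<in>S. \<Sum>q\<in>S. pi\<^sup>2/2 * c p) = T * (\<Sum>p\<in>S. c p)"
        by (simp add: T_def sum_distrib_left sum_distrib_right mult_ac)
      have 3: "(\<Sum>p\<in>S. \<Sum>q\<in>S. pi\<^sup>2/2 * c q) = T * (\<Sum>p\<in>S. c p)"
        by (simp add: T_def sum_distrib_left sum_distrib_right mult_ac)
      have "(\<Sum>p\<in>S. \<Sum>q\<in>S. pi\<^sup>2/2 * c p + pi\<^sup>2/2 * c q - 2 * a p * a q) =
        (\<Sum>p\<in>S. \<Sum>q\<in>S. pi\<^sup>2/2 * c p) + (\<Sum>p\<in>S. \<Sum>q\<in>S. pi\<^sup>2/2 * c q) - (\<Sum>p\<in>S. \<Sum>q\<in>S. 2 * a p * a q)"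
        by (simp only: sum.distrib sum_subtractf)
      then show ?thesis unfolding 1 2 3 by linarith
    qed
    finally have "2 * T * J (\<lambda>M \<xi>. (w M \<xi>)\<^sup>2) \<le> 2 * T * e" by (simp add: J_def c_def)
    then show ?thesis using T_pos by simp
  qed
  then show ?thesis using \<eta>(1) by blast
qed

end

section \<open>Correlations along \<open>geo\<close>, the matrix part of \<open>Phi\<close>\<close>

definition geo :: "real \<Rightarrow> real^2^2" where "geo t = dg (exp (t/2))"

lemma geo_SL [simp]: "geo t \<in> SL"
  by (simp add: geo_def)

lemma lo_geo: "lo s ** geo t = geo t ** lo (s * exp (- t))"
proof -
  have "exp (t/2) * exp (-t) = 1 / exp (t/2)"
    by (simp add: exp_minus_inverse field_simps flip: exp_add exp_minus)
  then show ?thesis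
    by (simp add: geo_def lo_def dg_def mult.left_commute)
qed

lemma lo_near_one: "d > 0 \<Longrightarrow> \<exists>r>0. \<forall>x. \<bar>x\<bar> < r \<longrightarrow> norm (lo x - mat 1) < d"
proof -
  assume d: "d > 0"
  have "continuous_on UNIV lo" unfolding lo_def[abs_def] by (intro continuous_intros)
  then have "\<exists>r>0. \<forall>x\<in>UNIV. dist x 0 < r \<longrightarrow> dist (lo x) (lo 0) < d"
    using d unfolding continuous_on_iff by blast
  moreover have "lo 0 = mat 1" by (simp add: lo_def mat_1_mat22)
  ultimately show ?thesis by (simp add: dist_norm)
qed

context torus_orbit_set
begin

definition ip :: "(real^2^2 \<Rightarrow> real^2 \<Rightarrow> real) \<Rightarrow> (real^2^2 \<Rightarrow> real^2 \<Rightarrow> real) \<Rightarrow> real \<Rightarrow> real" where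
  "ip f h t = J (\<lambda>M \<xi>. f (M ** geo t) \<xi> * h M \<xi>)"

lemma ip_good: "good f \<Longrightarrow> good h \<Longrightarrow> good (\<lambda>M \<xi>. f (M ** geo t) \<xi> * h M \<xi>)"
  by (intro good_mult good_translate geo_SL)

text \<open>Invariance of \<open>J\<close> moves the translation from \<open>w\<close> to
  \<open>f\<close>, where it stands before the flow. Pulled through the flow it becomes
  \<open>lo (- s * exp (- t))\<close>, which tends to the identity.\<close>

lemma ip_lo_shift:
  assumes f: "good f" and w: "good w"
  shows "((\<lambda>t. ip f (\<lambda>M \<xi>. w (M ** lo s) \<xi>) t - ip f w t) \<longlongrightarrow> 0) at_top"
proof (rule tendstoI)
  fix e :: real assume e: "e > 0"
  obtain B where B: "B > 0" "\<And>M \<xi>. M \<in> SL \<Longrightarrow> \<bar>w M \<xi>\<bar> \<le> B" using good_bound[OF w] by metis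
  define e' where "e' = e / (2 * B * T)"
  have e': "e' > 0" "e' * B * T < e" using e B(1) T_pos by (simp_all add: e'_def)
  obtain d where d: "d > 0" "\<And>M \<xi> h. M \<in> SL \<Longrightarrow> h \<in> SL \<Longrightarrow> norm (h - mat 1) < d \<Longrightarrow> \<bar>f (M ** h) \<xi> - f M \<xi>\<bar> < e'"
    using good_ucont[OF f e'(1)] by blast
  obtain r where r: "r > 0" "\<And>x. \<bar>x\<bar> < r \<Longrightarrow> norm (lo x - mat 1) < d" using lo_near_one[OF d(1)] by blast
  have "((\<lambda>t::real. - s * exp (- t)) \<longlongrightarrow> - s * 0) at_top"
    by (intro tendsto_mult tendsto_const filterlim_compose[OF exp_at_bot] filterlim_uminus_at_bot_at_top)
  then have "\<forall>\<^sub>F t in at_top. \<bar>- s * exp (- t)\<bar> < r"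
    using tendstoD[of "\<lambda>t. - s * exp (- t)" 0 at_top r] r(1) by (simp add: dist_real_def)
  then show "\<forall>\<^sub>F t in at_top. dist (ip f (\<lambda>M \<xi>. w (M ** lo s) \<xi>) t - ip f w t) 0 < e"
  proof eventually_elim
    case (elim t)
    let ?l = "lo (- s * exp (- t))"
    have nl: "norm (?l - mat 1) < d" using r(2)[OF elim] .
    have wl: "good (\<lambda>M \<xi>. w (M ** lo s) \<xi>)" by (intro good_translate w lo_SL)
    have "ip f (\<lambda>M \<xi>. w (M ** lo s) \<xi>) t = J (\<lambda>M \<xi>. f (M ** lo (-s) ** geo t) \<xi> * w (M ** lo (-s) ** lo s) \<xi>)"
      unfolding ip_def by (rule J_translate[OF ip_good[OF f wl] lo_SL, symmetric])
    also have "\<dots> = J (\<lambda>M \<xi>. f (M ** geo t ** ?l) \<xi> * w M \<xi>)"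
    proof (rule J_cong)
      fix M :: "real^2^2" and \<xi> :: "real^2"
      have "lo (-s) ** lo s = mat 1" by (simp add: lo_def mat_1_mat22)
      then show "f (M ** lo (-s) ** geo t) \<xi> * w (M ** lo (-s) ** lo s) \<xi> = f (M ** geo t ** ?l) \<xi> * w M \<xi>"
        by (simp only: matrix_mul_assoc[symmetric] lo_geo matrix_mul_rid)
    qed
    finally have 1: "ip f (\<lambda>M \<xi>. w (M ** lo s) \<xi>) t = J (\<lambda>M \<xi>. f (M ** geo t ** ?l) \<xi> * w M \<xi>)" .
    have g1: "good (\<lambda>M \<xi>. f (M ** geo t ** ?l) \<xi> * w M \<xi>)"
      using good_translate[OF good_translate[OF f lo_SL] geo_SL] by (rule good_mult[OF _ w])
    have "ip f (\<lambda>M \<xi>. w (M ** lo s) \<xi>) t - ip f w t = J (\<lambda>M \<xi>. f (M ** geo t ** ?l) \<xi> * w M \<xi> - f (M ** geo t) \<xi> * w M \<xi>)"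
      unfolding 1 unfolding ip_def by (rule J_diff[OF g1 ip_good[OF f w], symmetric])
    also have "\<bar>\<dots>\<bar> \<le> (e' * B) * T"
    proof (rule J_abs_le[OF good_diff[OF g1 ip_good[OF f w]]])
      fix M :: "real^2^2" and \<xi> :: "real^2" assume M: "M \<in> SL"
      have "\<bar>f (M ** geo t ** ?l) \<xi> * w M \<xi> - f (M ** geo t) \<xi> * w M \<xi>\<bar> = \<bar>f (M ** geo t ** ?l) \<xi> - f (M ** geo t) \<xi>\<bar> * \<bar>w M \<xi>\<bar>"
        by (simp add: abs_mult[symmetric] left_diff_distrib)
      also have "\<dots> \<le> e' * B"
        using d(2)[of "M ** geo t" ?l \<xi>] nl M B(2)[OF M, of \<xi>] e'(1) by (intro mult_mono) auto
      finally show "\<bar>f (M ** geo t ** ?l) \<xi> * w M \<xi> - f (M ** geo t) \<xi> * w M \<xi>\<bar> \<le> e' * B" .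
    qed
    finally show ?case using e'(2) by (simp add: dist_real_def)
  qed
qed

lemma ip_add: "good f \<Longrightarrow> good h \<Longrightarrow> good k \<Longrightarrow> ip f (\<lambda>M \<xi>. h M \<xi> + k M \<xi>) t = ip f h t + ip f k t"
  unfolding ip_def distrib_left by (rule J_add) (auto intro: ip_good)

lemma ip_cmult: "ip f (\<lambda>M \<xi>. c * h M \<xi>) t = c * ip f h t"
  unfolding ip_def J_cmult[symmetric] by (rule J_cong) simp

text \<open>A weighted arithmetic-geometric inequality in the role of Cauchy-Schwarz: one factor is
  controlled in sup norm, the other in mean square, and the free \<open>k\<close> balances the
  two.\<close>

lemma ip_bound:
  assumes f: "good f" and w: "good w" and B: "\<And>M \<xi>. M \<in> SL \<Longrightarrow> \<bar>f M \<xi>\<bar> \<le> B" and k: "k > 0"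
  shows "\<bar>ip f w t\<bar> \<le> k * (B\<^sup>2 * T) + J (\<lambda>M \<xi>. (w M \<xi>)\<^sup>2) / k"
proof -
  have key: "\<bar>x * y\<bar> \<le> k * B\<^sup>2 + (1/k) * y\<^sup>2" if "\<bar>x\<bar> \<le> B" for x y :: real
  proof -
    have "0 \<le> (\<bar>y\<bar> - k * \<bar>x\<bar>)\<^sup>2" by simp
    then have "2 * (k * (\<bar>x\<bar> * \<bar>y\<bar>)) \<le> y\<^sup>2 + k * (k * x\<^sup>2)" by (simp add: power2_eq_square algebra_simps abs_mult_self_eq)
    moreover have "0 \<le> k * (\<bar>x\<bar> * \<bar>y\<bar>)" using k by simp
    ultimately have "k * (\<bar>x\<bar> * \<bar>y\<bar>) \<le> y\<^sup>2 + k * (k * x\<^sup>2)" by linarith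
    then have "\<bar>x\<bar> * \<bar>y\<bar> \<le> y\<^sup>2 / k + k * x\<^sup>2" using k by (simp add: field_simps)
    moreover have "\<bar>x\<bar>\<^sup>2 \<le> B\<^sup>2" using that by (rule power_mono) simp
    then have "k * x\<^sup>2 \<le> k * B\<^sup>2" using k by simp
    ultimately show ?thesis by (simp add: abs_mult)
  qed
  have g: "good (\<lambda>M \<xi>. k * B\<^sup>2 + (1/k) * (w M \<xi>)\<^sup>2)" by (intro good_add good_const good_cmult good_power2 w)
  have val: "J (\<lambda>M \<xi>. k * B\<^sup>2 + (1/k) * (w M \<xi>)\<^sup>2) = k * (B\<^sup>2 * T) + J (\<lambda>M \<xi>. (w M \<xi>)\<^sup>2) / k"
    using J_add[OF good_const good_cmult[OF good_power2[OF w]], of "k * B\<^sup>2" "1/k"] unfolding J_const J_cmult by simp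
  have "f (M ** geo t) \<xi> * w M \<xi> \<le> k * B\<^sup>2 + (1/k) * (w M \<xi>)\<^sup>2" "- (k * B\<^sup>2 + (1/k) * (w M \<xi>)\<^sup>2) \<le> f (M ** geo t) \<xi> * w M \<xi>"
    if "M \<in> SL" for M \<xi>
    using key[OF B[of "M ** geo t" \<xi>], of "w M \<xi>"] that by (simp_all add: abs_le_iff)
  then have "ip f w t \<le> J (\<lambda>M \<xi>. k * B\<^sup>2 + (1/k) * (w M \<xi>)\<^sup>2)"
    "J (\<lambda>M \<xi>. (-1) * (k * B\<^sup>2 + (1/k) * (w M \<xi>)\<^sup>2)) \<le> ip f w t"
    unfolding ip_def by (intro J_mono ip_good good_cmult f w g; simp)+
  moreover have "\<bar>x\<bar> \<le> y" if "x \<le> y" "(-1) * y \<le> x" for x y :: real using that by simp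
  ultimately show ?thesis unfolding J_cmult val by blast
qed

lemma mixing_mean_zero:
  assumes f: "good f" and h: "good h" and h0: "J h = 0"
  shows "((\<lambda>t. ip f h t) \<longlongrightarrow> 0) at_top"
proof -
  obtain Bf where Bf: "Bf > 0" "\<And>M \<xi>. M \<in> SL \<Longrightarrow> \<bar>f M \<xi>\<bar> \<le> Bf" using good_bound[OF f] by metis
  obtain B where B: "B > 0" "\<And>M \<xi>. M \<in> SL \<Longrightarrow> \<bar>h M \<xi>\<bar> \<le> B" using good_bound[OF h] by metis
  \<comment> \<open>\<open>K\<close> plays the part of the convex hull of the lower unipotent
    translates of \<open>h\<close>. It records the properties of such averages that are wanted and
    is closed under averaging an element with one of its translates.\<close>
  define K where "K = {w. good w \<and> (\<forall>M\<in>SL. \<forall>\<xi>. \<bar>w M \<xi>\<bar> \<le> B) \<and> J w = 0 \<and> ((\<lambda>t. ip f w t - ip f h t) \<longlongrightarrow> 0) at_top}"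
  have hK: "h \<in> K" using h h0 B by (simp add: K_def)
  define N where "N w = J (\<lambda>M \<xi>. (w M \<xi>)\<^sup>2)" for w :: "real^2^2 \<Rightarrow> real^2 \<Rightarrow> real"
  have N0: "0 \<le> N w" for w unfolding N_def by (rule J_nonneg) simp
  have half: "(\<lambda>M \<xi>. (1/2) * (w M \<xi> + w (M ** lo s) \<xi>)) \<in> K" if wK: "w \<in> K" for w s
  proof -
    have w: "good w" and wB: "\<And>M \<xi>. M \<in> SL \<Longrightarrow> \<bar>w M \<xi>\<bar> \<le> B" and w0: "J w = 0"
      and wl: "((\<lambda>t. ip f w t - ip f h t) \<longlongrightarrow> 0) at_top" using wK by (auto simp: K_def)
    have ws: "good (\<lambda>M \<xi>. w (M ** lo s) \<xi>)" by (intro good_translate w lo_SL)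
    have ga: "good (\<lambda>M \<xi>. (1/2) * (w M \<xi> + w (M ** lo s) \<xi>))" by (intro good_cmult good_add w ws)
    have bd: "\<bar>(1/2) * (w M \<xi> + w (M ** lo s) \<xi>)\<bar> \<le> B" if "M \<in> SL" for M \<xi>
      using wB[OF that, of \<xi>] wB[OF SL_mult[OF that lo_SL], of s \<xi>] by simp
    have j0: "J (\<lambda>M \<xi>. (1/2) * (w M \<xi> + w (M ** lo s) \<xi>)) = 0"
      unfolding J_cmult J_add[OF w ws] J_translate[OF w lo_SL] w0 by simp
    have "((\<lambda>t. (ip f w t - ip f h t) + (1/2) * (ip f (\<lambda>M \<xi>. w (M ** lo s) \<xi>) t - ip f w t)) \<longlongrightarrow> 0 + (1/2) * 0) at_top"
      by (intro tendsto_add tendsto_mult tendsto_const wl ip_lo_shift f w)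
    moreover have "ip f (\<lambda>M \<xi>. (1/2) * (w M \<xi> + w (M ** lo s) \<xi>)) t - ip f h t =
      (ip f w t - ip f h t) + (1/2) * (ip f (\<lambda>M \<xi>. w (M ** lo s) \<xi>) t - ip f w t)" for t
      unfolding ip_cmult ip_add[OF f w ws] by (simp add: field_simps)
    ultimately have "((\<lambda>t. ip f (\<lambda>M \<xi>. (1/2) * (w M \<xi> + w (M ** lo s) \<xi>)) t - ip f h t) \<longlongrightarrow> 0) at_top" by (simp only: mult_zero_right add_0)
    then show ?thesis using ga bd j0 unfolding K_def by blast
  qed
  have small: "\<exists>w\<in>K. N w \<le> e" if e: "e > 0" for e
  proof -
    obtain \<eta> where \<eta>: "\<eta> > 0" "\<And>w. good w \<Longrightarrow> (\<forall>M\<in>SL. \<forall>\<xi>. \<bar>w M \<xi>\<bar> \<le> B) \<Longrightarrow> J w = 0 \<Longrightarrow> (\<forall>g\<in>SL. Q w g \<le> \<eta>) \<Longrightarrow> N w \<le> e"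
      unfolding N_def using variance_bound[OF B(1) e] by blast
    \<comment> \<open>The half-sum of \<open>w\<close> and its translate lies in \<open>K\<close>,
      so its \<open>N\<close> is at least \<open>D\<close> and the displacement is at most
      \<open>4 * (N w - D)\<close>. The slack \<open>\<eta> / (4 * 448)\<close> turns this into
      \<open>\<eta> / 448\<close>, which the loss 448 brings back to \<open>\<eta>\<close>.\<close>
    define D where "D = Inf (N ` K)"
    have bdd: "bdd_below (N ` K)" using N0 by (intro bdd_belowI[of _ 0]) auto
    have "\<exists>y\<in>N ` K. y < D + \<eta> / (4 * 448)"
      using cInf_lessD[of "N ` K" "D + \<eta> / (4 * 448)"] hK \<eta>(1) by (auto simp: D_def)
    then obtain w where wK: "w \<in> K" and wD: "N w < D + \<eta> / (4 * 448)" by blast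
    have w: "good w" and wB: "\<forall>M\<in>SL. \<forall>\<xi>. \<bar>w M \<xi>\<bar> \<le> B" and w0: "J w = 0" using wK by (auto simp: K_def)
    have Ql: "Q w (lo s) \<le> \<eta> / 448" for s
    proof -
      let ?u = "\<lambda>M \<xi>. (1/2) * (w M \<xi> + w (M ** lo s) \<xi>)"
      have ws: "good (\<lambda>M \<xi>. w (M ** lo s) \<xi>)" by (intro good_translate w lo_SL)
      have gu: "good ?u" by (intro good_cmult good_add w ws)
      have "D \<le> N ?u" unfolding D_def by (rule cInf_lower[OF imageI[OF half[OF wK]] bdd])
      moreover have "Q w (lo s) = 2 * N w + 2 * N (\<lambda>M \<xi>. w (M ** lo s) \<xi>) - 4 * N ?u"
      proof -
        have "Q w (lo s) = J (\<lambda>M \<xi>. (2 * (w M \<xi>)\<^sup>2 + 2 * (w (M ** lo s) \<xi>)\<^sup>2) - 4 * (?u M \<xi>)\<^sup>2)"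
          unfolding Q_def by (rule J_cong) (simp add: power2_eq_square field_simps)
        also have "\<dots> = J (\<lambda>M \<xi>. 2 * (w M \<xi>)\<^sup>2 + 2 * (w (M ** lo s) \<xi>)\<^sup>2) - J (\<lambda>M \<xi>. 4 * (?u M \<xi>)\<^sup>2)"
          by (rule J_diff; intro good_add good_cmult good_power2 w ws)
        also have "J (\<lambda>M \<xi>. 2 * (w M \<xi>)\<^sup>2 + 2 * (w (M ** lo s) \<xi>)\<^sup>2) = J (\<lambda>M \<xi>. 2 * (w M \<xi>)\<^sup>2) + J (\<lambda>M \<xi>. 2 * (w (M ** lo s) \<xi>)\<^sup>2)"
          by (rule J_add; intro good_cmult good_power2 w ws)
        finally show ?thesis unfolding J_cmult N_def .
      qed
      moreover have "N (\<lambda>M \<xi>. w (M ** lo s) \<xi>) = N w"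
        unfolding N_def by (rule J_translate[OF good_power2[OF w] lo_SL])
      ultimately show ?thesis using wD by simp
    qed
    have "Q w g \<le> \<eta>" if "g \<in> SL" for g
    proof -
      have "Q w g \<le> 448 * (\<eta> / 448)"
        using Q_mult[OF w] Q_continuous[OF w] Ql that by (rule mautner)
      then show ?thesis by simp
    qed
    then have "N w \<le> e" using \<eta>(2)[OF w wB w0] by blast
    then show ?thesis using wK by blast
  qed
  show ?thesis
  proof (rule tendstoI)
    fix e :: real assume e: "e > 0"
    \<comment> \<open>This makes the sup norm term equal to \<open>e / 4\<close>; the element
      \<open>w\<close> is then taken so small in mean square that the other term is at most
      \<open>e / 4\<close> as well.\<close>
    define k where "k = e / (4 * (Bf\<^sup>2 * T))"
    have BT: "Bf\<^sup>2 * T > 0" using Bf(1) T_pos by simp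
    have k: "k > 0" "k * (Bf\<^sup>2 * T) = e / 4" using e BT T_pos Bf(1) by (simp_all add: k_def)
    obtain w where wK: "w \<in> K" and wN: "N w \<le> k * (e / 4)" using small[of "k * (e/4)"] k(1) e by auto
    have w: "good w" and wl: "((\<lambda>t. ip f w t - ip f h t) \<longlongrightarrow> 0) at_top" using wK by (auto simp: K_def)
    have wb: "\<bar>ip f w t\<bar> \<le> e / 2" for t
    proof -
      have "\<bar>ip f w t\<bar> \<le> k * (Bf\<^sup>2 * T) + N w / k" using ip_bound[OF f w Bf(2) k(1)] unfolding N_def by blast
      moreover have "N w / k \<le> e / 4" using wN k(1) by (simp add: field_simps)
      ultimately show ?thesis using k(2) by linarith
    qed
    have "\<forall>\<^sub>F t in at_top. dist (ip f w t - ip f h t) 0 < e / 2" using tendstoD[OF wl, of "e/2"] e by simp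
    then show "\<forall>\<^sub>F t in at_top. dist (ip f h t) 0 < e"
    proof eventually_elim
      case (elim t)
      then have "\<bar>ip f w t - ip f h t\<bar> < e/2" by (simp only: dist_real_def diff_0_right)
      moreover have "\<bar>y\<bar> < e" if "\<bar>x - y\<bar> < e/2" "\<bar>x\<bar> \<le> e/2" for x y :: real using that by linarith
      ultimately show ?case using wb[of t] unfolding dist_real_def diff_0_right by blast
    qed
  qed
qed

theorem mixing:
  assumes f: "good f" and h: "good h"
  shows "((\<lambda>t. ip f h t) \<longlongrightarrow> J f * J h / T) at_top"
proof -
  define h0 where "h0 M \<xi> = h M \<xi> - J h / T" for M :: "real^2^2" and \<xi> :: "real^2"
  have h0: "good h0" unfolding h0_def[abs_def] by (intro good_diff h good_const)
  have J0: "J h0 = 0"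
    unfolding h0_def[abs_def] J_diff[OF h good_const] J_const using T_pos by simp
  have "ip f h t = ip f h0 t + J f * J h / T" for t
  proof -
    have "ip f h t = ip f (\<lambda>M \<xi>. h0 M \<xi> + (J h / T) * 1) t" by (simp add: h0_def)
    also have "\<dots> = ip f h0 t + (J h / T) * ip f (\<lambda>M \<xi>. 1) t"
      unfolding ip_add[OF f h0 good_cmult[OF good_const]] ip_cmult ..
    also have "ip f (\<lambda>M \<xi>. 1) t = J f"
      unfolding ip_def using J_translate[OF f geo_SL] by simp
    finally show ?thesis by (simp add: mult.commute)
  qed
  moreover have "((\<lambda>t. ip f h0 t + J f * J h / T) \<longlongrightarrow> 0 + J f * J h / T) at_top"
    by (intro tendsto_add tendsto_const mixing_mean_zero f h0 J0)
  ultimately show ?thesis by simp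
qed

end

subsection \<open>Thickening and unfolding\<close>

lemma norm_mat22: "norm M = sqrt ((M$1$1)\<^sup>2 + (M$1$2)\<^sup>2 + (M$2$1)\<^sup>2 + (M$2$2)\<^sup>2)" for M :: "real^2^2"
  by (simp add: norm_vec_def L2_set_def sum_2 add.assoc)

lemma norm_adj: "norm (adj h - mat 1) = norm (h - mat 1)"
proof -
  have *: "adj h - mat 1 = adj (h - mat 1)" by (simp add: mat22_eq_iff)
  show ?thesis unfolding * norm_mat22 by (simp add: algebra_simps)
qed

text \<open>\<open>M ** h\<close> may leave the compact set, so \<open>h\<close> is confined to the
  compact part \<open>C\<close> of the unit ball about the identity and uniform continuity is
  applied on \<open>K \<times> C\<close>.\<close>

lemma compact_right_ucont:
  fixes f :: "(real^2^2) \<times> (real^2) \<Rightarrow> real"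
  assumes K: "compact K" "K \<subseteq> SL \<times> UNIV" and f: "continuous_on (SL \<times> UNIV) f" and e: "e > 0"
  shows "\<exists>d>0. \<forall>M \<xi> h. (M,\<xi>) \<in> K \<longrightarrow> h \<in> SL \<longrightarrow> norm (h - mat 1) < d \<longrightarrow> \<bar>f (M ** h, \<xi>) - f (M, \<xi>)\<bar> < e"
proof -
  define C where "C = SL \<inter> cball (mat 1) 1"
  have C: "compact C" unfolding C_def using closed_SL by (simp add: closed_Int_compact)
  define P :: "((real^2^2) \<times> (real^2)) \<times> (real^2^2) \<Rightarrow> real" where "P = (\<lambda>z. f (fst (fst z) ** snd z, snd (fst z)))"
  have "continuous_on (K \<times> C) P"
    unfolding P_def
  proof (rule continuous_on_compose2[OF f])
    show "continuous_on (K \<times> C) (\<lambda>z. (fst (fst z) ** snd z, snd (fst z)))"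
      by (intro continuous_intros)
    show "(\<lambda>z. (fst (fst z) ** snd z, snd (fst z))) ` (K \<times> C) \<subseteq> SL \<times> UNIV"
      using K(2) by (auto simp: C_def)
  qed
  then have "uniformly_continuous_on (K \<times> C) P"
    using K(1) C by (intro compact_uniformly_continuous compact_Times)
  then obtain d where d: "d > 0" "\<And>z z'. z \<in> K \<times> C \<Longrightarrow> z' \<in> K \<times> C \<Longrightarrow> dist z' z < d \<Longrightarrow> dist (P z') (P z) < e"
    using e unfolding uniformly_continuous_on_def by metis
  show ?thesis
  proof (intro exI[of _ "min d 1"] conjI allI impI)
    fix M \<xi> h assume *: "(M,\<xi>) \<in> K" "h \<in> SL" "norm (h - mat 1) < min d 1"
    have "((M,\<xi>), h) \<in> K \<times> C" "((M,\<xi>), mat 1) \<in> K \<times> C"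
      using * by (auto simp: C_def dist_norm norm_minus_commute)
    moreover have "dist ((M,\<xi>), h) ((M,\<xi>), mat 1) < d" using *(3) by (simp add: dist_Pair_Pair dist_norm)
    ultimately have "dist (P ((M,\<xi>), h)) (P ((M,\<xi>), mat 1)) < e" by (intro d(2))
    then show "\<bar>f (M ** h, \<xi>) - f (M, \<xi>)\<bar> < e" by (simp add: P_def dist_real_def)
  qed (use d(1) in simp)
qed

definition SLbox :: "real \<Rightarrow> (real^2^2) set" where
  "SLbox R = {M\<in>SL. \<forall>i j. \<bar>M$i$j\<bar> \<le> R}"

lemma compact_SLbox: "compact (SLbox R)"
proof -
  have "SLbox R = SL \<inter> {M. \<forall>i j. \<bar>M$i$j\<bar> \<le> R}" by (auto simp: SLbox_def)
  moreover have "closed {M::real^2^2. \<forall>i j. \<bar>M$i$j\<bar> \<le> R}"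
    by (intro closed_Collect_all closed_Collect_le continuous_intros)
  ultimately have cl: "closed (SLbox R)" using closed_SL by (simp add: closed_Int)
  have "SLbox R \<subseteq> cball 0 (2 * \<bar>R\<bar>)"
  proof
    fix M assume "M \<in> SLbox R"
    then have "\<bar>M$i$j\<bar> \<le> R" for i j by (simp add: SLbox_def)
    then have b: "(M$i$j)\<^sup>2 \<le> R\<^sup>2" for i j
      using power_mono[of "\<bar>M$i$j\<bar>" R 2] by simp
    have "norm M \<le> sqrt (R\<^sup>2 + R\<^sup>2 + R\<^sup>2 + R\<^sup>2)"
      unfolding norm_mat22 by (intro real_sqrt_le_mono add_mono b)
    also have "R\<^sup>2 + R\<^sup>2 + R\<^sup>2 + R\<^sup>2 = (2 * \<bar>R\<bar>)\<^sup>2" by (simp add: power_mult_distrib)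
    finally have "norm M \<le> \<bar>2 * \<bar>R\<bar>\<bar>" by (simp only: real_sqrt_abs)
    then show "M \<in> cball 0 (2 * \<bar>R\<bar>)" by simp
  qed
  then have "bounded (SLbox R)" using bounded_cball bounded_subset by blast
  then show ?thesis using cl by (simp add: compact_eq_bounded_closed)
qed

text \<open>If \<open>g\<close> lies outside the box but \<open>g ** h\<close> inside, the estimate
  is made at \<open>g ** h\<close> with \<open>adj h\<close>, whose distance from the identity
  equals that of \<open>h\<close>.\<close>

lemma compact_support_ucont:
  fixes \<rho> :: "real^2^2 \<Rightarrow> real"
  assumes c: "continuous_on SL \<rho>" and s: "\<And>M. M \<in> SL \<Longrightarrow> \<rho> M \<noteq> 0 \<Longrightarrow> M \<in> SLbox R" and e: "e > 0"
  shows "\<exists>d>0. \<forall>g\<in>SL. \<forall>h\<in>SL. norm (h - mat 1) < d \<longrightarrow> \<bar>\<rho> (g ** h) - \<rho> g\<bar> < e"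
proof -
  have "\<exists>d>0. \<forall>M \<xi> h. (M,\<xi>) \<in> SLbox R \<times> {0::real^2} \<longrightarrow> h \<in> SL \<longrightarrow> norm (h - mat 1) < d \<longrightarrow> \<bar>(\<rho> \<circ> fst) (M ** h, \<xi>) - (\<rho> \<circ> fst) (M, \<xi>)\<bar> < e"
  proof (rule compact_right_ucont[OF _ _ _ e])
    show "compact (SLbox R \<times> {0::real^2})" by (intro compact_Times compact_SLbox) simp
    show "SLbox R \<times> {0::real^2} \<subseteq> SL \<times> UNIV" by (auto simp: SLbox_def)
    show "continuous_on (SL \<times> (UNIV::(real^2) set)) (\<rho> \<circ> fst)"
      by (rule continuous_on_compose[OF continuous_on_fst[OF continuous_on_id]]) (simp add: c)
  qed
  then obtain d where d: "d > 0" "\<And>M h. M \<in> SLbox R \<Longrightarrow> h \<in> SL \<Longrightarrow> norm (h - mat 1) < d \<Longrightarrow> \<bar>\<rho> (M ** h) - \<rho> M\<bar> < e"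
    by auto
  show ?thesis
  proof (intro exI[of _ d] conjI ballI impI)
    fix g h assume *: "g \<in> SL" "h \<in> SL" "norm (h - mat 1) < d"
    show "\<bar>\<rho> (g ** h) - \<rho> g\<bar> < e"
    proof (cases "g \<in> SLbox R")
      case True
      then show ?thesis using d(2) * by blast
    next
      case False
      then have g0: "\<rho> g = 0" using s * by blast
      show ?thesis
      proof (cases "g ** h \<in> SLbox R")
        case True
        then have "\<bar>\<rho> ((g ** h) ** adj h) - \<rho> (g ** h)\<bar> < e"
          using d(2)[of "g ** h" "adj h"] * by (simp add: norm_adj)
        then show ?thesis using * by (simp add: abs_minus_commute)
      next
        case False
        then show ?thesis using s[of "g ** h"] * g0 e by fastforce
      qed
    qed
  qed (rule d(1))
qed

section \<open>Counting group elements in boxes\<close>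

lemma finite_theta_box: "finite (Gamma_theta \<inter> SLbox R)"
proof -
  define k where "k = \<lceil>\<bar>R\<bar>\<rceil>"
  have "Gamma_theta \<inter> SLbox R \<subseteq> (\<lambda>(p,q,r,s). mat22 (of_int p) (of_int q) (of_int r) (of_int s)) ` ({-k..k} \<times> {-k..k} \<times> {-k..k} \<times> {-k..k})"
  proof
    fix M assume M: "M \<in> Gamma_theta \<inter> SLbox R"
    then obtain p q r s :: int where e: "M = mat22 (of_int p) (of_int q) (of_int r) (of_int s)"
      using theta_parity by blast
    have b: "\<bar>M$i$j\<bar> \<le> R" for i j using M by (auto simp: SLbox_def)
    have ib: "x \<in> {-k..k}" if "\<bar>real_of_int x\<bar> \<le> R" for x
    proof -
      have "real_of_int \<bar>x\<bar> \<le> of_int k" using that unfolding k_def by linarith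
      then show ?thesis by auto
    qed
    show "M \<in> (\<lambda>(p,q,r,s). mat22 (of_int p) (of_int q) (of_int r) (of_int s)) ` ({-k..k} \<times> {-k..k} \<times> {-k..k} \<times> {-k..k})"
      using b[of 1 1] b[of 1 2] b[of 2 1] b[of 2 2] by (intro image_eqI[of _ _ "(p,q,r,s)"]) (auto simp: e intro!: ib simp del: atLeastAtMost_iff)
  qed
  then show ?thesis by (rule finite_subset) auto
qed

text \<open>Two such elements \<open>G\<close> and \<open>G0\<close> differ by
  \<open>(G ** M) ** adj (G0 ** M)\<close>, which lies in \<open>Gamma_theta\<close> and has entries
  at most \<open>2 * R^2\<close>. The bound does not depend on \<open>M\<close>; this uniformity is
  what makes folded functions bounded and uniformly continuous.\<close>

lemma theta_box_card:
  assumes M: "M \<in> SL"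
  shows "finite {G\<in>Gamma_theta. G ** M \<in> SLbox R}"
    "card {G\<in>Gamma_theta. G ** M \<in> SLbox R} \<le> card (Gamma_theta \<inter> SLbox (2 * R\<^sup>2))"
proof -
  let ?A = "{G\<in>Gamma_theta. G ** M \<in> SLbox R}" and ?Z = "Gamma_theta \<inter> SLbox (2 * R\<^sup>2)"
  have fc: "finite ?A \<and> card ?A \<le> card ?Z"
  proof (cases "?A = {}")
    case False
    then obtain G0 where G0: "G0 \<in> Gamma_theta" "G0 ** M \<in> SLbox R" by blast
    define F where "F G = G ** adj G0" for G :: "real^2^2"
    have inj: "inj_on F ?A"
    proof (rule inj_onI)
      fix G G' assume "F G = F G'"
      then have "(G ** adj G0) ** G0 = (G' ** adj G0) ** G0" by (simp only: F_def)
      then show "G = G'" using G0 by simp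
    qed
    have sub: "F ` ?A \<subseteq> ?Z"
    proof (rule image_subsetI)
      fix G assume G: "G \<in> ?A"
      have Ft: "F G \<in> Gamma_theta" using G G0 by (simp add: F_def)
      have FG: "F G = (G ** M) ** adj (G0 ** M)"
      proof -
        have "adj (G0 ** M) = adj M ** adj G0" by (simp add: mat22_eq_iff)
        then show ?thesis using M by (simp add: F_def matrix_mul_assoc[symmetric])
      qed
      have "\<bar>((G ** M) ** adj (G0 ** M)) $ i $ j\<bar> \<le> 2 * R\<^sup>2" for i j
      proof -
        have a: "\<bar>(G ** M)$i$l\<bar> \<le> R" for l using G by (simp add: SLbox_def)
        have "\<bar>adj N $ l $ j\<bar> \<le> R" if "N \<in> SLbox R" for l N
          
        proof -
          have "\<bar>N$a$b\<bar> \<le> R" for a b using that by (simp add: SLbox_def)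
          then show ?thesis using exhaust_2[of l] exhaust_2[of j] by (elim disjE) simp_all
        qed
        then have b: "\<bar>adj (G0 ** M)$l$j\<bar> \<le> R" for l using G0 by blast
        have R: "0 \<le> R" using a[of 1] by linarith
        have "\<bar>((G ** M) ** adj (G0 ** M)) $ i $ j\<bar> \<le> \<bar>(G ** M)$i$1\<bar> * \<bar>adj (G0 ** M)$1$j\<bar> + \<bar>(G ** M)$i$2\<bar> * \<bar>adj (G0 ** M)$2$j\<bar>"
          unfolding matrix_mult_nth_22[of "G ** M"] by (rule order.trans[OF abs_triangle_ineq]) (simp add: abs_mult)
        also have "\<dots> \<le> R * R + R * R" using a b R by (intro add_mono mult_mono) auto
        finally show ?thesis by (simp add: power2_eq_square)
      qed
      then have "\<forall>i j. \<bar>F G $ i $ j\<bar> \<le> 2 * R\<^sup>2" unfolding FG by blast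
      then show "F G \<in> ?Z" using Ft theta_SL[OF Ft] unfolding SLbox_def by blast
    qed
    show ?thesis
      using finite_imageD[OF finite_subset[OF sub finite_theta_box] inj] card_inj_on_le[OF inj sub finite_theta_box] by (rule conjI)
  next
    case True
    show ?thesis unfolding True by simp
  qed
  then show "finite ?A" "card ?A \<le> card ?Z" by auto
qed

section \<open>The Poincare series of a compactly supported function\<close>

context
  fixes \<rho> :: "real^2^2 \<Rightarrow> real" and R :: real and v :: "real^2"
  assumes \<rho>_cont: "continuous_on SL \<rho>" and \<rho>_supp: "\<And>M. M \<in> SL \<Longrightarrow> \<rho> M \<noteq> 0 \<Longrightarrow> M \<in> SLbox R"
    and \<rho>_nonneg: "\<And>M. 0 \<le> \<rho> M"
begin

text \<open>Listing only the nonzero terms keeps the series a finite sum. The congruence selects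
  those \<open>G\<close> that bring \<open>\<xi>\<close> to the class of \<open>v\<close>, so the
  series is concentrated on the orbit of \<open>v\<close>.\<close>

definition theta_fold_set :: "real^2^2 \<Rightarrow> real^2 \<Rightarrow> (real^2^2) set" where
  "theta_fold_set M \<xi> = {G\<in>Gamma_theta. G *v \<xi> - v \<in> Int_lattice \<and> \<rho> (G ** M) \<noteq> 0}"

definition theta_fold :: "real^2^2 \<Rightarrow> real^2 \<Rightarrow> real" where
  "theta_fold M \<xi> = (\<Sum>G\<in>theta_fold_set M \<xi>. \<rho> (G ** M))"

lemma theta_fold_set_finite:
  assumes "M \<in> SL" shows "finite (theta_fold_set M \<xi>)" "card (theta_fold_set M \<xi>) \<le> card (Gamma_theta \<inter> SLbox (2 * R\<^sup>2))"
proof -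
  have sub: "theta_fold_set M \<xi> \<subseteq> {G\<in>Gamma_theta. G ** M \<in> SLbox R}"
    using \<rho>_supp assms by (auto simp: theta_fold_set_def)
  show "finite (theta_fold_set M \<xi>)" using finite_subset[OF sub theta_box_card(1)[OF assms]] .
  show "card (theta_fold_set M \<xi>) \<le> card (Gamma_theta \<inter> SLbox (2 * R\<^sup>2))"
    using card_mono[OF theta_box_card(1)[OF assms] sub] theta_box_card(2)[OF assms, of R] by linarith
qed

lemma theta_fold_nonneg: "0 \<le> theta_fold M \<xi>"
  unfolding theta_fold_def by (intro sum_nonneg \<rho>_nonneg)

lemma theta_fold_good: "good theta_fold"
proof -
  define C where "C = card (Gamma_theta \<inter> SLbox (2 * R\<^sup>2))"
  have "compact (\<rho> ` SLbox R)"
    by (rule compact_continuous_image[OF continuous_on_subset[OF \<rho>_cont] compact_SLbox]) (auto simp: SLbox_def)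
  then obtain b where b: "\<And>M. M \<in> SLbox R \<Longrightarrow> \<bar>\<rho> M\<bar> \<le> b" by (meson compact_imp_bounded bounded_real imageI)
  have \<rho>b: "\<rho> M \<le> \<bar>b\<bar>" if "M \<in> SL" for M
    using b[of M] \<rho>_supp[OF that] by (cases "\<rho> M = 0") auto
  show ?thesis
  proof (rule goodI[of _ "real C * \<bar>b\<bar>"])
    fix M \<xi> G n assume M: "M \<in> SL" and G: "G \<in> Gamma_theta" and n: "n \<in> Int_lattice"
    show "theta_fold (G ** M) (G *v \<xi> + n) = theta_fold M \<xi>"
      unfolding theta_fold_def
    proof (rule sum.reindex_bij_witness[where i="\<lambda>H. H ** adj G" and j="\<lambda>H. H ** G"])
      fix H assume H: "H \<in> theta_fold_set (G ** M) (G *v \<xi> + n)"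
      show "(H ** G) ** adj G = H" using G by simp
      have Ht: "H \<in> Gamma_theta" using H by (simp add: theta_fold_set_def)
      have "H *v (G *v \<xi> + n) - v \<in> Int_lattice" using H by (simp add: theta_fold_set_def)
      then have "H *v (G *v \<xi> + n) - v - H *v n \<in> Int_lattice"
        by (rule Int_lattice_diff[OF _ Int_lattice_theta[OF Ht n]])
      then have "(H ** G) *v \<xi> - v \<in> Int_lattice"
        by (simp add: matrix_vector_right_distrib matrix_vector_mul_assoc algebra_simps)
      then show "H ** G \<in> theta_fold_set M \<xi>"
        using H G Ht by (simp add: theta_fold_set_def matrix_mul_assoc)
      show "\<rho> (H ** G ** M) = \<rho> (H ** (G ** M))" by (simp only: matrix_mul_assoc)
    next
      fix H assume H: "H \<in> theta_fold_set M \<xi>"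
      show "H ** adj G ** G = H" using G by simp
      have Ht: "H \<in> Gamma_theta" using H by (simp add: theta_fold_set_def)
      have e: "(H ** adj G) *v (G *v \<xi> + n) = H *v \<xi> + (H ** adj G) *v n"
        using G by (simp only: matrix_vector_right_distrib matrix_vector_mul_assoc adj_mult_cancel theta_SL)
      have "(H *v \<xi> - v) + (H ** adj G) *v n \<in> Int_lattice"
      proof (rule Int_lattice_add)
        show "H *v \<xi> - v \<in> Int_lattice" using H by (simp add: theta_fold_set_def)
        show "(H ** adj G) *v n \<in> Int_lattice"
          by (rule Int_lattice_theta[OF theta_mult[OF Ht theta_adj[OF G]] n])
      qed
      then have "(H ** adj G) *v (G *v \<xi> + n) - v \<in> Int_lattice"
        unfolding e by (simp add: algebra_simps)
      moreover have "H ** adj G ** (G ** M) = H ** M" using G by (simp add: matrix_mul_assoc[symmetric])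
      ultimately show "H ** adj G \<in> theta_fold_set (G ** M) (G *v \<xi> + n)"
        using H G Ht by (simp add: theta_fold_set_def)
    qed
  next
    fix M :: "real^2^2" and \<xi> :: "real^2" assume M: "M \<in> SL"
    have "theta_fold M \<xi> \<le> (\<Sum>G\<in>theta_fold_set M \<xi>. \<bar>b\<bar>)"
      unfolding theta_fold_def using M by (intro sum_mono \<rho>b) (auto simp: theta_fold_set_def)
    also have "\<dots> \<le> real C * \<bar>b\<bar>"
      using theta_fold_set_finite(2)[OF M] by (simp add: C_def mult_right_mono)
    finally show "\<bar>theta_fold M \<xi>\<bar> \<le> real C * \<bar>b\<bar>" using theta_fold_nonneg by simp
  next
    fix e :: real assume e: "e > 0"
    \<comment> \<open>The two index sets together have at most \<open>2 * C\<close> elements; the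
      added 1 covers \<open>C = 0\<close>.\<close>
    define e' where "e' = e / (2 * real C + 1)"
    have e': "e' > 0" "2 * real C * e' < e"
    proof -
      show "e' > 0" using e by (simp add: e'_def)
      then have "2 * real C * e' < (2 * real C + 1) * e'" by (simp add: algebra_simps)
      also have "\<dots> = e" by (simp add: e'_def add_nonneg_eq_0_iff)
      finally show "2 * real C * e' < e" .
    qed
    obtain d where d: "d > 0" "\<And>g h. g \<in> SL \<Longrightarrow> h \<in> SL \<Longrightarrow> norm (h - mat 1) < d \<Longrightarrow> \<bar>\<rho> (g ** h) - \<rho> g\<bar> < e'"
      using compact_support_ucont[OF \<rho>_cont \<rho>_supp e'(1)] by blast
    show "\<exists>d>0. \<forall>M\<in>SL. \<forall>\<xi>. \<forall>h\<in>SL. norm (h - mat 1) < d \<longrightarrow> \<bar>theta_fold (M ** h) \<xi> - theta_fold M \<xi>\<bar> < e"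
    proof (intro exI[of _ d] conjI ballI allI impI)
      fix M \<xi> h assume *: "M \<in> SL" "h \<in> SL" "norm (h - mat 1) < d"
      let ?U = "theta_fold_set (M ** h) \<xi> \<union> theta_fold_set M \<xi>"
      have fin: "finite ?U" using theta_fold_set_finite(1) * by simp
      have cU: "real (card ?U) \<le> 2 * real C"
        using card_Un_le[of "theta_fold_set (M ** h) \<xi>" "theta_fold_set M \<xi>"] theta_fold_set_finite(2)[of M \<xi>] theta_fold_set_finite(2)[of "M ** h" \<xi>] *
        by (simp add: C_def)
      have "theta_fold (M ** h) \<xi> = (\<Sum>G\<in>?U. \<rho> (G ** (M ** h)))" "theta_fold M \<xi> = (\<Sum>G\<in>?U. \<rho> (G ** M))"
        unfolding theta_fold_def using fin by (auto intro!: sum.mono_neutral_left simp: theta_fold_set_def)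
      then have "\<bar>theta_fold (M ** h) \<xi> - theta_fold M \<xi>\<bar> = \<bar>\<Sum>G\<in>?U. \<rho> (G ** M ** h) - \<rho> (G ** M)\<bar>"
        by (simp add: sum_subtractf matrix_mul_assoc)
      also have "\<dots> \<le> (\<Sum>G\<in>?U. \<bar>\<rho> (G ** M ** h) - \<rho> (G ** M)\<bar>)" by (rule sum_abs)
      also have "\<dots> \<le> (\<Sum>G\<in>?U. e')"
      proof (rule sum_mono)
        fix G assume "G \<in> ?U"
        then have "G \<in> Gamma_theta" by (auto simp: theta_fold_set_def)
        then show "\<bar>\<rho> (G ** M ** h) - \<rho> (G ** M)\<bar> \<le> e'" using d(2)[of "G ** M" h] * by simp
      qed
      also have "\<dots> \<le> 2 * real C * e'" using cU e'(1) by (simp add: mult_right_mono)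
      finally show "\<bar>theta_fold (M ** h) \<xi> - theta_fold M \<xi>\<bar> < e" using e'(2) by linarith
    qed (rule d(1))
  qed
qed

text \<open>After unfolding, each \<open>G\<close> with \<open>\<rho> (G ** M) \<noteq> 0\<close>
  belongs to exactly one index \<open>p\<close>, the representative of \<open>adj G *v v\<close>,
  and invariance moves the value of \<open>f\<close> from \<open>(G ** M ** geo t, v)\<close> to
  \<open>(M ** geo t, p)\<close>.\<close>

lemma theta_fold_unfold:
  assumes S: "torus_orbit_set S" and v0: "v0 \<in> S" "v0 - v \<in> Int_lattice"
    and f: "good f" and f0: "\<And>M \<xi>. 0 \<le> f M \<xi>"
  shows "(\<integral>\<^sup>+M. ennreal (f (M ** geo t) v * \<rho> M) \<partial>haar) = ennreal (torus_orbit_set.ip S f theta_fold t)"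
proof -
  interpret torus_orbit_set S by fact
  have ft: "good (\<lambda>M \<xi>. f (M ** geo t) \<xi>)" by (intro good_translate f geo_SL)
  have [measurable]: "\<rho> \<in> borel_measurable SLb" by (rule borel_measurable_continuous_on_restrict[OF \<rho>_cont])
  have [measurable]: "(\<lambda>M. f (M ** geo t) v) \<in> borel_measurable SLb" using good_measurable[OF ft] by simp
  have mm: "(\<lambda>M. ennreal (f (M ** geo t) v * \<rho> M)) \<in> borel_measurable SLb" by measurable
  have ptw: "(\<integral>\<^sup>+G. ennreal (f (G ** M ** geo t) v * \<rho> (G ** M)) \<partial>count_space Gamma_theta) = ennreal (\<Sum>p\<in>S. f (M ** geo t) p * theta_fold M p)"
    if M: "M \<in> SL" for M
  proof -
    define A where "A = {G\<in>Gamma_theta. \<rho> (G ** M) \<noteq> 0}"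
    have finA: "finite A"
      using \<rho>_supp M by (intro finite_subset[OF _ theta_box_card(1)[OF M, of R]]) (auto simp: A_def)
    have "(\<integral>\<^sup>+G. ennreal (f (G ** M ** geo t) v * \<rho> (G ** M)) \<partial>count_space Gamma_theta) = (\<Sum>G\<in>A. ennreal (f (G ** M ** geo t) v * \<rho> (G ** M)))"
      by (rule nn_integral_count_space'[OF finA]) (auto simp: A_def)
    also have "\<dots> = ennreal (\<Sum>G\<in>A. f (G ** M ** geo t) v * \<rho> (G ** M))"
      by (rule sum_ennreal) (simp add: f0 \<rho>_nonneg)
    also have "(\<Sum>G\<in>A. f (G ** M ** geo t) v * \<rho> (G ** M)) = (\<Sum>p\<in>S. \<Sum>G\<in>theta_fold_set M p. f (M ** geo t) p * \<rho> (G ** M))"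
    proof -
      have AU: "A = (\<Union>p\<in>S. theta_fold_set M p)"
      proof (intro equalityI subsetI)
        fix G assume G: "G \<in> A"
        then have Gt: "G \<in> Gamma_theta" by (simp add: A_def)
        obtain q where q: "q \<in> S" "adj G *v v0 - q \<in> Int_lattice" using act[OF theta_adj[OF Gt] v0(1)] by blast
        have "(v0 - v) - G *v (adj G *v v0 - q) \<in> Int_lattice"
          by (rule Int_lattice_diff[OF v0(2) Int_lattice_theta[OF Gt q(2)]])
        moreover have "(v0 - v) - G *v (adj G *v v0 - q) = G *v q - v"
          using Gt by (simp add: matrix_vector_mult_diff_distrib matrix_vector_mul_assoc)
        ultimately show "G \<in> (\<Union>p\<in>S. theta_fold_set M p)" using q(1) G by (auto simp: theta_fold_set_def A_def)
      qed (auto simp: theta_fold_set_def A_def)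
      have disj: "theta_fold_set M p \<inter> theta_fold_set M q = {}" if pq: "p \<in> S" "q \<in> S" "p \<noteq> q" for p q
      proof (rule ccontr)
        assume "theta_fold_set M p \<inter> theta_fold_set M q \<noteq> {}"
        then obtain G where G: "G \<in> Gamma_theta" "G *v p - v \<in> Int_lattice" "G *v q - v \<in> Int_lattice"
          by (auto simp: theta_fold_set_def)
        have "adj G *v ((G *v p - v) - (G *v q - v)) \<in> Int_lattice"
          by (rule Int_lattice_theta[OF theta_adj[OF G(1)] Int_lattice_diff[OF G(2,3)]])
        moreover have "adj G *v ((G *v p - v) - (G *v q - v)) = p - q"
          using G(1) by (simp add: matrix_vector_mult_diff_distrib matrix_vector_mul_assoc)
        ultimately show False using reps pq by metis
      qed
      have "(\<Sum>G\<in>A. f (G ** M ** geo t) v * \<rho> (G ** M)) = (\<Sum>p\<in>S. \<Sum>G\<in>theta_fold_set M p. f (G ** M ** geo t) v * \<rho> (G ** M))"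
        unfolding AU using finS theta_fold_set_finite(1)[OF M] disj by (intro sum.UNION_disjoint) auto
      also have "\<dots> = (\<Sum>p\<in>S. \<Sum>G\<in>theta_fold_set M p. f (M ** geo t) p * \<rho> (G ** M))"
      proof (intro sum.cong refl)
        fix p G assume "G \<in> theta_fold_set M p"
        then have G: "G \<in> Gamma_theta" "G *v p - v \<in> Int_lattice" by (auto simp: theta_fold_set_def)
        have "f (G ** (M ** geo t)) (G *v p + - (G *v p - v)) = f (M ** geo t) p"
          using G M by (intro good_inv f Int_lattice_minus) auto
        then show "f (G ** M ** geo t) v * \<rho> (G ** M) = f (M ** geo t) p * \<rho> (G ** M)"
          by (simp add: matrix_mul_assoc)
      qed
      finally show ?thesis .
    qed
    finally show ?thesis by (simp only: theta_fold_def sum_distrib_left)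
  qed
  have mf: "(\<lambda>M. \<Sum>p\<in>S. f (M ** geo t) p * theta_fold M p) \<in> borel_measurable SLb"
    using good_measurable[OF ft] good_measurable[OF theta_fold_good] by measurable
  have "(\<integral>\<^sup>+M. ennreal (f (M ** geo t) v * \<rho> M) \<partial>haar)
     = (\<integral>\<^sup>+M. indicator FD M * (\<integral>\<^sup>+G. ennreal (f (G ** M ** geo t) v * \<rho> (G ** M)) \<partial>count_space Gamma_theta) \<partial>haar)"
    by (rule unfold_haar[OF mm])
  also have "\<dots> = (\<integral>\<^sup>+M. indicator FD M * ennreal (\<Sum>p\<in>S. f (M ** geo t) p * theta_fold M p) \<partial>haar)"
    by (rule nn_integral_cong) (simp add: ptw)
  also have "\<dots> = (\<integral>\<^sup>+M. ennreal (\<Sum>p\<in>S. f (M ** geo t) p * theta_fold M p) \<partial>fdm)"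
    by (rule nn_integral_fdm[symmetric]) (use mf in measurable)
  also have "\<dots> = ennreal (\<integral>M. (\<Sum>p\<in>S. f (M ** geo t) p * theta_fold M p) \<partial>fdm)"
    by (rule nn_integral_eq_integral)
       (auto intro!: Bochner_Integration.integrable_sum good_integrable[OF ip_good[OF f theta_fold_good]] sum_nonneg mult_nonneg_nonneg f0 theta_fold_nonneg)
  also have "(\<integral>M. (\<Sum>p\<in>S. f (M ** geo t) p * theta_fold M p) \<partial>fdm) = ip f theta_fold t"
    unfolding ip_def J_def
    by (rule Bochner_Integration.integral_sum) (rule good_integrable[OF ip_good[OF f theta_fold_good]])
  finally show ?thesis .
qed

end

section \<open>Equidistribution for continuous densities\<close>

lemma integrable_compact_support:
  fixes g :: "real \<Rightarrow> real"
  assumes [measurable]: "g \<in> borel_measurable borel" and b: "\<And>x. \<bar>g x\<bar> \<le> C" and z: "\<And>x. g x \<noteq> 0 \<Longrightarrow> \<bar>x\<bar> \<le> R"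
  shows "integrable lborel g"
proof (rule Bochner_Integration.integrable_bound)
  show "integrable lborel (\<lambda>x. C * indicator {-R..R} x :: real)"
    by (intro integrable_mult_right integrable_real_indicator) (simp_all add: emeasure_lborel_Icc_eq)
  show "AE x in lborel. norm (g x) \<le> norm (C * indicator {-R..R} x :: real)"
  proof (rule AE_I2)
    fix x
    have "0 \<le> C" using b[of 0] by linarith
    then show "norm (g x) \<le> norm (C * indicator {-R..R} x :: real)"
      using b[of x] z[of x] by (cases "g x = 0") (auto simp: abs_le_iff)
  qed
qed simp

definition tent :: "real \<Rightarrow> real \<Rightarrow> real" where "tent r x = max 0 (r - \<bar>x\<bar>)"

lemma tent_nonneg [simp]: "0 \<le> tent r x" by (simp add: tent_def)
lemma tent_zero: "tent r x \<noteq> 0 \<Longrightarrow> \<bar>x\<bar> < r" by (auto simp: tent_def max_def split: if_splits)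
lemma tent_continuous [continuous_intros]: "continuous_on A g \<Longrightarrow> continuous_on A (\<lambda>x. tent r (g x))"
  unfolding tent_def by (intro continuous_intros)
lemma tent_measurable [measurable]: "tent r \<in> borel_measurable borel"
  unfolding tent_def by measurable

lemma tent_integrable: "integrable lborel (tent r)"
  by (rule integrable_compact_support[of _ "\<bar>r\<bar>" "\<bar>r\<bar>"]) (auto simp: tent_def)

lemma tent_integral_pos:
  assumes r: "r > 0" shows "0 < (\<integral>x. tent r x \<partial>lborel)"
proof -
  have "(\<integral>x. r/2 * indicator {-(r/2)..r/2} x \<partial>lborel) \<le> (\<integral>x. tent r x \<partial>lborel)"
  proof (rule integral_mono[OF _ tent_integrable])
    show "integrable lborel (\<lambda>x. r/2 * indicator {-(r/2)..r/2} x :: real)"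
      by (intro integrable_mult_right integrable_real_indicator) (simp_all add: emeasure_lborel_Icc_eq)
  qed (auto simp: tent_def indicator_def)
  moreover have "(\<integral>x. r/2 * indicator {-(r/2)..r/2} x \<partial>lborel) = r/2 * r"
    using r by (simp add: measure_def)
  ultimately show ?thesis using r mult_pos_pos[of "r/2" r] by linarith
qed

lemma nn_integral_product3:
  fixes a b e :: "real \<Rightarrow> real"
  assumes i: "integrable lborel a" "integrable lborel b" "integrable lborel e"
    and n: "\<And>x. 0 \<le> a x" "\<And>x. 0 \<le> b x" "\<And>x. 0 \<le> e x"
  shows "(\<integral>\<^sup>+z. \<integral>\<^sup>+y. \<integral>\<^sup>+x. ennreal (a x * b y * e z) \<partial>lborel \<partial>lborel \<partial>lborel) =
    ennreal ((\<integral>x. a x \<partial>lborel) * (\<integral>x. b x \<partial>lborel) * (\<integral>x. e x \<partial>lborel))"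
proof -
  have [measurable]: "a \<in> borel_measurable borel" "b \<in> borel_measurable borel" "e \<in> borel_measurable borel"
    using i by (auto dest: borel_measurable_integrable)
  have A: "(\<integral>\<^sup>+x. ennreal (a x) \<partial>lborel) = ennreal (\<integral>x. a x \<partial>lborel)" "(\<integral>\<^sup>+x. ennreal (b x) \<partial>lborel) = ennreal (\<integral>x. b x \<partial>lborel)"
    "(\<integral>\<^sup>+x. ennreal (e x) \<partial>lborel) = ennreal (\<integral>x. e x \<partial>lborel)"
    using i n by (auto intro!: nn_integral_eq_integral)
  have p: "0 \<le> (\<integral>x. a x \<partial>lborel)" "0 \<le> (\<integral>x. b x \<partial>lborel)" using n by auto
  have "(\<integral>\<^sup>+z. \<integral>\<^sup>+y. \<integral>\<^sup>+x. ennreal (a x * b y * e z) \<partial>lborel \<partial>lborel \<partial>lborel) =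
    (\<integral>\<^sup>+z. \<integral>\<^sup>+y. \<integral>\<^sup>+x. ennreal (a x) * (ennreal (b y) * ennreal (e z)) \<partial>lborel \<partial>lborel \<partial>lborel)"
    using n by (intro nn_integral_cong) (simp add: ennreal_mult mult.assoc)
  also have "\<dots> = ennreal (\<integral>x. a x \<partial>lborel) * (ennreal (\<integral>x. b x \<partial>lborel) * ennreal (\<integral>x. e x \<partial>lborel))"
    by (simp add: nn_integral_multc nn_integral_cmult A)
  also have "\<dots> = ennreal ((\<integral>x. a x \<partial>lborel) * (\<integral>x. b x \<partial>lborel) * (\<integral>x. e x \<partial>lborel))"
    using p n by (simp add: ennreal_mult mult.assoc)
  finally show ?thesis .
qed

definition lowtri :: "real \<Rightarrow> real \<Rightarrow> real^2^2" where "lowtri c d = mat22 (1/d) 0 c d"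

lemma lowtri_SL [simp]: "d \<noteq> 0 \<Longrightarrow> lowtri c d \<in> SL"
  by (simp add: lowtri_def SL_def)

lemma par_lowtri: "d \<noteq> 0 \<Longrightarrow> par u c d = up u ** lowtri c d"
  by (simp add: par_def up_def lowtri_def)

text \<open>The flow leaves \<open>d\<close> alone and contracts \<open>c\<close>. Hence a point
  displaced from the horocycle by \<open>lowtri c d\<close> stays within the initial bounds on
  \<open>c\<close> and \<open>d\<close> for all \<open>t \<ge> 0\<close>.\<close>

lemma lowtri_geo: "lowtri c d ** geo t = geo t ** lowtri (c * exp (- t)) d"
proof -
  have "exp (t/2) * exp (-t) = 1 / exp (t/2)"
    by (simp add: exp_minus_inverse field_simps flip: exp_add exp_minus)
  then have "exp (t/2) * (c * exp (-t)) = c / exp (t/2)" by (simp add: mult.left_commute)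
  then show ?thesis
    by (simp add: geo_def lowtri_def dg_def mult.commute[of _ d])
qed

lemma lowtri_near_one:
  assumes e: "e > 0"
  shows "\<exists>r>0. r \<le> 1/2 \<and> (\<forall>c d. \<bar>c\<bar> < r \<longrightarrow> \<bar>d - 1\<bar> < r \<longrightarrow> norm (lowtri c d - mat 1) < e)"
proof -
  \<comment> \<open>On this region \<open>1/d\<close> is continuous; a radius of at most
    \<open>1/2\<close> keeps \<open>d\<close> inside it.\<close>
  let ?A = "UNIV \<times> {1/4<..} :: (real \<times> real) set"
  have "continuous_on ?A (\<lambda>z. lowtri (fst z) (snd z))"
    unfolding lowtri_def by (intro continuous_intros) auto
  then obtain r where r: "r > 0" "\<And>z. z \<in> ?A \<Longrightarrow> dist z (0,1) < r \<Longrightarrow> dist (lowtri (fst z) (snd z)) (lowtri 0 1) < e"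
    using e unfolding continuous_on_iff by (force dest: bspec[of _ _ "(0,1)"])
  have one: "lowtri 0 1 = mat 1" by (simp add: lowtri_def mat_1_mat22)
  show ?thesis
  proof (intro exI[of _ "min (1/2) (r/2)"] conjI allI impI)
    fix c d assume *: "\<bar>c\<bar> < min (1/2) (r/2)" "\<bar>d - 1\<bar> < min (1/2) (r/2)"
    have "dist (c,d) (0,1) \<le> \<bar>c\<bar> + \<bar>d - 1\<bar>"
      unfolding dist_Pair_Pair dist_real_def using sqrt_sum_squares_le_sum_abs[of "\<bar>c\<bar>" "\<bar>d - 1\<bar>"] by simp
    also have "\<dots> < r" using * by linarith
    finally have "dist (c,d) (0,1) < r" .
    moreover have "1/4 < d" using * by linarith
    then have "(c,d) \<in> ?A" by simp
    ultimately show "norm (lowtri c d - mat 1) < e" using r(2)[of "(c,d)"] by (simp add: one dist_norm)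
  qed (use r(1) in auto)
qed

lemma good_cong: "good f \<Longrightarrow> (\<And>M \<xi>. M \<in> SL \<Longrightarrow> f M \<xi> = g M \<xi>) \<Longrightarrow> good g"
  unfolding good_def by (simp cong: ball_cong)

lemma good_up_measurable:
  assumes f: "good f" shows "(\<lambda>u. f (up u ** geo t) v) \<in> borel_measurable borel"
proof -
  have "(\<lambda>u. up u) \<in> measurable borel SLb"
  proof (rule measurable_SLbI)
    show "(\<lambda>u. up u) \<in> borel_measurable borel" unfolding up_def by measurable
  qed simp
  from measurable_compose[OF this good_measurable[OF good_translate[OF f geo_SL]]] show ?thesis .
qed

context torus_orbit_set
begin

lemma equidistribution_continuous:
  assumes v0: "v0 \<in> S" "v0 - v \<in> Int_lattice"
    and f: "good f" and f0: "\<And>M \<xi>. 0 \<le> f M \<xi>"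
    and h: "continuous_on UNIV h" and h0: "\<And>u. 0 \<le> h u" and hs: "\<And>u. h u \<noteq> 0 \<Longrightarrow> \<bar>u\<bar> \<le> R0"
  shows "((\<lambda>t. \<integral>u. h u * f (up u ** geo t) v \<partial>lborel) \<longlongrightarrow> (J f / T) * (\<integral>u. h u \<partial>lborel)) at_top"
proof (rule tendstoI)
  fix e :: real assume e: "e > 0"
  have [measurable]: "h \<in> borel_measurable borel" by (rule borel_measurable_continuous_onI[OF h])
  obtain Bh where Bh: "\<And>u. \<bar>h u\<bar> \<le> Bh"
  proof -
    have "compact (h ` {-R0..R0})" by (rule compact_continuous_image[OF continuous_on_subset[OF h]]) auto
    then obtain b where b: "\<And>u. u \<in> {-R0..R0} \<Longrightarrow> \<bar>h u\<bar> \<le> b" by (meson compact_imp_bounded bounded_real imageI)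
    have "\<bar>h u\<bar> \<le> \<bar>b\<bar>" for u
      using b[of u] hs[of u] by (cases "h u = 0") (auto simp: abs_le_iff)
    then show ?thesis using that by blast
  qed
  have hi: "integrable lborel h" by (rule integrable_compact_support[of _ Bh R0]) (use Bh hs in auto)
  define Hh where "Hh = (\<integral>u. h u \<partial>lborel)"
  have Hh: "Hh \<ge> 0" unfolding Hh_def using h0 by simp
  obtain Bf where Bf: "\<And>M \<xi>. M \<in> SL \<Longrightarrow> \<bar>f M \<xi>\<bar> \<le> Bf" using good_bound[OF f] by metis
  define \<epsilon> where "\<epsilon> = e / (2 * (Hh + 1))"
  have \<epsilon>: "\<epsilon> > 0" "\<epsilon> * Hh \<le> e / 2"
  proof -
    show "\<epsilon> > 0" using e Hh by (simp add: \<epsilon>_def)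
    have "\<epsilon> * (Hh + 1) = e / 2" using Hh by (simp add: \<epsilon>_def divide_simps)
    then show "\<epsilon> * Hh \<le> e / 2" using \<open>\<epsilon> > 0\<close> by (simp add: algebra_simps)
  qed
  obtain \<delta> where \<delta>: "\<delta> > 0" "\<And>M \<xi> g. M \<in> SL \<Longrightarrow> g \<in> SL \<Longrightarrow> norm (g - mat 1) < \<delta> \<Longrightarrow> \<bar>f (M ** g) \<xi> - f M \<xi>\<bar> < \<epsilon>"
    using good_ucont[OF f \<epsilon>(1)] by blast
  obtain r where r: "r > 0" "r \<le> 1/2" "\<And>c d. \<bar>c\<bar> < r \<Longrightarrow> \<bar>d - 1\<bar> < r \<Longrightarrow> norm (lowtri c d - mat 1) < \<delta>"
    using lowtri_near_one[OF \<delta>(1)] by blast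
  \<comment> \<open>In the coordinates of \<open>par\<close> this is
    \<open>h u * tent r c * tent r (d - 1)\<close>, since \<open>u\<close> is the quotient of the
    entries of the right column. The \<open>max\<close> prevents division by zero and is inactive on
    the support, where \<open>d \<ge> 1/2\<close>.\<close>
  define \<rho> where "\<rho> M = h (M$1$2 / max (1/2) (M$2$2)) * tent r (M$2$1) * tent r (M$2$2 - 1)" for M :: "real^2^2"
  have \<rho>0: "0 \<le> \<rho> M" for M unfolding \<rho>_def using h0 by simp
  have \<rho>c: "continuous_on SL \<rho>"
    unfolding \<rho>_def
  proof (intro continuous_on_mult)
    show "continuous_on SL (\<lambda>M::real^2^2. h (M$1$2 / max (1/2) (M$2$2)))"
      by (rule continuous_on_compose2[OF h]) (auto intro!: continuous_intros)
  qed (intro continuous_intros)+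
  have \<rho>s: "M \<in> SLbox (2 * (1 + 2 * \<bar>R0\<bar>))" if M: "M \<in> SL" and nz: "\<rho> M \<noteq> 0" for M
  proof -
    let ?b = "M$1$2" and ?c = "M$2$1" and ?d = "M$2$2"
    have nz': "h (?b / max (1/2) ?d) \<noteq> 0" "tent r ?c \<noteq> 0" "tent r (?d - 1) \<noteq> 0"
      using nz by (auto simp: \<rho>_def)
    have c: "\<bar>?c\<bar> < r" and d: "\<bar>?d - 1\<bar> < r" and b: "\<bar>?b / max (1/2) ?d\<bar> \<le> R0"
      by (rule tent_zero[OF nz'(2)], rule tent_zero[OF nz'(3)], rule hs[OF nz'(1)])
    have d2: "1/2 \<le> ?d" "?d \<le> 2" using d r(2) by linarith+
    have c1: "\<bar>?c\<bar> \<le> 1" using c r(2) by linarith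
    have "\<bar>?b\<bar> \<le> R0 * ?d" using b d2 by (simp add: max_def abs_divide divide_simps split: if_splits)
    also have "\<dots> \<le> \<bar>R0\<bar> * 2" using d2 by (intro mult_mono) auto
    finally have b2: "\<bar>?b\<bar> \<le> 2 * \<bar>R0\<bar>" by simp
    have "M$1$1 * ?d = 1 + ?b * ?c" using M by (simp add: SL_iff algebra_simps)
    moreover have "\<bar>M$1$1\<bar> * ?d = \<bar>M$1$1 * ?d\<bar>" using d2 by (simp add: abs_mult)
    ultimately have "\<bar>M$1$1\<bar> * ?d = \<bar>1 + ?b * ?c\<bar>" by (simp only:)
    also have "\<dots> \<le> 1 + \<bar>?b\<bar> * \<bar>?c\<bar>" by (rule order.trans[OF abs_triangle_ineq]) (simp add: abs_mult)
    also have "\<dots> \<le> 1 + (2 * \<bar>R0\<bar>) * 1" using b2 c1 by (intro add_left_mono mult_mono) auto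
    finally have "\<bar>M$1$1\<bar> * ?d \<le> 1 + 2 * \<bar>R0\<bar>" by simp
    moreover have "\<bar>M$1$1\<bar> * (1/2) \<le> \<bar>M$1$1\<bar> * ?d" using d2 by (intro mult_left_mono) auto
    moreover have "x \<le> 2 * y" if "z \<le> y" "x * (1/2) \<le> z" for x y z :: real using that by simp
    ultimately have a: "\<bar>M$1$1\<bar> \<le> 2 * (1 + 2 * \<bar>R0\<bar>)" by blast
    show ?thesis using M a b2 c1 d2 by (auto simp: SLbox_def forall_2)
  qed
  define I where "I = (\<integral>x. tent r x \<partial>lborel)"
  have I: "I > 0" unfolding I_def by (rule tent_integral_pos[OF r(1)])
  have ti: "integrable lborel (\<lambda>x. tent r (x - 1))" "(\<integral>x. tent r (x - 1) \<partial>lborel) = I"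
    using lborel_integrable_real_affine[OF tent_integrable[of r], of 1 "-1"] lborel_integral_real_affine[of 1 "tent r" "-1"]
    by (simp_all add: I_def)
  have \<rho>par: "\<rho> (par u c d) = h u * tent r c * tent r (d - 1)" if "d \<noteq> 0" for u c d
  proof (cases "tent r (d - 1) = 0")
    case False
    then have "1/2 \<le> d" using tent_zero[of r "d - 1"] r(2) by linarith
    then show ?thesis using that by (simp add: \<rho>_def par_def max_def)
  next
    case True
    then show ?thesis using that by (simp add: \<rho>_def par_def)
  qed
  let ?H = "theta_fold \<rho> v"
  note fold_facts = theta_fold_good[OF \<rho>c \<rho>s \<rho>0, of v]
  have [measurable]: "\<rho> \<in> borel_measurable SLb" by (rule borel_measurable_continuous_on_restrict[OF \<rho>c])
  have unfold: "ennreal (ip g ?H t) = (\<integral>\<^sup>+d. \<integral>\<^sup>+c. \<integral>\<^sup>+u. ennreal (g (par u c d ** geo t) v * (h u * tent r c * tent r (d - 1))) \<partial>lborel \<partial>lborel \<partial>lborel)"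
    if g: "good g" "\<And>M \<xi>. 0 \<le> g M \<xi>" for g t
  proof -
    have [measurable]: "(\<lambda>M. g (M ** geo t) v) \<in> borel_measurable SLb"
      using good_measurable[OF good_translate[OF g(1) geo_SL]] .
    have "ennreal (ip g ?H t) = (\<integral>\<^sup>+M. ennreal (g (M ** geo t) v * \<rho> M) \<partial>haar)"
      by (rule theta_fold_unfold[OF \<rho>c \<rho>s \<rho>0 torus_orbit_set_axioms v0 g, symmetric])
    also have "\<dots> = (\<integral>\<^sup>+d. \<integral>\<^sup>+c. \<integral>\<^sup>+u. ennreal (g (par u c d ** geo t) v * \<rho> (par u c d)) \<partial>lborel \<partial>lborel \<partial>lborel)"
      by (rule nn_integral_haar) measurable
    also have "\<dots> = (\<integral>\<^sup>+d. \<integral>\<^sup>+c. \<integral>\<^sup>+u. ennreal (g (par u c d ** geo t) v * (h u * tent r c * tent r (d - 1))) \<partial>lborel \<partial>lborel \<partial>lborel)"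
      by (intro nn_integral_cong_AE, use AE_lborel_neq[of 0] in eventually_elim) (simp add: \<rho>par)
    finally show ?thesis .
  qed
  \<comment> \<open>The mass of the folded bump comes from unfolding against the constant function 1
    at time 0.\<close>
  have JH: "J ?H = Hh * I * I"
  proof -
    have "ennreal (ip (\<lambda>M \<xi>. 1) ?H 0) = ennreal (Hh * I * I)"
      using unfold[OF good_const, of 1 0] nn_integral_product3[OF hi tent_integrable ti(1) h0, of r]
      by (simp add: ti(2) Hh_def I_def)
    moreover have "ip (\<lambda>M \<xi>. 1) ?H 0 = J ?H" by (simp add: ip_def)
    moreover have "0 \<le> J ?H" by (intro J_nonneg theta_fold_nonneg[OF \<rho>c \<rho>s \<rho>0])
    ultimately show ?thesis using Hh I by simp
  qed
  \<comment> \<open>Thickening multiplies the horocycle integral by the mass \<open>I * I\<close> of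
    the two tents, up to an error uniform in \<open>t \<ge> 0\<close>; the same factor occurs in
    \<open>JH\<close> and cancels at the end.\<close>
  have close: "\<bar>ip f ?H t - I * I * (\<integral>u. h u * f (up u ** geo t) v \<partial>lborel)\<bar> \<le> \<epsilon> * Hh * I * I" if t: "t \<ge> 0" for t
  proof -
    define W where "W u = f (up u ** geo t) v" for u
    define P where "P u c d = f (par u c d ** geo t) v" for u c d
    have W[measurable]: "W \<in> borel_measurable borel" unfolding W_def by (rule good_up_measurable[OF f])
    have WB: "\<bar>W u\<bar> \<le> Bf" for u unfolding W_def by (rule Bf) simp
    have W0: "0 \<le> W u" for u unfolding W_def by (rule f0)
    have P0: "0 \<le> P u c d" for u c d unfolding P_def by (rule f0)
    have [measurable]: "(\<lambda>M. f (M ** geo t) v) \<in> borel_measurable SLb"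
      using good_measurable[OF good_translate[OF f geo_SL]] .
    have Pm[measurable (raw)]: "(\<lambda>x. P (a x) (b x) (c x)) \<in> borel_measurable M"
      if [measurable]: "a \<in> borel_measurable M" "b \<in> borel_measurable M" "c \<in> borel_measurable M" for a b c and M :: "'z measure"
      unfolding P_def by measurable
    have "0 \<le> Bh" using Bh[of 0] by linarith
    then have hWi: "integrable lborel (\<lambda>u. h u * W u)"
      using Bh WB hs by (intro integrable_compact_support[of _ "Bh * Bf" R0]) (auto simp: abs_mult intro!: mult_mono)
    define A where "A = (\<integral>u. h u * W u \<partial>lborel)"
    have A0: "A \<ge> 0" unfolding A_def using h0 W0 by simp
    have PW: "\<bar>P u c d - W u\<bar> \<le> \<epsilon>" if c: "tent r c \<noteq> 0" and d: "tent r (d - 1) \<noteq> 0" for u c d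
    proof -
      have cd: "\<bar>c\<bar> < r" "\<bar>d - 1\<bar> < r" using tent_zero c d by auto
      then have d0: "d \<noteq> 0" using r(2) by auto
      have "\<bar>c * exp (- t)\<bar> \<le> \<bar>c\<bar> * 1" unfolding abs_mult using t by (intro mult_left_mono) auto
      then have "\<bar>c * exp (- t)\<bar> < r" using cd by linarith
      then have "norm (lowtri (c * exp (- t)) d - mat 1) < \<delta>" using r(3) cd by blast
      then have "\<bar>f (up u ** geo t ** lowtri (c * exp (- t)) d) v - f (up u ** geo t) v\<bar> < \<epsilon>"
        by (intro \<delta>(2)) (use d0 in auto)
      moreover have "par u c d ** geo t = up u ** geo t ** lowtri (c * exp (- t)) d"
        by (simp only: par_lowtri[OF d0] matrix_mul_assoc[symmetric] lowtri_geo)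
      ultimately show ?thesis by (simp add: P_def W_def)
    qed
    have ipP: "ennreal (ip f ?H t) = (\<integral>\<^sup>+d. \<integral>\<^sup>+c. \<integral>\<^sup>+u. ennreal (P u c d * (h u * tent r c * tent r (d - 1))) \<partial>lborel \<partial>lborel \<partial>lborel)"
      unfolding P_def by (rule unfold[OF f f0])
    have ip0: "0 \<le> ip f ?H t" unfolding ip_def by (intro J_nonneg mult_nonneg_nonneg f0 theta_fold_nonneg[OF \<rho>c \<rho>s \<rho>0])
    have hs_i: "integrable lborel (\<lambda>u. h u * W u + \<epsilon> * h u)" using hWi hi by simp
    have val: "(\<integral>\<^sup>+d. \<integral>\<^sup>+c. \<integral>\<^sup>+u. ennreal ((h u * W u + \<epsilon> * h u) * tent r c * tent r (d - 1)) \<partial>lborel \<partial>lborel \<partial>lborel) = ennreal ((A + \<epsilon> * Hh) * I * I)"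
      using nn_integral_product3[OF hs_i tent_integrable ti(1), of r] h0 W0 \<epsilon>(1) hWi hi
      by (simp add: ti(2) Hh_def A_def I_def)
    have val2: "(\<integral>\<^sup>+d. \<integral>\<^sup>+c. \<integral>\<^sup>+u. ennreal ((h u * W u) * tent r c * tent r (d - 1)) \<partial>lborel \<partial>lborel \<partial>lborel) = ennreal (A * I * I)"
      using nn_integral_product3[OF hWi tent_integrable ti(1), of r] h0 W0
      by (simp add: ti(2) A_def I_def)
    have val3: "(\<integral>\<^sup>+d. \<integral>\<^sup>+c. \<integral>\<^sup>+u. ennreal ((\<epsilon> * h u) * tent r c * tent r (d - 1)) \<partial>lborel \<partial>lborel \<partial>lborel) = ennreal (\<epsilon> * Hh * I * I)"
      using nn_integral_product3[OF integrable_mult_right[OF hi, of \<epsilon>] tent_integrable ti(1), of r] h0 \<epsilon>(1)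
      by (simp add: ti(2) Hh_def I_def)
    have ineq: "P u c d * (h u * tent r c * tent r (d - 1)) \<le> (h u * W u + \<epsilon> * h u) * tent r c * tent r (d - 1)"
       "(h u * W u) * tent r c * tent r (d - 1) \<le> P u c d * (h u * tent r c * tent r (d - 1)) + (\<epsilon> * h u) * tent r c * tent r (d - 1)" for u c d
    proof -
      let ?k = "h u * tent r c * tent r (d - 1)"
      have k: "0 \<le> ?k" using h0 by simp
      have "P u c d * ?k \<le> (W u + \<epsilon>) * ?k \<and> W u * ?k \<le> (P u c d + \<epsilon>) * ?k"
      proof (cases "?k = 0")
        case False
        then have "\<bar>P u c d - W u\<bar> \<le> \<epsilon>" by (intro PW) auto
        then show ?thesis using k by (intro conjI mult_right_mono) linarith+
      next
        case True
        show ?thesis unfolding True by simp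
      qed
      then show "P u c d * (h u * tent r c * tent r (d - 1)) \<le> (h u * W u + \<epsilon> * h u) * tent r c * tent r (d - 1)"
       "(h u * W u) * tent r c * tent r (d - 1) \<le> P u c d * (h u * tent r c * tent r (d - 1)) + (\<epsilon> * h u) * tent r c * tent r (d - 1)"
        by (simp_all add: algebra_simps)
    qed
    have "ennreal (ip f ?H t) \<le> ennreal ((A + \<epsilon> * Hh) * I * I)"
      unfolding ipP val[symmetric] by (intro nn_integral_mono ennreal_leI ineq)
    then have up: "ip f ?H t \<le> (A + \<epsilon> * Hh) * I * I" using A0 \<epsilon>(1) Hh I by (simp add: ennreal_le_iff)
    \<comment> \<open>The lower bound is kept in additive form because subtraction of nonnegative
      extended numbers is truncated at 0.\<close>
    have "ennreal (A * I * I) \<le> (\<integral>\<^sup>+d. \<integral>\<^sup>+c. \<integral>\<^sup>+u. ennreal (P u c d * (h u * tent r c * tent r (d - 1))) + ennreal ((\<epsilon> * h u) * tent r c * tent r (d - 1)) \<partial>lborel \<partial>lborel \<partial>lborel)"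
      unfolding val2[symmetric]
    proof (intro nn_integral_mono)
      fix u c d
      have "ennreal ((h u * W u) * tent r c * tent r (d - 1)) \<le> ennreal (P u c d * (h u * tent r c * tent r (d - 1)) + (\<epsilon> * h u) * tent r c * tent r (d - 1))"
        by (intro ennreal_leI ineq)
      also have "\<dots> = ennreal (P u c d * (h u * tent r c * tent r (d - 1))) + ennreal ((\<epsilon> * h u) * tent r c * tent r (d - 1))"
        using P0 h0 \<epsilon>(1) by (intro ennreal_plus) auto
      finally show "ennreal ((h u * W u) * tent r c * tent r (d - 1)) \<le> ennreal (P u c d * (h u * tent r c * tent r (d - 1))) + ennreal ((\<epsilon> * h u) * tent r c * tent r (d - 1))" .
    qed
    also have "\<dots> = ennreal (ip f ?H t) + ennreal (\<epsilon> * Hh * I * I)"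
      unfolding ipP val3[symmetric] by (simp add: nn_integral_add)
    also have "\<dots> = ennreal (ip f ?H t + \<epsilon> * Hh * I * I)"
      using ip0 \<epsilon>(1) Hh I by (intro ennreal_plus[symmetric]) auto
    finally have lo': "ennreal (A * I * I) \<le> ennreal (ip f ?H t + \<epsilon> * Hh * I * I)" .
    have "0 \<le> ip f ?H t + \<epsilon> * Hh * I * I" using ip0 \<epsilon>(1) Hh I by simp
    then have lo: "A * I * I \<le> ip f ?H t + \<epsilon> * Hh * I * I" using lo' by (rule iffD1[OF ennreal_le_iff])
    have AI: "(\<integral>u. h u * f (up u ** geo t) v \<partial>lborel) = A" by (simp add: A_def W_def)
    show ?thesis unfolding AI using up lo by (simp add: abs_le_iff algebra_simps)
  qed
  have "((\<lambda>t. ip f ?H t) \<longlongrightarrow> J f * J ?H / T) at_top" by (rule mixing[OF f fold_facts])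
  then have "\<forall>\<^sub>F t in at_top. dist (ip f ?H t) (J f * J ?H / T) < e / 2 * (I * I)"
    using e I by (intro tendstoD) auto
  then show "\<forall>\<^sub>F t in at_top. dist (\<integral>u. h u * f (up u ** geo t) v \<partial>lborel) (J f / T * (\<integral>u. h u \<partial>lborel)) < e"
    using eventually_ge_at_top[of 0]
  proof eventually_elim
    case (elim t)
    define A where "A = (\<integral>u. h u * f (up u ** geo t) v \<partial>lborel)"
    define p where "p = ip f ?H t"
    have 1: "\<bar>p - J f / T * Hh * (I * I)\<bar> < e / 2 * (I * I)" using elim(1) by (simp add: JH dist_real_def p_def mult.assoc)
    have 2: "\<bar>p - I * I * A\<bar> \<le> e / 2 * (I * I)"
    proof -
      have "\<epsilon> * Hh * I * I \<le> e / 2 * (I * I)" using \<epsilon>(2) I by (simp add: mult.assoc mult_right_mono)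
      then show ?thesis using close[OF elim(2)] unfolding p_def A_def by (rule order.trans[rotated])
    qed
    have "\<bar>I * I * A - I * I * (J f / T * Hh)\<bar> < e * (I * I)"
    proof -
      have gen: "\<bar>x - y\<bar> < 2 * E" if "\<bar>p - y\<bar> < E" "\<bar>p - x\<bar> \<le> E" for x y E :: real using that by linarith
      have "\<bar>I * I * A - J f / T * Hh * (I * I)\<bar> < 2 * (e / 2 * (I * I))" by (rule gen[OF 1 2])
      moreover have "2 * (e / 2 * (I * I)) = e * (I * I)" by simp
      moreover have "J f / T * Hh * (I * I) = I * I * (J f / T * Hh)" by (rule mult.commute)
      ultimately show ?thesis by (simp only:)
    qed
    moreover have "\<bar>I * I * x - I * I * y\<bar> = \<bar>x - y\<bar> * (I * I)" for x y
    proof -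
      have "I * I * x - I * I * y = (x - y) * (I * I)" by (simp add: algebra_simps)
      then show ?thesis by (simp add: abs_mult)
    qed
    ultimately have "\<bar>A - J f / T * Hh\<bar> * (I * I) < e * (I * I)" by (simp only:)
    moreover have "0 < I * I" using I by simp
    ultimately have "\<bar>A - J f / T * Hh\<bar> < e" by (simp only: mult_less_cancel_right_pos)
    then show ?case unfolding A_def Hh_def by (simp add: dist_real_def)
  qed
qed

end

section \<open>Equidistribution for integrable densities\<close>

lemma indicator_L1_approx:
  fixes A :: "real set" and e :: real
  assumes A: "A \<in> sets lborel" "emeasure lborel A < \<infinity>" and e: "e > 0"
  shows "\<exists>h R. continuous_on UNIV h \<and> (\<forall>u. 0 \<le> h u) \<and> (\<forall>u. h u \<noteq> 0 \<longrightarrow> \<bar>u\<bar> \<le> R) \<and>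
    (\<integral>u. \<bar>indicator A u - h u\<bar> \<partial>lborel) < e"
proof -
  have [measurable]: "A \<in> sets borel" using A(1) by simp
  \<comment> \<open>Outer regularity reduces the claim to an open set of finite measure, whose
    indicator is the pointwise limit of the functions \<open>h n\<close> introduced below.\<close>
  obtain U where U: "open U" "A \<subseteq> U" "emeasure lebesgue (U - A) < ennreal (e/2)"
    using sets_lebesgue_outer_open[of A "e/2"] A(1) e by (metis half_gt_zero sets_completionI_sets)
  have [measurable]: "U \<in> sets borel" using U(1) by (rule borel_open)
  have UA: "emeasure lborel (U - A) < ennreal (e/2)"
    using U(3) emeasure_completion[of "U - A" lborel] by simp
  then have UA': "measure lborel (U - A) < e/2"
  proof -
    have "emeasure lborel (U - A) = ennreal (measure lborel (U - A))"
      using UA by (intro emeasure_eq_ennreal_measure) auto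
    then show ?thesis using UA by (simp add: ennreal_less_iff)
  qed
  have Ufin: "emeasure lborel U < \<infinity>"
  proof -
    have "emeasure lborel U = emeasure lborel A + emeasure lborel (U - A)"
      using U(2) by (subst plus_emeasure) (auto simp: Un_absorb1)
    also have "\<dots> < \<infinity>" using A(2) order.strict_trans[OF UA ennreal_less_top] by simp
    finally show ?thesis .
  qed
  define h where "h n u = min 1 (real n * infdist u (- U)) * min 1 (tent (real n) u)" for n u
  have hc: "continuous_on UNIV (h n)" for n
    unfolding h_def by (intro continuous_intros)
  have h0: "0 \<le> h n u" for n u unfolding h_def by (simp add: infdist_nonneg)
  have hs: "\<bar>u\<bar> \<le> real n" if "h n u \<noteq> 0" for n u
  proof -
    have "tent (real n) u \<noteq> 0" using that by (auto simp: h_def)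
    then show ?thesis by (rule less_imp_le[OF tent_zero])
  qed
  \<comment> \<open>\<open>infdist\<close> to the empty set is 0, which would make every
    \<open>h n\<close> vanish; the finite measure of \<open>U\<close> rules this case out.\<close>
  have ne: "- U \<noteq> {}"
  proof
    assume "- U = {}"
    then have "U = UNIV" by blast
    then show False using Ufin by simp
  qed
  have hU: "h n u \<le> indicator U u" for n u
  proof (cases "u \<in> U")
    case True
    have "h n u \<le> 1 * 1" unfolding h_def by (intro mult_mono) (auto simp: infdist_nonneg)
    then show ?thesis using True by simp
  next
    case False
    then show ?thesis by (simp add: h_def)
  qed
  have lim: "(\<lambda>n. h n u) \<longlonglongrightarrow> indicator U u" for u
  proof (cases "u \<in> U")
    case True
    have "infdist u (- U) > 0"
      using True U(1) ne by (intro infdist_pos_not_in_closed) (auto simp: closed_def)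
    then obtain m where m: "1 / infdist u (- U) \<le> real m" using real_arch_simple by blast
    obtain k where k: "\<bar>u\<bar> + 1 \<le> real k" using real_arch_simple by blast
    have "\<forall>\<^sub>F n in sequentially. h n u = 1"
      using eventually_ge_at_top[of "max m k"]
    proof eventually_elim
      case (elim n)
      have "1 / infdist u (- U) \<le> real n" using m elim by (meson max.boundedE of_nat_mono order.trans)
      then have "1 \<le> real n * infdist u (- U)" using \<open>infdist u (- U) > 0\<close> by (simp add: field_simps)
      moreover have "1 \<le> tent (real n) u" using k elim unfolding tent_def by linarith
      ultimately show ?case by (simp add: h_def)
    qed
    then show ?thesis using True by (simp add: tendsto_eventually)
  next
    case False
    then show ?thesis by (simp add: h_def)
  qed
  have [measurable]: "h n \<in> borel_measurable borel" for n by (rule borel_measurable_continuous_onI[OF hc])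
  have Ui: "integrable lborel (indicator U :: real \<Rightarrow> real)"
    by (intro integrable_real_indicator) (use Ufin in auto)
  have Ai: "integrable lborel (indicator A :: real \<Rightarrow> real)"
    by (intro integrable_real_indicator) (use A in auto)
  have hi: "integrable lborel (h n)" for n
    by (rule Bochner_Integration.integrable_bound[OF Ui]) (use hU h0 in \<open>auto intro!: AE_I2\<close>)
  have "(\<lambda>n. \<integral>u. \<bar>indicator U u - h n u\<bar> \<partial>lborel) \<longlonglongrightarrow> (\<integral>u. 0 \<partial>(lborel::real measure))"
  proof (rule integral_dominated_convergence[where w="indicator U"])
    show "AE u in lborel. (\<lambda>n. \<bar>indicator U u - h n u\<bar>) \<longlonglongrightarrow> 0"
    proof (rule AE_I2)
      fix u
      have "(\<lambda>n. \<bar>indicator U u - h n u\<bar>) \<longlonglongrightarrow> \<bar>indicator U u - indicator U u\<bar>"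
        by (intro tendsto_intros lim)
      then show "(\<lambda>n. \<bar>indicator U u - h n u\<bar>) \<longlonglongrightarrow> 0" by simp
    qed
    show "AE u in lborel. norm \<bar>indicator U u - h n u\<bar> \<le> indicator U u" for n
    proof (rule AE_I2)
      fix u
      have "\<bar>x - y\<bar> \<le> x" if "0 \<le> y" "y \<le> x" for x y :: real using that by linarith
      then show "norm \<bar>indicator U u - h n u\<bar> \<le> indicator U u" using hU[of n u] h0[of n u] by simp
    qed
  qed (use Ui in \<open>simp_all\<close>)
  then have "\<forall>\<^sub>F n in sequentially. (\<integral>u. \<bar>indicator U u - h n u\<bar> \<partial>lborel) < e/2"
    using e by (intro order_tendstoD(2)) auto
  then obtain n where n: "(\<integral>u. \<bar>indicator U u - h n u\<bar> \<partial>lborel) < e/2"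
    using eventually_happens'[OF sequentially_bot] by blast
  have "(\<integral>u. \<bar>indicator A u - h n u\<bar> \<partial>lborel) \<le> (\<integral>u. indicator (U - A) u + \<bar>indicator U u - h n u\<bar> \<partial>lborel)"
  proof (rule integral_mono)
    show "integrable lborel (\<lambda>u. \<bar>indicator A u - h n u\<bar>)" using Ai hi by simp
    show "integrable lborel (\<lambda>u. indicator (U - A) u + \<bar>indicator U u - h n u\<bar>)"
      using Ui hi UA by (intro Bochner_Integration.integrable_add integrable_real_indicator) (auto simp: less_top[symmetric] intro: order.strict_trans)
    fix u
    show "\<bar>indicator A u - h n u\<bar> \<le> indicator (U - A) u + \<bar>indicator U u - h n u\<bar>"
      using U(2) by (auto simp: indicator_def)
  qed
  also have "\<dots> = measure lborel (U - A) + (\<integral>u. \<bar>indicator U u - h n u\<bar> \<partial>lborel)"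
    using Ui hi UA by (subst Bochner_Integration.integral_add) (auto intro!: integrable_real_indicator simp: less_top[symmetric] intro: order.strict_trans)
  also have "\<dots> < e/2 + e/2" using UA' n by (rule add_strict_mono)
  finally have "(\<integral>u. \<bar>indicator A u - h n u\<bar> \<partial>lborel) < e" by simp
  then show ?thesis using hc h0 hs by blast
qed

text \<open>The uniform bound on \<open>W t\<close> makes integration against it Lipschitz in the
  \<open>L^1\<close> norm uniformly in \<open>t\<close>, so the densities for which the limit holds
  form an \<open>L^1\<close> closed set. It contains the indicators of sets of finite measure by
  approximation, and then every integrable function.\<close>

lemma weak_limit_L1:
  fixes W :: "real \<Rightarrow> real \<Rightarrow> real"
  assumes W: "\<And>t. W t \<in> borel_measurable borel" and WB: "\<And>t u. \<bar>W t u\<bar> \<le> B"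
    and cc: "\<And>h R. continuous_on UNIV h \<Longrightarrow> (\<And>u. 0 \<le> h u) \<Longrightarrow> (\<And>u. h u \<noteq> 0 \<Longrightarrow> \<bar>u\<bar> \<le> R) \<Longrightarrow>
      ((\<lambda>t. \<integral>u. h u * W t u \<partial>lborel) \<longlongrightarrow> c * (\<integral>u. h u \<partial>lborel)) at_top"
    and g: "integrable lborel g"
  shows "((\<lambda>t. \<integral>u. g u * W t u \<partial>lborel) \<longlongrightarrow> c * (\<integral>u. g u \<partial>lborel)) at_top"
proof -
  note [measurable] = W
  define P where "P h \<longleftrightarrow> ((\<lambda>t. \<integral>u. h u * W t u \<partial>lborel) \<longlongrightarrow> c * (\<integral>u. h u \<partial>lborel)) at_top" for h :: "real \<Rightarrow> real"
  have B: "B \<ge> 0" using WB[of 0 0] by linarith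
  have iW: "integrable lborel (\<lambda>u. h u * W t u)" if h: "integrable lborel h" for h t
  proof (rule Bochner_Integration.integrable_bound[OF integrable_mult_right[OF integrable_norm[OF h], of B]])
    show "(\<lambda>u. h u * W t u) \<in> borel_measurable lborel" using h by (auto dest: borel_measurable_integrable)
    show "AE u in lborel. norm (h u * W t u) \<le> norm (B * norm (h u))"
      using WB B by (intro AE_I2) (simp add: abs_mult mult.commute[of B] mult_left_mono)
  qed
  have close: "P h" if h: "integrable lborel h"
    and ap: "\<And>e. e > 0 \<Longrightarrow> \<exists>k. integrable lborel k \<and> P k \<and> (\<integral>u. \<bar>h u - k u\<bar> \<partial>lborel) < e" for h
    unfolding P_def
  proof (rule tendstoI)
    fix e :: real assume e: "e > 0"
    define d where "d = e / (2 * (B + \<bar>c\<bar> + 1))"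
    have d: "d > 0" "(B + \<bar>c\<bar>) * d < e / 2"
    proof -
      show "d > 0" using e B by (simp add: d_def)
      then have "(B + \<bar>c\<bar>) * d < (B + \<bar>c\<bar> + 1) * d" by (simp add: algebra_simps)
      also have "\<dots> = e / 2" using B by (simp add: d_def divide_simps)
      finally show "(B + \<bar>c\<bar>) * d < e / 2" .
    qed
    obtain k where k: "integrable lborel k" "P k" "(\<integral>u. \<bar>h u - k u\<bar> \<partial>lborel) < d" using ap[OF d(1)] by blast
    define D where "D = (\<integral>u. \<bar>h u - k u\<bar> \<partial>lborel)"
    have hk: "integrable lborel (\<lambda>u. h u - k u)" using h k(1) by simp
    have est1: "\<bar>(\<integral>u. h u * W t u \<partial>lborel) - (\<integral>u. k u * W t u \<partial>lborel)\<bar> \<le> B * D" for t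
    proof -
      have "(\<integral>u. h u * W t u \<partial>lborel) - (\<integral>u. k u * W t u \<partial>lborel) = (\<integral>u. (h u - k u) * W t u \<partial>lborel)"
        using iW[OF h, of t] iW[OF k(1), of t] by (simp add: left_diff_distrib)
      also have "\<bar>\<dots>\<bar> \<le> (\<integral>u. \<bar>(h u - k u) * W t u\<bar> \<partial>lborel)" using integral_norm_bound[of lborel "\<lambda>u. (h u - k u) * W t u"] by simp
      also have "\<dots> \<le> (\<integral>u. B * \<bar>h u - k u\<bar> \<partial>lborel)"
      proof (rule integral_mono)
        show "integrable lborel (\<lambda>u. \<bar>(h u - k u) * W t u\<bar>)" using iW[OF hk] by (rule integrable_abs)
        show "integrable lborel (\<lambda>u. B * \<bar>h u - k u\<bar>)" using hk by simp
        show "\<bar>(h u - k u) * W t u\<bar> \<le> B * \<bar>h u - k u\<bar>" for u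
          using WB[of t u] by (simp add: abs_mult mult.commute[of B] mult_left_mono)
      qed
      finally show ?thesis by (simp add: D_def)
    qed
    have est2: "\<bar>c * (\<integral>u. h u \<partial>lborel) - c * (\<integral>u. k u \<partial>lborel)\<bar> \<le> \<bar>c\<bar> * D"
    proof -
      have "c * (\<integral>u. h u \<partial>lborel) - c * (\<integral>u. k u \<partial>lborel) = c * (\<integral>u. h u - k u \<partial>lborel)"
        using h k(1) by (simp add: right_diff_distrib)
      moreover have "\<bar>\<integral>u. h u - k u \<partial>lborel\<bar> \<le> D" unfolding D_def using integral_norm_bound[of lborel "\<lambda>u. h u - k u"] by simp
      ultimately show ?thesis by (simp add: abs_mult mult_left_mono)
    qed
    have D: "(B + \<bar>c\<bar>) * D < e / 2"
      using d k(3) B mult_left_mono[of D d "B + \<bar>c\<bar>"] by (simp add: D_def)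
    have "\<forall>\<^sub>F t in at_top. dist (\<integral>u. k u * W t u \<partial>lborel) (c * (\<integral>u. k u \<partial>lborel)) < e/2"
      using k(2) e unfolding P_def by (intro tendstoD) auto
    then show "\<forall>\<^sub>F t in at_top. dist (\<integral>u. h u * W t u \<partial>lborel) (c * (\<integral>u. h u \<partial>lborel)) < e"
    proof eventually_elim
      case (elim t)
      have gen: "\<bar>a - a'\<bar> < e" if "\<bar>a - b\<bar> \<le> x" "\<bar>a' - b'\<bar> \<le> y" "\<bar>b - b'\<bar> < e/2" "x + y < e/2" for a a' b b' x y :: real
        using that by linarith
      have D': "B * D + \<bar>c\<bar> * D < e/2" using D by (simp only: ring_distribs)
      show ?case unfolding dist_real_def
        by (rule gen[OF est1 est2 elim[unfolded dist_real_def] D'])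
    qed
  qed
  have "P g" using g
  proof (induction rule: integrable_induct)
    case (base A c')
    have Ai: "integrable lborel (indicator A :: real \<Rightarrow> real)" using base by (intro integrable_real_indicator) auto
    have "P (indicator A)"
    proof (rule close[OF Ai])
      fix e :: real assume "e > 0"
      then obtain h R where h: "continuous_on UNIV h" "\<And>u. 0 \<le> h u" "\<And>u. h u \<noteq> 0 \<Longrightarrow> \<bar>u\<bar> \<le> R" "(\<integral>u. \<bar>indicator A u - h u\<bar> \<partial>lborel) < e"
        using indicator_L1_approx[OF base] by blast
      have hm: "h \<in> borel_measurable borel" by (rule borel_measurable_continuous_onI[OF h(1)])
      have "compact (h ` {-R..R})" by (rule compact_continuous_image[OF continuous_on_subset[OF h(1)]]) auto
      then obtain b where b: "\<And>u. u \<in> {-R..R} \<Longrightarrow> \<bar>h u\<bar> \<le> b" by (meson compact_imp_bounded bounded_real imageI)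
      have hb: "\<bar>h u\<bar> \<le> \<bar>b\<bar>" for u
        using b[of u] h(3)[of u] by (cases "h u = 0") (auto simp: abs_le_iff)
      have "integrable lborel h" by (rule integrable_compact_support[OF hm hb h(3)])
      moreover have "P h" unfolding P_def by (rule cc[OF h(1-3)])
      ultimately show "\<exists>k. integrable lborel k \<and> P k \<and> (\<integral>u. \<bar>indicator A u - k u\<bar> \<partial>lborel) < e" using h(4) by blast
    qed
    then have "((\<lambda>t. c' * (\<integral>u. indicator A u * W t u \<partial>lborel)) \<longlongrightarrow> c' * (c * (\<integral>u. indicator A u \<partial>lborel))) at_top"
      unfolding P_def by (intro tendsto_mult tendsto_const)
    moreover have "c' * (\<integral>u. indicator A u * W t u \<partial>lborel) = (\<integral>u. (indicator A u *\<^sub>R c') * W t u \<partial>lborel)" for t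
      by (subst integral_mult_right_zero[symmetric]) (simp add: mult_ac)
    moreover have "c' * (c * (\<integral>u. indicator A u \<partial>lborel)) = c * (\<integral>u. indicator A u *\<^sub>R c' \<partial>lborel)"
      by simp
    ultimately show ?case unfolding P_def by (simp only:)
  next
    case (add f k)
    have "((\<lambda>t. (\<integral>u. f u * W t u \<partial>lborel) + (\<integral>u. k u * W t u \<partial>lborel)) \<longlongrightarrow> c * (\<integral>u. f u \<partial>lborel) + c * (\<integral>u. k u \<partial>lborel)) at_top"
      using add.IH unfolding P_def by (intro tendsto_add)
    then show ?case
      unfolding P_def using add.hyps iW[OF add.hyps(1)] iW[OF add.hyps(2)] by (simp add: ring_distribs)
  next
    case (lim f s)
    show ?case
    proof (rule close[OF lim.hyps(4)])
      fix e :: real assume e: "e > 0"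
      have [measurable]: "f \<in> borel_measurable borel" "\<And>i. s i \<in> borel_measurable borel"
        using lim.hyps(1,4) by (auto dest: borel_measurable_integrable)
      have "(\<lambda>i. \<integral>u. \<bar>f u - s i u\<bar> \<partial>lborel) \<longlonglongrightarrow> (\<integral>u. 0 \<partial>(lborel::real measure))"
      proof (rule integral_dominated_convergence[where w="\<lambda>u. 3 * \<bar>f u\<bar>"])
        show "AE u in lborel. (\<lambda>i. \<bar>f u - s i u\<bar>) \<longlonglongrightarrow> 0"
        proof (rule AE_I2)
          fix u
          have "(\<lambda>i. \<bar>f u - s i u\<bar>) \<longlonglongrightarrow> \<bar>f u - f u\<bar>"
            by (intro tendsto_intros lim.hyps(2)) simp
          then show "(\<lambda>i. \<bar>f u - s i u\<bar>) \<longlonglongrightarrow> 0" by simp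
        qed
        show "AE u in lborel. norm \<bar>f u - s i u\<bar> \<le> 3 * \<bar>f u\<bar>" for i
        proof (rule AE_I2)
          fix u
          have "\<bar>s i u\<bar> \<le> 2 * \<bar>f u\<bar>" using lim.hyps(3)[of u i] by simp
          then show "norm \<bar>f u - s i u\<bar> \<le> 3 * \<bar>f u\<bar>" by simp
        qed
      qed (use lim.hyps(4) in simp_all)
      then have "\<forall>\<^sub>F i in sequentially. (\<integral>u. \<bar>f u - s i u\<bar> \<partial>lborel) < e"
        using e by (intro order_tendstoD(2)) auto
      then obtain i where "(\<integral>u. \<bar>f u - s i u\<bar> \<partial>lborel) < e"
        using eventually_happens'[OF sequentially_bot] by blast
      then show "\<exists>k. integrable lborel k \<and> P k \<and> (\<integral>u. \<bar>f u - k u\<bar> \<partial>lborel) < e" using lim.hyps(1) lim.IH by blast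
    qed
  qed
  then show ?thesis by (simp only: P_def)
qed

context torus_orbit_set
begin

theorem equidistribution_L1:
  assumes v0: "v0 \<in> S" "v0 - v \<in> Int_lattice" and f: "good f" and g: "integrable lborel g"
  shows "((\<lambda>t. \<integral>u. g u * f (up u ** geo t) v \<partial>lborel) \<longlongrightarrow> (J f / T) * (\<integral>u. g u \<partial>lborel)) at_top"
proof -
  obtain B where B: "B > 0" "\<And>M \<xi>. M \<in> SL \<Longrightarrow> \<bar>f M \<xi>\<bar> \<le> B" using good_bound[OF f] by metis
  \<comment> \<open>The maximum makes \<open>f'\<close> nonnegative off \<open>SL\<close> too, where
    \<open>good\<close> gives no information; on \<open>SL\<close> it changes nothing.\<close>
  define f' where "f' M \<xi> = max 0 (f M \<xi> + B)" for M \<xi>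
  have eq: "f M \<xi> + B = f' M \<xi>" if "M \<in> SL" for M \<xi>
    using B(2)[OF that, of \<xi>] by (simp add: f'_def)
  have f': "good f'" by (rule good_cong[OF good_add[OF f good_const[of B]]]) (rule eq)
  have f'0: "0 \<le> f' M \<xi>" for M \<xi> by (simp add: f'_def)
  have Jf': "J f' = J f + B * T"
  proof -
    have "J f' = J (\<lambda>M \<xi>. f M \<xi> + B)" by (rule J_cong) (simp add: eq)
    then show ?thesis using J_add[OF f good_const[of B]] by (simp add: J_const)
  qed
  have main: "((\<lambda>t. \<integral>u. g u * f' (up u ** geo t) v \<partial>lborel) \<longlongrightarrow> (J f' / T) * (\<integral>u. g u \<partial>lborel)) at_top"
  proof (rule weak_limit_L1[OF _ _ _ g])
    show "(\<lambda>u. f' (up u ** geo t) v) \<in> borel_measurable borel" for t by (rule good_up_measurable[OF f'])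
    show "\<bar>f' (up u ** geo t) v\<bar> \<le> 2 * B" for t u
    proof -
      have "\<bar>f (up u ** geo t) v\<bar> \<le> B" by (rule B(2)) simp
      then show ?thesis using B(1) unfolding f'_def by linarith
    qed
    show "((\<lambda>t. \<integral>u. h u * f' (up u ** geo t) v \<partial>lborel) \<longlongrightarrow> (J f' / T) * (\<integral>u. h u \<partial>lborel)) at_top"
      if "continuous_on UNIV h" "\<And>u. 0 \<le> h u" "\<And>u. h u \<noteq> 0 \<Longrightarrow> \<bar>u\<bar> \<le> R" for h R
      by (rule equidistribution_continuous[OF v0 f' f'0 that])
  qed
  have "(\<integral>u. g u * f' (up u ** geo t) v \<partial>lborel) = (\<integral>u. g u * f (up u ** geo t) v \<partial>lborel) + B * (\<integral>u. g u \<partial>lborel)" for t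
  proof -
    have [measurable]: "g \<in> borel_measurable borel" using g by (auto dest: borel_measurable_integrable)
    have [measurable]: "(\<lambda>u. f (up u ** geo t) v) \<in> borel_measurable borel" by (rule good_up_measurable[OF f])
    have i: "integrable lborel (\<lambda>u. g u * f (up u ** geo t) v)"
    proof (rule Bochner_Integration.integrable_bound[OF integrable_mult_right[OF integrable_norm[OF g], of B]])
      show "AE u in lborel. norm (g u * f (up u ** geo t) v) \<le> norm (B * norm (g u))"
        using B by (intro AE_I2) (simp add: abs_mult mult.commute[of B] mult_left_mono)
    qed simp
    have "(\<integral>u. g u * f' (up u ** geo t) v \<partial>lborel) = (\<integral>u. g u * f (up u ** geo t) v + B * g u \<partial>lborel)"
      by (rule Bochner_Integration.integral_cong) (simp_all add: eq[symmetric] algebra_simps)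
    also have "\<dots> = (\<integral>u. g u * f (up u ** geo t) v \<partial>lborel) + B * (\<integral>u. g u \<partial>lborel)"
      using i g by simp
    finally show ?thesis .
  qed
  then have "(\<lambda>t. \<integral>u. g u * f (up u ** geo t) v \<partial>lborel) = (\<lambda>t. (\<integral>u. g u * f' (up u ** geo t) v \<partial>lborel) - B * (\<integral>u. g u \<partial>lborel))"
    by simp
  moreover have "((\<lambda>t. (\<integral>u. g u * f' (up u ** geo t) v \<partial>lborel) - B * (\<integral>u. g u \<partial>lborel)) \<longlongrightarrow>
     (J f' / T) * (\<integral>u. g u \<partial>lborel) - B * (\<integral>u. g u \<partial>lborel)) at_top"
    by (rule tendsto_diff[OF main tendsto_const])
  moreover have "(J f' / T) * (\<integral>u. g u \<partial>lborel) - B * (\<integral>u. g u \<partial>lborel) = (J f / T) * (\<integral>u. g u \<partial>lborel)"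
    using T_pos unfolding Jf' by (simp add: add_divide_distrib algebra_simps)
  ultimately show ?thesis by (simp only:)
qed

end

subsection \<open>The rational orbit\<close>

lemma torus_rep_diff: "v - torus_rep v \<in> Int_lattice"
  by (simp add: torus_rep_def Int_lattice_def)

lemma torus_rep_eqI: "v - w \<in> Int_lattice \<Longrightarrow> torus_rep v = torus_rep w"
proof -
  assume vw: "v - w \<in> Int_lattice"
  have "v $ i - of_int \<lfloor>v $ i + 1/2\<rfloor> = w $ i - of_int \<lfloor>w $ i + 1/2\<rfloor>" for i
  proof -
    obtain k where "v $ i - w $ i = of_int k" using vw by (auto simp: Int_lattice_def elim: Ints_cases)
    then have "v $ i = w $ i + of_int k" by simp
    then show ?thesis by (simp add: add.commute[of _ "of_int k"] add.assoc)
  qed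
  then show ?thesis by (simp add: torus_rep_def vec_eq_iff)
qed

lemma torus_rep_idem [simp]: "torus_rep (torus_rep v) = torus_rep v"
  using torus_rep_eqI[OF torus_rep_diff, of v] by simp

lemma torus_rep_bound: "\<bar>torus_rep v $ i\<bar> \<le> 1/2"
proof -
  have "torus_rep v $ i = v $ i - of_int \<lfloor>v $ i + 1/2\<rfloor>" by (simp add: torus_rep_def)
  then show ?thesis using of_int_floor_le[of "v $ i + 1/2"] real_of_int_floor_add_one_gt[of "v $ i + 1/2"]
    by linarith
qed

lemma torus_orbit_iff:
  "p \<in> torus_orbit \<alpha> \<beta> \<longleftrightarrow> (\<exists>G\<in>Gamma_theta. \<exists>n\<in>Int_lattice. p = torus_rep (n + G *v torus_rep (vector [\<alpha>, \<beta>])))"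
  by (auto simp: torus_orbit_def orbit_def torus_act_def Gamma_lattice_def)

text \<open>A common denominator \<open>q\<close> of \<open>\<alpha>\<close> and
  \<open>\<beta>\<close> survives integral matrices, integral translations and reduction modulo the
  lattice, so the orbit consists of points with denominator \<open>q\<close> in a bounded
  square.\<close>

lemma torus_orbit_finite:
  assumes "\<alpha> \<in> \<rat>" "\<beta> \<in> \<rat>"
  shows "finite (torus_orbit \<alpha> \<beta>)"
proof -
  obtain a b :: int and c d :: int where ab: "c > 0" "\<alpha> = of_int a / of_int c" "d > 0" "\<beta> = of_int b / of_int d"
    using assms by (metis Rats_cases')
  define q where "q = c * d"
  have q: "q > 0" using ab by (simp add: q_def)
  have "of_int q * \<alpha> = of_int (d * a)" "of_int q * \<beta> = of_int (c * b)"
    using ab(1,3) unfolding ab(2,4) q_def by (simp_all add: field_simps)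
  then have "of_int q * \<alpha> \<in> \<int>" "of_int q * \<beta> \<in> \<int>" by (metis Ints_of_int)+
  then have qv: "real_of_int q *\<^sub>R vector [\<alpha>, \<beta>] \<in> (Int_lattice :: (real^2) set)"
    by (simp add: Int_lattice_def forall_2)
  have qi: "real_of_int q *\<^sub>R w \<in> Int_lattice" if "w \<in> Int_lattice" for w :: "real^2"
    using that by (simp add: Int_lattice_def)
  have qr: "real_of_int q *\<^sub>R torus_rep w \<in> Int_lattice" if "real_of_int q *\<^sub>R w \<in> Int_lattice" for w
  proof -
    have "real_of_int q *\<^sub>R w - real_of_int q *\<^sub>R (w - torus_rep w) \<in> Int_lattice"
      by (rule Int_lattice_diff[OF that qi[OF torus_rep_diff]])
    then show ?thesis by (simp add: scaleR_right_diff_distrib)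
  qed
  have "torus_orbit \<alpha> \<beta> \<subseteq> (\<lambda>(i,j). vector [of_int i / of_int q, of_int j / of_int q]) ` ({-q..q} \<times> {-q..q})"
  proof
    fix p assume "p \<in> torus_orbit \<alpha> \<beta>"
    then obtain G n where G: "G \<in> Gamma_theta" "n \<in> Int_lattice" "p = torus_rep (n + G *v torus_rep (vector [\<alpha>, \<beta>]))"
      by (auto simp: torus_orbit_iff)
    have "real_of_int q *\<^sub>R n + G *v (real_of_int q *\<^sub>R torus_rep (vector [\<alpha>, \<beta>])) \<in> Int_lattice"
      by (rule Int_lattice_add[OF qi[OF G(2)] Int_lattice_theta[OF G(1) qr[OF qv]]])
    then have "real_of_int q *\<^sub>R (n + G *v torus_rep (vector [\<alpha>, \<beta>])) \<in> Int_lattice"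
      by (simp add: scaleR_add_right matrix_vector_mult_scaleR)
    then have "real_of_int q *\<^sub>R p \<in> Int_lattice" unfolding G(3) by (rule qr)
    then have I: "real_of_int q * p $ i \<in> \<int>" for i by (simp add: Int_lattice_def)
    obtain i where i: "real_of_int q * p $ 1 = of_int i" using I[of 1] by (auto elim: Ints_cases)
    obtain j where j: "real_of_int q * p $ 2 = of_int j" using I[of 2] by (auto elim: Ints_cases)
    have pe: "p $ 1 = of_int i / of_int q" "p $ 2 = of_int j / of_int q" using i j q by (simp_all add: field_simps)
    have bd: "k \<in> {-q..q}" if "real_of_int q * p $ l = of_int k" for k l
    proof -
      have "\<bar>real_of_int k\<bar> = real_of_int q * \<bar>p $ l\<bar>" using that[symmetric] q by (simp add: abs_mult)
      also have "\<dots> \<le> real_of_int q * 1"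
      proof (rule mult_left_mono)
        have "\<bar>p $ l\<bar> \<le> 1/2" unfolding G(3) by (rule torus_rep_bound)
        then show "\<bar>p $ l\<bar> \<le> 1" by simp
      qed (use q in simp)
      finally show ?thesis by auto
    qed
    show "p \<in> (\<lambda>(i,j). vector [of_int i / of_int q, of_int j / of_int q]) ` ({-q..q} \<times> {-q..q})"
      using bd[OF i] bd[OF j] by (intro image_eqI[of _ _ "(i,j)"]) (auto simp: vec_eq_iff forall_2 pe)
  qed
  then show ?thesis by (rule finite_subset) simp
qed

text \<open>Translations in \<open>Gamma_lattice\<close> disappear modulo the integer lattice, so
  every orbit point is congruent to the image of the base point under \<open>Gamma_theta\<close>;
  the group laws then give stability and transitivity.\<close>

lemma torus_orbit_set_torus_orbit:
  assumes "\<alpha> \<in> \<rat>" "\<beta> \<in> \<rat>"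
  shows "torus_orbit_set (torus_orbit \<alpha> \<beta>)" "torus_rep (vector [\<alpha>, \<beta>]) \<in> torus_orbit \<alpha> \<beta>"
proof -
  let ?v = "torus_rep (vector [\<alpha>, \<beta>])"
  have "?v = torus_rep (0 + mat 1 *v ?v)" by simp
  then show mem: "?v \<in> torus_orbit \<alpha> \<beta>" unfolding torus_orbit_iff by (metis Int_lattice_zero theta_one)
  have rep: "\<exists>G\<in>Gamma_theta. G *v ?v - p \<in> Int_lattice" if p: "p \<in> torus_orbit \<alpha> \<beta>" for p
  proof -
    obtain G n where G: "G \<in> Gamma_theta" "n \<in> Int_lattice" "p = torus_rep (n + G *v ?v)"
      using p unfolding torus_orbit_iff by blast
    have "(n + G *v ?v - p) - n \<in> Int_lattice"
      unfolding G(3) by (rule Int_lattice_diff[OF torus_rep_diff G(2)])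
    then show ?thesis using G(1) by (intro bexI[of _ G]) (simp_all add: algebra_simps)
  qed
  have idem: "torus_rep p = p" if "p \<in> torus_orbit \<alpha> \<beta>" for p
    using that by (auto simp: torus_orbit_iff)
  show "torus_orbit_set (torus_orbit \<alpha> \<beta>)"
  proof
    show "finite (torus_orbit \<alpha> \<beta>)" by (rule torus_orbit_finite[OF assms])
    show "torus_orbit \<alpha> \<beta> \<noteq> {}" using mem by blast
  next
    fix G p assume G: "G \<in> Gamma_theta" and p: "p \<in> torus_orbit \<alpha> \<beta>"
    obtain H where H: "H \<in> Gamma_theta" "H *v ?v - p \<in> Int_lattice" using rep[OF p] by blast
    let ?n = "- (G *v (H *v ?v - p))"
    have n: "?n \<in> Int_lattice" by (rule Int_lattice_minus[OF Int_lattice_theta[OF G H(2)]])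
    have e: "?n + (G ** H) *v ?v = G *v p"
      by (simp add: matrix_vector_mult_diff_distrib matrix_vector_mul_assoc)
    have "torus_rep (G *v p) \<in> torus_orbit \<alpha> \<beta>"
      unfolding torus_orbit_iff by (rule bexI[of _ "G ** H"], rule bexI[of _ ?n]) (use n G H e in auto)
    then show "\<exists>q\<in>torus_orbit \<alpha> \<beta>. G *v p - q \<in> Int_lattice" using torus_rep_diff by blast
  next
    fix p q assume "p \<in> torus_orbit \<alpha> \<beta>" "q \<in> torus_orbit \<alpha> \<beta>" "p - q \<in> Int_lattice"
    then show "p = q" using torus_rep_eqI[of p q] idem by simp
  next
    fix p q assume p: "p \<in> torus_orbit \<alpha> \<beta>" and q: "q \<in> torus_orbit \<alpha> \<beta>"
    obtain G where G: "G \<in> Gamma_theta" "G *v ?v - p \<in> Int_lattice" using rep[OF p] by blast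
    obtain H where H: "H \<in> Gamma_theta" "H *v ?v - q \<in> Int_lattice" using rep[OF q] by blast
    have "(H *v ?v - q) - (H ** adj G) *v (G *v ?v - p) \<in> Int_lattice"
      by (rule Int_lattice_diff[OF H(2) Int_lattice_theta[OF theta_mult[OF H(1) theta_adj[OF G(1)]] G(2)]])
    moreover have "(H ** adj G) *v (G *v ?v) = H *v ?v"
      using G(1) by (simp only: matrix_vector_mul_assoc adj_mult_cancel theta_SL)
    ultimately have "(H ** adj G) *v p - q \<in> Int_lattice"
      by (simp add: matrix_vector_mult_diff_distrib)
    then show "\<exists>K\<in>Gamma_theta. K *v p - q \<in> Int_lattice"
      using theta_mult[OF H(1) theta_adj[OF G(1)]] by blast
  qed
qed

subsection \<open>The coset space\<close>

definition cs :: "real^2^2 \<Rightarrow> real^2 \<Rightarrow> ((real^2^2) \<times> (real^2)) set" where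
  "cs M \<xi> = Gamma_lattice #>\<^bsub>ASL2\<^esub> (M, \<xi>)"

lemma carrier_ASL2: "carrier ASL2 = SL \<times> UNIV"
  by (simp add: SL_def)

lemma cs_invariant:
  assumes M: "M \<in> SL" and G: "G \<in> Gamma_theta" and n: "n \<in> Int_lattice"
  shows "cs (G ** M) (G *v \<xi> + n) = cs M \<xi>"
proof -
  have g: "(G, n) \<in> Gamma_lattice" using G n by (simp add: Gamma_lattice_def)
  have c: "(G, n) \<in> carrier ASL2" "(M, \<xi>) \<in> carrier ASL2" "Gamma_lattice \<subseteq> carrier ASL2"
    using theta_SL[OF G] M subgroup.subset[OF subgroup_Gamma_lattice] unfolding carrier_ASL2 by auto
  have "(G ** M, G *v \<xi> + n) = (G, n) \<otimes>\<^bsub>ASL2\<^esub> (M, \<xi>)" by (simp add: add.commute)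
  then have "cs (G ** M) (G *v \<xi> + n) = (Gamma_lattice #>\<^bsub>ASL2\<^esub> (G, n)) #>\<^bsub>ASL2\<^esub> (M, \<xi>)"
    unfolding cs_def by (simp only: group.coset_mult_assoc[OF group_ASL2 c(3,1,2)])
  also have "Gamma_lattice #>\<^bsub>ASL2\<^esub> (G, n) = Gamma_lattice"
    by (rule group.coset_join2[OF group_ASL2 c(1) subgroup_Gamma_lattice g])
  finally show ?thesis by (simp only: cs_def)
qed

lemma cs_topspace: "M \<in> SL \<Longrightarrow> cs M \<xi> \<in> topspace coset_topology"
  unfolding topspace_coset_topology cs_def RCOSETS_def carrier_ASL2 by blast

lemma cs_continuous: "continuous_map (top_of_set (SL \<times> UNIV)) coset_topology (\<lambda>z. cs (fst z) (snd z))"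
  using quotient_imp_continuous_map[OF quotient_map_coset] unfolding carrier_ASL2 cs_def by simp

lemma lift_map_continuous:
  "continuous_map (top_of_set (UNIV \<times> (SL \<times> UNIV))) (prod_topology euclideanreal coset_topology) (\<lambda>z. (fst z, cs (fst (snd z)) (snd (snd z))))"
proof (rule continuous_map_pairedI)
  show "continuous_map (top_of_set (UNIV \<times> SL \<times> UNIV)) euclideanreal fst"
    unfolding continuous_map_iff_continuous by (intro continuous_intros)
  have "continuous_map (top_of_set (UNIV \<times> SL \<times> UNIV)) (top_of_set (SL \<times> UNIV)) snd"
    by (simp add: continuous_map_in_subtopology) (intro conjI continuous_intros; auto)
  from continuous_map_compose[OF this cs_continuous]
  show "continuous_map (top_of_set (UNIV \<times> SL \<times> UNIV)) coset_topology (\<lambda>z. cs (fst (snd z)) (snd (snd z)))"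
    by (simp add: o_def)
qed

lemma lift_continuous:
  assumes "continuous_map (prod_topology euclideanreal coset_topology) euclideanreal F"
  shows "continuous_on (UNIV \<times> (SL \<times> UNIV)) (\<lambda>z. F (fst z, cs (fst (snd z)) (snd (snd z))))"
  using continuous_map_compose[OF lift_map_continuous assms] by (simp add: o_def)

text \<open>Uniform convergence is assumed on compact sets of the quotient; this carries it over to
  compact sets of matrices and vectors.\<close>

lemma lift_compact:
  assumes K: "compact K" "K \<subseteq> UNIV \<times> (SL \<times> UNIV)"
  shows "compactin (prod_topology euclideanreal coset_topology) ((\<lambda>z. (fst z, cs (fst (snd z)) (snd (snd z)))) ` K)"
  by (rule image_compactin[OF _ lift_map_continuous]) (use K in \<open>simp add: compactin_subtopology\<close>)

lemma cs_measurable: "(\<lambda>M. cs M \<xi>) \<in> measurable SLb coset_borel"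
  unfolding coset_borel_def
proof (rule measurable_sigma_sets)
  show "sets (sigma (topspace coset_topology) {U. openin coset_topology U}) = sigma_sets (topspace coset_topology) {U. openin coset_topology U}"
    by (rule sets_measure_of) (auto dest: openin_subset)
  show "{U. openin coset_topology U} \<subseteq> Pow (topspace coset_topology)" by (auto dest: openin_subset)
  show "(\<lambda>M. cs M \<xi>) \<in> space SLb \<rightarrow> topspace coset_topology" using cs_topspace by auto
next
  fix U assume "U \<in> {U. openin coset_topology U}"
  then have U: "openin coset_topology U" by simp
  have "continuous_map (top_of_set SL) (top_of_set (SL \<times> UNIV)) (\<lambda>M. (M, \<xi>))"
    by (simp add: continuous_map_in_subtopology) (intro conjI continuous_intros; auto)
  from continuous_map_compose[OF this cs_continuous]
  have "continuous_map (top_of_set SL) coset_topology (\<lambda>M. cs M \<xi>)" by (simp add: o_def)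
  then have "openin (top_of_set SL) {M \<in> SL. cs M \<xi> \<in> U}"
    using openin_continuous_map_preimage[OF _ U] by fastforce
  then obtain V where V: "open V" "{M \<in> SL. cs M \<xi> \<in> U} = SL \<inter> V" unfolding openin_open by blast
  have "(\<lambda>M. cs M \<xi>) -` U \<inter> space SLb = SL \<inter> V" using V(2) by auto
  then show "(\<lambda>M. cs M \<xi>) -` U \<inter> space SLb \<in> sets SLb"
    unfolding sets_restrict_space by (simp only: imageI[OF borel_open[OF V(1)]])
qed

lemma iwasawa_measurable_hyp: "(\<lambda>z. iwasawa (fst z) (fst (snd z)) (snd (snd z))) \<in> measurable hyp_measure SLb"
proof -
  have "(\<lambda>z. if fst (snd z) > 0 then iwasawa (fst z) (fst (snd z)) (snd (snd z)) else mat 1) \<in> measurable hyp_measure SLb"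
    by (rule measurable_hyp_measure) measurable
  moreover have "(\<lambda>z. if fst (snd z) > 0 then iwasawa (fst z) (fst (snd z)) (snd (snd z)) else mat 1) \<in> measurable hyp_measure SLb \<longleftrightarrow>
    (\<lambda>z. iwasawa (fst z) (fst (snd z)) (snd (snd z))) \<in> measurable hyp_measure SLb"
    by (rule measurable_cong) (auto simp: space_hyp_measure hyp_region_def theta_domain_iff)
  ultimately show ?thesis by blast
qed

lemma finite_measure_hyp: "finite_measure hyp_measure"
  by (rule finite_measureI) (simp add: space_hyp_measure emeasure_hyp_measure)

lemma distr_hyp_measure:
  "distr hyp_measure SLb (\<lambda>z. iwasawa (fst z) (fst (snd z)) (snd (snd z))) = density fdm (\<lambda>_. 2)"
proof (rule measure_eqI)
  fix A assume "A \<in> sets (distr hyp_measure SLb (\<lambda>z. iwasawa (fst z) (fst (snd z)) (snd (snd z))))"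
  then have A: "A \<in> sets SLb" by (simp only: sets_distr)
  have iA: "indicator A \<in> borel_measurable SLb" by (rule borel_measurable_indicator[OF A])
  have "emeasure (distr hyp_measure SLb (\<lambda>z. iwasawa (fst z) (fst (snd z)) (snd (snd z)))) A
     = (\<integral>\<^sup>+M. indicator A M \<partial>distr hyp_measure SLb (\<lambda>z. iwasawa (fst z) (fst (snd z)) (snd (snd z))))"
    by (rule nn_integral_indicator[symmetric]) (simp only: sets_distr A)
  also have "\<dots> = (\<integral>\<^sup>+z. indicator A (iwasawa (fst z) (fst (snd z)) (snd (snd z))) \<partial>hyp_measure)"
    by (rule nn_integral_distr[OF iwasawa_measurable_hyp]) (simp only: measurable_distr_eq1 iA)
  also have "\<dots> = 2 * (\<integral>\<^sup>+M. indicator FD M * indicator A M \<partial>haar)"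
    using FD_iwasawa[OF iA] unfolding split_def .
  also have "(\<integral>\<^sup>+M. indicator FD M * indicator A M \<partial>haar) = (\<integral>\<^sup>+M. indicator A M \<partial>fdm)"
    by (rule nn_integral_fdm[OF iA, symmetric])
  also have "2 * (\<integral>\<^sup>+M. indicator A M \<partial>fdm) = emeasure (density fdm (\<lambda>_. 2)) A"
  proof -
    have "emeasure (density fdm (\<lambda>_. 2)) A = (\<integral>\<^sup>+M. 2 * indicator A M \<partial>fdm)"
      by (rule emeasure_density) (simp_all only: borel_measurable_const sets_fdm A)
    also have "\<dots> = 2 * (\<integral>\<^sup>+M. indicator A M \<partial>fdm)"
      by (rule nn_integral_cmult) (simp only: measurable_fdm_iff iA)
    finally show ?thesis by (rule sym)
  qed
  finally show "emeasure (distr hyp_measure SLb (\<lambda>z. iwasawa (fst z) (fst (snd z)) (snd (snd z)))) A = emeasure (density fdm (\<lambda>_. 2)) A" .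
qed (simp only: sets_distr sets_density sets_fdm)

lemma scale_measure_density: "scale_measure r M = density M (\<lambda>_. r)"
proof (rule measure_eqI)
  fix A assume "A \<in> sets (scale_measure r M)"
  then have A: "A \<in> sets M" by (simp only: sets_scale_measure)
  have "emeasure (density M (\<lambda>_. r)) A = (\<integral>\<^sup>+x. r * indicator A x \<partial>M)"
    by (rule emeasure_density[OF borel_measurable_const A])
  also have "\<dots> = r * emeasure M A" by (rule nn_integral_cmult_indicator[OF A])
  finally show "emeasure (scale_measure r M) A = emeasure (density M (\<lambda>_. r)) A"
    by (simp only: emeasure_scale_measure)
qed (simp only: sets_scale_measure sets_density)

text \<open>The factor 2 of the Iwasawa coordinates combines with the normalisation
  \<open>1 / (pi^2 * card S)\<close> to \<open>1 / T\<close>. Boundedness of \<open>G\<close> on the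
  finite product measure allows the integral to be iterated.\<close>

lemma integral_mu:
  fixes G :: "((real^2^2) \<times> (real^2)) set \<Rightarrow> real"
  assumes ab: "\<alpha> \<in> \<rat>" "\<beta> \<in> \<rat>"
    and G: "G \<in> borel_measurable coset_borel" and B: "\<And>g. g \<in> topspace coset_topology \<Longrightarrow> \<bar>G g\<bar> \<le> B"
  shows "(\<integral>g. G g \<partial>mu \<alpha> \<beta>) = torus_orbit_set.J (torus_orbit \<alpha> \<beta>) (\<lambda>M \<xi>. G (cs M \<xi>)) / torus_orbit_set.T (torus_orbit \<alpha> \<beta>)"
proof -
  let ?S = "torus_orbit \<alpha> \<beta>"
  interpret torus_orbit_set ?S by (rule torus_orbit_set_torus_orbit(1)[OF ab])
  interpret hyp: finite_measure hyp_measure by (rule finite_measure_hyp)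
  interpret cnt: finite_measure "count_space ?S" by (rule finite_measure_count_space[OF finS])
  interpret P: pair_sigma_finite hyp_measure "count_space ?S" ..
  interpret PF: finite_measure "hyp_measure \<Otimes>\<^sub>M count_space ?S"
    by (rule finite_measure_pair_measure) unfold_locales
  define tm where "tm = (\<lambda>w. cs (iwasawa (fst (fst w)) (fst (snd (fst w))) (snd (snd (fst w)))) (snd w))"
  have tm: "tm \<in> measurable (hyp_measure \<Otimes>\<^sub>M count_space ?S) coset_borel"
  proof -
    have each: "(\<lambda>z. tm (z, p)) \<in> measurable hyp_measure coset_borel" for p
      unfolding tm_def fst_conv snd_conv by (rule measurable_compose[OF iwasawa_measurable_hyp cs_measurable])
    show ?thesis
      by (subst measurable_pair_swap_iff, rule measurable_pair_measure_countable1)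
         (simp_all only: split_conv countable_finite[OF finS] each)
  qed
  have tmB: "\<bar>G (tm w)\<bar> \<le> B" if "w \<in> space (hyp_measure \<Otimes>\<^sub>M count_space ?S)" for w
    using that by (intro B) (auto simp: tm_def space_pair_measure space_hyp_measure hyp_region_def theta_domain_iff intro!: cs_topspace iwasawa_SL)
  define r where "r = 1 / (pi\<^sup>2 * real (card ?S))"
  have r0: "r \<ge> 0" by (simp add: r_def)
  have mu: "mu \<alpha> \<beta> = density (distr (hyp_measure \<Otimes>\<^sub>M count_space ?S) coset_borel tm) (\<lambda>_. ennreal r)"
    by (simp add: mu_def scale_measure_density r_def tm_def cs_def split_def)
  have "(\<integral>g. G g \<partial>mu \<alpha> \<beta>) = (\<integral>g. r *\<^sub>R G g \<partial>distr (hyp_measure \<Otimes>\<^sub>M count_space ?S) coset_borel tm)"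
    unfolding mu by (rule integral_density) (use G r0 in simp_all)
  also have "\<dots> = r * (\<integral>g. G g \<partial>distr (hyp_measure \<Otimes>\<^sub>M count_space ?S) coset_borel tm)" by simp
  also have "(\<integral>g. G g \<partial>distr (hyp_measure \<Otimes>\<^sub>M count_space ?S) coset_borel tm) = (\<integral>w. G (tm w) \<partial>(hyp_measure \<Otimes>\<^sub>M count_space ?S))"
    by (rule integral_distr[OF tm G])
  also have "\<dots> = (\<integral>z. (\<integral>p. G (tm (z, p)) \<partial>count_space ?S) \<partial>hyp_measure)"
  proof (rule P.integral_fst'[symmetric])
    show "integrable (hyp_measure \<Otimes>\<^sub>M count_space ?S) (\<lambda>w. G (tm w))"
      by (rule PF.integrable_const_bound[of _ B]) (use tmB in \<open>auto intro!: AE_I2 measurable_compose[OF tm G]\<close>)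
  qed
  also have "\<dots> = (\<integral>z. (\<Sum>p\<in>?S. G (tm (z, p))) \<partial>hyp_measure)"
    by (simp add: lebesgue_integral_count_space_finite[OF finS])
  also have "\<dots> = (\<Sum>p\<in>?S. \<integral>z. G (tm (z, p)) \<partial>hyp_measure)"
  proof (rule Bochner_Integration.integral_sum)
    fix p assume p: "p \<in> ?S"
    have m: "(\<lambda>z. G (cs (iwasawa (fst z) (fst (snd z)) (snd (snd z))) p)) \<in> borel_measurable hyp_measure"
      by (rule measurable_compose[OF measurable_compose[OF iwasawa_measurable_hyp cs_measurable] G])
    show "integrable hyp_measure (\<lambda>z. G (tm (z, p)))"
    proof (rule hyp.integrable_const_bound[of _ B])
      show "AE z in hyp_measure. norm (G (tm (z, p))) \<le> B"
        using tmB p by (intro AE_I2) (simp add: space_pair_measure)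
    qed (use m in \<open>simp add: tm_def\<close>)
  qed
  also have "\<dots> = (\<Sum>p\<in>?S. 2 * (\<integral>M. G (cs M p) \<partial>fdm))"
  proof (rule sum.cong[OF refl])
    fix p
    have m: "(\<lambda>M. G (cs M p)) \<in> borel_measurable SLb" by (rule measurable_compose[OF cs_measurable G])
    have "(\<integral>z. G (tm (z, p)) \<partial>hyp_measure) = (\<integral>M. G (cs M p) \<partial>distr hyp_measure SLb (\<lambda>z. iwasawa (fst z) (fst (snd z)) (snd (snd z))))"
      unfolding tm_def fst_conv snd_conv by (rule integral_distr[OF iwasawa_measurable_hyp m, symmetric])
    also have "\<dots> = (\<integral>M. G (cs M p) \<partial>density fdm (\<lambda>_. ennreal 2))" by (simp add: distr_hyp_measure)
    also have "\<dots> = (\<integral>M. 2 *\<^sub>R G (cs M p) \<partial>fdm)"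
      by (rule integral_density) (use m in simp_all)
    finally show "(\<integral>z. G (tm (z, p)) \<partial>hyp_measure) = 2 * (\<integral>M. G (cs M p) \<partial>fdm)" by simp
  qed
  also have "\<dots> = 2 * J (\<lambda>M \<xi>. G (cs M \<xi>))" by (simp add: J_def sum_distrib_left)
  finally show ?thesis by (simp add: r_def T_def mult.commute)
qed

subsection \<open>Cutoff and bounded continuous functions\<close>

lemma norm_mmult_le: "norm (A ** B) \<le> norm A * norm B" for A B :: "real^2^2"
proof -
  \<comment> \<open>Cauchy-Schwarz with its defect \<open>(a * g - b * e)^2\<close> written out. The
    norm on \<open>real^2^2\<close> is Euclidean in the four entries, so this is used once for each
    entry of the product.\<close>
  have cs: "(a * e + b * g)\<^sup>2 \<le> (a\<^sup>2 + b\<^sup>2) * (e\<^sup>2 + g\<^sup>2)" for a b e g :: real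
    using zero_le_power2[of "a * g - b * e"] by (simp add: power2_eq_square algebra_simps)
  have "((A ** B)$1$1)\<^sup>2 + ((A ** B)$1$2)\<^sup>2 + ((A ** B)$2$1)\<^sup>2 + ((A ** B)$2$2)\<^sup>2 \<le>
     ((A$1$1)\<^sup>2 + (A$1$2)\<^sup>2) * ((B$1$1)\<^sup>2 + (B$2$1)\<^sup>2) + ((A$1$1)\<^sup>2 + (A$1$2)\<^sup>2) * ((B$1$2)\<^sup>2 + (B$2$2)\<^sup>2) +
     ((A$2$1)\<^sup>2 + (A$2$2)\<^sup>2) * ((B$1$1)\<^sup>2 + (B$2$1)\<^sup>2) + ((A$2$1)\<^sup>2 + (A$2$2)\<^sup>2) * ((B$1$2)\<^sup>2 + (B$2$2)\<^sup>2)"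
    unfolding matrix_mult_nth_22 by (intro add_mono cs)
  also have "\<dots> = ((A$1$1)\<^sup>2 + (A$1$2)\<^sup>2 + (A$2$1)\<^sup>2 + (A$2$2)\<^sup>2) * ((B$1$1)\<^sup>2 + (B$1$2)\<^sup>2 + (B$2$1)\<^sup>2 + (B$2$2)\<^sup>2)"
    by (simp add: algebra_simps)
  finally show ?thesis unfolding norm_mat22 real_sqrt_mult[symmetric] by (rule real_sqrt_le_mono)
qed

lemma norm_SL_ge_1: assumes "M \<in> SL" shows "1 \<le> norm M"
proof -
  have "M$1$1 * M$2$2 - M$1$2 * M$2$1 = 1" using assms by (simp add: SL_iff)
  moreover have "0 \<le> (M$1$1 - M$2$2)\<^sup>2" "0 \<le> (M$1$2 + M$2$1)\<^sup>2" by simp_all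
  ultimately have "1 \<le> (M$1$1)\<^sup>2 + (M$1$2)\<^sup>2 + (M$2$1)\<^sup>2 + (M$2$2)\<^sup>2"
    by (simp add: power2_eq_square algebra_simps)
  then show ?thesis unfolding norm_mat22 by simp
qed

text \<open>The quotient by the lattice is exhausted by the sublevel sets of \<open>nu\<close>, each of which is
  relatively compact; this avoids any discussion of cusps.\<close>

definition nu :: "real^2^2 \<Rightarrow> real" where
  "nu M = Inf ((\<lambda>G. norm (G ** M)) ` Gamma_theta)"

lemma nu_bdd: "bdd_below ((\<lambda>G. norm (G ** M)) ` Gamma_theta)" for M :: "real^2^2"
  by (rule bdd_belowI[of _ 0]) auto

lemma nu_le: "G \<in> Gamma_theta \<Longrightarrow> nu M \<le> norm (G ** M)"
  unfolding nu_def by (rule cInf_lower[OF imageI nu_bdd])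

lemma theta_nonempty: "Gamma_theta \<noteq> {}" using theta_one by blast

lemma nu_ge_1: assumes M: "M \<in> SL" shows "1 \<le> nu M"
  unfolding nu_def
proof (rule cInf_greatest)
  fix x assume "x \<in> (\<lambda>G. norm (G ** M)) ` Gamma_theta"
  then show "1 \<le> x" using M by (auto intro!: norm_SL_ge_1)
qed (use theta_nonempty in simp)

lemma nu_invariant: assumes G: "G \<in> Gamma_theta" shows "nu (G ** M) = nu M"
proof -
  have "(\<lambda>H. norm (H ** (G ** M))) ` Gamma_theta = (\<lambda>H. norm (H ** M)) ` Gamma_theta"
  proof (intro equalityI image_subsetI)
    fix H assume "H \<in> Gamma_theta"
    then show "norm (H ** (G ** M)) \<in> (\<lambda>H. norm (H ** M)) ` Gamma_theta"
      using G by (intro image_eqI[of _ _ "H ** G"]) (simp_all only: matrix_mul_assoc theta_mult)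
  next
    fix H assume "H \<in> Gamma_theta"
    moreover have "(H ** adj G) ** (G ** M) = H ** M" using G by (simp add: matrix_mul_assoc[symmetric])
    ultimately show "norm (H ** M) \<in> (\<lambda>H. norm (H ** (G ** M))) ` Gamma_theta"
      using G by (intro image_eqI[of _ _ "H ** adj G"]) (simp_all only: theta_mult theta_adj)
  qed
  then show ?thesis by (simp only: nu_def)
qed

lemma nu_mult:
  assumes M: "M \<in> SL"
  shows "nu (M ** h) \<le> (1 + norm (h - mat 1)) * nu M"
proof -
  let ?d = "1 + norm (h - mat 1)"
  have d: "?d > 0" by (simp add: add_pos_nonneg)
  have "nu (M ** h) / ?d \<le> nu M"
    unfolding nu_def[of M]
  proof (rule cInf_greatest)
    fix x assume "x \<in> (\<lambda>G. norm (G ** M)) ` Gamma_theta"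
    then obtain G where G: "G \<in> Gamma_theta" "x = norm (G ** M)" by blast
    have "nu (M ** h) \<le> norm (G ** (M ** h))" by (rule nu_le[OF G(1)])
    also have "G ** (M ** h) = G ** M + G ** M ** (h - mat 1)"
    proof -
      have "h = mat 1 + (h - mat 1)" by simp
      then have "G ** M ** h = G ** M ** (mat 1 + (h - mat 1))" by (simp only:)
      then show ?thesis by (simp only: matrix_add_ldistrib matrix_mul_rid matrix_mul_assoc)
    qed
    also have "norm \<dots> \<le> norm (G ** M) + norm (G ** M) * norm (h - mat 1)"
      by (rule order.trans[OF norm_triangle_ineq add_left_mono[OF norm_mmult_le]])
    finally have "nu (M ** h) \<le> x * ?d" by (simp add: G(2) algebra_simps)
    then show "nu (M ** h) / ?d \<le> x" using d by (simp add: pos_divide_le_eq)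
  qed (use theta_nonempty in simp)
  then show ?thesis using d by (simp add: pos_divide_le_eq mult.commute)
qed

text \<open>Right multiplication changes \<open>nu\<close> by a factor near 1 however large
  \<open>nu\<close> is. Logarithms turn this into a Lipschitz bound, which is why the cutoff is a
  function of \<open>ln (nu M)\<close>.\<close>

lemma nu_ln:
  assumes M: "M \<in> SL" and h: "h \<in> SL"
  shows "\<bar>ln (nu (M ** h)) - ln (nu M)\<bar> \<le> norm (h - mat 1)"
proof -
  have up: "ln (nu (M ** h)) \<le> norm (h - mat 1) + ln (nu M)" if "M \<in> SL" "h \<in> SL" for M h
  proof -
    have p: "0 < nu M" "0 < nu (M ** h)" using nu_ge_1[of M] nu_ge_1[of "M ** h"] that by auto
    have d: "0 < 1 + norm (h - mat 1)" by (simp add: add_pos_nonneg)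
    have "ln (nu (M ** h)) \<le> ln ((1 + norm (h - mat 1)) * nu M)"
      using nu_mult[OF that(1), of h] p d by (intro ln_mono) auto
    also have "\<dots> = ln (1 + norm (h - mat 1)) + ln (nu M)"
      using p(1) d by (simp add: ln_mult)
    also have "ln (1 + norm (h - mat 1)) \<le> norm (h - mat 1)" by (rule ln_add_one_self_le_self) simp
    finally show ?thesis by simp
  qed
  have "ln (nu ((M ** h) ** adj h)) \<le> norm (adj h - mat 1) + ln (nu (M ** h))"
    using up[of "M ** h" "adj h"] M h by simp
  then have "ln (nu M) \<le> norm (h - mat 1) + ln (nu (M ** h))"
    using h by (simp add: norm_adj)
  then show ?thesis using up[OF M h] by (simp add: abs_le_iff)
qed

definition chi :: "real \<Rightarrow> real^2^2 \<Rightarrow> real" where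
  "chi R M = max 0 (min 1 (R + 1 - ln (nu M)))"

lemma chi_bounds: "0 \<le> chi R M" "chi R M \<le> 1"
  by (auto simp: chi_def)

lemma chi_good: "good (\<lambda>M \<xi>. chi R M)"
proof (rule goodI[of _ 1])
  fix M :: "real^2^2" and \<xi> :: "real^2" assume M: "M \<in> SL"
  show "\<bar>chi R M\<bar> \<le> 1" using chi_bounds by simp
  fix G and n :: "real^2" assume "G \<in> Gamma_theta"
  then show "chi R (G ** M) = chi R M" by (simp add: chi_def nu_invariant)
next
  fix e :: real assume e: "e > 0"
  have "\<bar>chi R (M ** h) - chi R M\<bar> < e" if "M \<in> SL" "h \<in> SL" "norm (h - mat 1) < e" for M h
  proof -
    have "\<bar>max 0 (min 1 (R + 1 - x)) - max 0 (min 1 (R + 1 - y))\<bar> \<le> \<bar>x - y\<bar>" for x y :: real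
      by (auto simp: max_def min_def)
    from order.trans[OF this nu_ln[OF that(1,2)]] show ?thesis
      using that(3) unfolding chi_def by (rule le_less_trans)
  qed
  then show "\<exists>d>0. \<forall>M\<in>SL. \<forall>\<xi>::real^2. \<forall>h\<in>SL. norm (h - mat 1) < d \<longrightarrow> \<bar>chi R (M ** h) - chi R M\<bar> < e"
    using e by blast
qed

text \<open>Where the cutoff \<open>chi R\<close> is nonzero, \<open>nu M < exp (R + 1)\<close>, so
  some translate of the matrix has norm below this radius, and the vector can be reduced to the unit
  square about 0. The square is taken closed for compactness.\<close>

definition core :: "real \<Rightarrow> ((real^2^2) \<times> (real^2)) set" where
  "core R = (SL \<inter> cball 0 (exp (R + 1))) \<times> cbox (\<chi> i. - 1/2) (\<chi> i. 1/2)"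

lemma core_compact: "compact (core R)"
  unfolding core_def by (intro compact_Times compact_cbox closed_Int_compact closed_SL compact_cball)

lemma core_subset: "core R \<subseteq> SL \<times> UNIV"
  by (auto simp: core_def)

lemma chi_reduce:
  assumes M: "M \<in> SL" and c: "chi R M \<noteq> 0"
  shows "\<exists>G\<in>Gamma_theta. \<exists>n\<in>Int_lattice. (G ** M, G *v \<xi> + n) \<in> core R"
proof -
  have "ln (nu M) < R + 1" using c by (auto simp: chi_def max_def min_def split: if_splits)
  moreover have "0 < nu M" using nu_ge_1[OF M] by simp
  ultimately have "nu M < exp (R + 1)" by (metis exp_less_cancel_iff exp_ln)
  then obtain G where G: "G \<in> Gamma_theta" "norm (G ** M) < exp (R + 1)"
    unfolding nu_def using cInf_lessD[of "(\<lambda>G. norm (G ** M)) ` Gamma_theta"] theta_nonempty by auto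
  let ?n = "- (G *v \<xi> - torus_rep (G *v \<xi>))"
  have "?n \<in> Int_lattice" by (rule Int_lattice_minus[OF torus_rep_diff])
  moreover have "torus_rep (G *v \<xi>) \<in> cbox (\<chi> i. - 1/2) (\<chi> i. 1/2)"
  proof -
    have "- (1/2) \<le> torus_rep (G *v \<xi>) $ i" "torus_rep (G *v \<xi>) $ i \<le> 1/2" for i
      using torus_rep_bound[of "G *v \<xi>" i] by (simp_all only: abs_le_iff) simp_all
    then show ?thesis by (simp add: mem_box_cart)
  qed
  ultimately show ?thesis
    using G M by (intro bexI[OF _ G(1)] bexI[of _ ?n]) (auto simp: core_def)
qed

text \<open>Invariance moves every point with nonzero cutoff into the compact \<open>core R\<close>,
  where continuity is uniform. If the cutoff vanishes at \<open>M\<close> but not at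
  \<open>M ** h\<close>, the estimate is made at \<open>M ** h\<close> with
  \<open>adj h\<close>.\<close>

lemma good_cutoff:
  fixes f :: "real^2^2 \<Rightarrow> real^2 \<Rightarrow> real"
  assumes inv: "\<And>M \<xi> G n. M \<in> SL \<Longrightarrow> G \<in> Gamma_theta \<Longrightarrow> n \<in> Int_lattice \<Longrightarrow> f (G ** M) (G *v \<xi> + n) = f M \<xi>"
    and bd: "\<And>M \<xi>. M \<in> SL \<Longrightarrow> \<bar>f M \<xi>\<bar> \<le> B"
    and cont: "continuous_on (SL \<times> UNIV) (\<lambda>z. f (fst z) (snd z))"
    and supp: "\<And>M \<xi>. M \<in> SL \<Longrightarrow> f M \<xi> \<noteq> 0 \<Longrightarrow> chi R M \<noteq> 0"
  shows "good f"
proof (rule goodI[OF inv bd])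
  fix e :: real assume e: "e > 0"
  obtain d where d: "d > 0" "\<And>M \<xi> h. (M,\<xi>) \<in> core R \<Longrightarrow> h \<in> SL \<Longrightarrow> norm (h - mat 1) < d \<Longrightarrow> \<bar>f (M ** h) \<xi> - f M \<xi>\<bar> < e"
    using compact_right_ucont[OF core_compact core_subset cont e, of R] by auto
  have main: "\<bar>f (M ** h) \<xi> - f M \<xi>\<bar> < e" if M: "M \<in> SL" "chi R M \<noteq> 0" and h: "h \<in> SL" "norm (h - mat 1) < d" for M \<xi> h
  proof -
    obtain G n where G: "G \<in> Gamma_theta" "n \<in> Int_lattice" "(G ** M, G *v \<xi> + n) \<in> core R"
      using chi_reduce[OF M] by blast
    have "f (G ** M ** h) (G *v \<xi> + n) = f (M ** h) \<xi>"
      using inv[OF SL_mult[OF M(1) h(1)] G(1,2), of \<xi>] by (simp only: matrix_mul_assoc)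
    then show ?thesis using d(2)[OF G(3) h] inv[OF M(1) G(1,2), of \<xi>] by simp
  qed
  show "\<exists>d>0. \<forall>M\<in>SL. \<forall>\<xi>. \<forall>h\<in>SL. norm (h - mat 1) < d \<longrightarrow> \<bar>f (M ** h) \<xi> - f M \<xi>\<bar> < e"
  proof (intro exI[of _ d] conjI ballI allI impI d(1))
    fix M \<xi> h assume *: "M \<in> SL" "h \<in> SL" "norm (h - mat 1) < d"
    show "\<bar>f (M ** h) \<xi> - f M \<xi>\<bar> < e"
    proof (cases "chi R M = 0")
      case False
      then show ?thesis using main * by blast
    next
      case True
      show ?thesis
      proof (cases "chi R (M ** h) = 0")
        case False
        then have "\<bar>f ((M ** h) ** adj h) \<xi> - f (M ** h) \<xi>\<bar> < e"
          using * by (intro main) (simp_all add: norm_adj)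
        then show ?thesis using * by (simp add: abs_minus_commute)
      next
        case c: True
        have "f M \<xi> = 0" using supp[OF *(1)] True by blast
        moreover have "f (M ** h) \<xi> = 0" using supp[OF SL_mult[OF *(1,2)]] c by blast
        ultimately show ?thesis using e by simp
      qed
    qed
  qed
qed

context torus_orbit_set
begin

lemma J_chi: "(\<lambda>n. J (\<lambda>M \<xi>. chi (real n) M)) \<longlonglongrightarrow> T"
proof -
  have "(\<lambda>n. \<integral>M. chi (real n) M \<partial>fdm) \<longlonglongrightarrow> (\<integral>M. 1 \<partial>fdm)"
  proof (rule integral_dominated_convergence[where w="\<lambda>_. 1"])
    show "AE M in fdm. (\<lambda>n. chi (real n) M) \<longlonglongrightarrow> 1"
    proof (rule AE_I2)
      fix M assume "M \<in> space fdm"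
      obtain k :: nat where k: "ln (nu M) \<le> real k" using real_arch_simple by blast
      have "\<forall>\<^sub>F n in sequentially. chi (real n) M = 1"
        using eventually_ge_at_top[of k]
      proof eventually_elim
        case (elim n)
        then have "ln (nu M) \<le> real n" using k by (meson of_nat_mono order.trans)
        then show ?case by (simp add: chi_def)
      qed
      then show "(\<lambda>n. chi (real n) M) \<longlonglongrightarrow> 1" by (rule tendsto_eventually)
    qed
    show "AE M in fdm. norm (chi (real n) M) \<le> 1" for n using chi_bounds by (intro AE_I2) simp
    show "(\<lambda>M. chi (real n) M) \<in> borel_measurable fdm" for n
      using good_measurable[OF chi_good] by (simp only: measurable_fdm_iff)
  qed simp_all
  then have "(\<lambda>n. \<Sum>p\<in>S. \<integral>M. chi (real n) M \<partial>fdm) \<longlonglongrightarrow> (\<Sum>p\<in>S. \<integral>M. 1 \<partial>fdm)"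
    by (intro tendsto_sum)
  then show ?thesis by (simp add: J_def T_def measure_fdm)
qed

lemma J_diff_bound:
  assumes a: "\<And>p. integrable fdm (\<lambda>M. a M p)" and b: "\<And>p. integrable fdm (\<lambda>M. b M p)" and c: "\<And>p. integrable fdm (\<lambda>M. c M p)"
    and le: "\<And>M p. M \<in> SL \<Longrightarrow> \<bar>a M p - b M p\<bar> \<le> c M p"
  shows "\<bar>J a - J b\<bar> \<le> J c"
proof -
  have "J a - J b = (\<Sum>p\<in>S. \<integral>M. a M p - b M p \<partial>fdm)"
    unfolding J_def using a b by (simp add: sum_subtractf)
  also have "\<bar>\<dots>\<bar> \<le> (\<Sum>p\<in>S. \<bar>\<integral>M. a M p - b M p \<partial>fdm\<bar>)" by (rule sum_abs)
  also have "\<dots> \<le> (\<Sum>p\<in>S. \<integral>M. c M p \<partial>fdm)"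
  proof (rule sum_mono)
    fix p
    have "\<bar>\<integral>M. a M p - b M p \<partial>fdm\<bar> \<le> (\<integral>M. \<bar>a M p - b M p\<bar> \<partial>fdm)"
      using integral_norm_bound[of fdm "\<lambda>M. a M p - b M p"] by simp
    also have "\<dots> \<le> (\<integral>M. c M p \<partial>fdm)"
      using a b c le by (intro integral_mono) auto
    finally show "\<bar>\<integral>M. a M p - b M p \<partial>fdm\<bar> \<le> (\<integral>M. c M p \<partial>fdm)" .
  qed
  finally show ?thesis by (simp only: J_def)
qed

text \<open>Absolute continuity supplies a density of \<open>L\<close>, and its restriction to
  \<open>A\<close> is integrable. Step functions in \<open>u\<close> are assembled from such
  sets.\<close>

lemma equidistribution_measure:
  assumes v0: "v0 \<in> S" "v0 - v \<in> Int_lattice" and f: "good f"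
    and L: "prob_space L" "sets L = sets borel" "absolutely_continuous lborel L"
    and A: "A \<in> sets borel"
  shows "((\<lambda>t. \<integral>u. indicator A u * f (up u ** geo t) v \<partial>L) \<longlongrightarrow> (J f / T) * measure L A) at_top"
proof -
  interpret L: prob_space L by fact
  obtain g0 where g0: "g0 \<in> borel_measurable lborel" "density lborel g0 = L"
    using sigma_finite_measure.Radon_Nikodym[OF sigma_finite_lborel L(3)] L(2) by auto
  have "(\<integral>\<^sup>+u. g0 u \<partial>lborel) = emeasure L (space L)"
    unfolding g0(2)[symmetric] using g0(1) by (simp add: emeasure_density)
  then have fin: "(\<integral>\<^sup>+u. g0 u \<partial>lborel) = 1" by (simp add: L.emeasure_space_1)
  define g where "g u = enn2real (g0 u)" for u
  have [measurable]: "g0 \<in> borel_measurable borel" using g0(1) by simp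
  have gm[measurable]: "g \<in> borel_measurable borel" unfolding g_def by measurable
  have g_nn: "0 \<le> g u" for u by (simp add: g_def)
  have AEg: "AE u in lborel. g0 u = ennreal (g u)"
    using nn_integral_PInf_AE[OF g0(1)] fin by (auto simp: g_def less_top)
  have Lg: "L = density lborel (\<lambda>u. ennreal (g u))"
    unfolding g0(2)[symmetric] using AEg by (intro density_cong) auto
  have "(\<integral>\<^sup>+u. ennreal (g u) \<partial>lborel) = 1"
    using fin AEg nn_integral_cong_AE[OF AEg] by simp
  then have gi: "integrable lborel g"
    by (intro integrableI_nonneg) (use g_nn in auto)
  have [measurable]: "A \<in> sets borel" by fact
  have gA: "integrable lborel (\<lambda>u. g u * indicator A u)"
    using integrable_mult_indicator[of A lborel g] gi A by (simp add: mult.commute)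
  have [measurable]: "(\<lambda>u. f (up u ** geo t) v) \<in> borel_measurable borel" for t by (rule good_up_measurable[OF f])
  have e1: "(\<integral>u. indicator A u * f (up u ** geo t) v \<partial>L) = (\<integral>u. (g u * indicator A u) * f (up u ** geo t) v \<partial>lborel)" for t
    unfolding Lg by (subst integral_density) (auto simp: g_nn mult.assoc)
  have "measure L A = (\<integral>u. indicator A u \<partial>L)" using A L(2) by simp
  also have "\<dots> = (\<integral>u. g u * indicator A u \<partial>lborel)"
    unfolding Lg by (subst integral_density) (auto simp: g_nn)
  finally have e2: "measure L A = (\<integral>u. g u * indicator A u \<partial>lborel)" .
  show ?thesis unfolding e1 e2 by (rule equidistribution_L1[OF v0 f gA])
qed

end

section \<open>From uniformly continuous functions to bounded continuous families\<close>

lemma integral_continuous_on: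
  fixes F :: "real \<times> 'a::metric_space \<Rightarrow> real"
  assumes L: "prob_space L" "sets L = sets borel"
    and F: "continuous_on (UNIV \<times> X) F" and B: "\<And>u x. x \<in> X \<Longrightarrow> \<bar>F (u, x)\<bar> \<le> B"
  shows "continuous_on X (\<lambda>x. \<integral>u. F (u, x) \<partial>L)"
  unfolding continuous_on_sequentially o_def
proof (intro allI ballI impI, elim conjE)
  fix s a assume a: "a \<in> X" "\<forall>n. s n \<in> X" "s \<longlonglongrightarrow> a"
  interpret prob_space L by fact
  have m: "(\<lambda>u. F (u, x)) \<in> borel_measurable L" if "x \<in> X" for x
  proof -
    have "continuous_on UNIV (\<lambda>u. F (u, x))"
      by (rule continuous_on_compose2[OF F]) (use that in \<open>auto intro!: continuous_intros\<close>)
    then show ?thesis unfolding measurable_cong_sets[OF L(2) refl] by (rule borel_measurable_continuous_onI)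
  qed
  show "(\<lambda>n. \<integral>u. F (u, s n) \<partial>L) \<longlonglongrightarrow> (\<integral>u. F (u, a) \<partial>L)"
  proof (rule integral_dominated_convergence[where w="\<lambda>_. B"])
    have "(\<lambda>n. F (u, s n)) \<longlonglongrightarrow> F (u, a)" for u
      by (rule continuous_on_tendsto_compose[OF F]) (use a in \<open>auto intro!: tendsto_intros\<close>)
    then show "AE u in L. (\<lambda>n. F (u, s n)) \<longlonglongrightarrow> F (u, a)" by simp
  qed (use a m B in auto)
qed

lemma prob_integral_bound:
  fixes f :: "'a \<Rightarrow> real"
  assumes "prob_space L" and f: "\<And>u. \<bar>f u\<bar> \<le> B"
  shows "\<bar>\<integral>u. f u \<partial>L\<bar> \<le> B"
proof (cases "integrable L f")
  case True
  interpret prob_space L by fact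
  have "\<bar>\<integral>u. f u \<partial>L\<bar> \<le> (\<integral>u. \<bar>f u\<bar> \<partial>L)" using integral_norm_bound[of L f] by simp
  also have "\<dots> \<le> (\<integral>u. B \<partial>L)" using True f by (intro integral_mono) auto
  finally show ?thesis by (simp add: prob_space)
next
  case False
  then show ?thesis using f[of undefined] by (simp add: not_integrable_integral_eq)
qed

text \<open>Splits \<open>x - y * c\<close> into \<open>(x - y) * c\<close> and
  \<open>x * (1 - c)\<close>. Here \<open>c\<close> is the cutoff, and \<open>x\<close> and
  \<open>y\<close> are known to be close only where it does not vanish.\<close>

lemma cutoff_error:
  fixes x y c :: real
  assumes "0 \<le> c" "c \<le> 1" "\<bar>x\<bar> \<le> B" "0 \<le> d" "c \<noteq> 0 \<Longrightarrow> \<bar>x - y\<bar> \<le> d"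
  shows "\<bar>x - y * c\<bar> \<le> d + B * (1 - c)"
proof -
  have "x - y * c = (x - y) * c + x * (1 - c)" by (simp add: algebra_simps)
  also have "\<bar>\<dots>\<bar> \<le> \<bar>x - y\<bar> * c + \<bar>x\<bar> * (1 - c)"
    using abs_triangle_ineq[of "(x - y) * c" "x * (1 - c)"] assms(1,2) by (simp add: abs_mult)
  also have "\<bar>x - y\<bar> * c \<le> d * 1"
    using assms by (cases "c = 0") (simp_all add: mult_mono del: mult_1_right)
  also have "\<bar>x\<bar> * (1 - c) \<le> B * (1 - c)" using assms by (intro mult_right_mono) simp_all
  finally show ?thesis by simp
qed

lemma compact_left_ucont:
  fixes F :: "real \<times> (real^2^2) \<times> (real^2) \<Rightarrow> real"
  assumes F: "continuous_on (UNIV \<times> (SL \<times> UNIV)) F" and e: "e > 0"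
  shows "\<exists>d>0. \<forall>u u' z. \<bar>u\<bar> \<le> K \<longrightarrow> \<bar>u'\<bar> \<le> K \<longrightarrow> \<bar>u - u'\<bar> < d \<longrightarrow> z \<in> core R \<longrightarrow> \<bar>F (u, z) - F (u', z)\<bar> < e"
proof -
  have "compact ({-K..K} \<times> core R)" by (intro compact_Times compact_Icc core_compact)
  moreover have "continuous_on ({-K..K} \<times> core R) F"
    by (rule continuous_on_subset[OF F]) (use core_subset in auto)
  ultimately have "uniformly_continuous_on ({-K..K} \<times> core R) F" by (intro compact_uniformly_continuous)
  then obtain d where d: "d > 0" "\<And>x y. x \<in> {-K..K} \<times> core R \<Longrightarrow> y \<in> {-K..K} \<times> core R \<Longrightarrow> dist y x < d \<Longrightarrow> dist (F y) (F x) < e"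
    unfolding uniformly_continuous_on_def using e by metis
  have "\<bar>F (u, z) - F (u', z)\<bar> < e" if "\<bar>u\<bar> \<le> K" "\<bar>u'\<bar> \<le> K" "\<bar>u - u'\<bar> < d" "z \<in> core R" for u u' z
    using d(2)[of "(u', z)" "(u, z)"] that by (simp add: dist_Pair_Pair dist_real_def abs_le_iff)
  then show ?thesis using d(1) by blast
qed

lemma prob_tail:
  fixes L :: "real measure"
  assumes L: "prob_space L" "sets L = sets borel" and e: "e > 0"
  shows "\<exists>r>0. measure L {u. r < \<bar>u\<bar>} \<le> e"
proof -
  interpret prob_space L by fact
  have "(\<lambda>n. measure L {u. real n < \<bar>u\<bar>}) \<longlonglongrightarrow> measure L (\<Inter>n. {u. real n < \<bar>u\<bar>})"
    by (rule finite_Lim_measure_decseq) (auto simp: decseq_def L(2))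
  moreover have "(\<Inter>n. {u. real n < \<bar>u\<bar>}) = {}"
    using real_arch_simple by (auto simp: not_less[symmetric])
  ultimately have "(\<lambda>n. measure L {u. real n < \<bar>u\<bar>}) \<longlonglongrightarrow> 0" by simp
  then have "\<forall>\<^sub>F n in sequentially. measure L {u. real n < \<bar>u\<bar>} < e" by (rule order_tendstoD(2)[OF _ e])
  with eventually_gt_at_top[of 0] have "\<forall>\<^sub>F n in sequentially. 0 < real n \<and> measure L {u. real n < \<bar>u\<bar>} < e"
    by eventually_elim auto
  then obtain n where "0 < real n \<and> measure L {u. real n < \<bar>u\<bar>} < e" by (auto dest!: eventually_happens)
  then show ?thesis by (intro exI[of _ "real n"]) simp
qed

context torus_orbit_set
begin

text \<open>Uniform estimates in \<open>u\<close> and on the quotient are available on compact sets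
  only. The comparison function \<open>\<Phi>\<close> is a step function in \<open>u\<close> with
  cut off values; it misses \<open>F\<close> by a uniform error, by \<open>B * (1 - chi R M)\<close>
  and by \<open>B\<close> on the tail \<open>r < |u|\<close>. The middle loss is small only on
  average, both over the quotient and, for large \<open>t\<close>, along the horocycle.\<close>

lemma equidistribution:
  fixes F :: "real \<Rightarrow> real^2^2 \<Rightarrow> real^2 \<Rightarrow> real" and Ft :: "real \<Rightarrow> real \<Rightarrow> real^2^2 \<Rightarrow> real^2 \<Rightarrow> real"
  assumes v0: "v0 \<in> S" "v0 - v \<in> Int_lattice"
    and L: "prob_space L" "sets L = sets borel" "absolutely_continuous lborel L"
    and inv: "\<And>u M \<xi> G n. M \<in> SL \<Longrightarrow> G \<in> Gamma_theta \<Longrightarrow> n \<in> Int_lattice \<Longrightarrow> F u (G ** M) (G *v \<xi> + n) = F u M \<xi>"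
    and inv_t: "\<And>t u M \<xi> G n. M \<in> SL \<Longrightarrow> G \<in> Gamma_theta \<Longrightarrow> n \<in> Int_lattice \<Longrightarrow> Ft t u (G ** M) (G *v \<xi> + n) = Ft t u M \<xi>"
    and bd: "\<And>u M \<xi>. M \<in> SL \<Longrightarrow> \<bar>F u M \<xi>\<bar> \<le> B"
    and bd_t: "\<And>t u M \<xi>. M \<in> SL \<Longrightarrow> \<bar>Ft t u M \<xi>\<bar> \<le> B"
    and cont: "continuous_on (UNIV \<times> (SL \<times> UNIV)) (\<lambda>z. F (fst z) (fst (snd z)) (snd (snd z)))"
    and cont_t: "\<And>t. continuous_on (UNIV \<times> (SL \<times> UNIV)) (\<lambda>z. Ft t (fst z) (fst (snd z)) (snd (snd z)))"
    and unif: "\<And>C. compact C \<Longrightarrow> C \<subseteq> UNIV \<times> (SL \<times> UNIV) \<Longrightarrow>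
      uniform_limit C (\<lambda>t z. Ft t (fst z) (fst (snd z)) (snd (snd z))) (\<lambda>z. F (fst z) (fst (snd z)) (snd (snd z))) at_top"
  shows "((\<lambda>t. \<integral>u. Ft t u (up u ** geo t) v \<partial>L) \<longlongrightarrow> J (\<lambda>M \<xi>. \<integral>u. F u M \<xi> \<partial>L) / T) at_top"
proof (rule tendstoI)
  fix \<epsilon> :: real assume \<epsilon>: "\<epsilon> > 0"
  interpret L: prob_space L by fact
  have B0: "0 \<le> B" using bd[of "mat 1" 0 0] by simp
  \<comment> \<open>The budget in units of \<open>\<delta>\<close>: \<open>2 + 3 * B\<close> from
    \<open>Ft\<close> to \<open>\<Phi>\<close>, 1 for the convergence of the integrals of
    \<open>\<Phi>\<close>, and \<open>1 + 2 * B\<close> from their limit to the true one. Together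
    this is \<open>4 + 5 * B\<close>, strictly below the divisor.\<close>
  define \<delta> where "\<delta> = \<epsilon> / (5 + 5 * B)"
  have \<delta>: "\<delta> > 0" using \<epsilon> B0 by (simp add: \<delta>_def)
  have \<delta>\<epsilon>: "(4 + 5 * B) * \<delta> < \<epsilon>"
  proof -
    have "(5 + 5 * B) * \<delta> = \<epsilon>" using B0 by (simp add: \<delta>_def)
    then show ?thesis using \<delta> by (simp add: algebra_simps)
  qed
  have "\<exists>n. (1 - \<delta>) * T < J (\<lambda>M \<xi>. chi (real n) M)"
  proof -
    have "(1 - \<delta>) * T < T" using T_pos \<delta> by (simp add: algebra_simps)
    then have "\<forall>\<^sub>F n in sequentially. (1 - \<delta>) * T < J (\<lambda>M \<xi>. chi (real n) M)" by (rule order_tendstoD(1)[OF J_chi])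
    then show ?thesis by (auto dest!: eventually_happens)
  qed
  then obtain R where "(1 - \<delta>) * T < J (\<lambda>M \<xi>. chi R M)" by blast
  then have R: "1 - J (\<lambda>M \<xi>. chi R M) / T \<le> \<delta>" using T_pos by (simp add: field_simps)
  obtain r where r: "r > 0" "measure L {u. r < \<bar>u\<bar>} \<le> \<delta>" using prob_tail[OF L(1,2) \<delta>] by blast
  define \<eta> where "\<eta> = measure L {u. r < \<bar>u\<bar>}"
  \<comment> \<open>The radius \<open>r + 1\<close> leaves room for the grid point
    \<open>p u\<close>, which may leave the interval by up to \<open>1 / N \<le> 1\<close>.\<close>
  obtain d where d: "d > 0" "\<And>u u' M \<xi>. \<bar>u\<bar> \<le> r + 1 \<Longrightarrow> \<bar>u'\<bar> \<le> r + 1 \<Longrightarrow> \<bar>u - u'\<bar> < d \<Longrightarrow> (M,\<xi>) \<in> core R \<Longrightarrow> \<bar>F u M \<xi> - F u' M \<xi>\<bar> < \<delta>"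
    using compact_left_ucont[OF cont \<delta>, of "r + 1" R] by auto
  define N where "N = max 1 (2 / d)"
  have N: "N \<ge> 1" "1 / N < d" using d(1) by (auto simp: N_def field_simps max_def)
  define p where "p u = real_of_int \<lfloor>N * u\<rfloor> / N" for u
  have p_close: "\<bar>u - p u\<bar> \<le> 1 / N" for u
  proof -
    have "real_of_int \<lfloor>N * u\<rfloor> \<le> N * u" "N * u \<le> real_of_int \<lfloor>N * u\<rfloor> + 1" by linarith+
    then have "\<bar>N * u - real_of_int \<lfloor>N * u\<rfloor>\<bar> \<le> 1" by linarith
    moreover have "u - p u = (N * u - real_of_int \<lfloor>N * u\<rfloor>) / N" using N(1) by (simp add: p_def diff_divide_distrib)
    ultimately show ?thesis using N(1) by (simp add: divide_right_mono)
  qed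
  have near: "\<bar>F u M \<xi> - F (p u) M \<xi>\<bar> \<le> \<delta>" if u: "\<bar>u\<bar> \<le> r" and M: "M \<in> SL" "chi R M \<noteq> 0" for u M \<xi>
  proof -
    obtain G n where G: "G \<in> Gamma_theta" "n \<in> Int_lattice" "(G ** M, G *v \<xi> + n) \<in> core R"
      using chi_reduce[OF M] by blast
    have "1 / N \<le> 1" using N(1) by simp
    moreover have gen: "\<bar>y\<bar> \<le> r + 1" if "\<bar>x\<bar> \<le> r" "\<bar>x - y\<bar> \<le> w" "w \<le> 1" for x y w :: real using that by linarith
    ultimately have "\<bar>p u\<bar> \<le> r + 1" using u p_close by blast
    then have "\<bar>F u (G ** M) (G *v \<xi> + n) - F (p u) (G ** M) (G *v \<xi> + n)\<bar> < \<delta>"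
      using u le_less_trans[OF p_close N(2)] by (intro d(2) G(3)) simp_all
    then show ?thesis by (simp add: inv[OF M(1) G(1,2)])
  qed
  \<comment> \<open>Large enough to contain every index \<open>\<lfloor>N * u\<rfloor>\<close> with
    \<open>|u| \<le> r\<close>; the added 1 absorbs the rounding.\<close>
  define K where "K = \<lceil>N * (r + 1)\<rceil>"
  define A where "A j = {u. \<bar>u\<bar> \<le> r \<and> \<lfloor>N * u\<rfloor> = j}" for j :: int
  define f where "f j M \<xi> = F (real_of_int j / N) M \<xi> * chi R M" for j M \<xi>
  define \<Phi> where "\<Phi> u M \<xi> = (\<Sum>j\<in>{-K..K}. indicator (A j) u * f j M \<xi>)" for u M \<xi>
  have A[measurable]: "A j \<in> sets borel" for j
    unfolding A_def by measurable
  have \<Phi>_in: "\<Phi> u M \<xi> = F (p u) M \<xi> * chi R M" if u: "\<bar>u\<bar> \<le> r" for u M \<xi>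
  proof -
    have Nu: "\<bar>N * u\<bar> \<le> N * r" using u N(1) by (simp add: abs_mult mult_left_mono)
    have gen: "- k \<le> \<lfloor>x\<rfloor> \<and> \<lfloor>x\<rfloor> \<le> k" if "\<bar>x\<bar> \<le> y" "k = \<lceil>z\<rceil>" "y + 1 \<le> z" for x y z :: real and k :: int
      using that by linarith
    have "N * r + 1 \<le> N * (r + 1)" using N(1) by (simp add: algebra_simps)
    from gen[OF Nu K_def this] have "\<lfloor>N * u\<rfloor> \<in> {-K..K}" by simp
    moreover have "indicator (A j) u * f j M \<xi> = (if j = \<lfloor>N * u\<rfloor> then f \<lfloor>N * u\<rfloor> M \<xi> else 0)" for j
      using u by (auto simp: A_def)
    ultimately show ?thesis by (simp add: \<Phi>_def f_def p_def)
  qed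
  have \<Phi>_out: "\<Phi> u M \<xi> = 0" if u: "\<not> \<bar>u\<bar> \<le> r" for u M \<xi>
    using u by (simp add: \<Phi>_def A_def)
  \<comment> \<open>One estimate for two purposes: it is used with \<open>c = \<delta>\<close> for
    \<open>F\<close> itself and with \<open>c = 2 * \<delta>\<close> for \<open>Ft\<close>, whose
    distance from \<open>F\<close> takes the second \<open>\<delta>\<close>.\<close>
  have error: "\<bar>x - \<Phi> u M \<xi>\<bar> \<le> c + B * (1 - chi R M) + B * indicator {u. r < \<bar>u\<bar>} u"
    if M: "M \<in> SL" and x: "\<bar>x\<bar> \<le> B" "0 \<le> c" "\<bar>u\<bar> \<le> r \<Longrightarrow> chi R M \<noteq> 0 \<Longrightarrow> \<bar>x - F (p u) M \<xi>\<bar> \<le> c" for x c u M \<xi>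
  proof (cases "\<bar>u\<bar> \<le> r")
    case True
    then show ?thesis using cutoff_error[OF chi_bounds x(1,2), of R M "F (p u) M \<xi>"] x(3) by (simp add: \<Phi>_in)
  next
    case False
    have "0 \<le> B * (1 - chi R M)" using B0 chi_bounds by simp
    then show ?thesis using False x by (simp add: \<Phi>_out)
  qed
  have fgood: "good (f j)" for j
  proof (rule good_cutoff[of _ B R])
    show "continuous_on (SL \<times> UNIV) (\<lambda>z. f j (fst z) (snd z))"
    proof -
      have "continuous_on (SL \<times> UNIV) (\<lambda>z. F (real_of_int j / N) (fst z) (snd z))"
      proof -
        have "continuous_on (SL \<times> UNIV) (\<lambda>z. (real_of_int j / N, z))" by (intro continuous_intros)
        from continuous_on_compose2[OF cont this] show ?thesis by auto
      qed
      moreover have "continuous_on (SL \<times> UNIV) (\<lambda>z. chi R (fst z))"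
        using good_continuous[OF chi_good, of R] by (rule continuous_on_compose2) (auto intro!: continuous_intros)
      ultimately show ?thesis unfolding f_def by (rule continuous_on_mult)
    qed
    fix M \<xi> assume M: "M \<in> SL"
    have "\<bar>F (real_of_int j / N) M \<xi> * chi R M\<bar> \<le> B * 1"
      unfolding abs_mult using bd[OF M] B0 chi_bounds by (intro mult_mono) simp_all
    then show "\<bar>f j M \<xi>\<bar> \<le> B" by (simp add: f_def)
    show "f j M \<xi> \<noteq> 0 \<Longrightarrow> chi R M \<noteq> 0" by (simp add: f_def)
    fix G n assume "G \<in> Gamma_theta" "n \<in> Int_lattice"
    then show "f j (G ** M) (G *v \<xi> + n) = f j M \<xi>" using M by (simp add: f_def inv chi_def nu_invariant)
  qed
  have x_SL: "up u ** geo t \<in> SL" for u t by simp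
  have mL: "h \<in> borel_measurable L" if "h \<in> borel_measurable borel" for h :: "real \<Rightarrow> real"
    using that unfolding measurable_cong_sets[OF L(2) refl] .
  have tail_int: "integrable L (\<lambda>u. indicator {u. r < \<bar>u\<bar>} u :: real)" "(\<integral>u. indicator {u. r < \<bar>u\<bar>} u \<partial>L) = \<eta>"
    by (auto simp: \<eta>_def L(2) L.emeasure_finite less_top[symmetric] intro!: integrable_real_indicator)
  have f_int: "integrable L (\<lambda>u. indicator (A j) u * f j (up u ** geo t) v)" for j t
  proof -
    obtain C where C: "\<And>M \<xi>. M \<in> SL \<Longrightarrow> \<bar>f j M \<xi>\<bar> \<le> C" using good_bound[OF fgood] by metis
    have [measurable]: "(\<lambda>u. f j (up u ** geo t) v) \<in> borel_measurable borel" by (rule good_up_measurable[OF fgood])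
    show ?thesis
    proof (rule L.integrable_const_bound[of _ C])
      show "AE u in L. norm (indicator (A j) u * f j (up u ** geo t) v) \<le> C"
        using C[OF x_SL] abs_ge_zero[THEN order.trans, OF C[OF x_SL]] by (intro AE_I2) (simp add: indicator_def)
    qed (rule mL, measurable)
  qed
  define c where "c t = (\<integral>u. chi R (up u ** geo t) \<partial>L)" for t
  have c_int: "integrable L (\<lambda>u. chi R (up u ** geo t))" for t
    by (rule L.integrable_const_bound[of _ 1])
      (use chi_bounds good_up_measurable[OF chi_good] in \<open>auto intro!: mL\<close>)
  have "((\<lambda>t. \<integral>u. indicator UNIV u * chi R (up u ** geo t) \<partial>L) \<longlongrightarrow> J (\<lambda>M \<xi>. chi R M) / T * measure L UNIV) at_top"
    by (rule equidistribution_measure[OF v0 chi_good L]) simp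
  moreover have "measure L UNIV = 1" using L.prob_space sets_eq_imp_space_eq[OF L(2)] by simp
  ultimately have c_lim: "(c \<longlongrightarrow> J (\<lambda>M \<xi>. chi R M) / T) at_top" by (simp add: c_def[abs_def])
  define s where "s = (\<Sum>j\<in>{-K..K}. J (f j) / T * measure L (A j))"
  have s_lim: "((\<lambda>t. \<integral>u. \<Phi> u (up u ** geo t) v \<partial>L) \<longlongrightarrow> s) at_top"
  proof -
    have "(\<integral>u. \<Phi> u (up u ** geo t) v \<partial>L) = (\<Sum>j\<in>{-K..K}. \<integral>u. indicator (A j) u * f j (up u ** geo t) v \<partial>L)" for t
      unfolding \<Phi>_def by (rule Bochner_Integration.integral_sum[OF f_int])
    then show ?thesis unfolding s_def by (simp only:) (intro tendsto_sum equidistribution_measure[OF v0] fgood L A)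
  qed
  have F_meas: "(\<lambda>u. F u M \<xi>) \<in> borel_measurable L" if "M \<in> SL" for M \<xi>
  proof (rule mL[OF borel_measurable_continuous_onI])
    show "continuous_on UNIV (\<lambda>u. F u M \<xi>)"
    proof -
      have "continuous_on UNIV (\<lambda>u::real. (u, M, \<xi>))" by (intro continuous_intros)
      from continuous_on_compose2[OF cont this] show ?thesis using that by auto
    qed
  qed
  have Ft_meas: "(\<lambda>u. Ft t u (up u ** geo t) v) \<in> borel_measurable L" for t
  proof (rule mL[OF borel_measurable_continuous_onI])
    have "continuous_on UNIV (\<lambda>u. (u, up u ** geo t, v))"
      unfolding up_def by (intro continuous_intros continuous_on_mat22)
    moreover have "(\<lambda>u. (u, up u ** geo t, v)) ` UNIV \<subseteq> UNIV \<times> (SL \<times> UNIV)" using x_SL by blast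
    ultimately show "continuous_on UNIV (\<lambda>u. Ft t u (up u ** geo t) v)"
      using continuous_on_compose2[OF cont_t[of t]] by fastforce
  qed
  have limit_close: "\<bar>J (\<lambda>M \<xi>. \<integral>u. F u M \<xi> \<partial>L) / T - s\<bar> \<le> \<delta> + B * \<delta> + B * \<delta>"
  proof -
    define b where "b M \<xi> = (\<Sum>j\<in>{-K..K}. measure L (A j) * f j M \<xi>)" for M \<xi>
    have Jb: "J b = s * T"
    proof -
      have "J b = (\<Sum>j\<in>{-K..K}. J (\<lambda>M \<xi>. measure L (A j) * f j M \<xi>))"
        unfolding b_def J_def using good_integrable[OF fgood]
        by (subst sum.swap) (simp add: Bochner_Integration.integral_sum)
      also have "\<dots> = s * T" unfolding s_def sum_distrib_right J_cmult using T_pos by (intro sum.cong refl) simp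
      finally show ?thesis .
    qed
    have "\<bar>J (\<lambda>M \<xi>. \<integral>u. F u M \<xi> \<partial>L) - J b\<bar> \<le> J (\<lambda>M \<xi>. \<delta> + B * (1 - chi R M) + B * \<eta>)"
    proof (rule J_diff_bound)
      fix p :: "real^2"
      show "integrable fdm (\<lambda>M. \<integral>u. F u M p \<partial>L)"
      proof (rule fdm.integrable_const_bound[of _ B])
        have "continuous_on SL (\<lambda>M. \<integral>u. (\<lambda>z. F (fst z) (snd z) p) (u, M) \<partial>L)"
        proof (rule integral_continuous_on[OF L(1,2), of _ _ B])
          show "continuous_on (UNIV \<times> SL) (\<lambda>z. F (fst z) (snd z) p)"
          proof -
            have "continuous_on (UNIV \<times> SL) (\<lambda>z::real \<times> (real^2^2). (fst z, snd z, p))" by (intro continuous_intros)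
            moreover have "(\<lambda>z::real \<times> (real^2^2). (fst z, snd z, p)) ` (UNIV \<times> SL) \<subseteq> UNIV \<times> (SL \<times> UNIV)" by auto
            ultimately show ?thesis using continuous_on_compose2[OF cont] by fastforce
          qed
        qed (use bd in simp)
        then have "(\<lambda>M. \<integral>u. F u M p \<partial>L) \<in> borel_measurable SLb"
          by (simp add: borel_measurable_continuous_on_restrict)
        then show "(\<lambda>M. \<integral>u. F u M p \<partial>L) \<in> borel_measurable fdm" by (simp only: measurable_fdm_iff)
        show "AE M in fdm. norm (\<integral>u. F u M p \<partial>L) \<le> B"
          using prob_integral_bound[OF L(1) bd] by (intro AE_I2) simp
      qed
      show "integrable fdm (\<lambda>M. b M p)" unfolding b_def using good_integrable[OF fgood] by simp
      show "integrable fdm (\<lambda>M. \<delta> + B * (1 - chi R M) + B * \<eta>)" using good_integrable[OF chi_good] by simp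
    next
      fix M p assume M: "M \<in> SL"
      have Fi: "integrable L (\<lambda>u. F u M p)"
        by (rule L.integrable_const_bound[of _ B]) (use bd M F_meas in auto)
      have ii: "integrable L (\<lambda>u. indicator (A j) u * f j M p)" for j
        by (intro integrable_mult_left integrable_real_indicator) (auto simp: L(2) L.emeasure_finite less_top[symmetric])
      then have \<Phi>i: "integrable L (\<lambda>u. \<Phi> u M p)" unfolding \<Phi>_def by (intro Bochner_Integration.integrable_sum)
      have "(\<integral>u. \<Phi> u M p \<partial>L) = b M p"
        unfolding \<Phi>_def b_def by (subst Bochner_Integration.integral_sum[OF ii]) (simp add: L(2))
      then have "\<bar>(\<integral>u. F u M p \<partial>L) - b M p\<bar> = \<bar>\<integral>u. F u M p - \<Phi> u M p \<partial>L\<bar>"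
        using Fi \<Phi>i by simp
      also have "\<dots> \<le> (\<integral>u. \<bar>F u M p - \<Phi> u M p\<bar> \<partial>L)"
        using integral_norm_bound[of L "\<lambda>u. F u M p - \<Phi> u M p"] by simp
      also have "\<dots> \<le> (\<integral>u. \<delta> + B * (1 - chi R M) + B * indicator {u. r < \<bar>u\<bar>} u \<partial>L)"
      proof (rule integral_mono)
        fix u
        show "\<bar>F u M p - \<Phi> u M p\<bar> \<le> \<delta> + B * (1 - chi R M) + B * indicator {u. r < \<bar>u\<bar>} u"
          by (rule error[OF M bd[OF M]]) (use \<delta> near[OF _ M] in auto)
      qed (use Fi \<Phi>i tail_int in auto)
      also have "\<dots> = \<delta> + B * (1 - chi R M) + B * \<eta>"
        using tail_int by (simp add: L.prob_space)
      finally show "\<bar>(\<integral>u. F u M p \<partial>L) - b M p\<bar> \<le> \<delta> + B * (1 - chi R M) + B * \<eta>" .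
    qed
    also have "J (\<lambda>M \<xi>. \<delta> + B * (1 - chi R M) + B * \<eta>) = J (\<lambda>M \<xi>. (\<delta> + B + B * \<eta>) - B * chi R M)"
      by (simp add: algebra_simps)
    also have "\<dots> = (\<delta> + B + B * \<eta>) * T - B * J (\<lambda>M \<xi>. chi R M)"
      by (simp add: J_diff good_const good_cmult chi_good J_const J_cmult)
    finally have "\<bar>J (\<lambda>M \<xi>. \<integral>u. F u M \<xi> \<partial>L) / T - s\<bar> * T \<le> (\<delta> + B + B * \<eta>) * T - B * J (\<lambda>M \<xi>. chi R M)"
      using T_pos abs_mult[of "J (\<lambda>M \<xi>. \<integral>u. F u M \<xi> \<partial>L) / T - s" T] by (simp add: Jb left_diff_distrib)
    also have "\<dots> = (\<delta> + B * (1 - J (\<lambda>M \<xi>. chi R M) / T) + B * \<eta>) * T"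
      using T_pos by (simp add: field_simps)
    finally have "\<bar>J (\<lambda>M \<xi>. \<integral>u. F u M \<xi> \<partial>L) / T - s\<bar> \<le> \<delta> + B * (1 - J (\<lambda>M \<xi>. chi R M) / T) + B * \<eta>"
      using T_pos by simp
    also have "\<dots> \<le> \<delta> + B * \<delta> + B * \<delta>"
      using R r(2) B0 by (intro add_mono mult_left_mono) (simp_all add: \<eta>_def)
    finally show ?thesis .
  qed
  have Ft_near: "\<forall>\<^sub>F t in at_top. \<forall>u M \<xi>. \<bar>u\<bar> \<le> r \<longrightarrow> M \<in> SL \<longrightarrow> chi R M \<noteq> 0 \<longrightarrow> \<bar>Ft t u M \<xi> - F u M \<xi>\<bar> < \<delta>"
  proof -
    have "compact ({-r..r} \<times> core R)" by (intro compact_Times compact_Icc core_compact)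
    moreover have "{-r..r} \<times> core R \<subseteq> UNIV \<times> (SL \<times> UNIV)" using core_subset by auto
    ultimately have "uniform_limit ({-r..r} \<times> core R) (\<lambda>t z. Ft t (fst z) (fst (snd z)) (snd (snd z))) (\<lambda>z. F (fst z) (fst (snd z)) (snd (snd z))) at_top"
      by (rule unif)
    then have "\<forall>\<^sub>F t in at_top. \<forall>z\<in>{-r..r} \<times> core R. dist (Ft t (fst z) (fst (snd z)) (snd (snd z))) (F (fst z) (fst (snd z)) (snd (snd z))) < \<delta>"
      using \<delta> by (simp only: uniform_limit_iff)
    then show ?thesis
    proof eventually_elim
      case (elim t)
      show ?case
      proof (intro allI impI)
        fix u M \<xi> assume u: "\<bar>u\<bar> \<le> r" and M: "M \<in> SL" "chi R M \<noteq> 0"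
        \<comment> \<open>Convergence is known on the compact \<open>core R\<close>; since
          \<open>F\<close> and \<open>Ft\<close> are invariant under the same \<open>(G, n)\<close>,
          it extends to all points with nonzero cutoff.\<close>
        obtain G n where G: "G \<in> Gamma_theta" "n \<in> Int_lattice" "(G ** M, G *v \<xi> + n) \<in> core R"
          using chi_reduce[OF M] by blast
        have "u \<in> {-r..r}" using u by (simp add: abs_le_iff)
        with elim G(3) have "dist (Ft t u (G ** M) (G *v \<xi> + n)) (F u (G ** M) (G *v \<xi> + n)) < \<delta>" by force
        then show "\<bar>Ft t u M \<xi> - F u M \<xi>\<bar> < \<delta>"
          by (simp add: inv[OF M(1) G(1,2)] inv_t[OF M(1) G(1,2)] dist_real_def)
      qed
    qed
  qed
  have c_near: "\<forall>\<^sub>F t in at_top. 1 - c t < 2 * \<delta>"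
  proof -
    have "1 - 2 * \<delta> < J (\<lambda>M \<xi>. chi R M) / T" using R \<delta> by linarith
    from order_tendstoD(1)[OF c_lim this] show ?thesis by eventually_elim linarith
  qed
  have s_near: "\<forall>\<^sub>F t in at_top. dist (\<integral>u. \<Phi> u (up u ** geo t) v \<partial>L) s < \<delta>"
    by (rule tendstoD[OF s_lim \<delta>])
  show "\<forall>\<^sub>F t in at_top. dist (\<integral>u. Ft t u (up u ** geo t) v \<partial>L) (J (\<lambda>M \<xi>. \<integral>u. F u M \<xi> \<partial>L) / T) < \<epsilon>"
    using Ft_near c_near s_near
  proof eventually_elim
    case (elim t)
    have Fi: "integrable L (\<lambda>u. Ft t u (up u ** geo t) v)"
      by (rule L.integrable_const_bound[of _ B]) (use bd_t[OF x_SL] Ft_meas in auto)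
    have \<Phi>i: "integrable L (\<lambda>u. \<Phi> u (up u ** geo t) v)"
      unfolding \<Phi>_def by (intro Bochner_Integration.integrable_sum f_int)
    have "\<bar>(\<integral>u. Ft t u (up u ** geo t) v \<partial>L) - (\<integral>u. \<Phi> u (up u ** geo t) v \<partial>L)\<bar>
        = \<bar>\<integral>u. Ft t u (up u ** geo t) v - \<Phi> u (up u ** geo t) v \<partial>L\<bar>"
      using Fi \<Phi>i by simp
    also have "\<dots> \<le> (\<integral>u. \<bar>Ft t u (up u ** geo t) v - \<Phi> u (up u ** geo t) v\<bar> \<partial>L)"
      using integral_norm_bound[of L "\<lambda>u. Ft t u (up u ** geo t) v - \<Phi> u (up u ** geo t) v"] by simp
    also have "\<dots> \<le> (\<integral>u. 2 * \<delta> + B * (1 - chi R (up u ** geo t)) + B * indicator {u. r < \<bar>u\<bar>} u \<partial>L)"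
    proof (rule integral_mono)
      fix u
      show "\<bar>Ft t u (up u ** geo t) v - \<Phi> u (up u ** geo t) v\<bar> \<le> 2 * \<delta> + B * (1 - chi R (up u ** geo t)) + B * indicator {u. r < \<bar>u\<bar>} u"
      proof (rule error[OF x_SL bd_t[OF x_SL]])
        assume u: "\<bar>u\<bar> \<le> r" "chi R (up u ** geo t) \<noteq> 0"
        have gen: "\<bar>x - z\<bar> \<le> 2 * \<delta>" if "\<bar>x - y\<bar> < \<delta>" "\<bar>y - z\<bar> \<le> \<delta>" for x y z using that by linarith
        show "\<bar>Ft t u (up u ** geo t) v - F (p u) (up u ** geo t) v\<bar> \<le> 2 * \<delta>"
          by (rule gen[OF _ near[OF u(1) x_SL u(2)]]) (use elim(1) u x_SL in blast)
      qed (use \<delta> in simp)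
    qed (use Fi \<Phi>i tail_int c_int in auto)
    also have "\<dots> = 2 * \<delta> + B * (1 - c t) + B * \<eta>"
      using tail_int c_int by (simp add: L.prob_space c_def)
    also have "\<dots> \<le> 2 * \<delta> + B * (2 * \<delta>) + B * \<delta>"
      using elim(2) r(2) B0 by (intro add_mono mult_left_mono) (simp_all add: \<eta>_def)
    finally have I: "\<bar>(\<integral>u. Ft t u (up u ** geo t) v \<partial>L) - (\<integral>u. \<Phi> u (up u ** geo t) v \<partial>L)\<bar> \<le> 2 * \<delta> + B * (2 * \<delta>) + B * \<delta>" .
    have gen: "\<bar>x - w\<bar> < \<epsilon>" if "\<bar>x - y\<bar> \<le> 2 * \<delta> + B * (2 * \<delta>) + B * \<delta>" "\<bar>y - z\<bar> < \<delta>" "\<bar>w - z\<bar> \<le> \<delta> + B * \<delta> + B * \<delta>" for x y z w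
    proof -
      have "\<bar>x - w\<bar> \<le> \<bar>x - y\<bar> + \<bar>y - z\<bar> + \<bar>w - z\<bar>" by linarith
      also have "\<dots> \<le> (4 + 5 * B) * \<delta>" using that by (simp add: algebra_simps)
      finally show ?thesis using \<delta>\<epsilon> by linarith
    qed
    show ?case unfolding dist_real_def
      using elim(3) by (intro gen[OF I _ limit_close]) (simp add: dist_real_def)
  qed
qed

end

section \<open>The statement on the coset space\<close>

lemma up_geo_ASL2:
  "(mat 1, v) \<otimes>\<^bsub>ASL2\<^esub> Psi u \<otimes>\<^bsub>ASL2\<^esub> Phi t = (up u ** geo t, v)"
  by (simp add: Psi_def Phi_def up_def geo_def dg_def exp_minus inverse_eq_divide matrix_vector_mult_0_right)

text \<open>The projection is a quotient map, so continuity may be checked on the group, a metric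
  space, where dominated convergence along sequences applies.\<close>

lemma coset_integral_continuous:
  assumes L: "prob_space L" "sets L = sets borel"
    and F: "continuous_map (prod_topology euclideanreal coset_topology) euclideanreal F"
    and B: "\<And>z. z \<in> UNIV \<times> topspace coset_topology \<Longrightarrow> \<bar>F z\<bar> \<le> B"
  shows "continuous_map coset_topology euclideanreal (\<lambda>g. \<integral>u. F (u, g) \<partial>L)"
proof (rule continuous_compose_quotient_map[OF quotient_map_coset])
  have "continuous_on (SL \<times> UNIV) (\<lambda>z. \<integral>u. (\<lambda>w. F (fst w, cs (fst (snd w)) (snd (snd w)))) (u, z) \<partial>L)"
    by (rule integral_continuous_on[OF L lift_continuous[OF F], of B]) (auto intro!: B cs_topspace)
  then show "continuous_map (top_of_set (carrier ASL2)) euclideanreal ((\<lambda>g. \<integral>u. F (u, g) \<partial>L) \<circ> (\<lambda>g. Gamma_lattice #>\<^bsub>ASL2\<^esub> g))"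
    unfolding carrier_ASL2 by (simp add: o_def cs_def)
qed

lemma borel_measurable_coset_borel:
  assumes G: "continuous_map coset_topology euclideanreal G"
  shows "G \<in> borel_measurable coset_borel"
proof (rule borel_measurableI)
  fix U :: "real set" assume "open U"
  then have "openin coset_topology {x \<in> topspace coset_topology. G x \<in> U}"
    using openin_continuous_map_preimage[OF G] by simp
  moreover have sp: "{U. openin coset_topology U} \<subseteq> Pow (topspace coset_topology)" by (auto dest: openin_subset)
  moreover have "G -` U \<inter> space coset_borel = {x \<in> topspace coset_topology. G x \<in> U}"
    unfolding coset_borel_def space_measure_of[OF sp] by auto
  ultimately show "G -` U \<inter> space coset_borel \<in> sets coset_borel"
    unfolding coset_borel_def sets_measure_of[OF sp] by (auto intro: sigma_sets.Basic)
qed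

theorem theorem4p1p2:
  fixes \<alpha> \<beta> :: real
    and L :: "real measure"
    and F :: "real \<times> ((real^2^2) \<times> (real^2)) set \<Rightarrow> real"
    and Ft :: "real \<Rightarrow> real \<times> ((real^2^2) \<times> (real^2)) set \<Rightarrow> real"
  assumes "\<alpha> \<in> \<rat>" and "\<beta> \<in> \<rat>"
    and "prob_space L" and "sets L = sets borel" and "absolutely_continuous lborel L"
    and "continuous_map (prod_topology euclideanreal coset_topology) euclideanreal F"
    and "\<exists>B. \<forall>z \<in> UNIV \<times> topspace coset_topology. \<bar>F z\<bar> \<le> B"
    and "\<And>t. continuous_map (prod_topology euclideanreal coset_topology) euclideanreal (Ft t)"
    and "\<exists>B. \<forall>t. \<forall>z \<in> UNIV \<times> topspace coset_topology. \<bar>Ft t z\<bar> \<le> B"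
    and "\<And>K. compactin (prod_topology euclideanreal coset_topology) K \<Longrightarrow> uniform_limit K Ft F at_top"
  shows "((\<lambda>t. LINT u|L. Ft t (u, Gamma_lattice #>\<^bsub>ASL2\<^esub> ((mat 1, vector [\<alpha>, \<beta>]) \<otimes>\<^bsub>ASL2\<^esub> Psi u \<otimes>\<^bsub>ASL2\<^esub> Phi t)))
           \<longlongrightarrow> (LINT g|mu \<alpha> \<beta>. LINT u|L. F (u, g))) at_top"
proof -
  note ab = assms(1,2) and L = assms(3-5) and contF = assms(6) and contFt = assms(8) and unif = assms(10)
  let ?v = "vector [\<alpha>, \<beta>] :: real^2"
  interpret torus_orbit_set "torus_orbit \<alpha> \<beta>" by (rule torus_orbit_set_torus_orbit(1)[OF ab])
  obtain B1 where B1: "\<And>z. z \<in> UNIV \<times> topspace coset_topology \<Longrightarrow> \<bar>F z\<bar> \<le> B1" using assms(7) by blast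
  obtain B2 where B2: "\<And>t z. z \<in> UNIV \<times> topspace coset_topology \<Longrightarrow> \<bar>Ft t z\<bar> \<le> B2" using assms(9) by blast
  define B where "B = max B1 B2"
  have FB: "\<bar>F (u, cs M \<xi>)\<bar> \<le> B" "\<bar>Ft t (u, cs M \<xi>)\<bar> \<le> B" if "M \<in> SL" for t u M \<xi>
    using B1[of "(u, cs M \<xi>)"] B2[of "(u, cs M \<xi>)" t] cs_topspace[OF that] by (auto simp: B_def le_max_iff_disj)
  \<comment> \<open>The vector itself need not lie in the fundamental square; the equidistribution
    result asks only for an orbit point congruent to it.\<close>
  have v0: "torus_rep ?v \<in> torus_orbit \<alpha> \<beta>" "torus_rep ?v - ?v \<in> Int_lattice"
    using torus_orbit_set_torus_orbit(2)[OF ab] Int_lattice_minus[OF torus_rep_diff[of ?v]] by simp_all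
  have "((\<lambda>t. \<integral>u. Ft t (u, cs (up u ** geo t) ?v) \<partial>L) \<longlongrightarrow> J (\<lambda>M \<xi>. \<integral>u. F (u, cs M \<xi>) \<partial>L) / T) at_top"
  proof (rule equidistribution[where F="\<lambda>u M \<xi>. F (u, cs M \<xi>)" and Ft="\<lambda>t u M \<xi>. Ft t (u, cs M \<xi>)" and B=B, OF v0 L])
    fix C :: "(real \<times> (real^2^2) \<times> (real^2)) set" assume C: "compact C" "C \<subseteq> UNIV \<times> (SL \<times> UNIV)"
    let ?q = "\<lambda>z :: real \<times> (real^2^2) \<times> (real^2). (fst z, cs (fst (snd z)) (snd (snd z)))"
    have lim: "uniform_limit (?q ` C) Ft F at_top" by (rule unif[OF lift_compact[OF C]])
    show "uniform_limit C (\<lambda>t z. Ft t (fst z, cs (fst (snd z)) (snd (snd z)))) (\<lambda>z. F (fst z, cs (fst (snd z)) (snd (snd z)))) at_top"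
      unfolding uniform_limit_iff
    proof (intro allI impI)
      fix e :: real assume "e > 0"
      with lim have "\<forall>\<^sub>F t in at_top. \<forall>x\<in>?q ` C. dist (Ft t x) (F x) < e" by (simp only: uniform_limit_iff)
      then show "\<forall>\<^sub>F t in at_top. \<forall>z\<in>C. dist (Ft t (?q z)) (F (?q z)) < e" by eventually_elim blast
    qed
  qed (simp_all add: cs_invariant FB lift_continuous contF contFt)
  moreover have "(\<integral>g. (\<integral>u. F (u, g) \<partial>L) \<partial>mu \<alpha> \<beta>) = J (\<lambda>M \<xi>. \<integral>u. F (u, cs M \<xi>) \<partial>L) / T"
  proof (rule integral_mu[OF ab])
    show "(\<lambda>g. \<integral>u. F (u, g) \<partial>L) \<in> borel_measurable coset_borel"
      by (rule borel_measurable_coset_borel[OF coset_integral_continuous[OF L(1,2) contF B1]])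
    show "\<bar>\<integral>u. F (u, g) \<partial>L\<bar> \<le> B1" if "g \<in> topspace coset_topology" for g
      using that by (intro prob_integral_bound[OF L(1)] B1) simp
  qed
  ultimately show ?thesis by (simp only: up_geo_ASL2 cs_def)
qed

end
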